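(* Let $X$ be a Banach space, $\omega\ge0$, $v:\mathbb{R}\to[1,\infty)$ strongly admissible, $A$ a densely defined operator on $X$, and $\theta>\omega$. Then the following are equivalent: (i) $A$ has a bounded (respectively $\gamma$-bounded, $R$-bounded) $\mathrm{H\ddot{o}r}^2_v(S_\omega)$-calculus; (ii) $A$ is of strip type $\omega$ and the set $\{\psi(A):\psi\in\mathrm{H}^\infty_0(S_\theta),\ \|\psi\|_{\mathrm{H\ddot{o}r}^2_v(S_\omega)}\le1\}\subseteq\mathcal L(X)$ is bounded (respectively $\gamma$-bounded, $R$-bounded).
   Context: $S_\omega=\{z:|\operatorname{Im}z|<\omega\}$ for $\omega>0$, $S_0=\mathbb{R}$; $\tau_tf=f(\cdot-t)$; $\hat g(t)=\int g(s)e^{-\mathrm{i}st}ds$. A measurable $v:\mathbb{R}\to(0,\infty)$ is admissible if $v\ge1$ and $\sup_{s,t}\frac{v(s+t)}{v(s)+v(t)}<\infty$, strongly admissible if moreover $1/v\in L^2(\mathbb{R})$. $\mathrm{W}^2_v(S_\omega)=\{\hat g: g\in L^2(\mathbb{R}),\ ve^{\omega|\cdot|}g\in L^2(\mathbb{R})\}$ (for $\omega>0$, holomorphic functions $z\mapsto\int e^{-\mathrm{i}zs}g(s)ds$ on $S_\omega$) with norm $\|ve^{\omega|\cdot|}g\|_2$. With $G(z)=e^{-z^2}$, $\mathrm{H\ddot{o}r}^2_v(S_\omega)$ is the space of functions $f$ on $S_\omega$ with $\tau_tG\cdot f\in\mathrm{W}^2_v(S_\omega)$ for all $t$ and norm $\sup_t\|\tau_tG\cdot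 f\|_{\mathrm{W}^2_v(S_\omega)}<\infty$. $\mathrm{H}^\infty_0(S_\theta)$ is the set of holomorphic $f$ on $S_\theta$ with $|f(z)|\lesssim(1+|\operatorname{Re}z|)^{-\alpha}$ for every $\alpha>0$. A closed operator $A$ is of strip type $\omega$ if $\sigma(A)\subseteq\overline{S_\omega}$ and $\sup_{|\operatorname{Im}\lambda|>\omega'}\|R(\lambda,A)\|<\infty$ for each $\omega'>\omega$. For $\psi\in\mathrm{H}^\infty_0(S_\theta)$, $\psi(A)=\frac1{2\pi\mathrm{i}}\int_{\partial S_{\omega'}}\psi(w)R(w,A)\,dw$ with $\omega<\omega'<\theta$. $A$ has a bounded ($\gamma$-bounded, $R$-bounded) $\mathrm{H\ddot{o}r}^2_v(S_\omega)$-calculus if there is a bounded unital algebra homomorphism $\Psi:\mathrm{H\ddot{o}r}^2_v(S_\omega)\to\mathcal L(X)$ with $\Psi((\lambda-z)^{-1})=R(\lambda,A)$ for $\lambda\in\mathbb{C}\setminus\overline{S_\omega}$ (and $\{\Psi(f):\|f\|\le1\}$ $\gamma$-bounded, resp. $R$-bounded). A set $\mathcal T\subseteq\mathcal L(X)$ is $\gamma$-bounded ($R$-bounded) if there is $C$ with $\mathbb E\|\sum_j g_jT_jx_j\|^2\le C^2\mathbb E\|\sum_jg_jx_j\|^2$ for all finite families $(T_j,x_j)\subseteq\mathcal T\times X$, where $(g_j)$ are independent standard complex Gaussians (resp. Rademacher variables). *)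

theory Defs
  imports "HOL-Analysis.Analysis" "HOL-Probability.Probability"
begin

text \<open>A complex Banach space X is modelled as a real Banach space ('a :: banach)
  together with a real-linear map J (multiplication by the imaginary unit).\<close>

definition cmult :: "('a::real_vector \<Rightarrow> 'a) \<Rightarrow> complex \<Rightarrow> 'a \<Rightarrow> 'a" where
  "cmult J z x = Re z *\<^sub>R x + Im z *\<^sub>R J x"

definition complex_structure :: "('a::real_normed_vector \<Rightarrow> 'a) \<Rightarrow> bool" where
  "complex_structure J \<longleftrightarrow> linear J \<and> (\<forall>x. J (J x) = - x)
     \<and> (\<forall>z x. norm (cmult J z x) = cmod z * norm x)"

section \<open>Unbounded operators (D = domain, A = action on D)\<close>

definition densely_defined_op :: "('a::real_normed_vector \<Rightarrow> 'a) \<Rightarrow> 'a set \<Rightarrow> ('a \<Rightarrow> 'a) \<Rightarrow> bool" where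
  "densely_defined_op J D A \<longleftrightarrow> subspace D \<and> (\<forall>x\<in>D. J x \<in> D)
     \<and> (\<forall>x\<in>D. \<forall>y\<in>D. A (x + y) = A x + A y)
     \<and> (\<forall>x\<in>D. \<forall>c. A (c *\<^sub>R x) = c *\<^sub>R A x)
     \<and> (\<forall>x\<in>D. A (J x) = J (A x))
     \<and> closure D = UNIV"

definition closed_op :: "'a::real_normed_vector set \<Rightarrow> ('a \<Rightarrow> 'a) \<Rightarrow> bool" where
  "closed_op D A \<longleftrightarrow> closed {(x, A x) | x. x \<in> D}"

definition is_resolvent :: "('a::real_normed_vector \<Rightarrow> 'a) \<Rightarrow> 'a set \<Rightarrow> ('a \<Rightarrow> 'a) \<Rightarrow> complex \<Rightarrow> ('a \<Rightarrow>\<^sub>L 'a) \<Rightarrow> bool" where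
  "is_resolvent J D A l R \<longleftrightarrow>
     (\<forall>x. blinfun_apply R x \<in> D \<and> cmult J l (blinfun_apply R x) - A (blinfun_apply R x) = x) \<and> (\<forall>x\<in>D. blinfun_apply R (cmult J l x - A x) = x)"

definition resolvent_set :: "('a::real_normed_vector \<Rightarrow> 'a) \<Rightarrow> 'a set \<Rightarrow> ('a \<Rightarrow> 'a) \<Rightarrow> complex set" where
  "resolvent_set J D A = {l. \<exists>R. is_resolvent J D A l R}"

definition resolvent :: "('a::real_normed_vector \<Rightarrow> 'a) \<Rightarrow> 'a set \<Rightarrow> ('a \<Rightarrow> 'a) \<Rightarrow> complex \<Rightarrow> ('a \<Rightarrow>\<^sub>L 'a)" where
  "resolvent J D A l = (THE R. is_resolvent J D A l R)"

definition op_spectrum :: "('a::real_normed_vector \<Rightarrow> 'a) \<Rightarrow> 'a set \<Rightarrow> ('a \<Rightarrow> 'a) \<Rightarrow> complex set" where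
  "op_spectrum J D A = UNIV - resolvent_set J D A"

definition strip :: "real \<Rightarrow> complex set" where
  "strip w = (if w > 0 then {z. \<bar>Im z\<bar> < w} else {z. Im z = 0})"

definition strip_type :: "('a::real_normed_vector \<Rightarrow> 'a) \<Rightarrow> 'a set \<Rightarrow> ('a \<Rightarrow> 'a) \<Rightarrow> real \<Rightarrow> bool" where
  "strip_type J D A w \<longleftrightarrow> closed_op D A
     \<and> op_spectrum J D A \<subseteq> closure (strip w)
     \<and> (\<forall>w'>w. \<exists>C. \<forall>l. \<bar>Im l\<bar> > w' \<longrightarrow> norm (resolvent J D A l) \<le> C)"

definition admissible :: "(real \<Rightarrow> real) \<Rightarrow> bool" where
  "admissible v \<longleftrightarrow> v \<in> borel_measurable lborel \<and> (\<forall>s. v s \<ge> 1)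
     \<and> (\<exists>C. \<forall>s t. v (s + t) \<le> C * (v s + v t))"

definition strongly_admissible :: "(real \<Rightarrow> real) \<Rightarrow> bool" where
  "strongly_admissible v \<longleftrightarrow> admissible v \<and> integrable lborel (\<lambda>s. (1 / v s)\<^sup>2)"

definition W_rep :: "(real \<Rightarrow> real) \<Rightarrow> real \<Rightarrow> (complex \<Rightarrow> complex) \<Rightarrow> (real \<Rightarrow> complex) \<Rightarrow> bool" where
  "W_rep v w h g \<longleftrightarrow> g \<in> borel_measurable lborel
     \<and> integrable lborel (\<lambda>s. (cmod (g s))\<^sup>2)
     \<and> integrable lborel (\<lambda>s. (v s * exp (w * \<bar>s\<bar>) * cmod (g s))\<^sup>2)
     \<and> (\<forall>z\<in>strip w. h z = (LINT s|lborel. exp (- \<i> * z * of_real s) * g s))"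

text \<open>Norm in W^2_v(S_w) (infinity if h is not in the space).\<close>
definition W_norm :: "(real \<Rightarrow> real) \<Rightarrow> real \<Rightarrow> (complex \<Rightarrow> complex) \<Rightarrow> ennreal" where
  "W_norm v w h = (INF g\<in>{g. W_rep v w h g}.
      ennreal (sqrt (LINT s|lborel. (v s * exp (w * \<bar>s\<bar>) * cmod (g s))\<^sup>2)))"

definition hor_norm :: "(real \<Rightarrow> real) \<Rightarrow> real \<Rightarrow> (complex \<Rightarrow> complex) \<Rightarrow> ennreal" where
  "hor_norm v w f = (SUP t::real. W_norm v w (\<lambda>z. exp (- (z - of_real t)\<^sup>2) * f z))"

definition hor_space :: "(real \<Rightarrow> real) \<Rightarrow> real \<Rightarrow> (complex \<Rightarrow> complex) set" where
  "hor_space v w = {f. hor_norm v w f < \<infinity>}"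

definition H0_infty :: "real \<Rightarrow> (complex \<Rightarrow> complex) set" where
  "H0_infty \<theta> = {\<psi>. \<psi> holomorphic_on strip \<theta>
     \<and> (\<forall>\<alpha>>0. \<exists>C. \<forall>z\<in>strip \<theta>. cmod (\<psi> z) \<le> C * (1 + \<bar>Re z\<bar>) powr (- \<alpha>))}"

definition cgauss :: "complex measure" where
  "cgauss = density lborel (\<lambda>z. ennreal (exp (- (cmod z)\<^sup>2) / pi))"

definition op_bounded :: "('a::real_normed_vector \<Rightarrow> 'a) set \<Rightarrow> bool" where
  "op_bounded T \<longleftrightarrow> (\<exists>C. \<forall>S\<in>T. \<forall>x. norm (S x) \<le> C * norm x)"

definition gamma_bounded :: "('a::real_normed_vector \<Rightarrow> 'a) \<Rightarrow> ('a \<Rightarrow> 'a) set \<Rightarrow> bool" where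
  "gamma_bounded J T \<longleftrightarrow> (\<exists>C. \<forall>n (S :: nat \<Rightarrow> 'a \<Rightarrow> 'a) (x :: nat \<Rightarrow> 'a). (\<forall>j<n. S j \<in> T) \<longrightarrow>
     (\<integral>\<^sup>+ g. ennreal ((norm (\<Sum>j<n. cmult J (g j) (S j (x j))))\<^sup>2) \<partial>(PiM {..<n} (\<lambda>_. cgauss)))
     \<le> ennreal (C\<^sup>2) * (\<integral>\<^sup>+ g. ennreal ((norm (\<Sum>j<n. cmult J (g j) (x j)))\<^sup>2) \<partial>(PiM {..<n} (\<lambda>_. cgauss))))"

text \<open>Rademacher average: expectation over all sign vectors (the factor 2^-n cancels).\<close>
definition R_bounded :: "('a::real_normed_vector \<Rightarrow> 'a) set \<Rightarrow> bool" where
  "R_bounded T \<longleftrightarrow> (\<exists>C. \<forall>n (S :: nat \<Rightarrow> 'a \<Rightarrow> 'a) (x :: nat \<Rightarrow> 'a). (\<forall>j<n. S j \<in> T) \<longrightarrow>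
     (\<Sum>\<epsilon>\<in>PiE {..<n} (\<lambda>_. {-1, 1::real}). (norm (\<Sum>j<n. \<epsilon> j *\<^sub>R S j (x j)))\<^sup>2)
     \<le> C\<^sup>2 * (\<Sum>\<epsilon>\<in>PiE {..<n} (\<lambda>_. {-1, 1::real}). (norm (\<Sum>j<n. \<epsilon> j *\<^sub>R x j))\<^sup>2))"

datatype bkind = Bdd | Gamma | Rad

definition kind_bounded :: "bkind \<Rightarrow> ('a::real_normed_vector \<Rightarrow> 'a) \<Rightarrow> ('a \<Rightarrow> 'a) set \<Rightarrow> bool" where
  "kind_bounded k J T = (case k of Bdd \<Rightarrow> op_bounded T | Gamma \<Rightarrow> gamma_bounded J T | Rad \<Rightarrow> R_bounded T)"

definition hor_calculus :: "bkind \<Rightarrow> ('a::banach \<Rightarrow> 'a) \<Rightarrow> 'a set \<Rightarrow> ('a \<Rightarrow> 'a) \<Rightarrow> (real \<Rightarrow> real) \<Rightarrow> real \<Rightarrow> bool" where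
  "hor_calculus k J D A v w \<longleftrightarrow> (\<exists>\<Psi> :: (complex \<Rightarrow> complex) \<Rightarrow> ('a \<Rightarrow>\<^sub>L 'a).
      (\<forall>f\<in>hor_space v w. \<forall>f'. (\<forall>z\<in>strip w. f z = f' z) \<longrightarrow> \<Psi> f = \<Psi> f')
    \<and> (\<forall>f\<in>hor_space v w. \<forall>x. blinfun_apply (\<Psi> f) (J x) = J (blinfun_apply (\<Psi> f) x))
    \<and> (\<forall>f\<in>hor_space v w. \<forall>g\<in>hor_space v w. \<Psi> (\<lambda>z. f z + g z) = \<Psi> f + \<Psi> g)
    \<and> (\<forall>f\<in>hor_space v w. \<forall>c x. blinfun_apply (\<Psi> (\<lambda>z. c * f z)) x = cmult J c (blinfun_apply (\<Psi> f) x))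
    \<and> (\<forall>f\<in>hor_space v w. \<forall>g\<in>hor_space v w. \<Psi> (\<lambda>z. f z * g z) = \<Psi> f o\<^sub>L \<Psi> g)
    \<and> \<Psi> (\<lambda>_. 1) = id_blinfun
    \<and> (\<forall>l. \<bar>Im l\<bar> > w \<longrightarrow> l \<in> resolvent_set J D A \<and> \<Psi> (\<lambda>z. 1 / (l - z)) = resolvent J D A l)
    \<and> kind_bounded k J (blinfun_apply ` \<Psi> ` {f. hor_norm v w f \<le> 1}))"

text \<open>psi(A) = 1/(2 pi i) \<integral> over the positively oriented boundary of S_w', w' = (w+theta)/2.\<close>
definition psi_op :: "('a::banach \<Rightarrow> 'a) \<Rightarrow> 'a set \<Rightarrow> ('a \<Rightarrow> 'a) \<Rightarrow> real \<Rightarrow> real \<Rightarrow> (complex \<Rightarrow> complex) \<Rightarrow> 'a \<Rightarrow> 'a" where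
  "psi_op J D A w \<theta> \<psi> x = (let w' = (w + \<theta>) / 2 in
     cmult J (1 / (2 * pi * \<i>))
       (integral UNIV (\<lambda>t::real.
          cmult J (\<psi> (of_real t - \<i> * of_real w')) (blinfun_apply (resolvent J D A (of_real t - \<i> * of_real w')) x)
        - cmult J (\<psi> (of_real t + \<i> * of_real w')) (blinfun_apply (resolvent J D A (of_real t + \<i> * of_real w')) x))))"

end

theory Submission
  imports Defs "HOL-Complex_Analysis.Complex_Analysis" "HOL-Real_Asymp.Real_Asymp"
begin

text \<open>Since \<open>1 / v \<in> L\<^sup>2\<close>, the space \<open>W\<close> is a Banach algebra under pointwise multiplication, and it contains the
  Gaussians and the resolvent functions \<open>1 / (\<lambda> - z)\<close> with \<open>|Im \<lambda>| > \<omega>\<close>.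

  From (i) to (ii): Riemann sums of Cauchy's formula for \<open>\<psi> \<in> H0\<close> are linear combinations of resolvent functions
  and converge to \<open>\<psi>\<close> in \<open>W\<close>, hence in the Hoermander norm, so \<open>\<psi>(A) = \<Psi>(\<psi>)\<close>.

  From (ii) to (i): the partition of unity \<open>(2/\<pi>)\<^bsup>1/2\<^esup> \<integral> G(z - s)\<^sup>2 ds = 1\<close> approximates every Hoermander function \<open>f\<close> by
  functions \<open>\<psi>\<^sub>n \<in> H0\<close> of comparable norm such that \<open>\<psi>\<^sub>n G\<^sup>2 \<rightarrow> f G\<^sup>2\<close> in \<open>W\<close>. The operator \<open>(G\<^sup>2)(A)\<close> has
  dense range, so \<open>\<psi>\<^sub>n(A)\<close> converges strongly, to a limit that depends only on \<open>f\<close>. All three kinds of boundedness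
  pass to strong limits.\<close>

section \<open>Riemann sums\<close>

text \<open>A Hoermander function lives on the strip S_\<omega> only, which for \<omega> = 0 has no
  interior, whereas the contour integral needs values on lines outside the closed strip. So f(A)
  cannot be written as an integral and has to come as a limit. The functions of H0 are not dense for
  the Hoermander norm (the constant 1 is out of reach), hence convergence is asked for only after
  multiplication by a power of the Gaussian; the price is that the corresponding operator must have
  dense range. A second Gaussian cannot show this, since exp(m z^2) exp(-z^2/n) grows for large n.
  The functions exp(-z^4/n) can: they tend to 1, boundedly on the contour, and stay in H0 when
  divided by any exp(-m z^2). Since X may be nonseparable, X-valued integrals are gauge integrals.
  Each limit of such integrals is reduced to Lebesgue's theorem for a scalar error, and operators
  are moved through contour integrals by way of Riemann sums, which are finite linear
  combinations.\<close>

lemma integrable_inverse_one_plus_square: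
  "integrable lborel (\<lambda>t::real. c / (1 + t\<^sup>2))"
proof -
  have "integrable lborel (\<lambda>x::real. inverse (1 + x^2))"
    using integrable_inverse_1_plus_square by (simp add: set_integrable_def)
  then have "integrable lborel (\<lambda>x::real. c * inverse (1 + x^2))"
    by (rule integrable_mult_right)
  then show ?thesis by (simp add: divide_inverse)
qed

lemma one_plus_square_pos [simp]: "0 < 1 + (t::real)\<^sup>2" "1 + (t::real)\<^sup>2 \<noteq> 0"
  by (smt (verit) zero_le_power2)+

lemma one_plus_square_le_of_close:
  fixes s t :: real
  assumes "\<bar>s - t\<bar> \<le> 1"
  shows "1 / (1 + s\<^sup>2) \<le> 3 / (1 + t\<^sup>2)"
proof -
  have "(t - s)\<^sup>2 \<le> 1"
    using assms by (metis abs_minus_commute abs_square_le_1)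
  \<comment> \<open>Half of this square plus 3/2 times \<open>1 - (t - s)\<^sup>2 \<ge> 0\<close>
    reads \<open>t\<^sup>2 \<le> 3 * s\<^sup>2 + 3 / 2\<close>.\<close>
  moreover have "0 \<le> (3 * s - t)\<^sup>2" by simp
  ultimately have "1 + t\<^sup>2 \<le> 3 * (1 + s\<^sup>2)"
    by (simp add: power2_eq_square algebra_simps)
  then show ?thesis by (simp add: field_simps)
qed

text \<open>Mesh 1/n on the window [-n, n): the single index n refines the mesh and exhausts the
  line at the same time. The sum is finite, so it commutes with every linear map.\<close>

definition rsum :: "nat \<Rightarrow> (real \<Rightarrow> 'a::real_vector) \<Rightarrow> 'a" where
  "rsum n F = (1 / real n) *\<^sub>R (\<Sum>j\<in>{- int (n\<^sup>2)..<int (n\<^sup>2)}. F (real_of_int j / real n))"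

lemma floor_piece_iff:
  assumes "n > (0::nat)"
  shows "t \<in> {real_of_int j / real n..<(real_of_int j + 1) / real n} \<longleftrightarrow> \<lfloor>real n * t\<rfloor> = j"
  using assms by (simp add: floor_eq_iff field_simps)

lemma sum_piece_integrals_le:
  fixes f :: "real \<Rightarrow> real"
  assumes "n > (0::nat)" "integrable lborel f" "\<And>t. f t \<ge> 0" "finite S"
  shows "(\<Sum>j\<in>S. LINT t:{real_of_int j / real n..<(real_of_int j + 1) / real n}|lborel. f t) \<le> (LINT t|lborel. f t)"
proof -
  let ?I = "\<lambda>j. {real_of_int j / real n..<(real_of_int j + 1) / real n}"
  have int: "integrable lborel (\<lambda>t. indicator (?I j) t *\<^sub>R f t)" for j
    using assms(2) by (intro integrable_mult_indicator) auto
  have "(\<Sum>j\<in>S. LINT t:?I j|lborel. f t) = (LINT t|lborel. (\<Sum>j\<in>S. indicator (?I j) t *\<^sub>R f t))"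
    unfolding set_lebesgue_integral_def using int by (subst Bochner_Integration.integral_sum) auto
  also have "\<dots> \<le> (LINT t|lborel. f t)"
  proof (rule integral_mono)
    show "integrable lborel (\<lambda>t. \<Sum>j\<in>S. indicator (?I j) t *\<^sub>R f t)"
      using int by (intro Bochner_Integration.integrable_sum) auto
    show "(\<Sum>j\<in>S. indicator (?I j) t *\<^sub>R f t) \<le> f t" for t
    proof -
      have "(\<Sum>j\<in>S. indicator (?I j) t *\<^sub>R f t) = (\<Sum>j\<in>S. if \<lfloor>real n * t\<rfloor> = j then f t else 0)"
        by (intro sum.cong refl) (simp only: indicator_def floor_piece_iff[OF assms(1)], simp)
      also have "\<dots> \<le> f t" using assms(3,4) by (simp add: sum.delta)
      finally show ?thesis .
    qed
  qed (use assms in auto)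
  finally show ?thesis .
qed

lemma sum_piece_integral_combine:
  fixes F :: "real \<Rightarrow> 'a::banach"
  assumes "continuous_on UNIV F" "n > (0::nat)" "a \<le> (b::int)"
  shows "(\<Sum>j\<in>{a..<b}. integral {real_of_int j / real n..(real_of_int j + 1) / real n} F)
     = integral {real_of_int a / real n..real_of_int b / real n} F"
  using assms(3)
proof (induction b rule: int_ge_induct)
  case base
  then show ?case by simp
next
  case (step i)
  have "{a..<i+1} = insert i {a..<i}" using step by auto
  moreover have "integral {a / real n..i / real n} F + integral {i / real n..(i + 1) / real n} F
      = integral {a / real n..(i + 1) / real n} F"
    using step assms(1,2)
    by (intro Henstock_Kurzweil_Integration.integral_combine)
       (auto simp: divide_right_mono intro!: integrable_continuous_interval intro: continuous_on_subset)
  ultimately show ?case using step by (simp add: add.commute)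
qed

lemma integrable_dominated:
  fixes F :: "real \<Rightarrow> 'a::banach"
  assumes "continuous_on UNIV F" "\<And>t. norm (F t) \<le> C / (1 + t\<^sup>2)"
  shows "F integrable_on UNIV"
  by (rule integrable_on_all_intervals_UNIV[where g="\<lambda>t. C / (1 + t\<^sup>2)"])
     (use assms in \<open>auto intro!: integrable_continuous_interval integrable_on_lborel
        integrable_inverse_one_plus_square intro: continuous_on_subset\<close>)

lemma norm_integral_dominated:
  fixes F :: "real \<Rightarrow> 'a::banach"
  assumes "F integrable_on UNIV" "integrable lborel g" "\<And>t. norm (F t) \<le> g t"
  shows "norm (integral UNIV F) \<le> (LINT t|lborel. g t)"
  using Henstock_Kurzweil_Integration.integral_norm_bound_integral[OF assms(1) integrable_on_lborel[OF assms(2)]]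
    assms(3) by (simp add: integral_lborel[OF assms(2)])

lemma integral_truncate_tendsto:
  fixes F :: "real \<Rightarrow> 'a::banach"
  assumes "continuous_on UNIV F" "\<And>t. norm (F t) \<le> C / (1 + t\<^sup>2)"
  shows "(\<lambda>n. integral {- real n..real n} F) \<longlonglongrightarrow> integral UNIV F"
proof -
  have F: "F integrable_on UNIV" by (rule integrable_dominated[OF assms])
  show ?thesis
  proof (rule LIMSEQ_I)
    fix e :: real assume "e > 0"
    then obtain B where B: "B > 0" "\<And>a b. ball 0 B \<subseteq> cbox a b \<Longrightarrow> norm (integral (cbox a b) F - integral UNIV F) < e"
      using F has_integral_alt'[of F "integral UNIV F" UNIV] by (auto simp: has_integral_integral)
    show "\<exists>no. \<forall>n\<ge>no. norm (integral {- real n..real n} F - integral UNIV F) < e"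
    proof (intro exI allI impI)
      fix n assume "n \<ge> nat \<lceil>B\<rceil>"
      then have "B \<le> real n" by linarith
      then have "ball 0 B \<subseteq> cbox (- real n) (real n)"
        by (auto simp: dist_norm)
      then show "norm (integral {- real n..real n} F - integral UNIV F) < e"
        using B(2) by simp
    qed
  qed
qed

text \<open>The sum is the integral over [-n, n] of the step function with value F(floor(n t) / n).
  Its distance \<open>d n\<close> to F is a scalar function that tends to 0 by continuity and has a
  fixed integrable majorant, so dominated convergence applies to \<open>d n\<close> whatever the
  Banach space of values.\<close>

lemma rsum_tendsto_integral:
  fixes F :: "real \<Rightarrow> 'a::banach"
  assumes F: "continuous_on UNIV F" and C: "\<And>t. norm (F t) \<le> C / (1 + t\<^sup>2)"
  shows "(\<lambda>n. rsum n F) \<longlonglongrightarrow> integral UNIV F"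
proof -
  define d where "d n t = norm (F (\<lfloor>real n * t\<rfloor> / real n) - F t)" for n :: nat and t
  have C0: "C \<ge> 0" using order_trans[OF norm_ge_zero C[of 0]] by simp
  have close: "\<bar>\<lfloor>real n * t\<rfloor> / real n - t\<bar> \<le> 1 / real n" if "n > 0" for n :: nat and t
  proof -
    have "\<bar>\<lfloor>real n * t\<rfloor> / real n - t\<bar> = \<bar>\<lfloor>real n * t\<rfloor> - real n * t\<bar> / real n"
      using that by (simp add: field_simps abs_if)
    also have "\<dots> \<le> 1 / real n"
      by (intro divide_right_mono) linarith+
    finally show ?thesis .
  qed
  \<comment> \<open>The sample point depends on t through the floor alone; for each of its countably
    many values the function is continuous in t.\<close>
  have dm [measurable]: "d n \<in> borel_measurable lborel" for n
  proof -
    have "continuous_on UNIV (\<lambda>t. norm (F (real_of_int k / real n) - F t))" for k :: int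
      by (intro continuous_intros F)
    then have m: "(\<lambda>t. norm (F (real_of_int k / real n) - F t)) \<in> borel_measurable borel" for k :: int
      by (rule borel_measurable_continuous_onI)
    have fl: "(\<lambda>t. \<lfloor>real n * t\<rfloor>) \<in> measurable borel (count_space UNIV)" by measurable
    from measurable_compose_countable[OF m fl] have "d n \<in> borel_measurable borel"
      unfolding d_def .
    then show ?thesis by simp
  qed
  \<comment> \<open>3 C comes from moving the sample point to t, a distance of at most 1, and C from
    \<open>F t\<close> itself.\<close>
  have dbd: "norm (d n t) \<le> (4 * C) / (1 + t\<^sup>2)" if "n > 0" for n t
  proof -
    have "1 / real n \<le> 1" using that by simp
    then have "\<bar>\<lfloor>real n * t\<rfloor> / real n - t\<bar> \<le> 1" using close[OF that, of t] by linarith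
    then have "C * (1 / (1 + (\<lfloor>real n * t\<rfloor> / real n)\<^sup>2)) \<le> C * (3 / (1 + t\<^sup>2))"
      by (intro mult_left_mono one_plus_square_le_of_close C0)
    then have "norm (F (\<lfloor>real n * t\<rfloor> / real n)) \<le> 3 * C / (1 + t\<^sup>2)"
      using C[of "\<lfloor>real n * t\<rfloor> / real n"] by (simp add: mult.commute)
    moreover have "norm (F (\<lfloor>real n * t\<rfloor> / real n) - F t) \<le> norm (F (\<lfloor>real n * t\<rfloor> / real n)) + norm (F t)"
      by (rule norm_triangle_ineq4)
    moreover have "3 * C / (1 + t\<^sup>2) + C / (1 + t\<^sup>2) = 4 * C / (1 + t\<^sup>2)"
      by (simp add: add_divide_distrib[symmetric])
    ultimately show ?thesis unfolding d_def using C[of t] by simp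
  qed
  have dint: "integrable lborel (d n)" if "n > 0" for n
    by (rule Bochner_Integration.integrable_bound[OF integrable_inverse_one_plus_square[of "4*C"]])
       (use dbd[OF that] C0 in \<open>auto intro!: AE_I2\<close>)
  \<comment> \<open>The shifted index keeps the mesh 1/n away from n = 0.\<close>
  have dlim: "(\<lambda>n. LINT t|lborel. d (Suc n) t) \<longlonglongrightarrow> (LINT t::real|lborel. 0::real)"
  proof (rule Bochner_Integration.integral_dominated_convergence[where s="\<lambda>n. d (Suc n)" and f="\<lambda>_. 0" and w="\<lambda>t. (4 * C) / (1 + t\<^sup>2)"])
    show "AE t in lborel. (\<lambda>n. d (Suc n) t) \<longlonglongrightarrow> 0"
    proof (rule AE_I2)
      fix t
      have "(\<lambda>n. \<lfloor>real (Suc n) * t\<rfloor> / real (Suc n) - t) \<longlonglongrightarrow> 0"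
      proof (rule Lim_null_comparison[OF always_eventually])
        show "\<forall>n. norm (\<lfloor>real (Suc n) * t\<rfloor> / real (Suc n) - t) \<le> 1 / real (Suc n)"
          using close[of "Suc _" t] by (simp del: of_nat_Suc)
        show "(\<lambda>n. 1 / real (Suc n)) \<longlonglongrightarrow> 0" by (rule LIMSEQ_Suc[OF lim_1_over_n])
      qed
      then have "(\<lambda>n. \<lfloor>real (Suc n) * t\<rfloor> / real (Suc n)) \<longlonglongrightarrow> t"
        by (simp add: LIM_zero_iff)
      then have "(\<lambda>n. F (\<lfloor>real (Suc n) * t\<rfloor> / real (Suc n))) \<longlonglongrightarrow> F t"
        using F by (metis continuous_on_eq_continuous_at isCont_tendsto_compose open_UNIV UNIV_I)
      then show "(\<lambda>n. d (Suc n) t) \<longlonglongrightarrow> 0"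
        unfolding d_def by (intro tendsto_norm_zero) (simp add: LIM_zero)
    qed
  qed (use dbd integrable_inverse_one_plus_square in \<open>auto\<close>)
  have key: "norm (rsum n F - integral {- real n..real n} F) \<le> (LINT t|lborel. d n t)" if n: "n > 0" for n
  proof -
    let ?S = "{- int (n\<^sup>2)..<int (n\<^sup>2)}"
    let ?J = "\<lambda>j. {real_of_int j / real n..(real_of_int j + 1) / real n}"
    let ?I = "\<lambda>j. {real_of_int j / real n..<(real_of_int j + 1) / real n}"
    have len: "(real_of_int j + 1) / real n - real_of_int j / real n = 1 / real n" for j
      by (simp add: diff_divide_distrib[symmetric])
    have Fi: "F integrable_on ?J j" for j
      using F by (auto intro!: integrable_continuous_interval intro: continuous_on_subset)
    have "integral {- real n..real n} F = (\<Sum>j\<in>?S. integral (?J j) F)"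
      using sum_piece_integral_combine[OF F n, of "- int (n\<^sup>2)" "int (n\<^sup>2)"] n
      by (simp add: power2_eq_square)
    moreover have "rsum n F = (\<Sum>j\<in>?S. integral (?J j) (\<lambda>t. F (real_of_int j / real n)))"
      using n by (simp add: rsum_def scaleR_sum_right len[simplified diff_divide_distrib] divide_right_mono add_divide_distrib)
    moreover have "integral (?J j) (\<lambda>t. F (real_of_int j / real n) - F t)
        = integral (?J j) (\<lambda>t. F (real_of_int j / real n)) - integral (?J j) F" for j
      by (rule Henstock_Kurzweil_Integration.integral_diff[OF integrable_const_ivl Fi])
    ultimately have "rsum n F - integral {- real n..real n} F
        = (\<Sum>j\<in>?S. integral (?J j) (\<lambda>t. F (real_of_int j / real n) - F t))"
      by (simp only: sum_subtractf)
    also have "norm \<dots> \<le> (\<Sum>j\<in>?S. LINT t:?I j|lborel. d n t)"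
    proof (rule sum_norm_le)
      fix j assume "j \<in> ?S"
      have cont: "continuous_on (?J j) (\<lambda>t. F (real_of_int j / real n) - F t)"
        using F by (auto intro!: continuous_intros intro: continuous_on_subset)
      have "norm (integral (?J j) (\<lambda>t. F (real_of_int j / real n) - F t))
          \<le> integral (?J j) (\<lambda>t. norm (F (real_of_int j / real n) - F t))"
        by (intro Henstock_Kurzweil_Integration.integral_norm_bound_integral integrable_continuous_interval continuous_on_norm cont) auto
      \<comment> \<open>The right endpoint is dropped because the floor jumps there.\<close>
      also have "\<dots> = integral (?I j) (\<lambda>t. norm (F (real_of_int j / real n) - F t))"
        by (rule integral_spike_set; rule negligible_subset[of "{(real_of_int j + 1) / real n}"]) auto
      also have "\<dots> = integral (?I j) (d n)"
      proof (rule Henstock_Kurzweil_Integration.integral_cong)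
        fix t assume "t \<in> ?I j"
        then have "\<lfloor>real n * t\<rfloor> = j" by (simp only: floor_piece_iff[OF n])
        then show "norm (F (real_of_int j / real n) - F t) = d n t" by (simp add: d_def)
      qed
      also have "\<dots> = (LINT t:?I j|lborel. d n t)"
        using dint[OF n] by (intro set_borel_integral_eq_integral(2)[symmetric])
          (auto simp: set_integrable_def intro!: integrable_mult_indicator[where f="d n", simplified])
      finally show "norm (integral (?J j) (\<lambda>t. F (real_of_int j / real n) - F t)) \<le> (LINT t:?I j|lborel. d n t)" .
    qed
    also have "\<dots> \<le> (LINT t|lborel. d n t)"
      by (rule sum_piece_integrals_le[OF n dint[OF n]]) (auto simp: d_def)
    finally show ?thesis .
  qed
  have "(\<lambda>n. rsum (Suc n) F - integral {- real (Suc n)..real (Suc n)} F) \<longlonglongrightarrow> 0"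
    by (rule Lim_null_comparison[OF _ dlim[simplified]]) (use key in \<open>auto simp del: of_nat_Suc\<close>)
  moreover have "(\<lambda>n. integral {- real (Suc n)..real (Suc n)} F) \<longlonglongrightarrow> integral UNIV F"
    using LIMSEQ_Suc[OF integral_truncate_tendsto[OF assms]] .
  ultimately have "(\<lambda>n. rsum (Suc n) F) \<longlonglongrightarrow> integral UNIV F"
    using tendsto_add by fastforce
  then show ?thesis by (rule LIMSEQ_imp_Suc)
qed

lemma rsum_norm_le: "norm (rsum n F) \<le> rsum n (\<lambda>t. norm (F t))"
  by (simp add: rsum_def) (intro divide_right_mono norm_sum, auto)

lemma rsum_mono:
  assumes "\<And>t. f t \<le> (g t :: real)"
  shows "rsum n f \<le> rsum n g"
  unfolding rsum_def by (simp add: divide_right_mono sum_mono assms)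

text \<open>A convergent sequence is bounded. K then dominates, uniformly in n, the Riemann sums of
  all functions with the standard majorant.\<close>

lemma rsum_bounded:
  obtains K where "K > 0" "\<And>n. rsum n (\<lambda>t::real. 1 / (1 + t\<^sup>2)) \<le> K"
proof -
  have "continuous_on UNIV (\<lambda>t::real. 1 / (1 + t\<^sup>2))"
    by (intro continuous_intros) simp
  from rsum_tendsto_integral[OF this, of 1] have "Bseq (\<lambda>n. rsum n (\<lambda>t::real. 1 / (1 + t\<^sup>2)))"
    by (intro convergent_imp_Bseq) (auto simp: convergent_def)
  then obtain K where "K > 0" "\<And>n. \<bar>rsum n (\<lambda>t::real. 1 / (1 + t\<^sup>2))\<bar> \<le> K"
    by (auto elim!: BseqE)
  then show ?thesis using that[of K] by (meson abs_le_D1)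
qed

section \<open>Convolutions and admissible weights\<close>

lemma one_plus_square_le_exp:
  fixes b :: real
  assumes "b > 0"
  shows "\<exists>K>0. \<forall>s::real. 1 + s\<^sup>2 \<le> K * exp (b * \<bar>s\<bar>)"
proof (intro exI conjI allI)
  \<comment> \<open>With this m one has
    \<open>1 + \<bar>s\<bar> \<le> m * (1 + b / 2 * \<bar>s\<bar>)\<close>, after which
    \<open>1 + x \<le> exp x\<close> is squared.\<close>
  let ?m = "max 1 (2 / b)"
  show "?m\<^sup>2 > 0" by simp
  fix s :: real
  have "1 + s\<^sup>2 \<le> (1 + \<bar>s\<bar>)\<^sup>2" by (simp add: power2_eq_square algebra_simps)
  also have "\<dots> \<le> (?m * (1 + b / 2 * \<bar>s\<bar>))\<^sup>2"
  proof (rule power_mono)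
    have "2 / b * (b / 2 * \<bar>s\<bar>) \<le> ?m * (b / 2 * \<bar>s\<bar>)"
      using assms by (intro mult_right_mono) auto
    then have "\<bar>s\<bar> \<le> ?m * (b / 2 * \<bar>s\<bar>)" using assms by simp
    then show "1 + \<bar>s\<bar> \<le> ?m * (1 + b / 2 * \<bar>s\<bar>)"
      unfolding distrib_left mult_1_right by (smt (verit) max.cobounded1)
  qed simp
  also have "\<dots> \<le> ?m\<^sup>2 * (exp (b / 2 * \<bar>s\<bar>))\<^sup>2"
    using assms by (auto simp: power_mult_distrib intro!: mult_left_mono power_mono)
  also have "(exp (b / 2 * \<bar>s\<bar>))\<^sup>2 = exp (b * \<bar>s\<bar>)"
    by (simp add: exp_double[symmetric])
  finally show "1 + s\<^sup>2 \<le> ?m\<^sup>2 * exp (b * \<bar>s\<bar>)" .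
qed

text \<open>Fubini and translation invariance. Since s -> exp(-i z s) is multiplicative, the
  convolution theorem for Fourier transforms is the case where this factor has been absorbed into
  \<open>a\<close> and \<open>b\<close>.\<close>

lemma convolution_integral:
  fixes a b :: "real \<Rightarrow> complex"
  assumes a: "integrable lborel a" and b: "integrable lborel b"
  shows "(LINT s|lborel. (LINT r|lborel. a r * b (s - r))) = (LINT r|lborel. a r) * (LINT r|lborel. b r)"
proof -
  have [measurable]: "a \<in> borel_measurable borel" "b \<in> borel_measurable borel"
    using a b by auto
  have bs: "has_bochner_integral lborel (\<lambda>s. b (s - r)) (LINT r|lborel. b r)" for r
    using lborel_has_bochner_integral_real_affine_iff[of 1 b "LINT r|lborel. b r" "- r"] b
    by (simp add: has_bochner_integral_integrable)
  have bsn: "(LINT s|lborel. norm (b (s - r))) = (LINT s|lborel. norm (b s))" for r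
    using lborel_integral_real_affine[of 1 "\<lambda>s. norm (b s)" "- r"] by simp
  have int: "integrable (lborel \<Otimes>\<^sub>M lborel) (\<lambda>(r, s). a r * b (s - r))"
  proof (rule lborel_pair.Fubini_integrable)
    show "(\<lambda>(r, s). a r * b (s - r)) \<in> borel_measurable (lborel \<Otimes>\<^sub>M lborel)" by measurable
    show "integrable lborel (\<lambda>x. LINT y|lborel. norm (case (x, y) of (r, s) \<Rightarrow> a r * b (s - r)))"
      using a by (simp add: norm_mult bsn)
    show "AE x in lborel. integrable lborel (\<lambda>y. case (x, y) of (r, s) \<Rightarrow> a r * b (s - r))"
      using bs by (auto simp: has_bochner_integral_iff intro!: AE_I2)
  qed
  have "(LINT s|lborel. (LINT r|lborel. a r * b (s - r))) = (LINT r|lborel. (LINT s|lborel. a r * b (s - r)))"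
    using lborel_pair.Fubini_integral[OF int] by simp
  also have "\<dots> = (LINT r|lborel. a r * (LINT s|lborel. b s))"
    using bs by (simp add: has_bochner_integral_iff)
  finally show ?thesis by simp
qed

text \<open>Cauchy-Schwarz for the measure P dr, with P split into two square roots, then Tonelli
  and translation invariance. Extended nonnegative integrals avoid presupposing that the convolution
  exists.\<close>

lemma Young_nn_integral:
  fixes P :: "real \<Rightarrow> real" and q :: "real \<Rightarrow> ennreal"
  assumes [measurable]: "P \<in> borel_measurable borel" "q \<in> borel_measurable borel"
    and P: "\<And>r. P r \<ge> 0"
  shows "(\<integral>\<^sup>+s. (\<integral>\<^sup>+r. ennreal (P r) * q (s - r) \<partial>lborel)\<^sup>2 \<partial>lborel)
    \<le> (\<integral>\<^sup>+r. ennreal (P r) \<partial>lborel)\<^sup>2 * (\<integral>\<^sup>+r. (q r)\<^sup>2 \<partial>lborel)"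
proof -
  let ?p = "\<lambda>r. ennreal (sqrt (P r))"
  have pp: "?p r * ?p r = ennreal (P r)" for r
    using P by (simp add: ennreal_mult[symmetric])
  let ?N = "\<integral>\<^sup>+r. ennreal (P r) \<partial>lborel"
  have "(\<integral>\<^sup>+r. ennreal (P r) * q (s - r) \<partial>lborel)\<^sup>2 \<le> ?N * (\<integral>\<^sup>+r. ennreal (P r) * (q (s - r))\<^sup>2 \<partial>lborel)" for s
  proof -
    have "(\<integral>\<^sup>+r. ?p r * (?p r * q (s - r)) \<partial>lborel)\<^sup>2
       \<le> (\<integral>\<^sup>+r. (?p r)\<^sup>2 \<partial>lborel) * (\<integral>\<^sup>+r. (?p r * q (s - r))\<^sup>2 \<partial>lborel)"
      by (rule Cauchy_Schwarz_nn_integral) measurable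
    moreover have "?p r * (?p r * q (s - r)) = ennreal (P r) * q (s - r)" for r
      by (simp only: mult.assoc[symmetric] pp)
    moreover have "(?p r * q (s - r))\<^sup>2 = ennreal (P r) * (q (s - r))\<^sup>2" "(?p r)\<^sup>2 = ennreal (P r)" for r
      by (simp_all only: power_mult_distrib power2_eq_square[of "?p r"] pp)
    ultimately show ?thesis by simp
  qed
  then have "(\<integral>\<^sup>+s. (\<integral>\<^sup>+r. ennreal (P r) * q (s - r) \<partial>lborel)\<^sup>2 \<partial>lborel)
     \<le> (\<integral>\<^sup>+s. ?N * (\<integral>\<^sup>+r. ennreal (P r) * (q (s - r))\<^sup>2 \<partial>lborel) \<partial>lborel)"
    by (rule nn_integral_mono)
  also have "\<dots> = ?N * (\<integral>\<^sup>+s. (\<integral>\<^sup>+r. ennreal (P r) * (q (s - r))\<^sup>2 \<partial>lborel) \<partial>lborel)"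
    by (rule nn_integral_cmult) measurable
  also have "(\<integral>\<^sup>+s. (\<integral>\<^sup>+r. ennreal (P r) * (q (s - r))\<^sup>2 \<partial>lborel) \<partial>lborel)
     = (\<integral>\<^sup>+r. (\<integral>\<^sup>+s. ennreal (P r) * (q (s - r))\<^sup>2 \<partial>lborel) \<partial>lborel)"
    by (rule lborel_pair.Fubini') measurable
  also have "\<dots> = (\<integral>\<^sup>+r. ennreal (P r) * (\<integral>\<^sup>+s. (q s)\<^sup>2 \<partial>lborel) \<partial>lborel)"
  proof (rule nn_integral_cong)
    fix r
    have "(\<integral>\<^sup>+s. (q s)\<^sup>2 \<partial>lborel) = (\<integral>\<^sup>+s. (q (s - r))\<^sup>2 \<partial>lborel)"
      using nn_integral_real_affine[of "\<lambda>s. (q s)\<^sup>2" 1 "- r"] by simp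
    then show "(\<integral>\<^sup>+s. ennreal (P r) * (q (s - r))\<^sup>2 \<partial>lborel) = ennreal (P r) * (\<integral>\<^sup>+s. (q s)\<^sup>2 \<partial>lborel)"
      by (simp add: nn_integral_cmult)
  qed
  also have "\<dots> = ?N * (\<integral>\<^sup>+s. (q s)\<^sup>2 \<partial>lborel)" by (rule nn_integral_multc) measurable
  finally show ?thesis by (simp add: power2_eq_square mult.assoc)
qed

text \<open>For z = x + i y the modulus of the integrand is largest at s = 2 a y. The real
  substitution \<open>s = 2 * a * y + sqrt (2 * a) * u\<close> centres it there and leaves the
  characteristic function of the normal distribution, so a complex z requires no shift of
  contour.\<close>

lemma gaussian_Fourier:
  fixes z :: complex
  assumes a: "a > (0::real)"
  defines "k \<equiv> \<lambda>s::real. complex_of_real (1 / (2 * sqrt (pi * a)) * exp (- (s\<^sup>2) / (4 * a)))"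
  shows "has_bochner_integral lborel (\<lambda>s. exp (- \<i> * z * of_real s) * k s) (exp (- of_real a * z\<^sup>2))"
proof -
  define c where "c = sqrt (2 * a)"
  have c: "c > 0" "c\<^sup>2 = 2 * a" using a by (auto simp: c_def)
  define x y where "x = Re z" and "y = Im z"
  have z: "z = of_real x + \<i> * of_real y" by (simp add: x_def y_def complex_eq_iff)
  have "integrable std_normal_distribution (\<lambda>u. iexp (- (x * c) * u))"
    using prob_space_normal_density[of 1 0, THEN prob_space.finite_measure]
    by (intro finite_measure.integrable_const_bound[where B=1]) auto
  moreover have "(LINT u|std_normal_distribution. iexp (- (x * c) * u)) = exp (- complex_of_real ((x * c)\<^sup>2 / 2))"
    using fun_cong[OF char_std_normal_distribution, of "- (x * c)"] by (simp add: char_def of_real_exp)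
  ultimately have "has_bochner_integral std_normal_distribution (\<lambda>u. iexp (- (x * c) * u)) (exp (- complex_of_real ((x * c)\<^sup>2 / 2)))"
    by (simp add: has_bochner_integral_iff)
  then have h1: "has_bochner_integral lborel (\<lambda>u. std_normal_density u *\<^sub>R iexp (- (x * c) * u)) (exp (- complex_of_real ((x * c)\<^sup>2 / 2)))"
    by (simp add: has_bochner_integral_iff integrable_density integral_density normal_density_nonneg)
  have h2: "has_bochner_integral lborel (\<lambda>u. (exp (of_real (a * y\<^sup>2) - 2 * \<i> * of_real (a * x * y)) / of_real c) * (std_normal_density u *\<^sub>R iexp (- (x * c) * u)))
     ((exp (of_real (a * y\<^sup>2) - 2 * \<i> * of_real (a * x * y)) / of_real c) * exp (- complex_of_real ((x * c)\<^sup>2 / 2)))"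
    by (rule has_bochner_integral_mult_right[OF h1])
  have e1: "(exp (of_real (a * y\<^sup>2) - 2 * \<i> * of_real (a * x * y)) / of_real c) * exp (- complex_of_real ((x * c)\<^sup>2 / 2))
     = exp (- of_real a * z\<^sup>2) / of_real c"
  proof -
    have "of_real (a * y\<^sup>2) - 2 * \<i> * of_real (a * x * y) + (- complex_of_real ((x * c)\<^sup>2 / 2)) = - of_real a * z\<^sup>2"
      using c(2) by (simp add: power_mult_distrib z power2_eq_square algebra_simps complex_eq_iff)
    then show ?thesis by (metis exp_add times_divide_eq_left)
  qed
  have e2: "exp (- \<i> * z * of_real (2 * a * y + c * u)) * k (2 * a * y + c * u)
     = (exp (of_real (a * y\<^sup>2) - 2 * \<i> * of_real (a * x * y)) / of_real c) * (std_normal_density u *\<^sub>R iexp (- (x * c) * u))" for u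
  proof -
    have k: "k (2 * a * y + c * u) = of_real (1 / (2 * sqrt (pi * a))) * exp (of_real (- ((2 * a * y + c * u)\<^sup>2) / (4 * a)))"
      by (simp add: k_def of_real_exp)
    have s: "std_normal_density u *\<^sub>R iexp (- (x * c) * u) = of_real (1 / sqrt (2 * pi)) * (exp (of_real (- (u\<^sup>2) / 2)) * iexp (- (x * c) * u))"
      by (simp add: std_normal_density_def scaleR_conv_of_real of_real_exp)
    have const: "1 / (2 * sqrt (pi * a)) = 1 / sqrt (2 * pi) / c"
    proof -
      have "sqrt (2 * pi) * c = 2 * sqrt (pi * a)"
        unfolding c_def by (simp add: real_sqrt_mult)
      then show ?thesis by (simp add: field_simps)
    qed
    have r: "- ((2 * a * y + c * u)\<^sup>2) / (4 * a) = - (a * y\<^sup>2) - y * c * u - u\<^sup>2 / 2"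
    proof -
      have "(2 * a * y + c * u)\<^sup>2 = 4 * a * (a * y\<^sup>2 + y * c * u) + c\<^sup>2 * u\<^sup>2"
        by (simp add: power2_eq_square algebra_simps)
      then show ?thesis using a c(2) by (simp add: field_simps)
    qed
    have "- \<i> * z * of_real (2 * a * y + c * u) + of_real (- ((2 * a * y + c * u)\<^sup>2) / (4 * a))
       = (of_real (a * y\<^sup>2) - 2 * \<i> * of_real (a * x * y)) + (of_real (- (u\<^sup>2) / 2) + \<i> * of_real (- (x * c) * u))"
      unfolding r by (simp add: z complex_eq_iff algebra_simps power2_eq_square)
    then have "exp (- \<i> * z * of_real (2 * a * y + c * u)) * exp (of_real (- ((2 * a * y + c * u)\<^sup>2) / (4 * a)))
       = exp (of_real (a * y\<^sup>2) - 2 * \<i> * of_real (a * x * y)) * (exp (of_real (- (u\<^sup>2) / 2)) * iexp (- (x * c) * u))"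
      by (metis exp_add)
    then show ?thesis unfolding k s const by (simp add: field_simps)
  qed
  have "has_bochner_integral lborel (\<lambda>u. exp (- \<i> * z * of_real (2 * a * y + c * u)) * k (2 * a * y + c * u))
     (exp (- of_real a * z\<^sup>2) /\<^sub>R \<bar>c\<bar>)"
    using h2 unfolding e2 e1 using c by (simp add: scaleR_conv_of_real divide_inverse mult.commute)
  then show ?thesis
    using lborel_has_bochner_integral_real_affine_iff[of c "\<lambda>s. exp (- \<i> * z * of_real s) * k s" "exp (- of_real a * z\<^sup>2)" "2 * a * y"] c
    by simp
qed

section \<open>Growth of admissible weights\<close>

locale weight =
  fixes v :: "real \<Rightarrow> real" and w :: real
  assumes sadm: "strongly_admissible v" and w_nonneg: "w \<ge> 0"
begin

lemma v_measurable [measurable]: "v \<in> borel_measurable borel"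
  using sadm by (simp add: strongly_admissible_def admissible_def)

lemma v_ge_1: "v s \<ge> 1"
  using sadm by (simp add: strongly_admissible_def admissible_def)

lemma v_pos: "v s > 0"
  using v_ge_1[of s] by linarith

lemma v_sub: "\<exists>C\<ge>1. \<forall>s t. v (s + t) \<le> C * (v s + v t)"
proof -
  obtain C where C: "\<And>s t. v (s + t) \<le> C * (v s + v t)"
    using sadm by (auto simp: strongly_admissible_def admissible_def)
  have "v (s + t) \<le> max C 1 * (v s + v t)" for s t
    using C[of s t] v_pos[of s] v_pos[of t]
    by (smt (verit) mult_right_mono max.cobounded1)
  then show ?thesis by (intro exI[of _ "max C 1"]) auto
qed

definition Cv where "Cv = (SOME C. C \<ge> 1 \<and> (\<forall>s t. v (s + t) \<le> C * (v s + v t)))"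

lemma Cv: "Cv \<ge> 1" "v (s + t) \<le> Cv * (v s + v t)"
proof -
  have "Cv \<ge> 1 \<and> (\<forall>s t. v (s + t) \<le> Cv * (v s + v t))"
    unfolding Cv_def by (rule someI_ex) (use v_sub in blast)
  then show "Cv \<ge> 1" "v (s + t) \<le> Cv * (v s + v t)" by auto
qed

text \<open>For most \<open>r\<close> in \<open>[0,1]\<close> both \<open>v r\<close> and \<open>v (s - r)\<close> are at most \<open>N\<close>, so
  \<open>v s \<le> C (v r + v (s - r)) \<le> 2 C N\<close>.\<close>
lemma v_bounded_near_0: "\<exists>M\<ge>1. \<forall>s. \<bar>s\<bar> \<le> 1 \<longrightarrow> v s \<le> M"
proof -
  \<comment> \<open>The window [-2, 2] contains r and s - r for r in [0, 1] and |s| at most 1, and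
    its finite measure permits continuity from above.\<close>
  define E where "E N = {r\<in>{-2..2}. v r > real N}" for N :: nat
  have Em [measurable]: "E N \<in> sets lborel" for N unfolding E_def by measurable
  have "(\<lambda>N. emeasure lborel (E N)) \<longlonglongrightarrow> emeasure lborel (\<Inter>N. E N)"
  proof (rule Lim_emeasure_decseq)
    show "range E \<subseteq> sets lborel" using Em by blast
    show "decseq E" by (auto simp: E_def decseq_def)
    show "emeasure lborel (E N) \<noteq> \<infinity>" for N
    proof -
      have "emeasure lborel (E N) \<le> emeasure lborel {-2..2::real}"
        by (rule emeasure_mono) (auto simp: E_def)
      also have "\<dots> < \<infinity>" by (simp add: emeasure_lborel_Icc_eq)
      finally show ?thesis by simp
    qed
  qed
  moreover have "(\<Inter>N. E N) = {}"
  proof (rule equals0I)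
    fix r assume "r \<in> (\<Inter>N. E N)"
    then have "v r > real N" for N by (auto simp: E_def)
    then show False by (meson less_asym reals_Archimedean2)
  qed
  ultimately have "(\<lambda>N. emeasure lborel (E N)) \<longlonglongrightarrow> 0" by simp
  then have "eventually (\<lambda>N. emeasure lborel (E N) < ennreal (1/2)) sequentially"
    using ennreal_lessI[of "1/2" 0] by (intro order_tendstoD) auto
  then obtain N where N: "emeasure lborel (E N) < ennreal (1/2)"
    by (auto simp: eventually_sequentially)
  have "v s \<le> Cv * (2 * real N)" if s: "\<bar>s\<bar> \<le> 1" for s
  proof (rule ccontr)
    assume contra: "\<not> v s \<le> Cv * (2 * real N)"
    define F where "F = {r. s - r \<in> E N}"
    have Fm [measurable]: "F \<in> sets lborel" unfolding F_def by measurable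
    have "emeasure lborel F = (\<integral>\<^sup>+r. indicator F r \<partial>lborel)"
      by (rule nn_integral_indicator[OF Fm, symmetric])
    also have "\<dots> = (\<integral>\<^sup>+r. indicator (E N) (s - r) \<partial>lborel)"
      by (intro nn_integral_cong) (simp add: F_def indicator_def)
    also have "\<dots> = emeasure lborel (E N)"
      using nn_integral_real_affine[of "indicator (E N)" "-1" s] nn_integral_indicator[OF Em, of N] by simp
    finally have F: "emeasure lborel F < ennreal (1/2)" using N by simp
    \<comment> \<open>Two sets of measure below 1/2 would cover an interval of length 1.\<close>
    have "{0..1} \<subseteq> E N \<union> F"
    proof
      fix r :: real assume r: "r \<in> {0..1}"
      show "r \<in> E N \<union> F"
      proof (rule ccontr)
        assume "r \<notin> E N \<union> F"
        then have "v r \<le> real N" "v (s - r) \<le> real N"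
          using r s by (auto simp: E_def F_def not_less)
        moreover have "v s \<le> Cv * (v r + v (s - r))" using Cv(2)[of r "s - r"] by simp
        moreover have "Cv * (v r + v (s - r)) \<le> Cv * (2 * real N)"
          using calculation Cv(1) by (intro mult_left_mono) auto
        ultimately show False using contra by linarith
      qed
    qed
    then have "emeasure lborel {0..1::real} \<le> emeasure lborel (E N) + emeasure lborel F"
      by (meson emeasure_mono emeasure_subadditive order_trans Em Fm sets.Un)
    also have "\<dots> < ennreal (1/2) + ennreal (1/2)"
      using N F by (rule add_strict_mono)
    also have "\<dots> = ennreal (1/2 + 1/2)" by (rule ennreal_plus[symmetric]) auto
    finally show False by (simp add: emeasure_lborel_Icc_eq)
  qed
  then show ?thesis by (intro exI[of _ "max 1 (Cv * (2 * real N))"]) (auto simp: le_max_iff_disj)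
qed

lemma v_double: "v s \<le> 2 * Cv * v (s / 2)"
  using Cv(2)[of "s/2" "s/2"] by simp

text \<open>Doubling the argument costs a factor \<open>2 * Cv\<close>, and finitely many doublings
  lead from [-1, 1] to any bounded interval.\<close>

lemma v_bounded_on: "\<exists>M\<ge>1. \<forall>s. \<bar>s\<bar> \<le> L \<longrightarrow> v s \<le> M"
proof -
  have *: "\<exists>M\<ge>1. \<forall>s. \<bar>s\<bar> \<le> 2 ^ n \<longrightarrow> v s \<le> M" for n :: nat
  proof (induction n)
    case 0
    then show ?case using v_bounded_near_0 by simp
  next
    case (Suc n)
    then obtain M where M: "M \<ge> 1" "\<And>s. \<bar>s\<bar> \<le> 2 ^ n \<Longrightarrow> v s \<le> M" by blast
    have "v s \<le> 2 * Cv * M" if "\<bar>s\<bar> \<le> 2 ^ Suc n" for s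
    proof -
      have "v (s / 2) \<le> M" using that by (intro M) simp
      then have "2 * Cv * v (s / 2) \<le> 2 * Cv * M" using Cv(1) by (intro mult_left_mono) auto
      then show ?thesis using v_double[of s] by linarith
    qed
    moreover have "2 * Cv * M \<ge> 1"
      using Cv(1) M(1) mult_mono[of 1 Cv 1 M] by auto
    ultimately show ?case by blast
  qed
  obtain n where "L < 2 ^ n" using real_arch_pow[of 2 L] by auto
  then show ?thesis using *[of n] by (meson less_imp_le order_trans)
qed

text \<open>Passing from s/2 to s multiplies v by at most the constant \<open>2 * Cv\<close>, but
  exp(b |s|) by the factor exp(b |s| / 2), which exceeds that constant once |s| is at least 2 L.
  Hence an induction over dyadic scales, started on [-2 L, 2 L].\<close>

lemma v_le_exp:
  assumes b: "b > 0"
  shows "\<exists>K>0. \<forall>s. v s \<le> K * exp (b * \<bar>s\<bar>)"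
proof -
  define L where "L = ln (2 * Cv) / b"
  have L: "L > 0" using Cv(1) b by (auto simp: L_def)
  obtain K where K: "K \<ge> 1" "\<And>s. \<bar>s\<bar> \<le> 2 * L \<Longrightarrow> v s \<le> K" using v_bounded_on by meson
  have *: "\<bar>s\<bar> \<le> 2 ^ n * (2 * L) \<Longrightarrow> v s \<le> K * exp (b * \<bar>s\<bar>)" for n :: nat and s
  proof (induction n arbitrary: s)
    case 0
    then have "v s \<le> K * 1" using K(2)[of s] by simp
    also have "\<dots> \<le> K * exp (b * \<bar>s\<bar>)" using K(1) b by (intro mult_left_mono) auto
    finally show ?case .
  next
    case (Suc n)
    show ?case
    proof (cases "\<bar>s\<bar> \<le> 2 * L")
      case True
      then have "v s \<le> K * 1" using K(2)[of s] by simp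
      also have "\<dots> \<le> K * exp (b * \<bar>s\<bar>)" using K(1) b by (intro mult_left_mono) auto
      finally show ?thesis .
    next
      case False
      have "ln (2 * Cv) \<le> b * \<bar>s / 2\<bar>" using False b by (simp add: L_def field_simps)
      then have "2 * Cv \<le> exp (b * \<bar>s / 2\<bar>)"
        using Cv(1) by (metis exp_le_cancel_iff exp_ln less_le_trans mult_pos_pos zero_less_numeral zero_less_one)
      moreover have "v (s / 2) \<le> K * exp (b * \<bar>s / 2\<bar>)" using Suc.IH[of "s / 2"] Suc.prems by simp
      ultimately have "2 * Cv * v (s / 2) \<le> exp (b * \<bar>s / 2\<bar>) * (K * exp (b * \<bar>s / 2\<bar>))"
        using Cv(1) v_pos[of "s/2"] by (intro mult_mono) auto
      also have "\<dots> = K * (exp (b * \<bar>s / 2\<bar>) * exp (b * \<bar>s / 2\<bar>))" by simp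
      also have "exp (b * \<bar>s / 2\<bar>) * exp (b * \<bar>s / 2\<bar>) = exp (b * \<bar>s\<bar>)"
        by (simp add: exp_add[symmetric])
      finally show ?thesis using v_double[of s] by linarith
    qed
  qed
  have "v s \<le> K * exp (b * \<bar>s\<bar>)" for s
  proof -
    obtain n where "\<bar>s\<bar> / (2 * L) < 2 ^ n" using real_arch_pow[of 2] by auto
    then show ?thesis using L by (intro *[of _ n]) (simp add: field_simps)
  qed
  then show ?thesis using K(1) by (intro exI[of _ K]) auto
qed

definition wt where "wt s = v s * exp (w * \<bar>s\<bar>)"

lemma wt_measurable [measurable]: "wt \<in> borel_measurable borel"
  unfolding wt_def by measurable

lemma wt_ge_1: "wt s \<ge> 1"
  using mult_mono[OF v_ge_1[of s], of 1 "exp (w * \<bar>s\<bar>)"] w_nonneg v_pos[of s] by (simp add: wt_def less_imp_le)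

lemma wt_pos: "wt s > 0"
  using wt_ge_1[of s] by linarith

text \<open>The factor v is quasi-subadditive and the exponential is submultiplicative. The two
  terms have the shape that a convolution can use: the full weight on one factor, and on the other
  just the exponential, for which an L1 bound is available.\<close>

lemma wt_sub: "wt (s + t) \<le> Cv * (wt s * exp (w * \<bar>t\<bar>) + exp (w * \<bar>s\<bar>) * wt t)"
proof -
  have "wt (s + t) \<le> (Cv * (v s + v t)) * (exp (w * \<bar>s\<bar>) * exp (w * \<bar>t\<bar>))"
    unfolding wt_def using w_nonneg Cv(1) v_pos[of s] v_pos[of t]
    by (intro mult_mono Cv(2)) (auto simp: exp_add[symmetric] distrib_left[symmetric] intro!: mult_left_mono abs_triangle_ineq)
  then show ?thesis by (simp add: wt_def algebra_simps)
qed

lemma wt_le_exp: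
  assumes h: "h > w"
  shows "\<exists>K>0. \<forall>s. wt s * exp (- (h * \<bar>s\<bar>)) \<le> K / (1 + s\<^sup>2)"
proof -
  \<comment> \<open>One half of the margin absorbs v, the other half absorbs 1 + s^2.\<close>
  define b where "b = (h - w) / 2"
  have b: "b > 0" using h by (simp add: b_def)
  obtain K where K: "K > 0" "\<And>s. v s \<le> K * exp (b * \<bar>s\<bar>)" using v_le_exp[OF b] by blast
  obtain L where L: "L > 0" "\<And>s::real. 1 + s\<^sup>2 \<le> L * exp (b * \<bar>s\<bar>)" using one_plus_square_le_exp[OF b] by blast
  have "wt s * exp (- (h * \<bar>s\<bar>)) * (1 + s\<^sup>2) \<le> K * L" for s
  proof -
    have "v s * (1 + s\<^sup>2) \<le> (K * exp (b * \<bar>s\<bar>)) * (L * exp (b * \<bar>s\<bar>))"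
      using K L v_pos[of s] by (intro mult_mono) auto
    then have "v s * (1 + s\<^sup>2) * exp (w * \<bar>s\<bar> - h * \<bar>s\<bar>)
        \<le> (K * exp (b * \<bar>s\<bar>)) * (L * exp (b * \<bar>s\<bar>)) * exp (w * \<bar>s\<bar> - h * \<bar>s\<bar>)"
      by (intro mult_right_mono) auto
    also have "\<dots> = K * L * exp (b * \<bar>s\<bar> + b * \<bar>s\<bar> + (w * \<bar>s\<bar> - h * \<bar>s\<bar>))"
      by (simp only: exp_add mult_ac)
    also have "b * \<bar>s\<bar> + b * \<bar>s\<bar> + (w * \<bar>s\<bar> - h * \<bar>s\<bar>) = 0"
      by (simp add: b_def field_simps)
    finally show ?thesis by (simp add: wt_def exp_diff exp_minus field_simps)
  qed
  then show ?thesis using K(1) L(1) by (intro exI[of _ "K * L"]) (simp add: field_simps)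
qed

lemma wt_le_gauss:
  assumes d: "d > 0"
  shows "\<exists>K>0. \<forall>s. wt s * exp (- (d * s\<^sup>2)) \<le> K / (1 + s\<^sup>2)"
proof -
  obtain K where K: "K > 0" "\<And>s. wt s * exp (- ((w + 1) * \<bar>s\<bar>)) \<le> K / (1 + s\<^sup>2)"
    using wt_le_exp[of "w + 1"] by auto
  \<comment> \<open>The maximum of \<open>exp ((w + 1) * r - d * r\<^sup>2)\<close> over r.\<close>
  let ?L = "exp ((w + 1)\<^sup>2 / (4 * d))"
  have "wt s * exp (- (d * s\<^sup>2)) \<le> K * ?L / (1 + s\<^sup>2)" for s
  proof -
    have "0 \<le> (2 * d * \<bar>s\<bar> - (w + 1))\<^sup>2" by simp
    then have "4 * d * ((w + 1) * \<bar>s\<bar> - d * s\<^sup>2) \<le> (w + 1)\<^sup>2"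
      by (simp add: power2_eq_square algebra_simps)
    then have "(w + 1) * \<bar>s\<bar> - d * s\<^sup>2 \<le> (w + 1)\<^sup>2 / (4 * d)"
      using d by (simp add: pos_le_divide_eq mult.commute)
    then have "exp ((w + 1) * \<bar>s\<bar> - d * s\<^sup>2) \<le> ?L" by simp
    then have "(wt s * exp (- ((w + 1) * \<bar>s\<bar>))) * exp ((w + 1) * \<bar>s\<bar> - d * s\<^sup>2) \<le> K / (1 + s\<^sup>2) * ?L"
      using K wt_pos[of s] by (intro mult_mono) auto
    then show ?thesis by (simp add: mult.assoc exp_add[symmetric])
  qed
  then show ?thesis using K(1) by (intro exI[of _ "K * ?L"]) auto
qed

end

section \<open>Weighted Fourier algebras on strips\<close>

text \<open>Cauchy-Schwarz in the form that gives Minkowski's inequality when a and b are the norms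
  of the two summands.\<close>

lemma weighted_square_sum_le:
  fixes a b x y :: real
  assumes "a > 0" "b > 0"
  shows "(x + y)\<^sup>2 \<le> (a + b) / a * x\<^sup>2 + (a + b) / b * y\<^sup>2"
proof -
  have "0 \<le> (b * x - a * y)\<^sup>2" by simp
  then have "2 * (a * b * (x * y)) \<le> b * b * (x * x) + a * a * (y * y)"
    by (simp add: power2_eq_square algebra_simps)
  then have "a * b * ((x + y) * (x + y)) \<le> (a + b) * b * (x * x) + (a + b) * a * (y * y)"
    by (simp add: algebra_simps)
  then have "(x + y) * (x + y) \<le> ((a + b) * b * (x * x) + (a + b) * a * (y * y)) / (a * b)"
    using assms by (simp add: pos_le_divide_eq mult.commute)
  also have "\<dots> = (a + b) / a * (x * x) + (a + b) / b * (y * y)"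
    using assms by (simp add: field_simps)
  finally show ?thesis by (simp add: power2_eq_square)
qed

lemma strip_Im_le: "z \<in> strip u \<Longrightarrow> u \<ge> 0 \<Longrightarrow> \<bar>Im z\<bar> \<le> u"
  by (auto simp: strip_def split: if_splits)

lemma norm_exp_strip:
  assumes "\<bar>Im z\<bar> \<le> u"
  shows "norm (exp (- \<i> * z * of_real s)) \<le> exp (u * \<bar>s\<bar>)"
proof -
  have "Im z * s \<le> \<bar>Im z\<bar> * \<bar>s\<bar>" by (metis abs_ge_self abs_mult)
  also have "\<dots> \<le> u * \<bar>s\<bar>" using assms by (intro mult_right_mono) auto
  finally show ?thesis by simp
qed

lemma Fourier_integrable:
  fixes g :: "real \<Rightarrow> complex"
  assumes [measurable]: "g \<in> borel_measurable borel"
    and "integrable lborel (\<lambda>s. exp (u * \<bar>s\<bar>) * cmod (g s))" "\<bar>Im z\<bar> \<le> u"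
  shows "integrable lborel (\<lambda>s. exp (- \<i> * z * of_real s) * g s)"
  by (rule Bochner_Integration.integrable_bound[OF assms(2)])
     (use norm_exp_strip[OF assms(3)] in \<open>auto simp: norm_mult intro!: AE_I2 mult_right_mono\<close>)

section \<open>The space W: norm, sums, products\<close>

context weight
begin

text \<open>One representing function of norm at most c takes the place of the infimum in
  \<open>W_norm\<close>. Such bounds combine under sums and products with explicit
  constants.\<close>

definition Wle where
  "Wle h c \<longleftrightarrow> (\<exists>g. W_rep v w h g \<and> (LINT s|lborel. (wt s * cmod (g s))\<^sup>2) \<le> c\<^sup>2)"

text \<open>A bound for the nonnegative integral gives integrability and its value together; the
  unweighted L2 condition follows from \<open>wt \<ge> 1\<close>.\<close>

lemma WleI:
  assumes [measurable]: "g \<in> borel_measurable borel"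
    and bd: "(\<integral>\<^sup>+s. ennreal ((wt s * cmod (g s))\<^sup>2) \<partial>lborel) \<le> ennreal (c\<^sup>2)"
    and "\<And>z. z \<in> strip w \<Longrightarrow> h z = (LINT s|lborel. exp (- \<i> * z * of_real s) * g s)"
  shows "Wle h c"
proof -
  have int: "integrable lborel (\<lambda>s. (wt s * cmod (g s))\<^sup>2)"
    by (rule integrableI_bounded) (use bd in \<open>auto simp: le_less_trans\<close>)
  have "integrable lborel (\<lambda>s. (cmod (g s))\<^sup>2)"
  proof (rule Bochner_Integration.integrable_bound[OF int])
    have "cmod (g s) \<le> wt s * cmod (g s)" for s
      using mult_right_mono[OF wt_ge_1, of "cmod (g s)" s] by simp
    then show "AE s in lborel. norm ((cmod (g s))\<^sup>2) \<le> norm ((wt s * cmod (g s))\<^sup>2)"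
      by (auto intro!: AE_I2 power_mono)
  qed measurable
  moreover have "(LINT s|lborel. (wt s * cmod (g s))\<^sup>2) \<le> c\<^sup>2"
    by (rule integral_real_bounded) (use bd in auto)
  ultimately show ?thesis
    unfolding Wle_def W_rep_def using assms(1,3) int by (intro exI[of _ g]) (auto simp: wt_def)
qed

lemma WleE:
  assumes "Wle h c"
  obtains g where "g \<in> borel_measurable borel" "integrable lborel (\<lambda>s. (wt s * cmod (g s))\<^sup>2)"
    "(LINT s|lborel. (wt s * cmod (g s))\<^sup>2) \<le> c\<^sup>2"
    "(\<integral>\<^sup>+s. ennreal ((wt s * cmod (g s))\<^sup>2) \<partial>lborel) \<le> ennreal (c\<^sup>2)"
    "\<forall>z\<in>strip w. h z = (LINT s|lborel. exp (- \<i> * z * of_real s) * g s)"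
proof -
  obtain g where g: "W_rep v w h g" "(LINT s|lborel. (wt s * cmod (g s))\<^sup>2) \<le> c\<^sup>2"
    using assms by (auto simp: Wle_def)
  then have int: "integrable lborel (\<lambda>s. (wt s * cmod (g s))\<^sup>2)" by (simp add: W_rep_def wt_def)
  have "(\<integral>\<^sup>+s. ennreal ((wt s * cmod (g s))\<^sup>2) \<partial>lborel) \<le> ennreal (c\<^sup>2)"
    using g(2) int by (subst nn_integral_eq_integral) (auto intro: ennreal_leI)
  then show ?thesis using g int that[of g] by (simp add: W_rep_def)
qed

lemma W_norm_le: "Wle h c \<Longrightarrow> c \<ge> 0 \<Longrightarrow> W_norm v w h \<le> ennreal c"
proof -
  assume "Wle h c" "c \<ge> 0"
  then obtain g where g: "W_rep v w h g" "(LINT s|lborel. (wt s * cmod (g s))\<^sup>2) \<le> c\<^sup>2"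
    by (auto simp: Wle_def)
  have "sqrt (LINT s|lborel. (wt s * cmod (g s))\<^sup>2) \<le> c"
    using g(2) \<open>c \<ge> 0\<close> real_le_lsqrt sqrt_le_D by (metis real_sqrt_le_mono real_sqrt_abs abs_of_nonneg)
  then have "ennreal (sqrt (LINT s|lborel. (v s * exp (w * \<bar>s\<bar>) * cmod (g s))\<^sup>2)) \<le> ennreal c"
    by (simp add: wt_def ennreal_leI)
  then show ?thesis unfolding W_norm_def using g(1) by (meson INF_lower2 mem_Collect_eq)
qed

text \<open>The strict inequality supplies a representing function below c without any claim that
  the infimum is attained.\<close>

lemma Wle_of_W_norm: "W_norm v w h < ennreal c \<Longrightarrow> Wle h c"
proof -
  assume "W_norm v w h < ennreal c"
  then obtain g where g: "W_rep v w h g" "ennreal (sqrt (LINT s|lborel. (v s * exp (w * \<bar>s\<bar>) * cmod (g s))\<^sup>2)) < ennreal c"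
    unfolding W_norm_def by (auto simp: INF_less_iff)
  then have "sqrt (LINT s|lborel. (wt s * cmod (g s))\<^sup>2) < c"
    by (subst (asm) ennreal_less_iff) (auto simp: wt_def)
  moreover have "0 \<le> (LINT s|lborel. (wt s * cmod (g s))\<^sup>2)" by simp
  ultimately have "(LINT s|lborel. (wt s * cmod (g s))\<^sup>2) \<le> c\<^sup>2"
    by (metis less_imp_le sqrt_le_D)
  then show ?thesis unfolding Wle_def using g by blast
qed

lemma Wle_cong:
  assumes "Wle h c" "\<And>z. z \<in> strip w \<Longrightarrow> h z = h' z"
  shows "Wle h' c"
proof -
  obtain g where g: "W_rep v w h g" "(LINT s|lborel. (wt s * cmod (g s))\<^sup>2) \<le> c\<^sup>2"
    using assms(1) unfolding Wle_def by blast
  have "W_rep v w h' g" using g(1) assms(2) unfolding W_rep_def by simp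
  then show ?thesis unfolding Wle_def using g(2) by blast
qed

lemma Wle_mono:
  assumes "Wle h c" "0 \<le> c" "c \<le> d"
  shows "Wle h d"
proof -
  have "c\<^sup>2 \<le> d\<^sup>2" using assms(2,3) by (intro power_mono) auto
  then show ?thesis using assms(1) unfolding Wle_def by (metis order_trans)
qed

text \<open>The constant that the inequality \<open>2 * x * y \<le> x\<^sup>2 + y\<^sup>2\<close>
  produces for x = 1 / v and y of L2 norm at most 1; it is positive even before the integral is
  known.\<close>

definition Av where "Av = ((LINT s|lborel. (1 / v s)\<^sup>2) + 1) / 2"

lemma Av_pos: "Av > 0"
proof -
  have "0 \<le> (LINT s|lborel. (1 / v s)\<^sup>2)" by simp
  then show ?thesis unfolding Av_def by (intro divide_pos_pos add_nonneg_pos) auto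
qed

text \<open>This is where \<open>1 / v \<in> L\<^sup>2\<close> enters.\<close>
lemma rep_L1:
  assumes [measurable]: "g \<in> borel_measurable borel"
    and int: "integrable lborel (\<lambda>s. (wt s * cmod (g s))\<^sup>2)"
    and le: "(LINT s|lborel. (wt s * cmod (g s))\<^sup>2) \<le> c\<^sup>2" and c: "c > 0"
  shows "integrable lborel (\<lambda>s. exp (w * \<bar>s\<bar>) * cmod (g s))"
    "(LINT s|lborel. exp (w * \<bar>s\<bar>) * cmod (g s)) \<le> Av * c"
proof -
  have vi: "integrable lborel (\<lambda>s. (1 / v s)\<^sup>2)"
    using sadm by (simp add: strongly_admissible_def)
  \<comment> \<open>c times the arithmetic-geometric mean bound for the product of
    \<open>1 / v s\<close> and \<open>wt s * cmod (g s) / c\<close>.\<close>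
  let ?d = "\<lambda>s. c / 2 * ((1 / v s)\<^sup>2 + (wt s * cmod (g s))\<^sup>2 / c\<^sup>2)"
  have dint: "integrable lborel ?d" using vi int by auto
  have bd: "exp (w * \<bar>s\<bar>) * cmod (g s) \<le> ?d s" for s
  proof -
    have "0 \<le> (1 / v s - wt s * cmod (g s) / c)\<^sup>2" by simp
    then have "2 * (1 / v s) * (wt s * cmod (g s) / c) \<le> (1 / v s)\<^sup>2 + (wt s * cmod (g s) / c)\<^sup>2"
      by (simp add: power2_diff)
    moreover have "2 * (1 / v s) * (wt s * cmod (g s) / c) = 2 / c * (exp (w * \<bar>s\<bar>) * cmod (g s))"
      using v_pos[of s] by (simp add: wt_def field_simps)
    ultimately have "2 / c * (exp (w * \<bar>s\<bar>) * cmod (g s)) \<le> (1 / v s)\<^sup>2 + (wt s * cmod (g s))\<^sup>2 / c\<^sup>2"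
      by (simp only: power_divide[of "wt s * cmod (g s)"])
    then have "c / 2 * (2 / c * (exp (w * \<bar>s\<bar>) * cmod (g s))) \<le> ?d s"
      using c by (intro mult_left_mono) auto
    then show ?thesis using c by simp
  qed
  show i: "integrable lborel (\<lambda>s. exp (w * \<bar>s\<bar>) * cmod (g s))"
    by (rule Bochner_Integration.integrable_bound[OF dint])
       (use bd in \<open>auto intro!: AE_I2 intro: order_trans[OF _ abs_ge_self]\<close>)
  have "(LINT s|lborel. exp (w * \<bar>s\<bar>) * cmod (g s)) \<le> (LINT s|lborel. ?d s)"
    using i dint bd by (rule integral_mono)
  also have "\<dots> = c / 2 * ((LINT s|lborel. (1 / v s)\<^sup>2) + (LINT s|lborel. (wt s * cmod (g s))\<^sup>2) / c\<^sup>2)"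
    using vi int by simp
  also have "\<dots> \<le> c / 2 * ((LINT s|lborel. (1 / v s)\<^sup>2) + 1)"
    using le c by (intro mult_left_mono add_left_mono) (auto simp: divide_le_eq)
  also have "\<dots> = Av * c" by (simp add: Av_def)
  finally show "(LINT s|lborel. exp (w * \<bar>s\<bar>) * cmod (g s)) \<le> Av * c" .
qed

lemma rep_FT_integrable:
  assumes "g \<in> borel_measurable borel"
    and int: "integrable lborel (\<lambda>s. (wt s * cmod (g s))\<^sup>2)" and z: "z \<in> strip w"
  shows "integrable lborel (\<lambda>s. exp (- \<i> * z * of_real s) * g s)"
proof (rule Fourier_integrable[OF assms(1)])
  let ?I = "LINT s|lborel. (wt s * cmod (g s))\<^sup>2"
  have "?I \<ge> 0" by simp
  \<comment> \<open>\<open>rep_L1\<close> asks for a positive c, hence the added 1, which covers g =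
    0.\<close>
  then have "?I \<le> (sqrt ?I + 1)\<^sup>2" "sqrt ?I + 1 > 0"
    by (auto simp: power2_sum add_nonneg_pos intro: add_increasing2)
  then show "integrable lborel (\<lambda>s. exp (w * \<bar>s\<bar>) * cmod (g s))"
    using rep_L1(1)[OF assms(1) int] by blast
  show "\<bar>Im z\<bar> \<le> w" by (rule strip_Im_le[OF z w_nonneg])
qed

lemma Wle_scale:
  assumes "Wle h c"
  shows "Wle (\<lambda>z. a * h z) (cmod a * c)"
proof -
  obtain g where g: "g \<in> borel_measurable borel" "integrable lborel (\<lambda>s. (wt s * cmod (g s))\<^sup>2)"
    "(LINT s|lborel. (wt s * cmod (g s))\<^sup>2) \<le> c\<^sup>2"
    "(\<integral>\<^sup>+s. ennreal ((wt s * cmod (g s))\<^sup>2) \<partial>lborel) \<le> ennreal (c\<^sup>2)"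
    "\<forall>z\<in>strip w. h z = (LINT s|lborel. exp (- \<i> * z * of_real s) * g s)"
    by (rule WleE[OF assms], rule that)
  have [measurable]: "g \<in> borel_measurable borel" by fact
  show ?thesis
  proof (rule WleI[where g="\<lambda>s. a * g s"])
    have "(\<integral>\<^sup>+s. ennreal ((wt s * cmod (a * g s))\<^sup>2) \<partial>lborel)
      = (\<integral>\<^sup>+s. ennreal ((cmod a)\<^sup>2) * ennreal ((wt s * cmod (g s))\<^sup>2) \<partial>lborel)"
      by (intro nn_integral_cong) (simp add: norm_mult power_mult_distrib ennreal_mult[symmetric] mult_ac)
    also have "\<dots> = ennreal ((cmod a)\<^sup>2) * (\<integral>\<^sup>+s. ennreal ((wt s * cmod (g s))\<^sup>2) \<partial>lborel)"
      by (rule nn_integral_cmult) measurable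
    also have "\<dots> \<le> ennreal ((cmod a)\<^sup>2) * ennreal (c\<^sup>2)" by (intro mult_left_mono g) simp
    finally show "(\<integral>\<^sup>+s. ennreal ((wt s * cmod (a * g s))\<^sup>2) \<partial>lborel) \<le> ennreal ((cmod a * c)\<^sup>2)"
      by (simp add: ennreal_mult[symmetric] power_mult_distrib)
    fix z assume "z \<in> strip w"
    then show "a * h z = (LINT s|lborel. exp (- \<i> * z * of_real s) * (a * g s))"
      using g(5) by (simp add: mult.left_commute)
  qed measurable
qed

lemma Wle_add:
  assumes "Wle h1 c1" "Wle h2 c2" "c1 > 0" "c2 > 0"
  shows "Wle (\<lambda>z. h1 z + h2 z) (c1 + c2)"
proof -
  obtain g1 where g1: "g1 \<in> borel_measurable borel" "integrable lborel (\<lambda>s. (wt s * cmod (g1 s))\<^sup>2)"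
    "(LINT s|lborel. (wt s * cmod (g1 s))\<^sup>2) \<le> c1\<^sup>2"
    "(\<integral>\<^sup>+s. ennreal ((wt s * cmod (g1 s))\<^sup>2) \<partial>lborel) \<le> ennreal (c1\<^sup>2)"
    "\<forall>z\<in>strip w. h1 z = (LINT s|lborel. exp (- \<i> * z * of_real s) * g1 s)"
    by (rule WleE[OF assms(1)], rule that)
  obtain g2 where g2: "g2 \<in> borel_measurable borel" "integrable lborel (\<lambda>s. (wt s * cmod (g2 s))\<^sup>2)"
    "(LINT s|lborel. (wt s * cmod (g2 s))\<^sup>2) \<le> c2\<^sup>2"
    "(\<integral>\<^sup>+s. ennreal ((wt s * cmod (g2 s))\<^sup>2) \<partial>lborel) \<le> ennreal (c2\<^sup>2)"
    "\<forall>z\<in>strip w. h2 z = (LINT s|lborel. exp (- \<i> * z * of_real s) * g2 s)"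
    by (rule WleE[OF assms(2)], rule that)
  have [measurable]: "g1 \<in> borel_measurable borel" "g2 \<in> borel_measurable borel" by fact+
  let ?d = "\<lambda>s. (c1 + c2) / c1 * (wt s * cmod (g1 s))\<^sup>2 + (c1 + c2) / c2 * (wt s * cmod (g2 s))\<^sup>2"
  have dint: "integrable lborel ?d" using g1 g2 by auto
  have "(LINT s|lborel. ?d s) = (c1 + c2) / c1 * (LINT s|lborel. (wt s * cmod (g1 s))\<^sup>2)
      + (c1 + c2) / c2 * (LINT s|lborel. (wt s * cmod (g2 s))\<^sup>2)"
    using g1(2) g2(2) by simp
  also have "\<dots> \<le> (c1 + c2) / c1 * c1\<^sup>2 + (c1 + c2) / c2 * c2\<^sup>2"
    using assms(3,4) by (intro add_mono mult_left_mono g1(3) g2(3)) auto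
  also have "\<dots> = (c1 + c2)\<^sup>2" using assms(3,4) by (simp add: power2_eq_square field_simps)
  finally have dle: "(LINT s|lborel. ?d s) \<le> (c1 + c2)\<^sup>2" .
  show ?thesis
  proof (rule WleI[where g="\<lambda>s. g1 s + g2 s"])
    \<comment> \<open>\<open>(x + y)\<^sup>2 \<le> x\<^sup>2 / \<lambda> + y\<^sup>2 / (1 - \<lambda>)\<close> with \<open>\<lambda> = c1 / (c1 + c2)\<close> gives Minkowski's inequality.\<close>
    have "(wt s * cmod (g1 s + g2 s))\<^sup>2 \<le> ?d s" for s
    proof -
      let ?x = "wt s * cmod (g1 s)" and ?y = "wt s * cmod (g2 s)"
      have "(wt s * cmod (g1 s + g2 s))\<^sup>2 \<le> (?x + ?y)\<^sup>2"
        using wt_pos[of s] norm_triangle_ineq[of "g1 s" "g2 s"]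
        by (intro power_mono) (auto simp: distrib_left[symmetric])
      also have "\<dots> \<le> (c1 + c2) / c1 * ?x\<^sup>2 + (c1 + c2) / c2 * ?y\<^sup>2"
        by (rule weighted_square_sum_le[OF assms(3,4)])
      finally show ?thesis .
    qed
    then have "(\<integral>\<^sup>+s. ennreal ((wt s * cmod (g1 s + g2 s))\<^sup>2) \<partial>lborel) \<le> (\<integral>\<^sup>+s. ennreal (?d s) \<partial>lborel)"
      by (intro nn_integral_mono ennreal_leI)
    also have "\<dots> = ennreal (LINT s|lborel. ?d s)"
      using assms by (intro nn_integral_eq_integral dint) auto
    also have "\<dots> \<le> ennreal ((c1 + c2)\<^sup>2)" using dle by (rule ennreal_leI)
    finally show "(\<integral>\<^sup>+s. ennreal ((wt s * cmod (g1 s + g2 s))\<^sup>2) \<partial>lborel) \<le> ennreal ((c1 + c2)\<^sup>2)" .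
    fix z assume z: "z \<in> strip w"
    show "h1 z + h2 z = (LINT s|lborel. exp (- \<i> * z * of_real s) * (g1 s + g2 s))"
      using g1(5) g2(5) z rep_FT_integrable[OF g1(1,2) z] rep_FT_integrable[OF g2(1,2) z]
      by (simp add: distrib_left)
  qed measurable
qed

lemma Wle_diff:
  assumes "Wle h1 c1" "Wle h2 c2" "c1 > 0" "c2 > 0"
  shows "Wle (\<lambda>z. h1 z - h2 z) (c1 + c2)"
  using Wle_add[OF assms(1) Wle_scale[OF assms(2), of "-1"]] assms by simp

lemma Wle_sum:
  assumes "finite S" "S \<noteq> {}" "\<And>i. i \<in> S \<Longrightarrow> Wle (h i) (c i)" "\<And>i. i \<in> S \<Longrightarrow> c i > 0"
  shows "Wle (\<lambda>z. \<Sum>i\<in>S. h i z) (\<Sum>i\<in>S. c i)"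
  using assms
proof (induction S rule: finite_ne_induct)
  case (singleton x)
  then show ?case by simp
next
  case (insert x F)
  then have "Wle (\<lambda>z. h x z + (\<Sum>i\<in>F. h i z)) (c x + (\<Sum>i\<in>F. c i))"
    by (intro Wle_add) (auto intro!: sum_pos)
  then show ?case using insert by simp
qed

text \<open>Cv comes from \<open>wt_sub\<close>, Av from the L1 bound, and 2 from the two terms of
  \<open>wt_sub\<close>: \<open>2 * Cv\<^sup>2 * (1 + 1)\<close> is the square of
  \<open>2 * Cv\<close>.\<close>

definition KW where "KW = 2 * Cv * Av"

lemma KW_pos: "KW > 0"
  unfolding KW_def using Cv(1) Av_pos by simp

text \<open>The product is represented by the convolution of g1 and g2. By \<open>wt_sub\<close> its
  weighted modulus is at most Cv times a sum of two convolutions, each of some p (exponential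
  weight, in L1 by \<open>rep_L1\<close>) with some q (full weight, in L2), and Young's inequality
  bounds both.\<close>

lemma Wle_mult:
  assumes "Wle h1 c1" "Wle h2 c2" and c: "c1 > 0" "c2 > 0"
  shows "Wle (\<lambda>z. h1 z * h2 z) (KW * c1 * c2)"
proof -
  obtain g1 where g1: "g1 \<in> borel_measurable borel" "integrable lborel (\<lambda>s. (wt s * cmod (g1 s))\<^sup>2)"
    "(LINT s|lborel. (wt s * cmod (g1 s))\<^sup>2) \<le> c1\<^sup>2"
    "(\<integral>\<^sup>+s. ennreal ((wt s * cmod (g1 s))\<^sup>2) \<partial>lborel) \<le> ennreal (c1\<^sup>2)"
    "\<forall>z\<in>strip w. h1 z = (LINT s|lborel. exp (- \<i> * z * of_real s) * g1 s)"
    by (rule WleE[OF assms(1)], rule that)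
  obtain g2 where g2: "g2 \<in> borel_measurable borel" "integrable lborel (\<lambda>s. (wt s * cmod (g2 s))\<^sup>2)"
    "(LINT s|lborel. (wt s * cmod (g2 s))\<^sup>2) \<le> c2\<^sup>2"
    "(\<integral>\<^sup>+s. ennreal ((wt s * cmod (g2 s))\<^sup>2) \<partial>lborel) \<le> ennreal (c2\<^sup>2)"
    "\<forall>z\<in>strip w. h2 z = (LINT s|lborel. exp (- \<i> * z * of_real s) * g2 s)"
    by (rule WleE[OF assms(2)], rule that)
  have [measurable]: "g1 \<in> borel_measurable borel" "g2 \<in> borel_measurable borel" by fact+
  define p1 p2 q1 q2 where "p1 r = exp (w * \<bar>r\<bar>) * cmod (g1 r)" and "p2 r = exp (w * \<bar>r\<bar>) * cmod (g2 r)"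
    and "q1 r = wt r * cmod (g1 r)" and "q2 r = wt r * cmod (g2 r)" for r
  have [measurable]: "p1 \<in> borel_measurable borel" "p2 \<in> borel_measurable borel"
    "q1 \<in> borel_measurable borel" "q2 \<in> borel_measurable borel"
    unfolding p1_def p2_def q1_def q2_def by measurable
  have nn: "p1 r \<ge> 0" "p2 r \<ge> 0" "q1 r \<ge> 0" "q2 r \<ge> 0" for r
    using wt_pos[of r] by (auto simp: p1_def p2_def q1_def q2_def)
  have P1: "(\<integral>\<^sup>+r. ennreal (p1 r) \<partial>lborel) \<le> ennreal (Av * c1)"
    using rep_L1[OF g1(1-3) c(1)] nn unfolding p1_def[symmetric]
    by (subst nn_integral_eq_integral) (auto intro: ennreal_leI)
  have P2: "(\<integral>\<^sup>+r. ennreal (p2 r) \<partial>lborel) \<le> ennreal (Av * c2)"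
    using rep_L1[OF g2(1-3) c(2)] nn unfolding p2_def[symmetric]
    by (subst nn_integral_eq_integral) (auto intro: ennreal_leI)
  define X Y where "X s = (\<integral>\<^sup>+r. ennreal (p2 r) * ennreal (q1 (s - r)) \<partial>lborel)"
    and "Y s = (\<integral>\<^sup>+r. ennreal (p1 r) * ennreal (q2 (s - r)) \<partial>lborel)" for s
  have [measurable]: "X \<in> borel_measurable borel" "Y \<in> borel_measurable borel"
    unfolding X_def Y_def by measurable
  have sq: "(ennreal (q1 r))\<^sup>2 = ennreal ((wt r * cmod (g1 r))\<^sup>2)"
    "(ennreal (q2 r))\<^sup>2 = ennreal ((wt r * cmod (g2 r))\<^sup>2)" for r
    using nn[of r] by (simp_all add: ennreal_power q1_def q2_def)
  have X2: "(\<integral>\<^sup>+s. (X s)\<^sup>2 \<partial>lborel) \<le> ennreal ((Av * c1 * c2)\<^sup>2)"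
  proof -
    have "(\<integral>\<^sup>+s. (X s)\<^sup>2 \<partial>lborel) \<le> (\<integral>\<^sup>+r. ennreal (p2 r) \<partial>lborel)\<^sup>2 * (\<integral>\<^sup>+r. (ennreal (q1 r))\<^sup>2 \<partial>lborel)"
      unfolding X_def by (rule Young_nn_integral) (use nn in auto)
    also have "\<dots> \<le> (ennreal (Av * c2))\<^sup>2 * ennreal (c1\<^sup>2)"
      using g1(4) P2 by (intro mult_mono power_mono) (auto simp: sq)
    also have "\<dots> = ennreal ((Av * c1 * c2)\<^sup>2)"
      using Av_pos c by (simp add: ennreal_power ennreal_mult[symmetric] power_mult_distrib mult_ac)
    finally show ?thesis .
  qed
  have Y2: "(\<integral>\<^sup>+s. (Y s)\<^sup>2 \<partial>lborel) \<le> ennreal ((Av * c1 * c2)\<^sup>2)"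
  proof -
    have "(\<integral>\<^sup>+s. (Y s)\<^sup>2 \<partial>lborel) \<le> (\<integral>\<^sup>+r. ennreal (p1 r) \<partial>lborel)\<^sup>2 * (\<integral>\<^sup>+r. (ennreal (q2 r))\<^sup>2 \<partial>lborel)"
      unfolding Y_def by (rule Young_nn_integral) (use nn in auto)
    also have "\<dots> \<le> (ennreal (Av * c1))\<^sup>2 * ennreal (c2\<^sup>2)"
      using g2(4) P1 by (intro mult_mono power_mono) (auto simp: sq)
    also have "\<dots> = ennreal ((Av * c1 * c2)\<^sup>2)"
      using Av_pos c by (simp add: ennreal_power ennreal_mult[symmetric] power_mult_distrib mult_ac)
    finally show ?thesis .
  qed
  define g where "g s = (LINT r|lborel. g1 r * g2 (s - r))" for s
  have [measurable]: "g \<in> borel_measurable borel" unfolding g_def by measurable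
  have gle: "ennreal (wt s * cmod (g s)) \<le> ennreal Cv * (X s + Y s)" for s
  proof -
    have "ennreal (cmod (g s)) \<le> (\<integral>\<^sup>+r. ennreal (cmod (g1 r * g2 (s - r))) \<partial>lborel)"
    proof (cases "integrable lborel (\<lambda>r. g1 r * g2 (s - r))")
      case True
      then show ?thesis unfolding g_def by (rule integral_norm_bound_ennreal)
    next
      \<comment> \<open>A divergent convolution integral has the value 0 by convention, so the bound
        holds at such s as well.\<close>
      case False
      then show ?thesis by (simp add: g_def not_integrable_integral_eq)
    qed
    then have "ennreal (wt s) * ennreal (cmod (g s)) \<le> ennreal (wt s) * (\<integral>\<^sup>+r. ennreal (cmod (g1 r * g2 (s - r))) \<partial>lborel)"
      by (rule mult_left_mono) simp
    also have "\<dots> = (\<integral>\<^sup>+r. ennreal (wt s) * ennreal (cmod (g1 r * g2 (s - r))) \<partial>lborel)"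
      by (rule nn_integral_cmult[symmetric]) measurable
    also have "\<dots> \<le> (\<integral>\<^sup>+r. ennreal Cv * (ennreal (q1 r) * ennreal (p2 (s - r)) + ennreal (p1 r) * ennreal (q2 (s - r))) \<partial>lborel)"
    proof (rule nn_integral_mono)
      fix r
      have "wt s * cmod (g1 r * g2 (s - r)) \<le> Cv * (wt r * exp (w * \<bar>s - r\<bar>) + exp (w * \<bar>r\<bar>) * wt (s - r)) * (cmod (g1 r) * cmod (g2 (s - r)))"
        using wt_sub[of r "s - r"] by (simp add: norm_mult mult_right_mono)
      also have "\<dots> = Cv * (q1 r * p2 (s - r) + p1 r * q2 (s - r))"
        by (simp add: p1_def p2_def q1_def q2_def algebra_simps)
      finally show "ennreal (wt s) * ennreal (cmod (g1 r * g2 (s - r))) \<le> ennreal Cv * (ennreal (q1 r) * ennreal (p2 (s - r)) + ennreal (p1 r) * ennreal (q2 (s - r)))"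
        using nn Cv(1) wt_pos[of s]
        by (simp add: ennreal_mult[symmetric] ennreal_plus[symmetric] ennreal_leI del: ennreal_plus)
    qed
    also have "\<dots> = ennreal Cv * ((\<integral>\<^sup>+r. ennreal (q1 r) * ennreal (p2 (s - r)) \<partial>lborel) + Y s)"
      by (simp add: nn_integral_cmult nn_integral_add Y_def)
    also have "(\<integral>\<^sup>+r. ennreal (q1 r) * ennreal (p2 (s - r)) \<partial>lborel) = X s"
      unfolding X_def using nn_integral_real_affine[of "\<lambda>r. ennreal (q1 r) * ennreal (p2 (s - r))" "-1" s]
      by (simp add: mult.commute)
    finally show ?thesis using wt_pos[of s] by (simp add: ennreal_mult)
  qed
  show ?thesis
  proof (rule WleI[where g=g])
    have "ennreal ((wt s * cmod (g s))\<^sup>2) \<le> ennreal (2 * Cv\<^sup>2) * ((X s)\<^sup>2 + (Y s)\<^sup>2)" for s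
    proof -
      have B: "(X s + Y s)\<^sup>2 \<le> 2 * ((X s)\<^sup>2 + (Y s)\<^sup>2)"
      proof (cases "X s = \<infinity> \<or> Y s = \<infinity>")
        case True
        then show ?thesis by (auto simp: power2_eq_square ennreal_mult_eq_top_iff)
      next
        case False
        then obtain x y where xy: "X s = ennreal x" "x \<ge> 0" "Y s = ennreal y" "y \<ge> 0"
          by (metis ennreal_cases infinity_ennreal_def)
        have "0 \<le> (x - y)\<^sup>2" by simp
        then have "(x + y)\<^sup>2 \<le> 2 * (x\<^sup>2 + y\<^sup>2)" by (simp add: power2_sum power2_diff)
        then have "ennreal ((x + y)\<^sup>2) \<le> ennreal (2 * (x\<^sup>2 + y\<^sup>2))" by (rule ennreal_leI)
        then show ?thesis using xy
          by (simp add: ennreal_mult ennreal_power[symmetric])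
      qed
      have "ennreal ((wt s * cmod (g s))\<^sup>2) = (ennreal (wt s * cmod (g s)))\<^sup>2"
        using wt_pos[of s] by (simp add: ennreal_power)
      also have "\<dots> \<le> (ennreal Cv * (X s + Y s))\<^sup>2" by (intro power_mono gle) simp
      also have "\<dots> = ennreal (Cv\<^sup>2) * (X s + Y s)\<^sup>2"
        using Cv(1) by (simp add: power_mult_distrib ennreal_power)
      also have "\<dots> \<le> ennreal (Cv\<^sup>2) * (2 * ((X s)\<^sup>2 + (Y s)\<^sup>2))"
        by (intro mult_left_mono B) simp
      also have "\<dots> = ennreal (2 * Cv\<^sup>2) * ((X s)\<^sup>2 + (Y s)\<^sup>2)"
        by (simp only: ennreal_mult[of 2, simplified] mult_ac zero_le_power2)
      finally show ?thesis .
    qed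
    then have "(\<integral>\<^sup>+s. ennreal ((wt s * cmod (g s))\<^sup>2) \<partial>lborel) \<le> (\<integral>\<^sup>+s. ennreal (2 * Cv\<^sup>2) * ((X s)\<^sup>2 + (Y s)\<^sup>2) \<partial>lborel)"
      by (rule nn_integral_mono)
    also have "\<dots> = ennreal (2 * Cv\<^sup>2) * ((\<integral>\<^sup>+s. (X s)\<^sup>2 \<partial>lborel) + (\<integral>\<^sup>+s. (Y s)\<^sup>2 \<partial>lborel))"
      by (simp add: nn_integral_cmult nn_integral_add)
    also have "\<dots> \<le> ennreal (2 * Cv\<^sup>2) * (ennreal ((Av * c1 * c2)\<^sup>2) + ennreal ((Av * c1 * c2)\<^sup>2))"
      by (intro mult_left_mono add_mono X2 Y2) simp
    also have "\<dots> = ennreal ((KW * c1 * c2)\<^sup>2)"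
      by (simp add: ennreal_mult[symmetric] ennreal_plus[symmetric] KW_def power_mult_distrib del: ennreal_plus)
    finally show "(\<integral>\<^sup>+s. ennreal ((wt s * cmod (g s))\<^sup>2) \<partial>lborel) \<le> ennreal ((KW * c1 * c2)\<^sup>2)" .
    fix z assume z: "z \<in> strip w"
    let ?a = "\<lambda>s. exp (- \<i> * z * of_real s) * g1 s" and ?b = "\<lambda>s. exp (- \<i> * z * of_real s) * g2 s"
    \<comment> \<open>Multiplicativity of the character lets it be shared out between the two
      factors of the convolution.\<close>
    have e: "exp (- \<i> * z * of_real r) * exp (- \<i> * z * of_real (s - r)) = exp (- \<i> * z * of_real s)" for r s
      by (simp add: exp_add[symmetric] algebra_simps)
    have "?a r * ?b (s - r) = exp (- \<i> * z * of_real s) * (g1 r * g2 (s - r))" for r s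
      unfolding e[of r s, symmetric] by (simp only: mult_ac)
    then have "(LINT s|lborel. (LINT r|lborel. ?a r * ?b (s - r))) = (LINT s|lborel. exp (- \<i> * z * of_real s) * g s)"
      unfolding g_def by (simp only: integral_mult_right_zero)
    then have "(LINT s|lborel. exp (- \<i> * z * of_real s) * g s) = (LINT s|lborel. (LINT r|lborel. ?a r * ?b (s - r)))"
      by (rule sym)
    also have "\<dots> = h1 z * h2 z"
      using convolution_integral[OF rep_FT_integrable[OF g1(1,2) z] rep_FT_integrable[OF g2(1,2) z]]
        g1(5) g2(5) z by simp
    finally show "h1 z * h2 z = (LINT s|lborel. exp (- \<i> * z * of_real s) * g s)" by simp
  qed measurable
qed

text \<open>The summand 1 makes Bq positive and gives \<open>I \<le> Bq\<^sup>2\<close> for the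
  integral I, without evaluating it.\<close>

definition Bq where "Bq = 1 + (LINT t::real|lborel. 1 / (1 + t\<^sup>2))"

lemma Bq_pos: "Bq > 0"
proof -
  have "0 \<le> (LINT t::real|lborel. 1 / (1 + t\<^sup>2))" by simp
  then show ?thesis unfolding Bq_def by (intro add_pos_nonneg) auto
qed

text \<open>The entry to W for functions with an explicit representing function: one of the two
  majorants 1 / (1 + s^2) is bounded by 1, the other is integrable.\<close>

lemma Wle_dominated:
  assumes "g \<in> borel_measurable borel" and K: "K \<ge> 0" "\<And>s. wt s * cmod (g s) \<le> K / (1 + s\<^sup>2)"
    and "\<And>z. z \<in> strip w \<Longrightarrow> h z = (LINT s|lborel. exp (- \<i> * z * of_real s) * g s)"
  shows "Wle h (K * Bq)"
proof (rule WleI[OF assms(1) _ assms(4)])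
  let ?I = "LINT t::real|lborel. 1 / (1 + t\<^sup>2)"
  have I: "0 \<le> ?I" by simp
  have "(wt s * cmod (g s))\<^sup>2 \<le> K\<^sup>2 * (1 / (1 + s\<^sup>2))" for s
  proof -
    have "(wt s * cmod (g s))\<^sup>2 \<le> (K / (1 + s\<^sup>2))\<^sup>2"
      using wt_pos[of s] by (intro power_mono K) auto
    also have "\<dots> = K\<^sup>2 * (1 / (1 + s\<^sup>2)) * (1 / (1 + s\<^sup>2))" by (simp add: power2_eq_square)
    also have "\<dots> \<le> K\<^sup>2 * (1 / (1 + s\<^sup>2)) * 1"
      by (intro mult_left_mono) (auto simp: divide_le_eq)
    finally show ?thesis by simp
  qed
  then have "(\<integral>\<^sup>+s. ennreal ((wt s * cmod (g s))\<^sup>2) \<partial>lborel) \<le> (\<integral>\<^sup>+s. ennreal (K\<^sup>2 * (1 / (1 + s\<^sup>2))) \<partial>lborel)"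
    by (intro nn_integral_mono ennreal_leI)
  also have "\<dots> = ennreal (LINT s|lborel. K\<^sup>2 * (1 / (1 + s\<^sup>2)))"
    by (intro nn_integral_eq_integral integrable_mult_right integrable_inverse_one_plus_square) auto
  also have "(LINT s|lborel. K\<^sup>2 * (1 / (1 + s\<^sup>2))) = K\<^sup>2 * ?I" by (rule integral_mult_right_zero)
  also have "ennreal (K\<^sup>2 * ?I) \<le> ennreal ((K * Bq)\<^sup>2)"
  proof (rule ennreal_leI)
    have "?I \<le> Bq\<^sup>2" using I unfolding Bq_def by (simp add: power2_sum)
    then show "K\<^sup>2 * ?I \<le> (K * Bq)\<^sup>2" by (simp add: power_mult_distrib mult_left_mono)
  qed
  finally show "(\<integral>\<^sup>+s. ennreal ((wt s * cmod (g s))\<^sup>2) \<partial>lborel) \<le> ennreal ((K * Bq)\<^sup>2)" .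
qed

end

section \<open>Transforms of half-line exponentials and of compactly supported functions\<close>

lemma exp_half_line:
  assumes c: "Re c > 0"
  shows "has_bochner_integral lborel (\<lambda>s::real. indicator {0<..} s *\<^sub>R exp (- (c * of_real s))) (1 / c)"
proof -
  have [simp]: "c \<noteq> 0" using c by auto
  let ?f = "\<lambda>s::real. exp (- (c * of_real s))"
  have "set_integrable lborel {0<..} (\<lambda>s::real. exp (- (s * Re c)))"
    by (rule integrable_I0i_exp_mscale[OF c])
  then have int: "set_integrable lborel {0<..} ?f"
    unfolding set_integrable_def
    by (rule Bochner_Integration.integrable_bound) (auto simp: indicator_def mult.commute intro!: AE_I2)
  have "(LBINT s=0..\<infinity>. ?f s) = 0 - (- (1 / c))"
  proof (rule interval_integral_FTC_integrable[where F="\<lambda>s. - exp (- (c * of_real s)) / c"])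
    show "((\<lambda>s. - exp (- (c * complex_of_real s)) / c) has_vector_derivative ?f x) (at x)" for x
      by (rule has_vector_derivative_real_field) (auto intro!: derivative_eq_intros)
    show "set_integrable lborel (einterval 0 \<infinity>) ?f" using int by (simp add: zero_ereal_def)
    have "((\<lambda>s::real. - exp (- (c * of_real s)) / c) \<longlongrightarrow> - (1 / c)) (at_right 0)"
      by (auto intro!: tendsto_eq_intros)
    then show "(((\<lambda>s::real. - exp (- (c * of_real s)) / c) \<circ> real_of_ereal) \<longlongrightarrow> - (1 / c)) (at_right 0)"
      by (simp add: zero_ereal_def ereal_tendsto_simps)
    have "((\<lambda>s::real. exp (- (Re c * s)) / cmod c) \<longlongrightarrow> 0) at_top"
      using c by real_asymp
    then have "((\<lambda>s::real. - exp (- (c * of_real s)) / c) \<longlongrightarrow> 0) at_top"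
      by (intro tendsto_norm_zero_cancel[of "\<lambda>s. - exp (- (c * of_real s)) / c"]) (simp add: norm_divide)
    then show "(((\<lambda>s::real. - exp (- (c * of_real s)) / c) \<circ> real_of_ereal) \<longlongrightarrow> 0) (at_left \<infinity>)"
      by (simp add: ereal_tendsto_simps)
  qed (auto intro!: continuous_intros)
  then have "(LINT s|lborel. indicator {0<..} s *\<^sub>R ?f s) = 1 / c"
    by (simp add: interval_lebesgue_integral_def set_lebesgue_integral_def zero_ereal_def)
  then show ?thesis using int by (simp add: has_bochner_integral_iff set_integrable_def)
qed

text \<open>The inverse Fourier transform of z -> 1 / (l - z): an exponential on the half-line on
  which exp(i l s) decays, so the side depends on the sign of Im l.\<close>

definition res_rep :: "complex \<Rightarrow> real \<Rightarrow> complex" where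
  "res_rep l s = (if Im l > 0 then - \<i> * indicator {0<..} s * exp (\<i> * l * of_real s)
                  else \<i> * indicator {..<0} s * exp (\<i> * l * of_real s))"

lemma res_rep_measurable [measurable]: "res_rep l \<in> borel_measurable borel"
  unfolding res_rep_def by measurable

lemma norm_res_rep: "cmod (res_rep l s) \<le> exp (- (\<bar>Im l\<bar> * \<bar>s\<bar>))"
  by (auto simp: res_rep_def norm_mult indicator_def)

lemma res_rep_Fourier:
  assumes "\<bar>Im z\<bar> < \<bar>Im l\<bar>"
  shows "has_bochner_integral lborel (\<lambda>s. exp (- \<i> * z * of_real s) * res_rep l s) (1 / (l - z))"
proof (cases "Im l > 0")
  case True
  have "Re (- \<i> * (l - z)) > 0" using True assms by auto
  from has_bochner_integral_mult_right[OF exp_half_line[OF this], of "- \<i>"]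
  have "has_bochner_integral lborel (\<lambda>s. - \<i> * (indicator {0<..} s *\<^sub>R exp (- (- \<i> * (l - z) * of_real s)))) (- \<i> * (1 / (- \<i> * (l - z))))"
    by simp
  moreover have "- \<i> * (indicator {0<..} s *\<^sub>R exp (- (- \<i> * (l - z) * of_real s))) = exp (- \<i> * z * of_real s) * res_rep l s" for s
  proof -
    have "exp (- (- \<i> * (l - z) * of_real s)) = exp (- \<i> * z * of_real s) * exp (\<i> * l * of_real s)"
      by (simp add: exp_add[symmetric] algebra_simps)
    then show ?thesis using True by (simp add: res_rep_def indicator_def)
  qed
  moreover have "- \<i> * (1 / (- \<i> * (l - z))) = 1 / (l - z)" by simp
  ultimately show ?thesis by simp
next
  case False
  have "Re (\<i> * (l - z)) > 0" using False assms by auto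
  from has_bochner_integral_mult_right[OF exp_half_line[OF this], of "\<i>"]
  have "has_bochner_integral lborel (\<lambda>s. \<i> * (indicator {0<..} s *\<^sub>R exp (- (\<i> * (l - z) * of_real s)))) (\<i> * (1 / (\<i> * (l - z))))"
    by simp
  \<comment> \<open>The reflection s -> -s carries the left half-line to the right one, where
    \<open>exp_half_line\<close> applies.\<close>
  moreover have "\<i> * (indicator {0<..} s *\<^sub>R exp (- (\<i> * (l - z) * of_real s))) = exp (- \<i> * z * of_real (- s)) * res_rep l (- s)" for s
  proof -
    have "exp (- (\<i> * (l - z) * of_real s)) = exp (- \<i> * z * of_real (- s)) * exp (\<i> * l * of_real (- s))"
      by (simp add: exp_add[symmetric] algebra_simps)
    then show ?thesis using False by (simp add: res_rep_def indicator_def)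
  qed
  moreover have "\<i> * (1 / (\<i> * (l - z))) = 1 / (l - z)" by simp
  ultimately have "has_bochner_integral lborel (\<lambda>s. exp (- \<i> * z * of_real (0 + (-1) * s)) * res_rep l (0 + (-1) * s)) ((1 / (l - z)) /\<^sub>R \<bar>-1\<bar>)"
    by simp
  then show ?thesis
    by (subst lborel_has_bochner_integral_real_affine_iff[of "-1" _ _ 0]) simp_all
qed

text \<open>The compact support keeps every exponential factor bounded. Differentiability is read
  off from a quadratic bound for the first-order remainder, obtained under the integral from the
  remainder of exp.\<close>

lemma holomorphic_bounded_Fourier:
  fixes g :: "real \<Rightarrow> complex"
  assumes g: "integrable lborel g" and supp: "\<And>s. \<bar>s\<bar> > N \<Longrightarrow> g s = 0" and N: "N \<ge> 0"
  shows "(\<lambda>z. LINT s|lborel. exp (- \<i> * z * of_real s) * g s) holomorphic_on UNIV"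
    and "\<bar>Im z\<bar> \<le> u \<Longrightarrow> cmod (LINT s|lborel. exp (- \<i> * z * of_real s) * g s) \<le> exp (u * N) * (LINT s|lborel. cmod (g s))"
proof -
  have [measurable]: "g \<in> borel_measurable borel" using g by auto
  have bd: "cmod (exp (- \<i> * z * of_real s) * g s) \<le> exp (u * N) * cmod (g s)" if "\<bar>Im z\<bar> \<le> u" for z s u
  proof (cases "\<bar>s\<bar> > N")
    case False
    have "cmod (exp (- \<i> * z * of_real s)) \<le> exp (u * \<bar>s\<bar>)" by (rule norm_exp_strip[OF that])
    also have "\<dots> \<le> exp (u * N)" using False that by (auto intro!: mult_left_mono)
    finally show ?thesis by (auto simp: norm_mult intro!: mult_right_mono)
  qed (simp add: supp)
  have gi: "integrable lborel (\<lambda>s. exp (- \<i> * z * of_real s) * g s)" for z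
    by (rule Bochner_Integration.integrable_bound[where f="\<lambda>s. exp (\<bar>Im z\<bar> * N) * cmod (g s)"])
       (use g bd[OF order.refl, of z] in \<open>auto intro!: AE_I2\<close>)
  show "cmod (LINT s|lborel. exp (- \<i> * z * of_real s) * g s) \<le> exp (u * N) * (LINT s|lborel. cmod (g s))" if "\<bar>Im z\<bar> \<le> u"
    using Bochner_Integration.integral_norm_bound_integral[OF gi[of z], of "\<lambda>s. exp (u * N) * cmod (g s)"] g bd[OF that] by auto
  show "(\<lambda>z. LINT s|lborel. exp (- \<i> * z * of_real s) * g s) holomorphic_on UNIV"
    unfolding holomorphic_on_def
  proof
    fix z :: complex
    define F where "F z = (LINT s|lborel. exp (- \<i> * z * of_real s) * g s)" for z
    define D where "D = (LINT s|lborel. exp (- \<i> * z * of_real s) * (- \<i> * of_real s * g s))"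
    define L where "L = (LINT s|lborel. cmod (g s))"
    \<comment> \<open>\<open>exp (\<bar>Im z\<bar> * N)\<close> bounds the character on the support
      of g, and \<open>exp N * N\<^sup>2\<close> the remainder of exp for increments of modulus at
      most 1.\<close>
    define M where "M = exp (\<bar>Im z\<bar> * N) * (exp N * N\<^sup>2)"
    have gi2: "integrable lborel (\<lambda>s. exp (- \<i> * z * of_real s) * (- \<i> * of_real s * g s))"
    proof (rule Bochner_Integration.integrable_bound[where f="\<lambda>s. N * (exp (\<bar>Im z\<bar> * N) * cmod (g s))"])
      have "cmod (exp (- \<i> * z * of_real s) * (- \<i> * of_real s * g s)) \<le> N * (exp (\<bar>Im z\<bar> * N) * cmod (g s))" for s
      proof (cases "\<bar>s\<bar> > N")
        case False
        have "\<bar>s\<bar> * cmod (exp (- \<i> * z * of_real s) * g s) \<le> N * (exp (\<bar>Im z\<bar> * N) * cmod (g s))"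
          using False N by (intro mult_mono bd) auto
        then show ?thesis by (simp add: norm_mult mult_ac)
      qed (simp add: supp)
      then show "AE s in lborel. norm (exp (- \<i> * z * of_real s) * (- \<i> * of_real s * g s)) \<le> norm (N * (exp (\<bar>Im z\<bar> * N) * cmod (g s)))"
        using N by (auto intro!: AE_I2)
    qed (use g in auto)
    have quad: "cmod (F (z + h) - F z - h * D) \<le> (M * L) * (cmod h)\<^sup>2" if h: "cmod h \<le> 1" for h
    proof -
      have E: "F (z + h) - F z - h * D = (LINT s|lborel. exp (- \<i> * (z + h) * of_real s) * g s - exp (- \<i> * z * of_real s) * g s
           - h * (exp (- \<i> * z * of_real s) * (- \<i> * of_real s * g s)))"
        unfolding F_def D_def using gi gi2 by simp
      have "cmod (F (z + h) - F z - h * D) \<le> (LINT s|lborel. M * (cmod h)\<^sup>2 * cmod (g s))"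
        unfolding E
      proof (rule Bochner_Integration.integral_norm_bound_integral)
        show "integrable lborel (\<lambda>s. exp (- \<i> * (z + h) * of_real s) * g s - exp (- \<i> * z * of_real s) * g s
           - h * (exp (- \<i> * z * of_real s) * (- \<i> * of_real s * g s)))"
          using gi gi2 by (intro Bochner_Integration.integrable_diff integrable_mult_right) auto
        fix s
        show "cmod (exp (- \<i> * (z + h) * of_real s) * g s - exp (- \<i> * z * of_real s) * g s
           - h * (exp (- \<i> * z * of_real s) * (- \<i> * of_real s * g s))) \<le> M * (cmod h)\<^sup>2 * cmod (g s)"
        proof (cases "\<bar>s\<bar> > N")
          case False
          let ?u = "- \<i> * h * of_real s"
          have u: "cmod ?u \<le> cmod h * N" using False by (auto simp: norm_mult intro!: mult_left_mono)
          also have "\<dots> \<le> 1 * N" using h N by (intro mult_right_mono) auto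
          finally have "\<bar>Re ?u\<bar> \<le> N" using abs_Re_le_cmod[of ?u] by linarith
          have "cmod (exp ?u - 1 - ?u) \<le> exp \<bar>Re ?u\<bar> * (cmod ?u)\<^sup>2"
            using Taylor_exp[of ?u 1] by (simp add: numeral_2_eq_2 algebra_simps)
          also have "\<dots> \<le> exp N * (cmod h * N)\<^sup>2"
            using \<open>\<bar>Re ?u\<bar> \<le> N\<close> u by (intro mult_mono power_mono) auto
          finally have e: "cmod (exp ?u - 1 - ?u) \<le> exp N * (cmod h * N)\<^sup>2" .
          have "exp (- \<i> * (z + h) * of_real s) = exp (- \<i> * z * of_real s) * exp ?u"
            by (simp add: exp_add[symmetric] algebra_simps)
          then have "exp (- \<i> * (z + h) * of_real s) * g s - exp (- \<i> * z * of_real s) * g s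
             - h * (exp (- \<i> * z * of_real s) * (- \<i> * of_real s * g s))
             = (exp ?u - 1 - ?u) * (exp (- \<i> * z * of_real s) * g s)"
            by (simp add: algebra_simps)
          also have "cmod \<dots> \<le> (exp N * (cmod h * N)\<^sup>2) * (exp (\<bar>Im z\<bar> * N) * cmod (g s))"
            unfolding norm_mult[of "exp ?u - 1 - ?u"] by (intro mult_mono e bd) auto
          finally show ?thesis by (simp add: M_def power_mult_distrib mult_ac)
        qed (simp add: supp)
      qed (intro integrable_mult_right integrable_norm g)
      also have "\<dots> = M * (cmod h)\<^sup>2 * L" unfolding L_def by (rule integral_mult_right_zero)
      finally show ?thesis by (simp only: mult_ac)
    qed
    have "(F has_field_derivative D) (at z)"
      unfolding has_field_derivative_def has_derivative_at_within
    proof (intro conjI bounded_linear_mult_right)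
      have "((\<lambda>h. (M * L) * cmod h) \<longlongrightarrow> 0) (at 0)"
        by (auto intro!: tendsto_eq_intros)
      then have "((\<lambda>h. (F (z + h) - F z - D * h) /\<^sub>R norm h) \<longlongrightarrow> 0) (at 0)"
      proof (rule Lim_null_comparison[rotated])
        show "\<forall>\<^sub>F h in at 0. norm ((F (z + h) - F z - D * h) /\<^sub>R norm h) \<le> (M * L) * cmod h"
          unfolding eventually_at
        proof (intro exI[of _ 1] conjI ballI impI)
          fix h :: complex assume h: "h \<noteq> 0 \<and> dist h 0 < 1"
          then have "cmod (F (z + h) - F z - D * h) / cmod h \<le> M * L * cmod h"
            using quad[of h] by (simp add: pos_divide_le_eq power2_eq_square mult.assoc mult.commute[of D h])
          moreover have "norm ((F (z + h) - F z - D * h) /\<^sub>R norm h) = cmod (F (z + h) - F z - D * h) / cmod h"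
            by (simp add: divide_inverse mult.commute)
          ultimately show "norm ((F (z + h) - F z - D * h) /\<^sub>R norm h) \<le> (M * L) * cmod h" by linarith
        qed simp
      qed
      then show "((\<lambda>y. (F y - F z - D * (y - z)) /\<^sub>R norm (y - z)) \<longlongrightarrow> 0) (at z)"
        by (subst LIM_offset_zero_iff) auto
    qed
    then show "(\<lambda>z. LINT s|lborel. exp (- \<i> * z * of_real s) * g s) field_differentiable at z within UNIV"
      unfolding F_def[abs_def] by (auto simp: field_differentiable_def)
  qed
qed

section \<open>Gaussians, resolvent functions and truncations in W\<close>

context weight
begin

text \<open>A real translation by m multiplies the representing function by a factor of modulus 1,
  so K does not depend on m. \<open>wt_le_gauss\<close> then absorbs the weight.\<close>

lemma Wle_gauss:
  assumes a: "a > 0"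
  shows "\<exists>K>0. \<forall>m::real. Wle (\<lambda>z. exp (- of_real a * (z - of_real m)\<^sup>2)) K"
proof -
  let ?c = "1 / (2 * sqrt (pi * a))"
  let ?k = "\<lambda>s::real. complex_of_real (?c * exp (- (s\<^sup>2) / (4 * a)))"
  obtain K where K: "K > 0" "\<And>s. wt s * exp (- (1 / (4 * a) * s\<^sup>2)) \<le> K / (1 + s\<^sup>2)"
    using wt_le_gauss[of "1 / (4 * a)"] a by auto
  have "Wle (\<lambda>z. exp (- of_real a * (z - of_real m)\<^sup>2)) (?c * K * Bq)" for m :: real
  proof (rule Wle_dominated[where g="\<lambda>s. exp (\<i> * of_real (m * s)) * ?k s"])
    show "?c * K \<ge> 0" using K a by simp
    show "wt s * cmod (exp (\<i> * complex_of_real (m * s)) * ?k s) \<le> ?c * K / (1 + s\<^sup>2)" for s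
    proof -
      have "?c * (wt s * exp (- (1 / (4 * a) * s\<^sup>2))) \<le> ?c * (K / (1 + s\<^sup>2))"
        using a by (intro mult_left_mono K) auto
      moreover have "cmod (exp (\<i> * complex_of_real (m * s)) * ?k s) = ?c * exp (- (1 / (4 * a) * s\<^sup>2))"
        using a by (simp only: norm_mult norm_exp_i_times norm_of_real) simp
      ultimately show ?thesis by (simp only: mult.left_commute[of "wt s"]) simp
    qed
    fix z
    have "exp (- \<i> * (z - of_real m) * of_real s) = exp (- \<i> * z * of_real s) * exp (\<i> * of_real (m * s))" for s
      by (simp add: exp_add[symmetric] algebra_simps)
    then have "exp (- \<i> * (z - of_real m) * of_real s) * ?k s = exp (- \<i> * z * of_real s) * (exp (\<i> * of_real (m * s)) * ?k s)" for s
      by (simp only: mult.assoc)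
    then show "exp (- of_real a * (z - of_real m)\<^sup>2) = (LINT s|lborel. exp (- \<i> * z * of_real s) * (exp (\<i> * of_real (m * s)) * ?k s))"
      using gaussian_Fourier[OF a, of "z - of_real m"] unfolding has_bochner_integral_iff by (simp only:)
  qed measurable
  moreover have "?c * K * Bq > 0" using K a Bq_pos by simp
  ultimately show ?thesis by blast
qed

text \<open>K is uniform over |Im l| at least h, because \<open>res_rep l\<close> is dominated by
  exp(-h |s|). This uniformity later becomes the resolvent bound in the definition of strip
  type.\<close>

lemma Wle_resolvent:
  assumes h: "h > w"
  shows "\<exists>K>0. \<forall>l. \<bar>Im l\<bar> \<ge> h \<longrightarrow> Wle (\<lambda>z. 1 / (l - z)) K"
proof -
  obtain K where K: "K > 0" "\<And>s. wt s * exp (- (h * \<bar>s\<bar>)) \<le> K / (1 + s\<^sup>2)"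
    using wt_le_exp[OF h] by blast
  have "Wle (\<lambda>z. 1 / (l - z)) (K * Bq)" if l: "\<bar>Im l\<bar> \<ge> h" for l
  proof (rule Wle_dominated[where g="res_rep l"])
    fix s
    have "cmod (res_rep l s) \<le> exp (- (h * \<bar>s\<bar>))"
      using norm_res_rep[of l s] l mult_right_mono[OF l, of "\<bar>s\<bar>"] by (smt (verit) abs_ge_zero exp_le_cancel_iff)
    then have "wt s * cmod (res_rep l s) \<le> wt s * exp (- (h * \<bar>s\<bar>))"
      using wt_pos[of s] by (intro mult_left_mono) auto
    then show "wt s * cmod (res_rep l s) \<le> K / (1 + s\<^sup>2)" using K(2)[of s] by linarith
  next
    fix z assume "z \<in> strip w"
    then have "\<bar>Im z\<bar> < \<bar>Im l\<bar>" using strip_Im_le[OF _ w_nonneg] h l by fastforce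
    then show "1 / (l - z) = (LINT s|lborel. exp (- \<i> * z * of_real s) * res_rep l s)"
      using res_rep_Fourier by (simp add: has_bochner_integral_iff)
  qed (use K in auto)
  moreover have "K * Bq > 0" using K Bq_pos by simp
  ultimately show ?thesis by blast
qed

text \<open>Cutting the representing function off at |s| = n makes its transform entire and bounded
  on every strip, does not increase the norm, and leaves a tail of small norm. It is the way from
  functions on S_\<omega> to functions on the larger strip.\<close>

lemma Wle_truncate:
  assumes "Wle h c" and e: "e > 0"
  obtains F where "F holomorphic_on UNIV" "\<And>u. \<exists>C. \<forall>z. \<bar>Im z\<bar> \<le> u \<longrightarrow> cmod (F z) \<le> C"
    "Wle F c" "Wle (\<lambda>z. F z - h z) e"
proof -
  obtain g where g: "g \<in> borel_measurable borel" "integrable lborel (\<lambda>s. (wt s * cmod (g s))\<^sup>2)"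
    "(LINT s|lborel. (wt s * cmod (g s))\<^sup>2) \<le> c\<^sup>2"
    "(\<integral>\<^sup>+s. ennreal ((wt s * cmod (g s))\<^sup>2) \<partial>lborel) \<le> ennreal (c\<^sup>2)"
    "\<forall>z\<in>strip w. h z = (LINT s|lborel. exp (- \<i> * z * of_real s) * g s)"
    by (rule WleE[OF assms(1)], rule that)
  have [measurable]: "g \<in> borel_measurable borel" by fact
  define gn where "gn n s = indicator {- real n..real n} s * g s" for n :: nat and s
  \<comment> \<open>The negative tail, so that \<open>hn = gn - g\<close> represents
    \<open>F - h\<close>.\<close>
  define hn where "hn n s = (if \<bar>s\<bar> \<le> real n then 0 else - g s)" for n :: nat and s
  have [measurable]: "gn n \<in> borel_measurable borel" "hn n \<in> borel_measurable borel" for n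
    unfolding gn_def hn_def by measurable
  have gnle: "cmod (gn n s) \<le> cmod (g s)" "cmod (hn n s) \<le> cmod (g s)" for n s
    by (auto simp: gn_def hn_def indicator_def)
  have wle: "(wt s * cmod (gn n s))\<^sup>2 \<le> (wt s * cmod (g s))\<^sup>2" "(wt s * cmod (hn n s))\<^sup>2 \<le> (wt s * cmod (g s))\<^sup>2" for n s
    using wt_pos[of s] gnle by (auto intro!: power_mono mult_left_mono)
  have "(\<lambda>n. LINT s|lborel. (wt s * cmod (hn n s))\<^sup>2) \<longlonglongrightarrow> (LINT s::real|lborel. 0)"
  proof (rule Bochner_Integration.integral_dominated_convergence[OF _ _ g(2)])
    show "AE s in lborel. (\<lambda>n. (wt s * cmod (hn n s))\<^sup>2) \<longlonglongrightarrow> 0"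
    proof (rule AE_I2)
      fix s :: real
      have "eventually (\<lambda>n. hn n s = 0) sequentially"
        using eventually_ge_at_top[of "nat \<lceil>\<bar>s\<bar>\<rceil>"] by eventually_elim (auto simp: hn_def; linarith)
      then show "(\<lambda>n. (wt s * cmod (hn n s))\<^sup>2) \<longlonglongrightarrow> 0"
        by (intro tendsto_eventually) (auto elim!: eventually_mono)
    qed
  qed (use wle in auto)
  then have "eventually (\<lambda>n. (LINT s|lborel. (wt s * cmod (hn n s))\<^sup>2) < e\<^sup>2) sequentially"
    by (rule order_tendstoD) (use e in simp)
  then obtain n where n: "(LINT s|lborel. (wt s * cmod (hn n s))\<^sup>2) < e\<^sup>2"
    by (auto simp: eventually_sequentially)
  have hni: "integrable lborel (\<lambda>s. (wt s * cmod (hn n s))\<^sup>2)"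
    by (rule Bochner_Integration.integrable_bound[OF g(2)]) (use wle in \<open>auto intro!: AE_I2\<close>)
  have gni: "integrable lborel (\<lambda>s. (wt s * cmod (gn n s))\<^sup>2)"
    by (rule Bochner_Integration.integrable_bound[OF g(2)]) (use wle in \<open>auto intro!: AE_I2\<close>)
  define F where "F z = (LINT s|lborel. exp (- \<i> * z * of_real s) * gn n s)" for z
  have gn1: "integrable lborel (gn n)"
  proof -
    have "integrable lborel (\<lambda>s. exp (- \<i> * 0 * of_real s) * gn n s)"
      by (rule rep_FT_integrable[OF _ gni]) (auto simp: strip_def)
    then show ?thesis by simp
  qed
  have supp: "gn n s = 0" if "\<bar>s\<bar> > real n" for s using that by (auto simp: gn_def indicator_def)
  show thesis
  proof (rule that[of F])
    show "F holomorphic_on UNIV"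
      unfolding F_def by (rule holomorphic_bounded_Fourier(1)[OF gn1 supp]) auto
    show "\<exists>C. \<forall>z. \<bar>Im z\<bar> \<le> u \<longrightarrow> cmod (F z) \<le> C" for u
      unfolding F_def using holomorphic_bounded_Fourier(2)[OF gn1 supp] by (meson of_nat_0_le_iff)
    show "Wle F c"
    proof (rule WleI[where g="gn n"])
      show "(\<integral>\<^sup>+s. ennreal ((wt s * cmod (gn n s))\<^sup>2) \<partial>lborel) \<le> ennreal (c\<^sup>2)"
        by (rule order_trans[OF _ g(4)]) (intro nn_integral_mono ennreal_leI wle)
    qed (auto simp: F_def)
    show "Wle (\<lambda>z. F z - h z) e"
    proof (rule WleI[where g="hn n"])
      show "(\<integral>\<^sup>+s. ennreal ((wt s * cmod (hn n s))\<^sup>2) \<partial>lborel) \<le> ennreal (e\<^sup>2)"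
        using n hni by (subst nn_integral_eq_integral) (auto intro: ennreal_leI)
      fix z assume z: "z \<in> strip w"
      have "hn n s = gn n s - g s" for s by (auto simp: hn_def gn_def indicator_def)
      then show "F z - h z = (LINT s|lborel. exp (- \<i> * z * of_real s) * hn n s)"
        using rep_FT_integrable[OF _ gni z] rep_FT_integrable[OF g(1,2) z] g(5) z
        by (simp add: F_def right_diff_distrib)
    qed measurable
  qed
qed

end

section \<open>The Hoermander norm\<close>

lemma exp_neg_square_le:
  fixes s c :: real
  assumes "c \<ge> 0"
  shows "exp (- (c * s\<^sup>2)) \<le> 1 / (1 + c * s\<^sup>2)"
proof -
  have "0 < 1 + c * s\<^sup>2" using assms by (intro add_pos_nonneg) auto
  then have "inverse (exp (c * s\<^sup>2)) \<le> inverse (1 + c * s\<^sup>2)"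
    by (intro le_imp_inverse_le exp_ge_add_one_self)
  then show ?thesis by (simp add: exp_minus inverse_eq_divide)
qed

text \<open>Expanding the square gives exp(-2 z^2) times exp(4 z s) exp(-2 s^2), and exp(4 z s) is
  the Fourier kernel at the complex frequency 4 i z. So \<open>gaussian_Fourier\<close> with a = 1/8
  covers a complex centre.\<close>

lemma gaussian_integral_shifted:
  fixes z :: complex
  shows "has_bochner_integral lborel (\<lambda>s::real. of_real (sqrt (2 / pi)) * exp (- 2 * (z - of_real s)\<^sup>2)) 1"
proof -
  have c: "1 / (2 * sqrt (pi * (1 / 8))) = sqrt (2 / pi)"
  proof -
    have "2 * sqrt (pi * (1 / 8)) = sqrt (4 * (pi * (1 / 8)))" by (simp only: real_sqrt_mult real_sqrt_four)
    also have "\<dots> = sqrt (pi / 2)" by simp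
    finally show ?thesis by (simp add: real_sqrt_divide)
  qed
  have eq: "exp (- 2 * z\<^sup>2) * (exp (- \<i> * (4 * \<i> * z) * of_real s) * complex_of_real (1 / (2 * sqrt (pi * (1 / 8))) * exp (- (s\<^sup>2) / (4 * (1 / 8)))))
    = of_real (sqrt (2 / pi)) * exp (- 2 * (z - of_real s)\<^sup>2)" for s
  proof -
    have "- 2 * (z - of_real s)\<^sup>2 = - 2 * z\<^sup>2 + (- \<i> * (4 * \<i> * z) * of_real s + of_real (- (s\<^sup>2) / (4 * (1 / 8))))"
      by (simp add: power2_eq_square algebra_simps)
    then have "exp (- 2 * (z - of_real s)\<^sup>2) = exp (- 2 * z\<^sup>2) * (exp (- \<i> * (4 * \<i> * z) * of_real s) * exp (of_real (- (s\<^sup>2) / (4 * (1 / 8)))))"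
      by (simp only: exp_add)
    then show ?thesis unfolding c of_real_mult of_real_exp by (simp only: mult_ac)
  qed
  have "exp (- 2 * z\<^sup>2) * exp (- of_real (1 / 8) * (4 * \<i> * z)\<^sup>2) = 1"
    by (simp add: exp_add[symmetric] power_mult_distrib)
  moreover have "has_bochner_integral lborel (\<lambda>s. exp (- 2 * z\<^sup>2) * (exp (- \<i> * (4 * \<i> * z) * of_real s) * complex_of_real (1 / (2 * sqrt (pi * (1 / 8))) * exp (- (s\<^sup>2) / (4 * (1 / 8))))))
     (exp (- 2 * z\<^sup>2) * exp (- of_real (1 / 8) * (4 * \<i> * z)\<^sup>2))"
    by (rule has_bochner_integral_mult_right[OF gaussian_Fourier]) simp
  ultimately show ?thesis unfolding eq by simp
qed

context weight
begin

text \<open>Convergence of Riemann sums in W without integration theory for W-valued functions. For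
  fixed r the sums of s -> k s r converge to kb r as scalars; the product majorant makes this
  dominated in r, so the errors tend to 0 in the weighted L2 norm. Fubini identifies kb as the
  representing function of the integral.\<close>

lemma Wle_rsum:
  fixes k :: "real \<Rightarrow> real \<Rightarrow> complex"
  assumes km [measurable]: "(\<lambda>(s, r). k s r) \<in> borel_measurable (borel \<Otimes>\<^sub>M borel)"
    and cont: "\<And>r. continuous_on UNIV (\<lambda>s. k s r)"
    and bd: "\<And>s r. wt r * cmod (k s r) \<le> K / (1 + r\<^sup>2) / (1 + s\<^sup>2)" and K: "K > 0"
    and H: "\<And>s z. z \<in> strip w \<Longrightarrow> H s z = (LINT r|lborel. exp (- \<i> * z * of_real r) * k s r)"
  shows "\<exists>c>0. Wle (\<lambda>z. LINT s|lborel. H s z) c"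
    and "e > 0 \<Longrightarrow> eventually (\<lambda>n. Wle (\<lambda>z. rsum n (\<lambda>s. H s z) - (LINT s|lborel. H s z)) e) sequentially"
proof -
  have [measurable]: "k s \<in> borel_measurable borel" "(\<lambda>s. k s r) \<in> borel_measurable borel" for s r
    using measurable_compose[OF measurable_Pair1' km] measurable_compose[OF measurable_Pair2' km] by auto
  let ?I = "LINT s::real|lborel. 1 / (1 + s\<^sup>2)"
  have I: "0 \<le> ?I" "?I \<le> Bq" by (auto simp: Bq_def)
  have bd1: "cmod (k s r) \<le> K / (1 + r\<^sup>2) / wt r / (1 + s\<^sup>2)" for s r
  proof -
    have "cmod (k s r) \<le> K / (1 + r\<^sup>2) / (1 + s\<^sup>2) / wt r"
      using bd[of r s] wt_pos[of r] by (simp only: pos_le_divide_eq mult.commute)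
    then show ?thesis by (simp only: divide_divide_eq_left mult_ac)
  qed
  have ki: "integrable lborel (\<lambda>s. k s r)" for r
    by (rule Bochner_Integration.integrable_bound[OF integrable_inverse_one_plus_square[of "K / (1 + r\<^sup>2) / wt r"]])
       (use bd1 K wt_pos[of r] in \<open>auto intro!: AE_I2\<close>)
  define kb where "kb r = (LINT s|lborel. k s r)" for r
  have kbm [measurable]: "kb \<in> borel_measurable borel" unfolding kb_def by measurable
  have kb: "wt r * cmod (kb r) \<le> K * Bq / (1 + r\<^sup>2)" for r
  proof -
    have "cmod (kb r) \<le> (LINT s|lborel. K / (1 + r\<^sup>2) / wt r / (1 + s\<^sup>2))"
      unfolding kb_def
      by (rule Bochner_Integration.integral_norm_bound_integral[OF ki integrable_inverse_one_plus_square bd1])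
    also have "\<dots> = (LINT s|lborel. K / (1 + r\<^sup>2) / wt r * (1 / (1 + s\<^sup>2)))" by simp
    also have "\<dots> = K / (1 + r\<^sup>2) / wt r * ?I" by (rule integral_mult_right_zero)
    also have "\<dots> \<le> K / (1 + r\<^sup>2) / wt r * Bq" using I K wt_pos[of r] by (intro mult_left_mono) auto
    finally have "wt r * cmod (kb r) \<le> wt r * (K / (1 + r\<^sup>2) / wt r * Bq)"
      using wt_pos[of r] by (intro mult_left_mono) auto
    then show ?thesis using wt_pos[of r] by simp
  qed
  have FT: "(LINT s|lborel. H s z) = (LINT r|lborel. exp (- \<i> * z * of_real r) * kb r)" if z: "z \<in> strip w" for z
  proof -
    have pw: "cmod (exp (- \<i> * z * of_real r) * k s r) \<le> K / (1 + s\<^sup>2) / (1 + r\<^sup>2)" for s r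
    proof -
      have "cmod (exp (- \<i> * z * of_real r)) \<le> exp (w * \<bar>r\<bar>)"
        by (rule norm_exp_strip[OF strip_Im_le[OF z w_nonneg]])
      also have "\<dots> \<le> wt r" using v_ge_1[of r] by (simp add: wt_def mult_right_mono[of 1, simplified])
      finally have "cmod (exp (- \<i> * z * of_real r)) * cmod (k s r) \<le> wt r * cmod (k s r)"
        by (rule mult_right_mono) simp
      also have "\<dots> \<le> K / (1 + r\<^sup>2) / (1 + s\<^sup>2)" by (rule bd)
      finally show ?thesis by (simp add: norm_mult mult.commute)
    qed
    have ir: "integrable lborel (\<lambda>r. exp (- \<i> * z * of_real r) * k s r)" for s
      by (rule Bochner_Integration.integrable_bound[OF integrable_inverse_one_plus_square[of "K / (1 + s\<^sup>2)"]])
         (use pw K in \<open>auto intro!: AE_I2\<close>)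
    have int: "integrable (lborel \<Otimes>\<^sub>M lborel) (\<lambda>(s, r). exp (- \<i> * z * of_real r) * k s r)"
    proof (rule lborel_pair.Fubini_integrable)
      show "(\<lambda>(s, r). exp (- \<i> * z * of_real r) * k s r) \<in> borel_measurable (lborel \<Otimes>\<^sub>M lborel)"
      proof -
        have "(\<lambda>p. exp (- \<i> * z * of_real (snd p)) * (case p of (s, r) \<Rightarrow> k s r)) \<in> borel_measurable (borel \<Otimes>\<^sub>M borel)"
          by measurable
        then show ?thesis by (simp add: case_prod_beta' measurable_def sets_pair_measure space_pair_measure cong: sets_pair_measure_cong)
      qed
      show "integrable lborel (\<lambda>s. LINT r|lborel. norm (case (s, r) of (s, r) \<Rightarrow> exp (- \<i> * z * of_real r) * k s r))"
      proof (rule Bochner_Integration.integrable_bound[OF integrable_inverse_one_plus_square[of "K * ?I"]])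
        have "(LINT r|lborel. norm (exp (- \<i> * z * of_real r) * k s r)) \<le> K * ?I / (1 + s\<^sup>2)" for s
        proof -
          have "(LINT r|lborel. norm (exp (- \<i> * z * of_real r) * k s r)) \<le> (LINT r|lborel. K / (1 + s\<^sup>2) / (1 + r\<^sup>2))"
            by (rule integral_mono[OF integrable_norm[OF ir] integrable_inverse_one_plus_square pw])
          also have "\<dots> = (LINT r|lborel. K / (1 + s\<^sup>2) * (1 / (1 + r\<^sup>2)))" by simp
          also have "\<dots> = K / (1 + s\<^sup>2) * ?I" by (rule integral_mult_right_zero)
          finally show ?thesis by simp
        qed
        then show "AE s in lborel. norm (LINT r|lborel. norm (case (s, r) of (s, r) \<Rightarrow> exp (- \<i> * z * of_real r) * k s r)) \<le> norm (K * ?I / (1 + s\<^sup>2))"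
          using K I by (auto intro!: AE_I2)
        show "(\<lambda>s. LINT r|lborel. norm (case (s, r) of (s, r) \<Rightarrow> exp (- \<i> * z * of_real r) * k s r)) \<in> borel_measurable lborel"
          by measurable
      qed
      show "AE s in lborel. integrable lborel (\<lambda>r. case (s, r) of (s, r) \<Rightarrow> exp (- \<i> * z * of_real r) * k s r)"
        using ir by auto
    qed
    have "(LINT s|lborel. H s z) = (LINT s|lborel. (LINT r|lborel. exp (- \<i> * z * of_real r) * k s r))"
      by (simp only: H[OF z])
    also have "\<dots> = (LINT r|lborel. (LINT s|lborel. exp (- \<i> * z * of_real r) * k s r))"
      by (rule lborel_pair.Fubini_integral[OF int, symmetric])
    also have "\<dots> = (LINT r|lborel. exp (- \<i> * z * of_real r) * kb r)"
      unfolding kb_def by (simp only: integral_mult_right_zero)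
    finally show ?thesis .
  qed
  have "Wle (\<lambda>z. LINT s|lborel. H s z) (K * Bq * Bq)"
    by (rule Wle_dominated[OF kbm _ kb FT]) (use K Bq_pos in auto)
  then show "\<exists>c>0. Wle (\<lambda>z. LINT s|lborel. H s z) c"
    using K Bq_pos by (intro exI[of _ "K * Bq * Bq"]) auto
  obtain B where B: "B > 0" "\<And>n. rsum n (\<lambda>t::real. 1 / (1 + t\<^sup>2)) \<le> B" using rsum_bounded by blast
  define d where "d n r = rsum n (\<lambda>s. k s r) - kb r" for n r
  have [measurable]: "d n \<in> borel_measurable borel" for n
    unfolding d_def rsum_def by measurable
  have dbd: "wt r * cmod (d n r) \<le> K * (B + Bq) / (1 + r\<^sup>2)" for n r
  proof -
    have "cmod (rsum n (\<lambda>s. k s r)) \<le> rsum n (\<lambda>s. cmod (k s r))" by (rule rsum_norm_le)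
    also have "\<dots> \<le> rsum n (\<lambda>s. K / (1 + r\<^sup>2) / wt r * (1 / (1 + s\<^sup>2)))"
      by (rule rsum_mono) (use bd1 in simp)
    also have "\<dots> = K / (1 + r\<^sup>2) / wt r * rsum n (\<lambda>s. 1 / (1 + s\<^sup>2))"
      by (simp add: rsum_def sum_distrib_left mult.left_commute divide_inverse mult.assoc)
    also have "\<dots> \<le> K / (1 + r\<^sup>2) / wt r * B" using K wt_pos[of r] by (intro mult_left_mono B) auto
    finally have "wt r * cmod (rsum n (\<lambda>s. k s r)) \<le> wt r * (K / (1 + r\<^sup>2) / wt r * B)"
      using wt_pos[of r] by (intro mult_left_mono) auto
    then have 1: "wt r * cmod (rsum n (\<lambda>s. k s r)) \<le> K * B / (1 + r\<^sup>2)" using wt_pos[of r] by simp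
    have "wt r * cmod (d n r) \<le> wt r * (cmod (rsum n (\<lambda>s. k s r)) + cmod (kb r))"
      unfolding d_def using wt_pos[of r] by (intro mult_left_mono norm_triangle_ineq4) auto
    also have "\<dots> \<le> K * B / (1 + r\<^sup>2) + K * Bq / (1 + r\<^sup>2)"
      unfolding distrib_left by (intro add_mono 1 kb)
    also have "\<dots> = K * (B + Bq) / (1 + r\<^sup>2)" by (simp add: add_divide_distrib distrib_left)
    finally show ?thesis .
  qed
  have dbd2: "(wt r * cmod (d n r))\<^sup>2 \<le> (K * (B + Bq))\<^sup>2 / (1 + r\<^sup>2)" for n r
  proof -
    have "(wt r * cmod (d n r))\<^sup>2 \<le> (K * (B + Bq) / (1 + r\<^sup>2))\<^sup>2"
      using wt_pos[of r] by (intro power_mono dbd) auto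
    also have "\<dots> = (K * (B + Bq))\<^sup>2 / (1 + r\<^sup>2) * (1 / (1 + r\<^sup>2))" by (simp add: power2_eq_square)
    also have "\<dots> \<le> (K * (B + Bq))\<^sup>2 / (1 + r\<^sup>2) * 1"
      by (intro mult_left_mono) (auto simp: divide_le_eq)
    finally show ?thesis by simp
  qed
  have di: "integrable lborel (\<lambda>r. (wt r * cmod (d n r))\<^sup>2)" for n
    by (rule Bochner_Integration.integrable_bound[OF integrable_inverse_one_plus_square[of "(K * (B + Bq))\<^sup>2"]])
       (use dbd2 in \<open>auto intro!: AE_I2\<close>)
  have lim: "(\<lambda>n. LINT r|lborel. (wt r * cmod (d n r))\<^sup>2) \<longlonglongrightarrow> (LINT r::real|lborel. 0)"
  proof (rule Bochner_Integration.integral_dominated_convergence[OF _ _ integrable_inverse_one_plus_square[of "(K * (B + Bq))\<^sup>2"]])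
    show "AE r in lborel. (\<lambda>n. (wt r * cmod (d n r))\<^sup>2) \<longlonglongrightarrow> 0"
    proof (rule AE_I2)
      fix r
      have "(\<lambda>n. rsum n (\<lambda>s. k s r)) \<longlonglongrightarrow> kb r"
        using rsum_tendsto_integral[OF cont bd1, of r] by (simp add: kb_def integral_lborel[OF ki])
      then have "(\<lambda>n. d n r) \<longlonglongrightarrow> 0" unfolding d_def by (rule LIM_zero)
      then show "(\<lambda>n. (wt r * cmod (d n r))\<^sup>2) \<longlonglongrightarrow> 0" by (auto intro!: tendsto_eq_intros)
    qed
  qed (use dbd2 in auto)
  assume e: "e > 0"
  have "eventually (\<lambda>n. (LINT r|lborel. (wt r * cmod (d n r))\<^sup>2) < e\<^sup>2) sequentially"
    using lim by (intro order_tendstoD) (use e in auto)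
  then show "eventually (\<lambda>n. Wle (\<lambda>z. rsum n (\<lambda>s. H s z) - (LINT s|lborel. H s z)) e) sequentially"
  proof eventually_elim
    case (elim n)
    show ?case
    proof (rule WleI[where g="d n"])
      show "(\<integral>\<^sup>+r. ennreal ((wt r * cmod (d n r))\<^sup>2) \<partial>lborel) \<le> ennreal (e\<^sup>2)"
        using elim di by (subst nn_integral_eq_integral) (auto intro: ennreal_leI)
      fix z assume z: "z \<in> strip w"
      have sq: "integrable lborel (\<lambda>r. (wt r * cmod (f r))\<^sup>2)"
        if [measurable]: "f \<in> borel_measurable borel" and f: "\<And>r. wt r * cmod (f r) \<le> C / (1 + r\<^sup>2)" for f C
      proof (rule Bochner_Integration.integrable_bound[OF integrable_inverse_one_plus_square[of "C\<^sup>2"]])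
        have "(wt r * cmod (f r))\<^sup>2 \<le> C\<^sup>2 / (1 + r\<^sup>2)" for r
        proof -
          have "(wt r * cmod (f r))\<^sup>2 \<le> (C / (1 + r\<^sup>2))\<^sup>2" using wt_pos[of r] by (intro power_mono f) auto
          also have "\<dots> = C\<^sup>2 / (1 + r\<^sup>2) * (1 / (1 + r\<^sup>2))" by (simp add: power2_eq_square)
          also have "\<dots> \<le> C\<^sup>2 / (1 + r\<^sup>2) * 1" by (intro mult_left_mono) (auto simp: divide_le_eq)
          finally show ?thesis by simp
        qed
        then show "AE r in lborel. norm ((wt r * cmod (f r))\<^sup>2) \<le> norm (C\<^sup>2 / (1 + r\<^sup>2))"
          by (auto intro!: AE_I2)
      qed measurable
      have ik: "integrable lborel (\<lambda>r. exp (- \<i> * z * of_real r) * k s r)" for s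
        by (rule rep_FT_integrable[OF _ sq[of "k s" "K / (1 + s\<^sup>2)"] z]) (use bd[of _ s] in \<open>auto simp: mult.commute\<close>)
      have ikb: "integrable lborel (\<lambda>r. exp (- \<i> * z * of_real r) * kb r)"
        by (rule rep_FT_integrable[OF kbm sq[OF kbm kb] z])
      have "(LINT r|lborel. exp (- \<i> * z * of_real r) * d n r)
        = (LINT r|lborel. rsum n (\<lambda>s. exp (- \<i> * z * of_real r) * k s r) - exp (- \<i> * z * of_real r) * kb r)"
        by (simp add: d_def rsum_def sum_distrib_left right_diff_distrib)
      also have "\<dots> = rsum n (\<lambda>s. LINT r|lborel. exp (- \<i> * z * of_real r) * k s r) - (LINT r|lborel. exp (- \<i> * z * of_real r) * kb r)"
        unfolding rsum_def using ik ikb by simp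
      finally show "rsum n (\<lambda>s. H s z) - (LINT s|lborel. H s z) = (LINT r|lborel. exp (- \<i> * z * of_real r) * d n r)"
        by (simp only: FT[OF z], simp only: H[OF z])
    qed measurable
  qed
qed

definition Hle where "Hle f c \<longleftrightarrow> (\<forall>t::real. Wle (\<lambda>z. exp (- (z - of_real t)\<^sup>2) * f z) c)"

lemma hor_norm_le: "Hle f c \<Longrightarrow> c \<ge> 0 \<Longrightarrow> hor_norm v w f \<le> ennreal c"
  unfolding hor_norm_def Hle_def by (intro SUP_least W_norm_le) auto

lemma Hle_of_hor_norm:
  assumes "hor_norm v w f \<le> ennreal c'" "c' < c" "0 \<le> c'"
  shows "Hle f c"
  unfolding Hle_def
proof
  fix t :: real
  have "W_norm v w (\<lambda>z. exp (- (z - of_real t)\<^sup>2) * f z) \<le> hor_norm v w f"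
    unfolding hor_norm_def by (rule SUP_upper) simp
  also have "\<dots> \<le> ennreal c'" by fact
  also have "\<dots> < ennreal c" using assms by (intro ennreal_lessI) auto
  finally show "Wle (\<lambda>z. exp (- (z - of_real t)\<^sup>2) * f z) c" by (rule Wle_of_W_norm)
qed

lemma hor_spaceI: "Hle f c \<Longrightarrow> c \<ge> 0 \<Longrightarrow> f \<in> hor_space v w"
  using hor_norm_le[of f c] by (auto simp: hor_space_def intro: le_less_trans)

lemma hor_space_Hle:
  assumes "f \<in> hor_space v w"
  obtains c where "c > 0" "Hle f c"
proof -
  have "hor_norm v w f < \<infinity>" using assms by (simp add: hor_space_def)
  then obtain c where c: "hor_norm v w f = ennreal c" "c \<ge> 0"
    by (metis ennreal_cases infinity_ennreal_def less_irrefl)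
  show ?thesis by (rule that[of "c + 1"]) (use c in \<open>auto intro!: Hle_of_hor_norm[of f c]\<close>)
qed

lemma Hle_scale: "Hle f c \<Longrightarrow> Hle (\<lambda>z. a * f z) (cmod a * c)"
  unfolding Hle_def using Wle_scale[of _ c a] by (simp add: mult.left_commute)

definition KG where "KG = (SOME K. K > 0 \<and> (\<forall>m::real. Wle (\<lambda>z. exp (- (z - of_real m)\<^sup>2)) K))"

lemma KG: "KG > 0" "Wle (\<lambda>z. exp (- (z - of_real m)\<^sup>2)) KG"
proof -
  have "KG > 0 \<and> (\<forall>m::real. Wle (\<lambda>z. exp (- (z - of_real m)\<^sup>2)) KG)"
    unfolding KG_def by (rule someI_ex) (use Wle_gauss[of 1] in simp)
  then show "KG > 0" "Wle (\<lambda>z. exp (- (z - of_real m)\<^sup>2)) KG" by auto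
qed

text \<open>W is an algebra and all real translates of the Gaussian have the same bound KG
  there.\<close>

lemma Wle_imp_Hle: "Wle h c \<Longrightarrow> c > 0 \<Longrightarrow> Hle h (KW * KG * c)"
  unfolding Hle_def using Wle_mult[OF KG(2)] KG(1) by blast

text \<open>Around the midpoint m = (t + s) / 2 the product is a narrower Gaussian times exp(-(t -
  s)^2 / 2). This decay makes translates far from t negligible in the Hoermander norm.\<close>

lemma Wle_gauss_pair:
  "\<exists>K>0. \<forall>s t::real. Wle (\<lambda>z. exp (- (z - of_real t)\<^sup>2) * exp (- (z - of_real s)\<^sup>2)) (K * exp (- ((t - s)\<^sup>2) / 2))"
proof -
  obtain K where K: "K > 0" "\<And>m::real. Wle (\<lambda>z. exp (- of_real 2 * (z - of_real m)\<^sup>2)) K"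
    using Wle_gauss[of 2] by auto
  have "Wle (\<lambda>z. exp (- (z - of_real t)\<^sup>2) * exp (- (z - of_real s)\<^sup>2)) (K * exp (- ((t - s)\<^sup>2) / 2))" for s t :: real
  proof -
    have "exp (of_real (- ((t - s)\<^sup>2) / 2)) * exp (- of_real 2 * (z - of_real ((t + s) / 2))\<^sup>2)
        = exp (- (z - of_real t)\<^sup>2) * exp (- (z - of_real s)\<^sup>2)" for z :: complex
    proof -
      define m d where "m = (t + s) / 2" and "d = (t - s) / 2"
      have ts: "t = m + d" "s = m - d" by (auto simp: m_def d_def field_simps)
      have "of_real (- ((t - s)\<^sup>2) / 2) + - of_real 2 * (z - of_real ((t + s) / 2))\<^sup>2 = - (z - of_real t)\<^sup>2 + - (z - of_real s)\<^sup>2"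
        unfolding ts by (simp add: power2_eq_square algebra_simps)
      then show ?thesis by (metis exp_add)
    qed
    then show ?thesis
      using Wle_scale[OF K(2)[of "(t + s) / 2"], of "exp (of_real (- ((t - s)\<^sup>2) / 2))"]
      by (simp add: mult.commute)
  qed
  then show ?thesis using K(1) by blast
qed

text \<open>The Riemann sums of the partition of unity cannot tend to 1 in W, since elements of W
  vanish at infinity along the real line. The factor exp(-z^2) repairs this and gives the summands
  the decay in s that \<open>Wle_rsum\<close> demands.\<close>

lemma gauss_partition_tendsto:
  assumes e: "e > 0"
  shows "eventually (\<lambda>n. Wle (\<lambda>z. rsum n (\<lambda>s. of_real (sqrt (2 / pi)) * exp (- 2 * (z - of_real s)\<^sup>2) * exp (- z\<^sup>2)) - exp (- z\<^sup>2)) e) sequentially"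
proof -
  \<comment> \<open>By \<open>- 2 * (z - s)\<^sup>2 - z\<^sup>2 = - 3 * (z - 2 / 3 * s)\<^sup>2 - 2
    / 3 * s\<^sup>2\<close> the summand is a decaying multiple of the Gaussian with a = 3 and centre
    2 s / 3; 12 is 4 a.\<close>
  define c0 where "c0 = sqrt (2 / pi) * (1 / (2 * sqrt (pi * 3)))"
  define k where "k s r = complex_of_real (c0 * exp (- (r\<^sup>2) / 12) * exp (- (2 / 3 * s\<^sup>2))) * exp (\<i> * of_real (2 / 3 * s * r))" for s r :: real
  have c0: "c0 > 0" by (simp add: c0_def)
  obtain K where K: "K > 0" "\<And>r. wt r * exp (- (1 / 12 * r\<^sup>2)) \<le> K / (1 + r\<^sup>2)"
    using wt_le_gauss[of "1 / 12"] by auto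
  define H where "H s z = of_real (sqrt (2 / pi)) * exp (- 2 * (z - of_real s)\<^sup>2) * exp (- z\<^sup>2)" for s :: real and z :: complex
  have Hk: "H s z = (LINT r|lborel. exp (- \<i> * z * of_real r) * k s r)" for s z
  proof -
    let ?kk = "\<lambda>r::real. complex_of_real (1 / (2 * sqrt (pi * 3)) * exp (- (r\<^sup>2) / (4 * 3)))"
    let ?C = "complex_of_real (sqrt (2 / pi)) * exp (of_real (- (2 / 3 * s\<^sup>2)))"
    have i: "has_bochner_integral lborel (\<lambda>r. exp (- \<i> * (z - of_real (2 / 3 * s)) * of_real r) * ?kk r) (exp (- of_real 3 * (z - of_real (2 / 3 * s))\<^sup>2))"
      by (rule gaussian_Fourier) simp
    have e1: "exp (- \<i> * (z - of_real (2 / 3 * s)) * of_real r) = exp (- \<i> * z * of_real r) * exp (\<i> * of_real (2 / 3 * s * r))" for r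
      by (simp add: exp_add[symmetric] algebra_simps)
    have e2: "?C * (exp (- \<i> * (z - of_real (2 / 3 * s)) * of_real r) * ?kk r) = exp (- \<i> * z * of_real r) * k s r" for r
      unfolding e1 k_def c0_def by (simp add: of_real_exp mult_ac)
    have e3: "?C * exp (- of_real 3 * (z - of_real (2 / 3 * s))\<^sup>2) = H s z"
    proof -
      have "of_real (- (2 / 3 * s\<^sup>2)) + - of_real 3 * (z - of_real (2 / 3 * s))\<^sup>2 = - 2 * (z - of_real s)\<^sup>2 + - z\<^sup>2"
        by (simp add: power2_eq_square field_simps)
      then have "exp (of_real (- (2 / 3 * s\<^sup>2))) * exp (- of_real 3 * (z - of_real (2 / 3 * s))\<^sup>2) = exp (- 2 * (z - of_real s)\<^sup>2) * exp (- z\<^sup>2)"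
        by (metis exp_add)
      then show ?thesis unfolding H_def by (simp only: mult.assoc)
    qed
    from has_bochner_integral_mult_right[OF i, of ?C] show ?thesis
      unfolding e2 e3 by (simp add: has_bochner_integral_iff)
  qed
  have "eventually (\<lambda>n. Wle (\<lambda>z. rsum n (\<lambda>s. H s z) - (LINT s|lborel. H s z)) e) sequentially"
  proof (rule Wle_rsum(2)[OF _ _ _ _ Hk e])
    show "(\<lambda>(s, r). k s r) \<in> borel_measurable (borel \<Otimes>\<^sub>M borel)" unfolding k_def by measurable
    show "continuous_on UNIV (\<lambda>s. k s r)" for r unfolding k_def by (intro continuous_intros)
    show "2 * c0 * K > 0" using c0 K by simp
    fix s r
    have "wt r * cmod (k s r) = c0 * (wt r * exp (- (1 / 12 * r\<^sup>2))) * exp (- (2 / 3 * s\<^sup>2))"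
      unfolding k_def using c0 by (simp only: norm_mult norm_exp_i_times norm_of_real) simp
    also have "\<dots> \<le> c0 * (K / (1 + r\<^sup>2)) * (2 / (1 + s\<^sup>2))"
    proof (intro mult_mono order.refl K(2))
      have "exp (- (2 / 3 * s\<^sup>2)) \<le> 1 / (1 + 2 / 3 * s\<^sup>2)" by (rule exp_neg_square_le) simp
      also have "\<dots> \<le> 1 / ((1 + s\<^sup>2) / 2)"
      proof (intro divide_left_mono mult_pos_pos add_pos_nonneg)
        show "(1 + s\<^sup>2) / 2 \<le> 1 + 2 / 3 * s\<^sup>2" using zero_le_power2[of s] by (simp add: field_simps)
      qed auto
      also have "\<dots> = 2 / (1 + s\<^sup>2)" by simp
      finally show "exp (- (2 / 3 * s\<^sup>2)) \<le> 2 / (1 + s\<^sup>2)" .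
    qed (use c0 K wt_pos[of r] in auto)
    finally show "wt r * cmod (k s r) \<le> 2 * c0 * K / (1 + r\<^sup>2) / (1 + s\<^sup>2)" by (simp add: mult_ac)
  qed
  moreover have "(LINT s|lborel. H s z) = exp (- z\<^sup>2)" for z
    unfolding H_def using gaussian_integral_shifted[of z] by (simp add: has_bochner_integral_iff)
  ultimately show ?thesis unfolding H_def by simp
qed

end

section \<open>Integrals along horizontal lines\<close>

lemma strip_pos: "u > 0 \<Longrightarrow> strip u = {z. \<bar>Im z\<bar> < u}"
  by (simp add: strip_def)

lemma open_strip: "u > 0 \<Longrightarrow> open (strip u)"
  by (auto simp: strip_pos intro!: open_Collect_less continuous_intros)

locale cstruct =
  fixes J :: "'a::banach \<Rightarrow> 'a"
  assumes cs: "complex_structure J"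
begin

abbreviation sc (infixr "\<odot>" 75) where "sc z x \<equiv> cmult J z x"

lemma J_linear: "linear J" and J_J [simp]: "J (J x) = - x" and norm_sc [simp]: "norm (z \<odot> x) = cmod z * norm x"
  using cs by (auto simp: complex_structure_def)

lemma norm_J [simp]: "norm (J x) = norm x"
  using norm_sc[of \<i> x] by (simp add: cmult_def)

lemma J_simps [simp]: "J (x + y) = J x + J y" "J (x - y) = J x - J y" "J (- x) = - J x" "J (r *\<^sub>R x) = r *\<^sub>R J x" "J 0 = 0"
  using linear_add[OF J_linear] linear_diff[OF J_linear] linear_neg[OF J_linear] linear_cmul[OF J_linear] linear_0[OF J_linear]
  by auto

lemma J_bounded_linear: "bounded_linear J"
  by (rule bounded_linear_intro[where K=1]) simp_all

lemma sc_bounded_bilinear: "bounded_bilinear (cmult J)"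
proof
  show "\<exists>K. \<forall>a b. norm (a \<odot> b) \<le> norm a * norm b * K" by (intro exI[of _ 1]) simp
qed (simp_all add: cmult_def algebra_simps)

sublocale sc: bounded_bilinear "cmult J" by (rule sc_bounded_bilinear)

lemma sc_mult: "a \<odot> (b \<odot> x) = (a * b) \<odot> x"
  by (simp add: cmult_def algebra_simps)

lemma sc_one [simp]: "1 \<odot> x = x" and sc_i: "\<i> \<odot> x = J x" and sc_of_real: "of_real r \<odot> x = r *\<^sub>R x"
  and sc_J: "z \<odot> J x = J (z \<odot> x)" and sc_scaleR: "(r *\<^sub>R z) \<odot> x = r *\<^sub>R (z \<odot> x)"
  by (simp_all add: cmult_def algebra_simps)

lemma linear_sc_commute:
  assumes "linear T" "\<And>x. T (J x) = J (T x)"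
  shows "T (z \<odot> x) = z \<odot> T x"
  using assms(2) by (simp add: cmult_def linear_add[OF assms(1)] linear_cmul[OF assms(1)])

text \<open>Cauchy's theorem on a rectangle, for functions that are complex differentiable with
  respect to J. As the y-derivative of F is J times its t-derivative, the derivative in y of the
  integral over [-N, N] is J applied to the difference of the end values, hence at most 2 B.\<close>

lemma line_shift:
  fixes F F' :: "complex \<Rightarrow> 'a"
  assumes der: "\<And>z. y1 \<le> Im z \<Longrightarrow> Im z \<le> y2 \<Longrightarrow> (F has_derivative (\<lambda>u. u \<odot> F' z)) (at z)"
    and cont: "continuous_on {z. y1 \<le> Im z \<and> Im z \<le> y2} F'"
    and bd: "\<And>y. y1 \<le> y \<Longrightarrow> y \<le> y2 \<Longrightarrow> norm (F (Complex N y)) \<le> B \<and> norm (F (Complex (- N) y)) \<le> B"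
    and y: "y1 \<le> y2" and N: "N \<ge> 0"
  shows "norm (integral {-N..N} (\<lambda>t. F (Complex t y2)) - integral {-N..N} (\<lambda>t. F (Complex t y1))) \<le> 2 * B * (y2 - y1)"
proof -
  have Cplx: "Complex t y = of_real t + \<i> * of_real y" for t y by (simp add: complex_eq_iff)
  have dy: "((\<lambda>y. Complex t y) has_derivative (\<lambda>h. \<i> * of_real h)) (at y within S)" for t y S
    unfolding Cplx by (auto intro!: derivative_eq_intros)
  have dt: "((\<lambda>t. Complex t y) has_derivative (\<lambda>h. of_real h)) (at t within S)" for t y S
    unfolding Cplx by (auto intro!: derivative_eq_intros)
  \<comment> \<open>Moving in the direction i inserts the factor J, moving in the real direction
    (\<open>vt\<close>) does not.\<close>
  have vy: "((\<lambda>y. F (Complex t y)) has_vector_derivative J (F' (Complex t y))) (at y within S)"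
    if "y1 \<le> y" "y \<le> y2" for t y S
    unfolding has_vector_derivative_def
    using has_derivative_compose[OF dy der, of t y] that
    by (simp add: sc_mult[symmetric] sc_i sc_of_real)
  have vt: "((\<lambda>t. F (Complex t y)) has_vector_derivative F' (Complex t y)) (at t within S)"
    if "y1 \<le> y" "y \<le> y2" for t y S
    unfolding has_vector_derivative_def
    using has_derivative_compose[OF dt der, of t y] that by (simp add: sc_of_real)
  have cF: "continuous_on {z. y1 \<le> Im z \<and> Im z \<le> y2} F"
    by (rule continuous_at_imp_continuous_on) (auto intro!: has_derivative_continuous der)
  have cl: "continuous_on UNIV (\<lambda>t. F (Complex t y))" if "y1 \<le> y" "y \<le> y2" for y
    unfolding Cplx using that by (intro continuous_on_compose2[OF cF] continuous_intros) auto
  define I where "I y = integral (cbox (-N) N) (\<lambda>t. F (Complex t y))" for y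
  have dI: "(I has_vector_derivative J (F (Complex N y) - F (Complex (-N) y))) (at y within {y1..y2})"
    if yy: "y \<in> {y1..y2}" for y
  proof -
    have "(I has_vector_derivative integral (cbox (-N) N) (\<lambda>t. J (F' (Complex t y)))) (at y within {y1..y2})"
      unfolding I_def
    proof (rule leibniz_rule_vector_derivative[where fx="\<lambda>y t. J (F' (Complex t y))"])
      show "((\<lambda>x. F (Complex t x)) has_vector_derivative J (F' (Complex t x))) (at x within {y1..y2})"
        if "x \<in> {y1..y2}" for x t using that by (intro vy) auto
      show "(\<lambda>t. F (Complex t x)) integrable_on cbox (-N) N" if "x \<in> {y1..y2}" for x
        by (rule integrable_continuous[OF continuous_on_subset[OF cl]]) (use that in auto)
      have "continuous_on ({y1..y2} \<times> cbox (-N) N) (\<lambda>p. J (F' (of_real (snd p) + \<i> * of_real (fst p))))"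
        by (rule bounded_linear.continuous_on[OF J_bounded_linear], rule continuous_on_compose2[OF cont])
           (auto intro!: continuous_intros)
      then show "continuous_on ({y1..y2} \<times> cbox (-N) N) (\<lambda>(x, t). J (F' (Complex t x)))"
        by (simp add: Cplx case_prod_beta)
    qed (use yy in auto)
    moreover have "((\<lambda>t. F' (Complex t y)) has_integral (F (Complex N y) - F (Complex (-N) y))) {-N..N}"
      using yy N by (intro fundamental_theorem_of_calculus vt) auto
    from has_integral_linear[OF this J_bounded_linear]
    have "((\<lambda>t. J (F' (Complex t y))) has_integral J (F (Complex N y) - F (Complex (-N) y))) {-N..N}"
      by (simp only: o_def)
    ultimately show ?thesis by (simp add: integral_unique)
  qed
  have "norm (I y2 - I y1) \<le> (2 * B) * norm (y2 - y1)"
  proof (rule differentiable_bound[where S="{y1..y2}"])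
    fix y assume yy: "y \<in> {y1..y2}"
    show "(I has_derivative (\<lambda>h. h *\<^sub>R J (F (Complex N y) - F (Complex (-N) y)))) (at y within {y1..y2})"
      using dI[OF yy] by (simp add: has_vector_derivative_def)
    have "norm (F (Complex N y) - F (Complex (-N) y)) \<le> 2 * B"
      using bd[of y] yy norm_triangle_ineq4[of "F (Complex N y)" "F (Complex (-N) y)"] by auto
    then show "onorm (\<lambda>h. h *\<^sub>R J (F (Complex N y) - F (Complex (-N) y))) \<le> 2 * B"
      by (intro onorm_le) (simp add: mult.commute mult_left_mono J_simps(2)[symmetric] del: J_simps)
  qed (use y in auto)
  then show ?thesis using y by (simp add: I_def)
qed

text \<open>\<open>line_shift\<close> with the bound C / (1 + n^2) on the vertical sides, which
  tends to 0.\<close>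

lemma line_shift_UNIV:
  fixes F F' :: "complex \<Rightarrow> 'a"
  assumes der: "\<And>z. y1 \<le> Im z \<Longrightarrow> Im z \<le> y2 \<Longrightarrow> (F has_derivative (\<lambda>u. u \<odot> F' z)) (at z)"
    and cont: "continuous_on {z. y1 \<le> Im z \<and> Im z \<le> y2} F'"
    and bd: "\<And>t y. y1 \<le> y \<Longrightarrow> y \<le> y2 \<Longrightarrow> norm (F (Complex t y)) \<le> C / (1 + t\<^sup>2)"
    and y: "y1 \<le> y2"
  shows "integral UNIV (\<lambda>t. F (Complex t y2)) = integral UNIV (\<lambda>t. F (Complex t y1))"
proof -
  have Cplx: "Complex t y = of_real t + \<i> * of_real y" for t y by (simp add: complex_eq_iff)
  have cF: "continuous_on {z. y1 \<le> Im z \<and> Im z \<le> y2} F"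
    by (rule continuous_at_imp_continuous_on) (auto intro!: has_derivative_continuous der)
  have cl: "continuous_on UNIV (\<lambda>t. F (Complex t y))" if "y1 \<le> y" "y \<le> y2" for y
    unfolding Cplx using that by (intro continuous_on_compose2[OF cF] continuous_intros) auto
  have lim: "(\<lambda>n. integral {- real n..real n} (\<lambda>t. F (Complex t y))) \<longlonglongrightarrow> integral UNIV (\<lambda>t. F (Complex t y))"
    if "y1 \<le> y" "y \<le> y2" for y
    by (rule integral_truncate_tendsto[OF cl bd]) (use that in auto)
  have "(\<lambda>n. integral {- real n..real n} (\<lambda>t. F (Complex t y2)) - integral {- real n..real n} (\<lambda>t. F (Complex t y1))) \<longlonglongrightarrow> 0"
  proof (rule Lim_null_comparison[OF always_eventually])
    show "\<forall>n. norm (integral {- real n..real n} (\<lambda>t. F (Complex t y2)) - integral {- real n..real n} (\<lambda>t. F (Complex t y1)))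
        \<le> 2 * (C / (1 + (real n)\<^sup>2)) * (y2 - y1)"
    proof
      fix n
      show "norm (integral {- real n..real n} (\<lambda>t. F (Complex t y2)) - integral {- real n..real n} (\<lambda>t. F (Complex t y1)))
        \<le> 2 * (C / (1 + (real n)\<^sup>2)) * (y2 - y1)"
        by (rule line_shift[OF der cont _ y]) (use bd[of _ "real n"] bd[of _ "- real n"] in auto)
    qed
    show "(\<lambda>n. 2 * (C / (1 + (real n)\<^sup>2)) * (y2 - y1)) \<longlonglongrightarrow> 0" by real_asymp
  qed
  moreover have "(\<lambda>n. integral {- real n..real n} (\<lambda>t. F (Complex t y2)) - integral {- real n..real n} (\<lambda>t. F (Complex t y1)))
     \<longlonglongrightarrow> integral UNIV (\<lambda>t. F (Complex t y2)) - integral UNIV (\<lambda>t. F (Complex t y1))"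
    using y by (intro tendsto_diff lim) auto
  ultimately show ?thesis using LIMSEQ_unique by fastforce
qed

end

text \<open>Taking the complex plane as the space X makes the line-shift lemmas available for scalar
  holomorphic functions.\<close>

interpretation cplx: cstruct "\<lambda>x::complex. \<i> * x"
  rewrites "cmult (\<lambda>x::complex. \<i> * x) = (*)"
proof -
  have *: "cmult (\<lambda>x::complex. \<i> * x) = (*)"
    by (auto simp: cmult_def fun_eq_iff complex_eq_iff scaleR_conv_of_real algebra_simps)
  show "cstruct (\<lambda>x::complex. \<i> * x)"
    by standard (auto simp: complex_structure_def * norm_mult intro!: linearI algebra_simps)
  show "cmult (\<lambda>x::complex. \<i> * x) = (*)" by (rule *)
qed

lemma holomorphic_has_derivative:
  assumes "f holomorphic_on S" "open S" "z \<in> S"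
  shows "(f has_derivative (\<lambda>u. u * deriv f z)) (at z)"
  using holomorphic_derivI[OF assms] by (simp add: has_field_derivative_def mult_commute_abs)

text \<open>E is an explicit primitive: the difference of the logarithms of t - i h - z and t + i h
  - z, with arctan in place of the arguments so that no branch cut is crossed. Its real parts cancel
  in the limit and each arctan contributes pi.\<close>

lemma integral_inverse_lines:
  fixes z :: complex
  assumes "\<bar>Im z\<bar> < h"
  shows "(\<lambda>n. integral {- real n..real n} (\<lambda>t. 1 / (Complex t (-h) - z) - 1 / (Complex t h - z))) \<longlonglongrightarrow> 2 * pi * \<i>"
proof -
  define a c d where "a = Re z" and "c = h + Im z" and "d = h - Im z"
  have cd: "c > 0" "d > 0" using assms by (auto simp: c_def d_def)
  define E where "E t = Complex (ln ((t - a)\<^sup>2 + c\<^sup>2) / 2 - ln ((t - a)\<^sup>2 + d\<^sup>2) / 2) (arctan ((t - a) / c) + arctan ((t - a) / d))" for t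
  have pos: "(t - a)\<^sup>2 + c\<^sup>2 > 0" "(t - a)\<^sup>2 + d\<^sup>2 > 0" for t
    using cd by (auto intro!: add_nonneg_pos)
  have der: "(E has_vector_derivative (1 / (Complex t (-h) - z) - 1 / (Complex t h - z))) (at t within S)" for t S
  proof -
    let ?re = "\<lambda>t. ln ((t - a)\<^sup>2 + c\<^sup>2) / 2 - ln ((t - a)\<^sup>2 + d\<^sup>2) / 2"
    let ?im = "\<lambda>t. arctan ((t - a) / c) + arctan ((t - a) / d)"
    have r: "(?re has_real_derivative ((t - a) / ((t - a)\<^sup>2 + c\<^sup>2) - (t - a) / ((t - a)\<^sup>2 + d\<^sup>2))) (at t within S)"
    proof -
      have "((\<lambda>t. ln ((t - a)\<^sup>2 + b\<^sup>2) / 2) has_real_derivative (t - a) / ((t - a)\<^sup>2 + b\<^sup>2)) (at t within S)"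
        if b: "(t - a)\<^sup>2 + b\<^sup>2 > 0" for b
      proof -
        have "((\<lambda>t. ln ((t - a)\<^sup>2 + b\<^sup>2)) has_real_derivative (2 * (t - a)) / ((t - a)\<^sup>2 + b\<^sup>2)) (at t within S)"
          using b by (auto intro!: derivative_eq_intros)
        moreover have "2 * (t - a) / ((t - a)\<^sup>2 + b\<^sup>2) / 2 = (t - a) / ((t - a)\<^sup>2 + b\<^sup>2)"
        proof -
          have "2 * u / q / 2 = u / q" for u q :: real by simp
          then show ?thesis .
        qed
        ultimately show ?thesis using DERIV_cdivide[of _ "2 * (t - a) / ((t - a)\<^sup>2 + b\<^sup>2)" t S 2] by metis
      qed
      then show ?thesis using pos by (intro DERIV_diff) auto
    qed
    have i: "(?im has_real_derivative (c / ((t - a)\<^sup>2 + c\<^sup>2) + d / ((t - a)\<^sup>2 + d\<^sup>2))) (at t within S)"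
    proof -
      have "((\<lambda>t. arctan ((t - a) / b)) has_real_derivative b / ((t - a)\<^sup>2 + b\<^sup>2)) (at t within S)" if "b > 0" for b
      proof -
        have "((\<lambda>t. arctan ((t - a) / b)) has_real_derivative inverse (1 + ((t - a) / b)\<^sup>2) * (1 / b)) (at t within S)"
          by (rule DERIV_chain2[OF DERIV_arctan]) (use that in \<open>auto intro!: derivative_eq_intros\<close>)
        moreover have "inverse (1 + ((t - a) / b)\<^sup>2) * (1 / b) = b / ((t - a)\<^sup>2 + b\<^sup>2)"
          using that by (simp add: power_divide divide_simps power2_eq_square add.commute)
        ultimately show ?thesis by simp
      qed
      then show ?thesis using cd by (intro DERIV_add) auto
    qed
    have E: "E = (\<lambda>t. of_real (?re t) + \<i> * of_real (?im t))" by (auto simp: E_def complex_eq_iff)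
    have "(E has_vector_derivative (of_real ((t - a) / ((t - a)\<^sup>2 + c\<^sup>2) - (t - a) / ((t - a)\<^sup>2 + d\<^sup>2))
         + \<i> * of_real (c / ((t - a)\<^sup>2 + c\<^sup>2) + d / ((t - a)\<^sup>2 + d\<^sup>2)))) (at t within S)"
      unfolding E using r i
      by (intro has_vector_derivative_add has_vector_derivative_mult_right has_vector_derivative_of_real)
         (simp_all add: has_real_derivative_iff_has_vector_derivative)
    moreover have "of_real ((t - a) / ((t - a)\<^sup>2 + c\<^sup>2) - (t - a) / ((t - a)\<^sup>2 + d\<^sup>2))
         + \<i> * of_real (c / ((t - a)\<^sup>2 + c\<^sup>2) + d / ((t - a)\<^sup>2 + d\<^sup>2)) = 1 / (Complex t (-h) - z) - 1 / (Complex t h - z)"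
    proof -
      have "Complex t (-h) - z = Complex (t - a) (- c)" "Complex t h - z = Complex (t - a) d"
        by (auto simp: complex_eq_iff a_def c_def d_def)
      moreover have "u * q / q\<^sup>2 = u / q" for u q :: real by (simp add: power2_eq_square)
      ultimately show ?thesis by (simp add: complex_eq_iff Re_divide Im_divide)
    qed
    ultimately show ?thesis by simp
  qed
  have int: "integral {- real n..real n} (\<lambda>t. 1 / (Complex t (-h) - z) - 1 / (Complex t h - z)) = E (real n) - E (- real n)" for n :: nat
    by (rule integral_unique, rule fundamental_theorem_of_calculus) (use der in auto)
  have "(\<lambda>n. Re (E (real n) - E (- real n))) \<longlonglongrightarrow> 0"
    unfolding E_def using cd by simp real_asymp
  moreover have "(\<lambda>n. Im (E (real n) - E (- real n))) \<longlonglongrightarrow> 2 * pi"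
    unfolding E_def using cd by simp real_asymp
  ultimately have "(\<lambda>n. E (real n) - E (- real n)) \<longlonglongrightarrow> Complex 0 (2 * pi)"
    by (subst tendsto_complex_iff) simp
  moreover have "Complex 0 (2 * pi) = 2 * pi * \<i>" by (simp add: complex_eq_iff)
  ultimately show ?thesis by (simp add: int)
qed

section \<open>Cauchy's formula on a strip\<close>

lemma Complex_line: "Complex t y = of_real t + \<i> * of_real y"
  by (simp add: complex_eq_iff)

lemma H0_holomorphic: "\<psi> \<in> H0_infty \<theta> \<Longrightarrow> \<psi> holomorphic_on strip \<theta>"
  by (simp add: H0_infty_def)

text \<open>The case \<alpha> = 2, in the shape of the standard integrable majorant.\<close>

lemma H0_decay:
  assumes "\<psi> \<in> H0_infty \<theta>"
  shows "\<exists>C>0. \<forall>z\<in>strip \<theta>. cmod (\<psi> z) \<le> C / (1 + (Re z)\<^sup>2)"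
proof -
  obtain C where C: "\<And>z. z \<in> strip \<theta> \<Longrightarrow> cmod (\<psi> z) \<le> C * (1 + \<bar>Re z\<bar>) powr (- 2)"
  proof -
    have "\<exists>C. \<forall>z\<in>strip \<theta>. cmod (\<psi> z) \<le> C * (1 + \<bar>Re z\<bar>) powr (- 2)"
      using assms zero_less_numeral[of "num.Bit0 num.One"] unfolding H0_infty_def by blast
    then show ?thesis using that by blast
  qed
  have "cmod (\<psi> z) \<le> (\<bar>C\<bar> + 1) / (1 + (Re z)\<^sup>2)" if "z \<in> strip \<theta>" for z
  proof -
    have "cmod (\<psi> z) \<le> (\<bar>C\<bar> + 1) * (1 + \<bar>Re z\<bar>) powr (- 2)"
      by (rule order_trans[OF C[OF that] mult_right_mono]) auto
    also have "(1 + \<bar>Re z\<bar>) powr (- 2) = 1 / (1 + \<bar>Re z\<bar>)\<^sup>2"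
      by (simp add: powr_minus powr_numeral divide_inverse)
    also have "(\<bar>C\<bar> + 1) * (1 / (1 + \<bar>Re z\<bar>)\<^sup>2) \<le> (\<bar>C\<bar> + 1) * (1 / (1 + (Re z)\<^sup>2))"
    proof (intro mult_left_mono divide_left_mono)
      show "1 + (Re z)\<^sup>2 \<le> (1 + \<bar>Re z\<bar>)\<^sup>2" by (simp add: power2_sum)
    qed (auto intro!: mult_pos_pos zero_less_power)
    finally show ?thesis by simp
  qed
  then show ?thesis by (intro exI[of _ "\<bar>C\<bar> + 1"]) auto
qed

text \<open>\<open>(1 + x) powr \<alpha> \<le> exp (\<alpha> * x)\<close>, and \<alpha> x - c x^2
  never exceeds \<alpha>^2 / (4 c).\<close>

lemma H0_gaussI:
  assumes "\<psi> holomorphic_on strip \<theta>" "c > 0" "\<And>z. z \<in> strip \<theta> \<Longrightarrow> cmod (\<psi> z) \<le> C * exp (- (c * (Re z)\<^sup>2))"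
  shows "\<psi> \<in> H0_infty \<theta>"
  unfolding H0_infty_def
proof (intro CollectI conjI allI impI assms(1))
  fix \<alpha> :: real assume \<alpha>: "\<alpha> > 0"
  show "\<exists>K. \<forall>z\<in>strip \<theta>. cmod (\<psi> z) \<le> K * (1 + \<bar>Re z\<bar>) powr (- \<alpha>)"
  proof (intro exI ballI)
    fix z assume z: "z \<in> strip \<theta>"
    let ?x = "\<bar>Re z\<bar>"
    have "0 \<le> (2 * c * ?x - \<alpha>)\<^sup>2" by simp
    then have "4 * c * (\<alpha> * ?x - c * (Re z)\<^sup>2) \<le> \<alpha>\<^sup>2"
      by (simp add: power2_eq_square algebra_simps)
    then have 1: "\<alpha> * ?x - c * (Re z)\<^sup>2 \<le> \<alpha>\<^sup>2 / (4 * c)"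
      using assms(2) by (simp add: pos_le_divide_eq mult.commute)
    have "(1 + ?x) powr \<alpha> = exp (\<alpha> * ln (1 + ?x))" by (simp add: powr_def)
    also have "\<dots> \<le> exp (\<alpha> * ?x)" using \<alpha> ln_add_one_self_le_self[of ?x] by auto
    finally have "(1 + ?x) powr \<alpha> * exp (- (c * (Re z)\<^sup>2)) \<le> exp (\<alpha> * ?x) * exp (- (c * (Re z)\<^sup>2))"
      by (rule mult_right_mono) simp
    also have "\<dots> \<le> exp (\<alpha>\<^sup>2 / (4 * c))" using 1 by (simp add: exp_add[symmetric])
    finally have "exp (- (c * (Re z)\<^sup>2)) \<le> exp (\<alpha>\<^sup>2 / (4 * c)) * (1 + ?x) powr (- \<alpha>)"
      by (simp add: powr_minus field_simps)
    moreover have "cmod (\<psi> z) \<le> \<bar>C\<bar> * exp (- (c * (Re z)\<^sup>2))"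
      by (rule order_trans[OF assms(3)[OF z] mult_right_mono]) auto
    ultimately have "cmod (\<psi> z) \<le> \<bar>C\<bar> * (exp (\<alpha>\<^sup>2 / (4 * c)) * (1 + ?x) powr (- \<alpha>))"
      by (meson abs_ge_zero mult_left_mono order_trans)
    then show "cmod (\<psi> z) \<le> \<bar>C\<bar> * exp (\<alpha>\<^sup>2 / (4 * c)) * (1 + \<bar>Re z\<bar>) powr (- \<alpha>)" by (simp add: mult.assoc)
  qed
qed

text \<open>The decay of order \<alpha> + 1 pays for linear growth. The intended factor is l - z,
  which undoes a resolvent.\<close>

lemma H0_mult_linear:
  assumes "\<psi> \<in> H0_infty \<theta>" "b holomorphic_on strip \<theta>" "\<And>z. z \<in> strip \<theta> \<Longrightarrow> cmod (b z) \<le> M * (1 + \<bar>Re z\<bar>)"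
  shows "(\<lambda>z. b z * \<psi> z) \<in> H0_infty \<theta>"
  unfolding H0_infty_def
proof (intro CollectI conjI allI impI)
  show "(\<lambda>z. b z * \<psi> z) holomorphic_on strip \<theta>"
    using assms H0_holomorphic by (intro holomorphic_on_mult) auto
  fix \<alpha> :: real assume \<alpha>: "\<alpha> > 0"
  obtain C where C: "\<And>z. z \<in> strip \<theta> \<Longrightarrow> cmod (\<psi> z) \<le> C * (1 + \<bar>Re z\<bar>) powr (- (\<alpha> + 1))"
  proof -
    have "\<alpha> + 1 > 0" using \<alpha> by simp
    then have "\<exists>C. \<forall>z\<in>strip \<theta>. cmod (\<psi> z) \<le> C * (1 + \<bar>Re z\<bar>) powr (- (\<alpha> + 1))"
      using assms(1) unfolding H0_infty_def by blast
    then show ?thesis using that by blast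
  qed
  show "\<exists>K. \<forall>z\<in>strip \<theta>. cmod (b z * \<psi> z) \<le> K * (1 + \<bar>Re z\<bar>) powr (- \<alpha>)"
  proof (intro exI ballI)
    fix z assume z: "z \<in> strip \<theta>"
    have M: "0 \<le> M * (1 + \<bar>Re z\<bar>)" using order_trans[OF norm_ge_zero assms(3)[OF z]] .
    have "cmod (b z * \<psi> z) \<le> (M * (1 + \<bar>Re z\<bar>)) * (C * (1 + \<bar>Re z\<bar>) powr (- (\<alpha> + 1)))"
      unfolding norm_mult using z M by (intro mult_mono assms(3) C) auto
    also have "\<dots> = M * C * ((1 + \<bar>Re z\<bar>) powr 1 * (1 + \<bar>Re z\<bar>) powr (- (\<alpha> + 1)))" by simp
    also have "(1 + \<bar>Re z\<bar>) powr 1 * (1 + \<bar>Re z\<bar>) powr (- (\<alpha> + 1)) = (1 + \<bar>Re z\<bar>) powr (- \<alpha>)"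
      by (simp only: powr_add[symmetric]) simp
    finally show "cmod (b z * \<psi> z) \<le> M * C * (1 + \<bar>Re z\<bar>) powr (- \<alpha>)" .
  qed
qed

lemma H0_mult_bounded:
  assumes "\<psi> \<in> H0_infty \<theta>" "b holomorphic_on strip \<theta>" "\<And>z. z \<in> strip \<theta> \<Longrightarrow> cmod (b z) \<le> M"
  shows "(\<lambda>z. b z * \<psi> z) \<in> H0_infty \<theta>"
proof (rule H0_mult_linear[OF assms(1,2)])
  fix z assume z: "z \<in> strip \<theta>"
  have "0 \<le> M" using order_trans[OF norm_ge_zero assms(3)[OF z]] .
  then have "M * 1 \<le> M * (1 + \<bar>Re z\<bar>)" by (intro mult_left_mono) auto
  then show "cmod (b z) \<le> M * (1 + \<bar>Re z\<bar>)" using assms(3)[OF z] by linarith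
qed

lemma H0_mult:
  assumes "\<phi> \<in> H0_infty \<theta>" "\<psi> \<in> H0_infty \<theta>"
  shows "(\<lambda>z. \<phi> z * \<psi> z) \<in> H0_infty \<theta>"
proof -
  obtain C where C: "C > 0" "\<And>z. z \<in> strip \<theta> \<Longrightarrow> cmod (\<phi> z) \<le> C / (1 + (Re z)\<^sup>2)"
    using H0_decay[OF assms(1)] by blast
  show ?thesis
  proof (rule H0_mult_bounded[OF assms(2) H0_holomorphic[OF assms(1)]])
    fix z assume "z \<in> strip \<theta>"
    then have "cmod (\<phi> z) \<le> C / (1 + (Re z)\<^sup>2)" by (rule C)
    also have "\<dots> \<le> C" using C(1) by (simp add: divide_le_eq)
    finally show "cmod (\<phi> z) \<le> C" .
  qed
qed

lemma H0_scale: "\<psi> \<in> H0_infty \<theta> \<Longrightarrow> (\<lambda>z. c * \<psi> z) \<in> H0_infty \<theta>"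
  by (rule H0_mult_bounded[where M="cmod c"]) auto

lemma H0_add:
  assumes "\<phi> \<in> H0_infty \<theta>" "\<psi> \<in> H0_infty \<theta>"
  shows "(\<lambda>z. \<phi> z + \<psi> z) \<in> H0_infty \<theta>"
  unfolding H0_infty_def
proof (intro CollectI conjI allI impI)
  show "(\<lambda>z. \<phi> z + \<psi> z) holomorphic_on strip \<theta>"
    using assms H0_holomorphic by (intro holomorphic_on_add) auto
  fix \<alpha> :: real assume "\<alpha> > 0"
  then obtain C D where CD: "\<And>z. z \<in> strip \<theta> \<Longrightarrow> cmod (\<phi> z) \<le> C * (1 + \<bar>Re z\<bar>) powr (- \<alpha>)"
    "\<And>z. z \<in> strip \<theta> \<Longrightarrow> cmod (\<psi> z) \<le> D * (1 + \<bar>Re z\<bar>) powr (- \<alpha>)"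
    using assms unfolding H0_infty_def by blast
  show "\<exists>K. \<forall>z\<in>strip \<theta>. cmod (\<phi> z + \<psi> z) \<le> K * (1 + \<bar>Re z\<bar>) powr (- \<alpha>)"
  proof (intro exI ballI)
    fix z assume "z \<in> strip \<theta>"
    then show "cmod (\<phi> z + \<psi> z) \<le> (C + D) * (1 + \<bar>Re z\<bar>) powr (- \<alpha>)"
      using CD[of z] norm_triangle_ineq[of "\<phi> z" "\<psi> z"] by (simp add: distrib_right)
  qed
qed

lemma H0_diff: "\<phi> \<in> H0_infty \<theta> \<Longrightarrow> \<psi> \<in> H0_infty \<theta> \<Longrightarrow> (\<lambda>z. \<phi> z - \<psi> z) \<in> H0_infty \<theta>"
  using H0_add[OF _ H0_scale[of \<psi> \<theta> "-1"], of \<phi>] by simp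

lemma H0_zero: "(\<lambda>z. 0) \<in> H0_infty \<theta>"
  by (rule H0_gaussI[where c=1 and C=0]) auto

lemma H0_sum: "finite S \<Longrightarrow> (\<And>i. i \<in> S \<Longrightarrow> \<psi> i \<in> H0_infty \<theta>) \<Longrightarrow> (\<lambda>z. \<Sum>i\<in>S. \<psi> i z) \<in> H0_infty \<theta>"
  by (induction S rule: finite_induct) (auto intro: H0_add H0_zero)

lemma H0_gauss:
  assumes "\<theta> > 0" "a > 0"
  shows "(\<lambda>z. exp (- of_real a * (z - of_real m)\<^sup>2)) \<in> H0_infty \<theta>"
proof (rule H0_gaussI[where c="a / 2" and C="exp (a * (\<theta>\<^sup>2 + m\<^sup>2))"])
  show "(\<lambda>z. exp (- of_real a * (z - of_real m)\<^sup>2)) holomorphic_on strip \<theta>" by (intro holomorphic_intros)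
  fix z assume z: "z \<in> strip \<theta>"
  have "(Im z)\<^sup>2 \<le> \<theta>\<^sup>2" using strip_Im_le[OF z] assms(1) by (metis abs_le_square_iff abs_of_pos less_imp_le)
  \<comment> \<open>Half of this square is the gap in (Re z - m)^2 \<ge> (Re z)^2 / 2 - m^2.\<close>
  moreover have "0 \<le> (Re z - 2 * m)\<^sup>2" by simp
  ultimately have "- ((Re z - m)\<^sup>2 - (Im z)\<^sup>2) \<le> (\<theta>\<^sup>2 + m\<^sup>2) - (Re z)\<^sup>2 / 2"
    by (simp add: power2_eq_square field_simps)
  then have "a * - ((Re z - m)\<^sup>2 - (Im z)\<^sup>2) \<le> a * ((\<theta>\<^sup>2 + m\<^sup>2) - (Re z)\<^sup>2 / 2)"
    using assms(2) by (intro mult_left_mono) auto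
  then have "Re (- of_real a * (z - of_real m)\<^sup>2) \<le> a * (\<theta>\<^sup>2 + m\<^sup>2) + - (a / 2 * (Re z)\<^sup>2)"
  proof -
    have "Re (- of_real a * (z - of_real m)\<^sup>2) = a * - ((Re z - m)\<^sup>2 - (Im z)\<^sup>2)"
      by (simp add: power2_eq_square algebra_simps)
    then show ?thesis using \<open>a * - ((Re z - m)\<^sup>2 - (Im z)\<^sup>2) \<le> _\<close> by (simp add: right_diff_distrib)
  qed
  then show "cmod (exp (- of_real a * (z - of_real m)\<^sup>2)) \<le> exp (a * (\<theta>\<^sup>2 + m\<^sup>2)) * exp (- (a / 2 * (Re z)\<^sup>2))"
    unfolding norm_exp_eq_Re exp_add[symmetric] by simp
qed (use assms in auto)

lemma Cauchy_kernel:
  assumes \<psi>: "\<psi> \<in> H0_infty \<theta>" and h: "h < \<theta>" "\<bar>Im z\<bar> < h" and C: "C > 0" "\<And>z. z \<in> strip \<theta> \<Longrightarrow> cmod (\<psi> z) \<le> C / (1 + (Re z)\<^sup>2)"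
  shows "continuous_on UNIV (\<lambda>t. \<psi> (Complex t (-h)) / (Complex t (-h) - z) - \<psi> (Complex t h) / (Complex t h - z))"
    and "cmod (\<psi> (Complex t (-h)) / (Complex t (-h) - z) - \<psi> (Complex t h) / (Complex t h - z)) \<le> (2 * C / (h - \<bar>Im z\<bar>)) / (1 + t\<^sup>2)"
proof -
  have \<theta>: "\<theta> > 0" using h by linarith
  have inS: "Complex t y \<in> strip \<theta>" if "\<bar>y\<bar> \<le> h" for t y using that h by (simp add: strip_pos[OF \<theta>])
  have ne: "Complex t h - z \<noteq> 0" "Complex t (-h) - z \<noteq> 0" for t
    using h by (auto simp: complex_eq_iff)
  have lc: "continuous_on UNIV (\<lambda>t. \<psi> (Complex t y))" if "\<bar>y\<bar> \<le> h" for y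
    by (rule continuous_on_compose2[OF holomorphic_on_imp_continuous_on[OF H0_holomorphic[OF \<psi>]]])
       (use inS[OF that] in \<open>auto simp: Complex_line intro!: continuous_intros\<close>)
  let ?f = "\<lambda>t. \<psi> (Complex t (-h)) / (Complex t (-h) - z) - \<psi> (Complex t h) / (Complex t h - z)"
  show "continuous_on UNIV ?f"
    using lc[of h] lc[of "-h"] ne h
    by (intro continuous_intros) (auto simp: Complex_line intro!: continuous_intros)
  define \<delta> where "\<delta> = h - \<bar>Im z\<bar>"
  have \<delta>: "\<delta> > 0" using h by (simp add: \<delta>_def)
  have far: "\<delta> \<le> cmod (Complex t h - z)" "\<delta> \<le> cmod (Complex t (-h) - z)" for t
    using abs_Im_le_cmod[of "Complex t h - z"] abs_Im_le_cmod[of "Complex t (-h) - z"] h by (auto simp: \<delta>_def)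
  show "cmod (?f t) \<le> (2 * C / (h - \<bar>Im z\<bar>)) / (1 + t\<^sup>2)"
  proof -
    have "cmod (\<psi> (Complex t y) / (Complex t y - z)) \<le> (C / (1 + t\<^sup>2)) / \<delta>" if "y = h \<or> y = -h" for y
      unfolding norm_divide using that far[of t] \<delta> C(2)[OF inS, of y t] C(1) h
      by (intro frac_le) auto
    then have "cmod (?f t) \<le> (C / (1 + t\<^sup>2)) / \<delta> + (C / (1 + t\<^sup>2)) / \<delta>"
      by (intro order_trans[OF norm_triangle_ineq4] add_mono) auto
    then show ?thesis by (simp add: \<delta>_def mult.commute)
  qed
qed

text \<open>Cauchy's formula on a strip: \<open>(\<psi> u - \<psi> z) / (u - z)\<close> is holomorphic, so its integrals along
  the two lines agree, and the remaining integral of \<open>1 / (u - z)\<close> is elementary.\<close>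
lemma Cauchy_strip:
  assumes \<psi>: "\<psi> \<in> H0_infty \<theta>" and h: "h < \<theta>" "\<bar>Im z\<bar> < h"
  shows "integral UNIV (\<lambda>t. \<psi> (Complex t (-h)) / (Complex t (-h) - z) - \<psi> (Complex t h) / (Complex t h - z)) = 2 * pi * \<i> * \<psi> z"
proof -
  have \<theta>: "\<theta> > 0" using h by linarith
  have hol: "\<psi> holomorphic_on strip \<theta>" by (rule H0_holomorphic[OF \<psi>])
  obtain C where C: "C > 0" "\<And>z. z \<in> strip \<theta> \<Longrightarrow> cmod (\<psi> z) \<le> C / (1 + (Re z)\<^sup>2)"
    using H0_decay[OF \<psi>] by blast
  \<comment> \<open>The difference quotient, with its removable singularity at z filled in.\<close>
  define \<rho> where "\<rho> = (\<lambda>u. if u = z then deriv \<psi> z else (\<psi> u - \<psi> z) / (u - z))"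
  have zs: "z \<in> strip \<theta>" using h by (simp add: strip_pos[OF \<theta>])
  have \<rho>: "\<rho> holomorphic_on strip \<theta>"
    unfolding \<rho>_def using pole_lemma[OF hol, of z] zs open_strip[OF \<theta>] by (simp add: interior_open)
  have inS: "Complex t y \<in> strip \<theta>" if "\<bar>y\<bar> \<le> h" for t y using that h by (simp add: strip_pos[OF \<theta>])
  have ne: "Complex t h - z \<noteq> 0" "Complex t (-h) - z \<noteq> 0" for t
    using h by (auto simp: complex_eq_iff)
  have lc: "continuous_on UNIV (\<lambda>t. f (Complex t y))" if "f holomorphic_on strip \<theta>" "\<bar>y\<bar> \<le> h" for f y
    by (rule continuous_on_compose2[OF holomorphic_on_imp_continuous_on[OF that(1)]])
       (use inS[OF that(2)] in \<open>auto simp: Complex_line intro!: continuous_intros\<close>)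
  let ?f = "\<lambda>t. \<psi> (Complex t (-h)) / (Complex t (-h) - z) - \<psi> (Complex t h) / (Complex t h - z)"
  let ?g = "\<lambda>t. 1 / (Complex t (-h) - z) - 1 / (Complex t h - z)"
  \<comment> \<open>The split is made on [-n, n], since \<rho> in general decays only like 1/|u| and
    need not be absolutely integrable along the lines.\<close>
  have fin: "integral {- real n..real n} ?f
     = (integral {- real n..real n} (\<lambda>t. \<rho> (Complex t (-h))) - integral {- real n..real n} (\<lambda>t. \<rho> (Complex t h)))
       + integral {- real n..real n} ?g * \<psi> z" for n :: nat
  proof -
    have eq: "?f t = \<rho> (Complex t (-h)) - \<rho> (Complex t h) + ?g t * \<psi> z" for t
    proof -
      have "\<rho> u = \<psi> u / (u - z) - \<psi> z / (u - z)" if "u - z \<noteq> 0" for u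
        using that by (auto simp: \<rho>_def diff_divide_distrib)
      then show ?thesis using ne[of t] by (simp add: left_diff_distrib)
    qed
    have cg: "continuous_on UNIV ?g"
      using ne by (auto simp: Complex_line intro!: continuous_intros)
    have i: "f integrable_on {- real n..real n}" if "continuous_on UNIV f" for f :: "real \<Rightarrow> complex"
      using that by (intro integrable_continuous_interval continuous_on_subset[OF that]) auto
    show ?thesis unfolding eq
      using i[OF lc[OF \<rho>, of h]] i[OF lc[OF \<rho>, of "-h"]] i[OF cg] h
      by (simp add: Henstock_Kurzweil_Integration.integral_add Henstock_Kurzweil_Integration.integral_diff integrable_diff integrable_on_mult_left)
  qed
  have "(\<lambda>n. integral {- real n..real n} (\<lambda>t. \<rho> (Complex t h)) - integral {- real n..real n} (\<lambda>t. \<rho> (Complex t (-h)))) \<longlonglongrightarrow> 0"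
  proof (rule Lim_null_comparison)
    show "\<forall>\<^sub>F n in sequentially. norm (integral {- real n..real n} (\<lambda>t. \<rho> (Complex t h)) - integral {- real n..real n} (\<lambda>t. \<rho> (Complex t (-h))))
       \<le> 2 * (2 * C / (real n - \<bar>Re z\<bar>)) * (h - - h)"
      using eventually_gt_at_top[of "nat \<lceil>\<bar>Re z\<bar>\<rceil>"]
    proof eventually_elim
      case (elim n)
      then have n: "real n > \<bar>Re z\<bar>" by linarith
      show ?case
      proof (rule cplx.line_shift[where F'="deriv \<rho>"])
        show "(\<rho> has_derivative (\<lambda>v. v * deriv \<rho> u)) (at u)" if "- h \<le> Im u" "Im u \<le> h" for u
          using that h by (intro holomorphic_has_derivative[OF \<rho> open_strip[OF \<theta>]]) (auto simp: strip_pos[OF \<theta>])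
        show "continuous_on {u. - h \<le> Im u \<and> Im u \<le> h} (deriv \<rho>)"
          using h by (intro continuous_on_subset[OF holomorphic_on_imp_continuous_on[OF holomorphic_deriv[OF \<rho> open_strip[OF \<theta>]]]])
                     (auto simp: strip_pos[OF \<theta>])
        have bnd: "cmod (\<rho> (Complex t y)) \<le> 2 * C / (real n - \<bar>Re z\<bar>)" if y: "- h \<le> y" "y \<le> h" and t: "\<bar>t\<bar> = real n" for t y
        proof -
          have far: "real n - \<bar>Re z\<bar> \<le> cmod (Complex t y - z)"
            using abs_Re_le_cmod[of "Complex t y - z"] t by auto
          then have neq: "Complex t y \<noteq> z" using n by auto
          have le: "cmod (\<psi> u) \<le> C" if "u \<in> strip \<theta>" for u
          proof -
            have "C / (1 + (Re u)\<^sup>2) \<le> C" using C(1) by (simp add: divide_le_eq)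
            then show ?thesis using C(2)[OF that] by linarith
          qed
          have "\<bar>y\<bar> \<le> h" using y by auto
          then have "cmod (\<psi> (Complex t y) - \<psi> z) \<le> 2 * C"
            using norm_triangle_ineq4[of "\<psi> (Complex t y)" "\<psi> z"] le[OF zs] le[OF inS, of y t] by linarith
          then show ?thesis using far n neq C(1) by (auto simp: \<rho>_def norm_divide intro!: frac_le)
        qed
        then show "cmod (\<rho> (Complex (real n) y)) \<le> 2 * C / (real n - \<bar>Re z\<bar>) \<and> cmod (\<rho> (Complex (- real n) y)) \<le> 2 * C / (real n - \<bar>Re z\<bar>)"
          if "- h \<le> y" "y \<le> h" for y using that by simp
      qed (use h in auto)
    qed
    show "(\<lambda>n. 2 * (2 * C / (real n - \<bar>Re z\<bar>)) * (h - - h)) \<longlonglongrightarrow> 0" by real_asymp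
  qed
  from tendsto_minus[OF this] have r0: "(\<lambda>n. integral {- real n..real n} (\<lambda>t. \<rho> (Complex t (-h))) - integral {- real n..real n} (\<lambda>t. \<rho> (Complex t h))) \<longlonglongrightarrow> 0"
    by simp
  have "(\<lambda>n. integral {- real n..real n} ?f) \<longlonglongrightarrow> 0 + 2 * pi * \<i> * \<psi> z"
    unfolding fin by (intro tendsto_add r0 tendsto_mult_right integral_inverse_lines h)
  moreover have "(\<lambda>n. integral {- real n..real n} ?f) \<longlonglongrightarrow> integral UNIV ?f"
    by (rule integral_truncate_tendsto[OF Cauchy_kernel[OF \<psi> h C]])
  ultimately show ?thesis using LIMSEQ_unique by fastforce
qed

text \<open>Cauchy's theorem for a decaying function that is holomorphic between the two lines. It
  removes the scalar term that the resolvent identity produces in \<open>ctr_res\<close>.\<close>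

lemma Cauchy_lines_eq:
  assumes e: "e holomorphic_on {z. \<bar>Im z\<bar> < k}" and h: "0 < h" "h < k"
    and bd: "\<And>z. \<bar>Im z\<bar> \<le> h \<Longrightarrow> cmod (e z) \<le> C / (1 + (Re z)\<^sup>2)"
  shows "integral UNIV (\<lambda>t. e (Complex t (-h)) - e (Complex t h)) = 0"
proof -
  have op: "open {z. \<bar>Im z\<bar> < k}" by (auto intro!: open_Collect_less continuous_intros)
  have lc: "continuous_on UNIV (\<lambda>t. e (Complex t y))" if "\<bar>y\<bar> \<le> h" for y
    by (rule continuous_on_compose2[OF holomorphic_on_imp_continuous_on[OF e]])
       (use that h in \<open>auto simp: Complex_line intro!: continuous_intros\<close>)
  have "integral UNIV (\<lambda>t. e (Complex t h)) = integral UNIV (\<lambda>t. e (Complex t (-h)))"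
  proof (rule cplx.line_shift_UNIV[where F'="deriv e"])
    show "(e has_derivative (\<lambda>v. v * deriv e u)) (at u)" if "- h \<le> Im u" "Im u \<le> h" for u
      using that h by (intro holomorphic_has_derivative[OF e op]) auto
    show "continuous_on {u. - h \<le> Im u \<and> Im u \<le> h} (deriv e)"
      using h by (intro continuous_on_subset[OF holomorphic_on_imp_continuous_on[OF holomorphic_deriv[OF e op]]]) auto
    show "cmod (e (Complex t y)) \<le> C / (1 + t\<^sup>2)" if "- h \<le> y" "y \<le> h" for t y
      using bd[of "Complex t y"] that by auto
  qed (use h in auto)
  moreover have "(\<lambda>t. e (Complex t y)) integrable_on UNIV" if "\<bar>y\<bar> \<le> h" for y
    by (rule integrable_dominated[OF lc[OF that]]) (use bd[of "Complex _ y"] that in auto)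
  ultimately show ?thesis using h by (subst Henstock_Kurzweil_Integration.integral_diff) auto
qed

section \<open>The elementary functional calculus\<close>

text \<open>The norm of the error is at most the scalar integral of \<open>d n\<close>, to which
  Lebesgue's theorem applies whatever the space of values.\<close>

lemma integral_dominated_tendsto:
  fixes F :: "nat \<Rightarrow> real \<Rightarrow> 'a::banach"
  assumes c: "\<And>n. continuous_on UNIV (F n)" "continuous_on UNIV G"
    and bd: "\<And>n t. norm (F n t) \<le> C / (1 + t\<^sup>2)" and lim: "\<And>t. (\<lambda>n. F n t) \<longlonglongrightarrow> G t"
  shows "(\<lambda>n. integral UNIV (F n)) \<longlonglongrightarrow> integral UNIV G"
proof -
  have bG: "norm (G t) \<le> C / (1 + t\<^sup>2)" for t
    using bd by (intro LIMSEQ_le_const2[OF tendsto_norm[OF lim[of t]]]) auto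
  define d where "d n t = norm (F n t - G t)" for n t
  have [measurable]: "d n \<in> borel_measurable borel" for n
    unfolding d_def using c by (intro borel_measurable_continuous_onI continuous_intros) auto
  have db: "d n t \<le> (2 * C) / (1 + t\<^sup>2)" for n t
    using bd[of n t] bG[of t] norm_triangle_ineq4[of "F n t" "G t"] unfolding d_def
    by (simp only: mult_2 add_divide_distrib)
  have dn: "d n t \<ge> 0" for n t by (simp add: d_def)
  have di: "integrable lborel (d n)" for n
    by (rule Bochner_Integration.integrable_bound[OF integrable_inverse_one_plus_square[of "2 * C"]])
       (use dn order_trans[OF db abs_ge_self] in \<open>auto intro!: AE_I2 simp del: abs_divide\<close>)
  have "(\<lambda>n. LINT t|lborel. d n t) \<longlonglongrightarrow> (LINT t::real|lborel. 0)"
  proof (rule Bochner_Integration.integral_dominated_convergence[OF _ _ integrable_inverse_one_plus_square[of "2 * C"]])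
    show "AE t in lborel. (\<lambda>n. d n t) \<longlonglongrightarrow> 0"
      unfolding d_def by (intro AE_I2 tendsto_norm_zero LIM_zero lim)
  qed (use db dn in auto)
  then have lim0: "(\<lambda>n. LINT t|lborel. d n t) \<longlonglongrightarrow> 0" by simp
  have Fi: "F n integrable_on UNIV" "G integrable_on UNIV" for n
    by (auto intro: integrable_dominated[OF c(1) bd] integrable_dominated[OF c(2) bG])
  have "(\<lambda>n. integral UNIV (F n) - integral UNIV G) \<longlonglongrightarrow> 0"
  proof (rule Lim_null_comparison[OF always_eventually lim0], rule)
    fix n
    have "norm (integral UNIV (\<lambda>t. F n t - G t)) \<le> (LINT t|lborel. d n t)"
      by (rule norm_integral_dominated[OF integrable_diff[OF Fi] di]) (simp add: d_def)
    then show "norm (integral UNIV (F n) - integral UNIV G) \<le> (LINT t|lborel. d n t)"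
      by (simp add: Henstock_Kurzweil_Integration.integral_diff[OF Fi])
  qed
  then show ?thesis by (simp add: LIM_zero_iff)
qed

lemma is_resolvent_unique:
  assumes "is_resolvent J D A l R" "is_resolvent J D A l S"
  shows "R = S"
proof (rule blinfun_eqI)
  fix x
  have "R x \<in> D" "cmult J l (R x) - A (R x) = x" using assms(1) by (auto simp: is_resolvent_def)
  then have "S x = R x" using assms(2) by (metis is_resolvent_def)
  then show "R x = S x" by simp
qed

lemma is_resolvent_resolvent:
  assumes "l \<in> resolvent_set J D A"
  shows "is_resolvent J D A l (resolvent J D A l)"
proof -
  obtain R where R: "is_resolvent J D A l R" using assms by (auto simp: resolvent_set_def)
  show ?thesis unfolding resolvent_def
    by (rule theI[where P="is_resolvent J D A l", OF R]) (rule is_resolvent_unique[OF _ R])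
qed

lemma closure_strip: "\<omega> \<ge> 0 \<Longrightarrow> closure (strip \<omega>) = {z. \<bar>Im z\<bar> \<le> \<omega>}"
proof
  assume w: "\<omega> \<ge> 0"
  have "closed {z. \<bar>Im z\<bar> \<le> \<omega>}" by (intro closed_Collect_le continuous_intros)
  then show "closure (strip \<omega>) \<subseteq> {z. \<bar>Im z\<bar> \<le> \<omega>}"
    using strip_Im_le[OF _ w] by (intro closure_minimal) auto
  show "{z. \<bar>Im z\<bar> \<le> \<omega>} \<subseteq> closure (strip \<omega>)"
  proof
    fix z assume z: "z \<in> {z. \<bar>Im z\<bar> \<le> \<omega>}"
    show "z \<in> closure (strip \<omega>)"
    proof (cases "\<omega> = 0")
      case True
      then have "z \<in> strip \<omega>" using z by (simp add: strip_def)
      then show ?thesis using closure_subset by blast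
    next
      case False
      \<comment> \<open>Shrinking z towards 0 moves a boundary point into the open strip. It is used
        for positive \<omega>; \<open>strip 0\<close> is the closed real line.\<close>
      let ?x = "\<lambda>n::nat. of_real (1 - 1 / (real n + 2)) * z"
      have "?x n \<in> strip \<omega>" for n
      proof -
        have "\<bar>1 - 1 / (real n + 2)\<bar> * \<bar>Im z\<bar> \<le> \<bar>1 - 1 / (real n + 2)\<bar> * \<omega>"
          using z by (intro mult_left_mono) auto
        also have "\<dots> < 1 * \<omega>" using False w by (intro mult_strict_right_mono) (auto simp: abs_if field_simps)
        finally show ?thesis using False w by (simp add: strip_def abs_mult)
      qed
      moreover have "?x \<longlonglongrightarrow> of_real 1 * z"
        by (intro tendsto_mult tendsto_of_real tendsto_const) real_asymp
      ultimately show ?thesis unfolding closure_sequential by (intro exI[of _ ?x]) auto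
    qed
  qed
qed

section \<open>Resolvents of an operator of strip type\<close>

locale strip_op = cstruct J for J :: "'a::banach \<Rightarrow> 'a" +
  fixes D :: "'a set" and A :: "'a \<Rightarrow> 'a" and \<omega> :: real
  assumes dd: "densely_defined_op J D A" and st: "strip_type J D A \<omega>" and \<omega>: "\<omega> \<ge> 0"
begin

declare sc.zero_left [simp] sc.zero_right [simp]

abbreviation res where "res l \<equiv> blinfun_apply (resolvent J D A l)"

lemma is_res: "\<bar>Im l\<bar> > \<omega> \<Longrightarrow> is_resolvent J D A l (resolvent J D A l)"
proof (rule is_resolvent_resolvent)
  assume l: "\<bar>Im l\<bar> > \<omega>"
  have "l \<notin> closure (strip \<omega>)" using l by (simp add: closure_strip[OF \<omega>])
  then show "l \<in> resolvent_set J D A" using st by (auto simp: strip_type_def op_spectrum_def)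
qed

lemma D_closed: "x \<in> D \<Longrightarrow> y \<in> D \<Longrightarrow> x + y \<in> D" "x \<in> D \<Longrightarrow> r *\<^sub>R x \<in> D" "x \<in> D \<Longrightarrow> J x \<in> D" "x \<in> D \<Longrightarrow> z \<odot> x \<in> D"
  using dd by (auto simp: densely_defined_op_def cmult_def subspace_add subspace_scale)

lemma A_lin: "x \<in> D \<Longrightarrow> y \<in> D \<Longrightarrow> A (x + y) = A x + A y" "x \<in> D \<Longrightarrow> A (r *\<^sub>R x) = r *\<^sub>R A x" "x \<in> D \<Longrightarrow> A (J x) = J (A x)"
  using dd by (auto simp: densely_defined_op_def)

lemma res_D: "\<bar>Im l\<bar> > \<omega> \<Longrightarrow> res l x \<in> D"
  and res_right: "\<bar>Im l\<bar> > \<omega> \<Longrightarrow> l \<odot> res l x - A (res l x) = x"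
  and res_left: "\<bar>Im l\<bar> > \<omega> \<Longrightarrow> x \<in> D \<Longrightarrow> res l (l \<odot> x - A x) = x"
  using is_res by (auto simp: is_resolvent_def)

text \<open>Bounded operators are only real-linear by type, so complex linearity of the resolvent is
  derived from that of A.\<close>

lemma res_J: "\<bar>Im l\<bar> > \<omega> \<Longrightarrow> res l (J x) = J (res l x)"
proof -
  assume l: "\<bar>Im l\<bar> > \<omega>"
  have "l \<odot> J (res l x) - A (J (res l x)) = J x"
    using res_right[OF l, of x] res_D[OF l] by (simp add: sc_J A_lin J_simps(2)[symmetric] del: J_simps)
  then show ?thesis using res_left[OF l D_closed(3)[OF res_D[OF l]], of x] by simp
qed

lemma res_sc: "\<bar>Im l\<bar> > \<omega> \<Longrightarrow> res l (z \<odot> x) = z \<odot> res l x"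
  by (rule linear_sc_commute) (auto simp: res_J bounded_linear.linear blinfun.bounded_linear_right)

lemma res_identity:
  assumes "\<bar>Im l\<bar> > \<omega>" "\<bar>Im m\<bar> > \<omega>"
  shows "res l x - res m x = (m - l) \<odot> res l (res m x)"
proof -
  let ?y = "res m x"
  have "x = (l \<odot> ?y - A ?y) + (m - l) \<odot> ?y"
    using res_right[OF assms(2), of x] by (simp add: sc.diff_left)
  then have "res l x = res l ((l \<odot> ?y - A ?y) + (m - l) \<odot> ?y)" by simp
  also have "\<dots> = ?y + (m - l) \<odot> res l ?y"
    using res_left[OF assms(1) res_D[OF assms(2)]] by (simp add: blinfun.add_right res_sc[OF assms(1)])
  finally show ?thesis by simp
qed

lemma res_commute:
  assumes "\<bar>Im l\<bar> > \<omega>" "\<bar>Im m\<bar> > \<omega>"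
  shows "res l (res m x) = res m (res l x)"
proof (cases "l = m")
  case False
  have "(m - l) \<odot> res l (res m x) = - ((l - m) \<odot> res m (res l x))"
    using res_identity[OF assms, of x] res_identity[OF assms(2,1), of x] by (metis minus_diff_eq)
  then have "(m - l) \<odot> (res l (res m x) - res m (res l x)) = 0"
    by (simp add: sc.diff_right sc.diff_left algebra_simps)
  then have "norm ((m - l) \<odot> (res l (res m x) - res m (res l x))) = 0" by simp
  then show ?thesis using False by (simp del: sc.zero_right)
qed simp

lemma res_bound:
  assumes "h > \<omega>"
  obtains M where "M > 0" "\<And>l x. \<bar>Im l\<bar> \<ge> h \<Longrightarrow> norm (res l x) \<le> M * norm x"
proof -
  have "(\<omega> + h) / 2 > \<omega>" using assms by simp
  then obtain C where C: "\<And>l. \<bar>Im l\<bar> > (\<omega> + h) / 2 \<Longrightarrow> norm (resolvent J D A l) \<le> C"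
    using st unfolding strip_type_def by blast
  have "norm (res l x) \<le> (\<bar>C\<bar> + 1) * norm x" if "\<bar>Im l\<bar> \<ge> h" for l x
  proof -
    have "norm (resolvent J D A l) \<le> \<bar>C\<bar> + 1" using C[of l] that assms by fastforce
    then show ?thesis
      using norm_blinfun[of "resolvent J D A l" x] by (meson mult_right_mono norm_ge_zero order_trans)
  qed
  then show ?thesis using that[of "\<bar>C\<bar> + 1"] by auto
qed

text \<open>Applying the resolvent identity twice turns the first-order remainder into (l - m)^2
  R(m) R(l) R(l) x, and R is bounded near l.\<close>

lemma res_has_derivative:
  assumes l: "\<bar>Im l\<bar> > \<omega>"
  shows "((\<lambda>l. res l x) has_derivative (\<lambda>u. u \<odot> (- res l (res l x)))) (at l)"
  unfolding has_derivative_iff_norm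
proof
  show "bounded_linear (\<lambda>u. u \<odot> (- res l (res l x)))" by (rule sc.bounded_linear_left)
  define h where "h = (\<omega> + \<bar>Im l\<bar>) / 2"
  have h: "h > \<omega>" "h < \<bar>Im l\<bar>" using l by (auto simp: h_def)
  obtain M where M: "M > 0" "\<And>l x. \<bar>Im l\<bar> \<ge> h \<Longrightarrow> norm (res l x) \<le> M * norm x" using res_bound[OF h(1)] by blast
  define y where "y = res l x"
  let ?q = "\<lambda>m. norm (res m x - res l x - (m - l) \<odot> (- res l (res l x))) / norm (m - l)"
  show "(?q \<longlongrightarrow> 0) (at l)"
  proof (rule Lim_null_comparison)
    show "((\<lambda>m. norm (m - l) * (M * (M * norm y))) \<longlongrightarrow> 0) (at l)"
      by (auto intro!: tendsto_eq_intros)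
    show "\<forall>\<^sub>F m in at l. norm (?q m) \<le> norm (m - l) * (M * (M * norm y))"
      unfolding eventually_at
    proof (intro exI[of _ "\<bar>Im l\<bar> - h"] conjI ballI impI)
      fix m assume m: "m \<noteq> l \<and> dist m l < \<bar>Im l\<bar> - h"
      then have "\<bar>Im m - Im l\<bar> < \<bar>Im l\<bar> - h"
        using abs_Im_le_cmod[of "m - l"] by (simp add: dist_norm)
      then have mh: "\<bar>Im m\<bar> \<ge> h" by linarith
      then have mw: "\<bar>Im m\<bar> > \<omega>" using h by linarith
      have "res m x - res l x = (l - m) \<odot> res m y"
        unfolding y_def by (rule res_identity[OF mw l])
      then have "res m x - res l x - (m - l) \<odot> (- res l (res l x)) = (l - m) \<odot> (res m y - res l y)"
        by (simp add: y_def sc.diff_left sc.diff_right sc.minus_right)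
      also have "res m y - res l y = (l - m) \<odot> res m (res l y)" by (rule res_identity[OF mw l])
      finally have "norm (res m x - res l x - (m - l) \<odot> (- res l (res l x))) = norm (m - l) * (norm (m - l) * norm (res m (res l y)))"
        by (simp add: norm_minus_commute)
      moreover have "norm (res m (res l y)) \<le> M * (M * norm y)"
        by (rule order_trans[OF M(2)[OF mh]]) (use M h in \<open>auto intro!: mult_left_mono\<close>)
      ultimately have "norm (res m x - res l x - (m - l) \<odot> (- res l (res l x))) \<le> norm (m - l) * (norm (m - l) * (M * (M * norm y)))"
        by (simp add: mult_left_mono)
      then show "norm (?q m) \<le> norm (m - l) * (M * (M * norm y))"
        using m by (simp add: divide_le_eq mult.commute mult.left_commute)
    qed (use h in auto)
  qed
qed

lemma res_continuous_on: "S \<subseteq> {l. \<bar>Im l\<bar> > \<omega>} \<Longrightarrow> continuous_on S (\<lambda>l. res l x)"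
  by (rule continuous_at_imp_continuous_on) (auto intro: has_derivative_continuous[OF res_has_derivative])

lemma res_line_continuous: "\<bar>y\<bar> > \<omega> \<Longrightarrow> continuous_on UNIV (\<lambda>t. res (Complex t y) x)"
  by (rule continuous_on_compose2[OF res_continuous_on[of "{l. \<bar>Im l\<bar> > \<omega>}"]])
     (auto simp: Complex_line intro!: continuous_intros)

text \<open>The contour integral sees just the values on the two lines. Asking for continuity and
  decay there admits functions with poles elsewhere, such as the Riemann sums of Cauchy's formula in
  \<open>ctr_mult_nested\<close>.\<close>

definition lines :: "real \<Rightarrow> (complex \<Rightarrow> complex) \<Rightarrow> bool" where
  "lines h \<phi> \<longleftrightarrow> continuous_on UNIV (\<lambda>t. \<phi> (Complex t h)) \<and> continuous_on UNIV (\<lambda>t. \<phi> (Complex t (-h)))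
     \<and> (\<exists>C. \<forall>t. cmod (\<phi> (Complex t h)) \<le> C / (1 + t\<^sup>2) \<and> cmod (\<phi> (Complex t (-h))) \<le> C / (1 + t\<^sup>2))"

definition cint :: "real \<Rightarrow> (complex \<Rightarrow> complex) \<Rightarrow> 'a \<Rightarrow> real \<Rightarrow> 'a" where
  "cint h \<phi> x t = \<phi> (Complex t (-h)) \<odot> res (Complex t (-h)) x - \<phi> (Complex t h) \<odot> res (Complex t h) x"

definition ctr :: "real \<Rightarrow> (complex \<Rightarrow> complex) \<Rightarrow> 'a \<Rightarrow> 'a" where
  "ctr h \<phi> x = (1 / (2 * pi * \<i>)) \<odot> integral UNIV (cint h \<phi> x)"

lemma psi_op_eq: "psi_op J D A \<omega> \<theta> \<psi> = ctr ((\<omega> + \<theta>) / 2) \<psi>"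
proof -
  have "complex_of_real t - \<i> * complex_of_real h = Complex t (-h)" "complex_of_real t + \<i> * complex_of_real h = Complex t h" for t h
    by (auto simp: complex_eq_iff)
  then show ?thesis
    by (simp only: fun_eq_iff psi_op_def Let_def ctr_def cint_def[abs_def]) simp
qed

lemma cint_continuous: "lines h \<phi> \<Longrightarrow> h > \<omega> \<Longrightarrow> continuous_on UNIV (cint h \<phi> x)"
  unfolding cint_def lines_def using \<omega>
  by (intro continuous_on_diff sc.continuous_on res_line_continuous) auto

lemma cint_bound:
  assumes C: "\<And>t. cmod (\<phi> (Complex t h)) \<le> C t \<and> cmod (\<phi> (Complex t (-h))) \<le> C t"
    and M: "\<And>l x. \<bar>Im l\<bar> \<ge> h \<Longrightarrow> norm (res l x) \<le> M * norm x"
  shows "norm (cint h \<phi> x t) \<le> 2 * M * norm x * C t"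
proof -
  have C0: "C t \<ge> 0" using C[of t] order_trans[OF norm_ge_zero] by blast
  have "norm (\<phi> (Complex t y) \<odot> res (Complex t y) x) \<le> C t * (M * norm x)" if "y = h \<or> y = -h" for y
    using that C[of t] M[of "Complex t y" x] C0 by (auto intro!: mult_mono)
  then have "norm (cint h \<phi> x t) \<le> C t * (M * norm x) + C t * (M * norm x)"
    unfolding cint_def by (intro order_trans[OF norm_triangle_ineq4] add_mono) auto
  then show ?thesis by (simp add: algebra_simps)
qed

lemma cint_dominated:
  assumes "lines h \<phi>" "h > \<omega>"
  obtains C where "\<And>x t. norm (cint h \<phi> x t) \<le> (C * norm x) / (1 + t\<^sup>2)" "C \<ge> 0"
proof -
  obtain M where M: "M > 0" "\<And>l x. \<bar>Im l\<bar> \<ge> h \<Longrightarrow> norm (res l x) \<le> M * norm x" using res_bound[OF assms(2)] by blast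
  obtain C where C: "\<And>t. cmod (\<phi> (Complex t h)) \<le> C / (1 + t\<^sup>2) \<and> cmod (\<phi> (Complex t (-h))) \<le> C / (1 + t\<^sup>2)"
    using assms(1) by (auto simp: lines_def)
  have "C \<ge> 0" using C[of 0] order_trans[OF norm_ge_zero] by fastforce
  then show ?thesis
    using that[of "2 * M * C"] cint_bound[where C="\<lambda>t. C / (1 + t\<^sup>2)", OF C M(2)] M(1) by (simp add: mult_ac)
qed

lemma cint_integrable: "lines h \<phi> \<Longrightarrow> h > \<omega> \<Longrightarrow> cint h \<phi> x integrable_on UNIV"
  by (rule cint_dominated) (auto intro: integrable_dominated[OF cint_continuous])

lemma cint_add_x: "h > \<omega> \<Longrightarrow> cint h \<phi> (x + y) t = cint h \<phi> x t + cint h \<phi> y t"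
  by (simp add: cint_def blinfun.add_right sc.add_right)

lemma cint_commute:
  assumes T: "bounded_linear T" "\<And>x. T (J x) = J (T x)" and c: "\<And>l x. \<bar>Im l\<bar> > \<omega> \<Longrightarrow> T (res l x) = res l (T x)" and h: "h > \<omega>"
  shows "T (cint h \<phi> x t) = cint h \<phi> (T x) t"
  using c[of "Complex t h" x] c[of "Complex t (-h)" x] h \<omega>
  by (simp add: cint_def linear_diff[OF bounded_linear.linear[OF T(1)]] linear_sc_commute[OF bounded_linear.linear[OF T(1)] T(2)])

text \<open>T may be J, a real scalar or a resolvent; the three commutation rules are
  instances.\<close>

lemma ctr_commute:
  assumes T: "bounded_linear T" "\<And>x. T (J x) = J (T x)" and c: "\<And>l x. \<bar>Im l\<bar> > \<omega> \<Longrightarrow> T (res l x) = res l (T x)"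
    and h: "h > \<omega>" and \<phi>: "lines h \<phi>"
  shows "T (ctr h \<phi> x) = ctr h \<phi> (T x)"
proof -
  have "T (integral UNIV (cint h \<phi> x)) = integral UNIV (T \<circ> cint h \<phi> x)"
    by (rule integral_linear[OF cint_integrable[OF \<phi> h] T(1), symmetric])
  also have "T \<circ> cint h \<phi> x = cint h \<phi> (T x)"
    using cint_commute[OF T c h] by (auto simp: fun_eq_iff)
  finally show ?thesis unfolding ctr_def
    by (simp add: linear_sc_commute[OF bounded_linear.linear[OF T(1)] T(2)])
qed

lemma ctr_J: "h > \<omega> \<Longrightarrow> lines h \<phi> \<Longrightarrow> ctr h \<phi> (J x) = J (ctr h \<phi> x)"
  by (rule ctr_commute[symmetric]) (auto simp: J_bounded_linear res_J)

lemma ctr_res_commute: "h > \<omega> \<Longrightarrow> lines h \<phi> \<Longrightarrow> \<bar>Im l\<bar> > \<omega> \<Longrightarrow> res l (ctr h \<phi> x) = ctr h \<phi> (res l x)"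
  by (rule ctr_commute) (auto simp: blinfun.bounded_linear_right res_J res_commute)

lemma ctr_bounded_linear:
  assumes h: "h > \<omega>" and \<phi>: "lines h \<phi>"
  shows "bounded_linear (ctr h \<phi>)"
proof -
  obtain C where C: "\<And>x t. norm (cint h \<phi> x t) \<le> (C * norm x) / (1 + t\<^sup>2)" "C \<ge> 0" using cint_dominated[OF \<phi> h] by blast
  have *: "ctr h \<phi> (x + y) = ctr h \<phi> x + ctr h \<phi> y" for x y
    using cint_integrable[OF \<phi> h]
    by (simp add: ctr_def cint_add_x[OF h] Henstock_Kurzweil_Integration.integral_add sc.add_right cong: Henstock_Kurzweil_Integration.integral_cong)
  have **: "ctr h \<phi> (r *\<^sub>R x) = r *\<^sub>R ctr h \<phi> x" for r x
    by (rule ctr_commute[OF _ _ _ h \<phi>, where T="\<lambda>x. r *\<^sub>R x", symmetric]) (auto simp: bounded_linear_scaleR_right blinfun.scaleR_right)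
  let ?I = "LINT t::real|lborel. 1 / (1 + t\<^sup>2)"
  have "norm (ctr h \<phi> x) \<le> norm x * (cmod (1 / (2 * pi * \<i>)) * (C * ?I))" for x
  proof -
    have "norm (integral UNIV (cint h \<phi> x)) \<le> (LINT t::real|lborel. (C * norm x) / (1 + t\<^sup>2))"
      by (rule norm_integral_dominated[OF cint_integrable[OF \<phi> h] integrable_inverse_one_plus_square C(1)])
    also have "\<dots> = (LINT t::real|lborel. (C * norm x) * (1 / (1 + t\<^sup>2)))" by simp
    also have "\<dots> = (C * norm x) * ?I" by (rule integral_mult_right_zero)
    finally have "cmod (1 / (2 * pi * \<i>)) * norm (integral UNIV (cint h \<phi> x)) \<le> cmod (1 / (2 * pi * \<i>)) * ((C * norm x) * ?I)"
      by (intro mult_left_mono) auto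
    then show ?thesis unfolding ctr_def norm_sc by (simp only: mult_ac)
  qed
  then show ?thesis using * ** by (intro bounded_linear_intro)
qed

lemma lines_add: "lines h \<phi> \<Longrightarrow> lines h \<psi> \<Longrightarrow> lines h (\<lambda>z. \<phi> z + \<psi> z)"
proof -
  assume a: "lines h \<phi>" "lines h \<psi>"
  obtain C C' where C: "\<And>t. cmod (\<phi> (Complex t h)) \<le> C / (1 + t\<^sup>2) \<and> cmod (\<phi> (Complex t (-h))) \<le> C / (1 + t\<^sup>2)"
    "\<And>t. cmod (\<psi> (Complex t h)) \<le> C' / (1 + t\<^sup>2) \<and> cmod (\<psi> (Complex t (-h))) \<le> C' / (1 + t\<^sup>2)"
    using a unfolding lines_def by blast
  have "cmod (\<phi> z + \<psi> z) \<le> (C + C') / (1 + t\<^sup>2)" if "z = Complex t h \<or> z = Complex t (-h)" for t z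
    using that C(1)[of t] C(2)[of t] norm_triangle_ineq[of "\<phi> z" "\<psi> z"] by (auto simp: add_divide_distrib)
  then show ?thesis using a unfolding lines_def by (auto intro!: continuous_on_add exI[of _ "C + C'"])
qed

lemma lines_scale: "lines h \<phi> \<Longrightarrow> lines h (\<lambda>z. c * \<phi> z)"
proof -
  assume a: "lines h \<phi>"
  obtain C where C: "\<And>t. cmod (\<phi> (Complex t h)) \<le> C / (1 + t\<^sup>2) \<and> cmod (\<phi> (Complex t (-h))) \<le> C / (1 + t\<^sup>2)"
    using a unfolding lines_def by blast
  have "cmod (c * \<phi> z) \<le> (cmod c * C) / (1 + t\<^sup>2)" if "z = Complex t h \<or> z = Complex t (-h)" for t z
    using that C[of t] mult_left_mono[of "cmod (\<phi> z)" "C / (1 + t\<^sup>2)" "cmod c"] by (auto simp: norm_mult)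
  then show ?thesis using a unfolding lines_def by (auto intro!: continuous_intros exI[of _ "cmod c * C"])
qed

lemma lines_zero: "lines h (\<lambda>z. 0)"
  by (auto simp: lines_def intro!: exI[of _ 0])

lemma ctr_add: "h > \<omega> \<Longrightarrow> lines h \<phi> \<Longrightarrow> lines h \<psi> \<Longrightarrow> ctr h (\<lambda>z. \<phi> z + \<psi> z) x = ctr h \<phi> x + ctr h \<psi> x"
proof -
  assume a: "h > \<omega>" "lines h \<phi>" "lines h \<psi>"
  have "cint h (\<lambda>z. \<phi> z + \<psi> z) x = (\<lambda>t. cint h \<phi> x t + cint h \<psi> x t)"
    by (auto simp: cint_def sc.add_left fun_eq_iff)
  then show ?thesis using cint_integrable a by (simp add: ctr_def Henstock_Kurzweil_Integration.integral_add sc.add_right)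
qed

lemma ctr_scale: "h > \<omega> \<Longrightarrow> lines h \<phi> \<Longrightarrow> ctr h (\<lambda>z. c * \<phi> z) x = c \<odot> ctr h \<phi> x"
proof -
  assume a: "h > \<omega>" "lines h \<phi>"
  have "cint h (\<lambda>z. c * \<phi> z) x = (\<lambda>u. c \<odot> u) \<circ> cint h \<phi> x"
    by (auto simp: cint_def sc_mult[symmetric] sc.diff_right fun_eq_iff)
  then have "integral UNIV (cint h (\<lambda>z. c * \<phi> z) x) = c \<odot> integral UNIV (cint h \<phi> x)"
    using integral_linear[OF cint_integrable[OF a(2,1)] sc.bounded_linear_right[of c], of x] by simp
  then show ?thesis by (simp add: ctr_def sc_mult mult.commute)
qed

lemma ctr_sum:
  assumes "h > \<omega>" "finite S" "\<And>i. i \<in> S \<Longrightarrow> lines h (\<phi> i)"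
  shows "lines h (\<lambda>z. \<Sum>i\<in>S. \<phi> i z) \<and> ctr h (\<lambda>z. \<Sum>i\<in>S. \<phi> i z) x = (\<Sum>i\<in>S. ctr h (\<phi> i) x)"
  using assms(2,3)
proof (induction S rule: finite_induct)
  case empty
  have "cint h (\<lambda>z. 0) x = (\<lambda>t. 0)" by (rule ext) (simp add: cint_def sc.zero_left)
  then show ?case using lines_zero by (simp add: ctr_def)
next
  case (insert i S)
  then show ?case using ctr_add[OF assms(1), of "\<phi> i" "\<lambda>z. \<Sum>i\<in>S. \<phi> i z" x] lines_add[of h "\<phi> i" "\<lambda>z. \<Sum>i\<in>S. \<phi> i z"] by simp
qed

lemma ctr_cong:
  assumes "\<And>t. \<phi> (Complex t h) = \<psi> (Complex t h) \<and> \<phi> (Complex t (-h)) = \<psi> (Complex t (-h))"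
  shows "ctr h \<phi> x = ctr h \<psi> x"
  using assms by (simp add: ctr_def cint_def[abs_def])

text \<open>By the resolvent identity \<open>(l - z) \<odot> R(z) R(l) x = R(z) x - R(l) x\<close>.
  The first term integrates to \<open>ctr h e x\<close>, the second to a scalar multiple of R(l) x
  whose scalar is 0 by hypothesis.\<close>

lemma ctr_res:
  assumes l: "\<bar>Im l\<bar> > \<omega>" and h: "h > \<omega>" and e: "lines h e" and le: "lines h (\<lambda>z. (l - z) * e z)"
    and 0: "integral UNIV (\<lambda>t. e (Complex t (-h)) - e (Complex t h)) = 0"
  shows "res l (ctr h (\<lambda>z. (l - z) * e z) x) = ctr h e x"
proof -
  have k: "(l - z) \<odot> res z (res l x) = res z x - res l x" if "\<bar>Im z\<bar> > \<omega>" for z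
    by (rule res_identity[OF that l, symmetric])
  have eq: "cint h (\<lambda>z. (l - z) * e z) (res l x) t = cint h e x t - (e (Complex t (-h)) - e (Complex t h)) \<odot> res l x" for t
  proof -
    have E: "((l - z) * e z) \<odot> res z (res l x) = e z \<odot> res z x - e z \<odot> res l x" if "\<bar>Im z\<bar> > \<omega>" for z
      using k[OF that] by (metis mult.commute sc_mult sc.diff_right)
    have i: "\<bar>Im (Complex t h)\<bar> > \<omega>" "\<bar>Im (Complex t (-h))\<bar> > \<omega>" using h \<omega> by auto
    show ?thesis by (simp only: cint_def E[OF i(1)] E[OF i(2)] sc.diff_left) (simp add: algebra_simps)
  qed
  obtain C where C: "\<And>t. cmod (e (Complex t h)) \<le> C / (1 + t\<^sup>2) \<and> cmod (e (Complex t (-h))) \<le> C / (1 + t\<^sup>2)"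
    using e by (auto simp: lines_def)
  have ei: "(\<lambda>t. e (Complex t (-h)) - e (Complex t h)) integrable_on UNIV"
  proof (rule integrable_dominated[where C="2 * C"])
    show "continuous_on UNIV (\<lambda>t. e (Complex t (-h)) - e (Complex t h))"
      using e by (auto simp: lines_def intro: continuous_on_diff)
    show "cmod (e (Complex t (-h)) - e (Complex t h)) \<le> 2 * C / (1 + t\<^sup>2)" for t
      using C[of t] norm_triangle_ineq4[of "e (Complex t (-h))" "e (Complex t h)"]
      by (simp only: mult_2 add_divide_distrib) linarith
  qed
  have "(\<lambda>t. (e (Complex t (-h)) - e (Complex t h)) \<odot> res l x) integrable_on UNIV"
    "integral UNIV (\<lambda>t. (e (Complex t (-h)) - e (Complex t h)) \<odot> res l x) = 0"
    using integrable_linear[OF ei sc.bounded_linear_left[of "res l x"]] integral_linear[OF ei sc.bounded_linear_left[of "res l x"]] 0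
    by (auto simp: o_def)
  then have "integral UNIV (cint h (\<lambda>z. (l - z) * e z) (res l x)) = integral UNIV (cint h e x)"
    unfolding eq[abs_def] using cint_integrable[OF e h] by (simp add: Henstock_Kurzweil_Integration.integral_diff)
  then have "ctr h (\<lambda>z. (l - z) * e z) (res l x) = ctr h e x" by (simp add: ctr_def)
  then show ?thesis using ctr_res_commute[OF h le l] by simp
qed

lemma ctr_tendsto:
  assumes h: "h > \<omega>" and ln: "\<And>n. lines h (\<phi> n)" and l: "lines h \<psi>"
    and bd: "\<And>n t. cmod (\<phi> n (Complex t h)) \<le> C / (1 + t\<^sup>2) \<and> cmod (\<phi> n (Complex t (-h))) \<le> C / (1 + t\<^sup>2)"
    and lim: "\<And>t. (\<lambda>n. \<phi> n (Complex t h)) \<longlonglongrightarrow> \<psi> (Complex t h)" "\<And>t. (\<lambda>n. \<phi> n (Complex t (-h))) \<longlonglongrightarrow> \<psi> (Complex t (-h))"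
  shows "(\<lambda>n. ctr h (\<phi> n) x) \<longlonglongrightarrow> ctr h \<psi> x"
proof -
  obtain M where M: "M > 0" "\<And>l x. \<bar>Im l\<bar> \<ge> h \<Longrightarrow> norm (res l x) \<le> M * norm x" using res_bound[OF h] by blast
  have "(\<lambda>n. integral UNIV (cint h (\<phi> n) x)) \<longlonglongrightarrow> integral UNIV (cint h \<psi> x)"
  proof (rule integral_dominated_tendsto)
    show "norm (cint h (\<phi> n) x t) \<le> (2 * M * norm x * C) / (1 + t\<^sup>2)" for n t
      using cint_bound[of "\<phi> n", OF bd M(2), of x t] by simp
    show "(\<lambda>n. cint h (\<phi> n) x t) \<longlonglongrightarrow> cint h \<psi> x t" for t
      unfolding cint_def by (intro tendsto_diff sc.tendsto lim tendsto_const)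
  qed (intro cint_continuous ln l h)+
  then show ?thesis unfolding ctr_def by (intro sc.tendsto tendsto_const)
qed

text \<open>Continuity in operator norm is used because in the derivative
  \<open>res z (res z x)\<close> both the operator and its argument depend on z.\<close>

lemma resolvent_continuous_on: "S \<subseteq> {l. \<bar>Im l\<bar> > \<omega>} \<Longrightarrow> continuous_on S (resolvent J D A)"
proof (rule continuous_at_imp_continuous_on, rule)
  fix l assume "S \<subseteq> {l. \<bar>Im l\<bar> > \<omega>}" "l \<in> S"
  then have l: "\<bar>Im l\<bar> > \<omega>" by auto
  define h where "h = (\<omega> + \<bar>Im l\<bar>) / 2"
  have h: "h > \<omega>" "h < \<bar>Im l\<bar>" using l by (auto simp: h_def)
  obtain M where M: "M > 0" "\<And>l x. \<bar>Im l\<bar> \<ge> h \<Longrightarrow> norm (res l x) \<le> M * norm x" using res_bound[OF h(1)] by blast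
  have "(resolvent J D A \<longlongrightarrow> resolvent J D A l) (at l)"
  proof (rule LIM_zero_cancel, rule Lim_null_comparison)
    show "((\<lambda>m. cmod (l - m) * (M * M)) \<longlongrightarrow> 0) (at l)" by (auto intro!: tendsto_eq_intros)
    show "\<forall>\<^sub>F m in at l. norm (resolvent J D A m - resolvent J D A l) \<le> cmod (l - m) * (M * M)"
      unfolding eventually_at
    proof (intro exI[of _ "\<bar>Im l\<bar> - h"] conjI ballI impI)
      fix m assume m: "m \<noteq> l \<and> dist m l < \<bar>Im l\<bar> - h"
      then have "\<bar>Im m - Im l\<bar> < \<bar>Im l\<bar> - h"
        using abs_Im_le_cmod[of "m - l"] by (simp add: dist_norm)
      then have mh: "\<bar>Im m\<bar> \<ge> h" by linarith
      then have mw: "\<bar>Im m\<bar> > \<omega>" using h by linarith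
      show "norm (resolvent J D A m - resolvent J D A l) \<le> cmod (l - m) * (M * M)"
      proof (rule norm_blinfun_bound)
        fix x
        have "norm (res m (res l x)) \<le> M * (M * norm x)"
          by (rule order_trans[OF M(2)[OF mh]]) (use M h in \<open>auto intro!: mult_left_mono\<close>)
        then have "cmod (l - m) * norm (res m (res l x)) \<le> cmod (l - m) * (M * (M * norm x))"
          by (intro mult_left_mono) auto
        then show "norm (blinfun_apply (resolvent J D A m - resolvent J D A l) x) \<le> cmod (l - m) * (M * M) * norm x"
          by (simp add: blinfun.diff_left res_identity[OF mw l] mult.assoc)
      qed simp
    qed (use h in auto)
  qed
  then show "isCont (resolvent J D A) l" by (simp add: isCont_def)
qed

section \<open>Contour integrals of H0 functions: change of height, resolvents, products\<close>

lemma lines_H0: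
  assumes "\<psi> \<in> H0_infty \<theta>" "0 \<le> h" "h < \<theta>"
  shows "lines h \<psi>"
proof -
  have \<theta>: "\<theta> > 0" using assms by linarith
  have inS: "Complex t h \<in> strip \<theta>" "Complex t (-h) \<in> strip \<theta>" for t using assms by (auto simp: strip_pos[OF \<theta>])
  obtain C where C: "\<And>z. z \<in> strip \<theta> \<Longrightarrow> cmod (\<psi> z) \<le> C / (1 + (Re z)\<^sup>2)" using H0_decay[OF assms(1)] by blast
  have c: "continuous_on UNIV (\<lambda>t. \<psi> (Complex t y))" if "\<And>t. Complex t y \<in> strip \<theta>" for y
    by (rule continuous_on_compose2[OF holomorphic_on_imp_continuous_on[OF H0_holomorphic[OF assms(1)]]])
       (use that in \<open>auto simp: Complex_line intro!: continuous_intros\<close>)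
  show ?thesis unfolding lines_def
    using c[OF inS(1)] c[OF inS(2)] C[OF inS(1)] C[OF inS(2)] by auto
qed

text \<open>z -> \<psi>(z) R(z) x is holomorphic between the two heights, above and below the strip,
  so each line can be moved separately. \<open>Phi\<close> uses one fixed height, the product
  formula needs two.\<close>

lemma ctr_height:
  assumes \<psi>: "\<psi> \<in> H0_infty \<theta>" and h: "\<omega> < h1" "h1 \<le> h2" "h2 < \<theta>"
  shows "ctr h1 \<psi> x = ctr h2 \<psi> x"
proof -
  have \<theta>: "\<theta> > 0" using h \<omega> by linarith
  note hol = H0_holomorphic[OF \<psi>]
  obtain C where C: "C > 0" "\<And>z. z \<in> strip \<theta> \<Longrightarrow> cmod (\<psi> z) \<le> C / (1 + (Re z)\<^sup>2)" using H0_decay[OF \<psi>] by blast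
  obtain M where M: "M > 0" "\<And>l x. \<bar>Im l\<bar> \<ge> h1 \<Longrightarrow> norm (res l x) \<le> M * norm x" using res_bound[OF h(1)] by blast
  define F where "F z = \<psi> z \<odot> res z x" for z
  define F' where "F' z = deriv \<psi> z \<odot> res z x + \<psi> z \<odot> (- res z (res z x))" for z
  have reg: "(F has_derivative (\<lambda>u. u \<odot> F' z)) (at z)" if "\<bar>Im z\<bar> < \<theta>" "\<bar>Im z\<bar> > \<omega>" for z
  proof -
    have "(F has_derivative (\<lambda>u. \<psi> z \<odot> (u \<odot> (- res z (res z x))) + (u * deriv \<psi> z) \<odot> res z x)) (at z)"
      unfolding F_def
      using that by (intro sc.FDERIV holomorphic_has_derivative[OF hol open_strip[OF \<theta>]] res_has_derivative) (auto simp: strip_pos[OF \<theta>])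
    then show ?thesis by (simp add: F'_def sc_mult sc.add_right mult.commute add.commute)
  qed
  have cont: "continuous_on {z. \<bar>Im z\<bar> < \<theta> \<and> \<bar>Im z\<bar> > \<omega>} F'"
    unfolding F'_def
    by (intro continuous_on_add sc.continuous_on continuous_on_minus blinfun.continuous_on resolvent_continuous_on continuous_on_const
          continuous_on_subset[OF holomorphic_on_imp_continuous_on[OF hol]]
          continuous_on_subset[OF holomorphic_on_imp_continuous_on[OF holomorphic_deriv[OF hol open_strip[OF \<theta>]]]])
       (auto simp: strip_pos[OF \<theta>])
  have bd: "norm (F (Complex t y)) \<le> (C * (M * norm x)) / (1 + t\<^sup>2)" if "\<bar>y\<bar> < \<theta>" "\<bar>y\<bar> \<ge> h1" for t y
  proof -
    have "norm (F (Complex t y)) \<le> C / (1 + t\<^sup>2) * (M * norm x)"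
      unfolding F_def norm_sc using C(2)[of "Complex t y"] M(2)[of "Complex t y" x] C(1) that
      by (intro mult_mono) (auto simp: strip_pos[OF \<theta>])
    then show ?thesis by simp
  qed
  have up: "integral UNIV (\<lambda>t. F (Complex t h2)) = integral UNIV (\<lambda>t. F (Complex t h1))"
    by (rule line_shift_UNIV[OF reg continuous_on_subset[OF cont] bd]) (use h \<omega> in auto)
  have dn: "integral UNIV (\<lambda>t. F (Complex t (-h1))) = integral UNIV (\<lambda>t. F (Complex t (-h2)))"
    by (rule line_shift_UNIV[OF reg continuous_on_subset[OF cont] bd]) (use h \<omega> in auto)
  have int: "(\<lambda>t. F (Complex t y)) integrable_on UNIV" if "\<bar>y\<bar> < \<theta>" "\<bar>y\<bar> \<ge> h1" for y
  proof (rule integrable_dominated[OF _ bd[OF that]])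
    have "continuous_on {z. \<bar>Im z\<bar> < \<theta> \<and> \<bar>Im z\<bar> > \<omega>} F"
      by (rule continuous_at_imp_continuous_on) (auto intro!: has_derivative_continuous reg)
    then show "continuous_on UNIV (\<lambda>t. F (Complex t y))"
      by (rule continuous_on_compose2) (use that h in \<open>auto simp: Complex_line intro!: continuous_intros\<close>)
  qed
  have "integral UNIV (cint k \<psi> x) = integral UNIV (\<lambda>t. F (Complex t (-k))) - integral UNIV (\<lambda>t. F (Complex t k))" if "k = h1 \<or> k = h2" for k
    unfolding cint_def[abs_def] F_def[symmetric]
    by (rule Henstock_Kurzweil_Integration.integral_diff; rule int) (use that h \<omega> in auto)
  then show ?thesis unfolding ctr_def using up dn by simp
qed

lemma lines_cong:
  assumes "lines h \<phi>" "\<And>t. \<phi> (Complex t h) = \<psi> (Complex t h) \<and> \<phi> (Complex t (-h)) = \<psi> (Complex t (-h))"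
  shows "lines h \<psi>"
  using assms by (simp add: lines_def)

text \<open>e = \<psi> / (u - z) has its pole beyond the lines of height h, so its integrals over
  them cancel; with (u - z) e = \<psi> the claim is \<open>ctr_res\<close>.\<close>

lemma ctr_resolvent_kernel:
  assumes \<psi>: "\<psi> \<in> H0_infty \<theta>" and h: "\<omega> < h" "h < \<theta>" "h < \<bar>Im u\<bar>"
  shows "lines h (\<lambda>z. 1 / (u - z) * \<psi> z)" "res u (ctr h \<psi> x) = ctr h (\<lambda>z. 1 / (u - z) * \<psi> z) x"
proof -
  have \<theta>: "\<theta> > 0" using h \<omega> by linarith
  obtain C where C: "C > 0" "\<And>z. z \<in> strip \<theta> \<Longrightarrow> cmod (\<psi> z) \<le> C / (1 + (Re z)\<^sup>2)" using H0_decay[OF \<psi>] by blast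
  let ?e = "\<lambda>z. 1 / (u - z) * \<psi> z"
  define d where "d = \<bar>Im u\<bar> - h"
  have d: "d > 0" using h by (simp add: d_def)
  have bd: "cmod (?e z) \<le> (C / d) / (1 + (Re z)\<^sup>2)" if "\<bar>Im z\<bar> \<le> h" for z
  proof -
    have "d \<le> cmod (u - z)" using abs_Im_le_cmod[of "u - z"] that by (simp add: d_def)
    then have "1 / cmod (u - z) \<le> 1 / d" using d by (intro frac_le) auto
    then have "1 / cmod (u - z) * cmod (\<psi> z) \<le> 1 / d * (C / (1 + (Re z)\<^sup>2))"
      using that h d by (intro mult_mono C) (auto simp: strip_pos[OF \<theta>])
    then show ?thesis by (simp add: norm_mult norm_divide mult.commute)
  qed
  have hol: "?e holomorphic_on {z. \<bar>Im z\<bar> < min \<theta> \<bar>Im u\<bar>}"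
    using H0_holomorphic[OF \<psi>]
    by (intro holomorphic_intros) (auto simp: strip_pos[OF \<theta>] intro: holomorphic_on_subset)
  show l: "lines h ?e"
    unfolding lines_def
  proof (intro conjI exI allI)
    have "continuous_on UNIV (\<lambda>t. ?e (Complex t y))" if "\<bar>y\<bar> = h" for y
      by (rule continuous_on_compose2[OF holomorphic_on_imp_continuous_on[OF hol]])
         (use that h in \<open>auto simp: Complex_line intro!: continuous_intros\<close>)
    then show "continuous_on UNIV (\<lambda>t. ?e (Complex t h))" "continuous_on UNIV (\<lambda>t. ?e (Complex t (-h)))"
      using h \<omega> by auto
    show "cmod (?e (Complex t h)) \<le> (C / d) / (1 + t\<^sup>2)" "cmod (?e (Complex t (-h))) \<le> (C / d) / (1 + t\<^sup>2)" for t
      using bd[of "Complex t h"] bd[of "Complex t (-h)"] h \<omega> by auto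
  qed
  have eq: "(u - Complex t y) * ?e (Complex t y) = \<psi> (Complex t y)" if "\<bar>y\<bar> = h" for t y
    using that h by (auto simp: complex_eq_iff)
  have l': "lines h (\<lambda>z. (u - z) * ?e z)"
    by (rule lines_cong[OF lines_H0[OF \<psi>]]) (use eq h \<omega> in auto)
  have "integral UNIV (\<lambda>t. ?e (Complex t (-h)) - ?e (Complex t h)) = 0"
    by (rule Cauchy_lines_eq[OF hol _ _ bd]) (use h \<omega> in auto)
  then have "res u (ctr h (\<lambda>z. (u - z) * ?e z) x) = ctr h ?e x"
    using h \<omega> by (intro ctr_res l l') auto
  moreover have "ctr h (\<lambda>z. (u - z) * ?e z) x = ctr h \<psi> x"
    by (rule ctr_cong) (use eq h \<omega> in auto)
  ultimately show "res u (ctr h \<psi> x) = ctr h ?e x" by simp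
qed

text \<open>The outer contour integral is a limit of Riemann sums of resolvents \<open>R(u)\<close> with \<open>u\<close> outside the
  inner contour, and there \<open>R(u) \<psi>(A) = (\<psi> / (u - z))(A)\<close>.\<close>
lemma ctr_mult_nested:
  assumes \<phi>: "\<phi> \<in> H0_infty \<theta>" and \<psi>: "\<psi> \<in> H0_infty \<theta>" and h: "\<omega> < h1" "h1 < h2" "h2 < \<theta>"
  shows "ctr h2 \<phi> (ctr h1 \<psi> x) = ctr h1 (\<lambda>z. \<phi> z * \<psi> z) x"
proof -
  have \<theta>: "\<theta> > 0" using h \<omega> by linarith
  have h0: "h1 \<ge> 0" "h2 \<ge> 0" "h2 > \<omega>" "h1 < \<theta>" using h \<omega> by auto
  note l\<phi> = lines_H0[OF \<phi> h0(2) h(3)]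
  define y where "y = ctr h1 \<psi> x"
  define c where "c = 1 / (2 * complex_of_real pi * \<i>)"
  define k where "k z t = \<phi> (Complex t (-h2)) * (1 / (Complex t (-h2) - z)) + (- \<phi> (Complex t h2)) * (1 / (Complex t h2 - z))" for z t
  \<comment> \<open>The Riemann sums of Cauchy's formula for \<phi> over the outer lines. They have
    poles there but converge boundedly to \<phi> on the inner lines.\<close>
  define \<rho> where "\<rho> n z = c * rsum n (k z)" for n z
  have lk: "lines h1 (\<lambda>z. k z t * \<psi> z)" and Ft: "cint h2 \<phi> y t = ctr h1 (\<lambda>z. k z t * \<psi> z) x" for t
  proof -
    have i: "h1 < \<bar>Im (Complex t h2)\<bar>" "h1 < \<bar>Im (Complex t (-h2))\<bar>" using h \<omega> by auto
    note kp = ctr_resolvent_kernel[OF \<psi> h(1) h0(4) i(1)] and km = ctr_resolvent_kernel[OF \<psi> h(1) h0(4) i(2)]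
    have "(\<lambda>z. k z t * \<psi> z) = (\<lambda>z. \<phi> (Complex t (-h2)) * (1 / (Complex t (-h2) - z) * \<psi> z) + (- \<phi> (Complex t h2)) * (1 / (Complex t h2 - z) * \<psi> z))"
      by (simp add: k_def fun_eq_iff distrib_right mult.assoc left_diff_distrib)
    moreover have "lines h1 (\<lambda>z. \<phi> (Complex t (-h2)) * (1 / (Complex t (-h2) - z) * \<psi> z) + (- \<phi> (Complex t h2)) * (1 / (Complex t h2 - z) * \<psi> z))"
      by (intro lines_add lines_scale kp km)
    moreover have "ctr h1 (\<lambda>z. \<phi> (Complex t (-h2)) * (1 / (Complex t (-h2) - z) * \<psi> z) + (- \<phi> (Complex t h2)) * (1 / (Complex t h2 - z) * \<psi> z)) x
       = \<phi> (Complex t (-h2)) \<odot> res (Complex t (-h2)) y + (- \<phi> (Complex t h2)) \<odot> res (Complex t h2) y"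
      unfolding y_def kp(2) km(2)
      by (subst ctr_add[OF h(1) lines_scale[OF km(1)] lines_scale[OF kp(1)]]) (simp only: ctr_scale[OF h(1) km(1)] ctr_scale[OF h(1) kp(1)])
    ultimately show "lines h1 (\<lambda>z. k z t * \<psi> z)" "cint h2 \<phi> y t = ctr h1 (\<lambda>z. k z t * \<psi> z) x"
      by (auto simp: cint_def sc.minus_left)
  qed
  have l\<rho>: "lines h1 (\<lambda>z. \<rho> n z * \<psi> z)" and c\<rho>: "c \<odot> rsum n (cint h2 \<phi> y) = ctr h1 (\<lambda>z. \<rho> n z * \<psi> z) x" for n
  proof -
    let ?S = "{- int (n\<^sup>2)..<int (n\<^sup>2)}" and ?g = "\<lambda>j z. k z (real_of_int j / real n) * \<psi> z"
    have s: "lines h1 (\<lambda>z. \<Sum>j\<in>?S. ?g j z)" "ctr h1 (\<lambda>z. \<Sum>j\<in>?S. ?g j z) x = (\<Sum>j\<in>?S. ctr h1 (?g j) x)"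
      using ctr_sum[OF h(1), of ?S ?g] lk by auto
    have eq: "(\<lambda>z. \<rho> n z * \<psi> z) = (\<lambda>z. (c * of_real (1 / real n)) * (\<Sum>j\<in>?S. ?g j z))"
      by (simp add: \<rho>_def rsum_def fun_eq_iff scaleR_conv_of_real sum_distrib_right mult.assoc)
    show "lines h1 (\<lambda>z. \<rho> n z * \<psi> z)" unfolding eq by (rule lines_scale[OF s(1)])
    have "ctr h1 (\<lambda>z. \<rho> n z * \<psi> z) x = (c * of_real (1 / real n)) \<odot> (\<Sum>j\<in>?S. ctr h1 (?g j) x)"
      unfolding eq ctr_scale[OF h(1) s(1)] s(2) ..
    then show "c \<odot> rsum n (cint h2 \<phi> y) = ctr h1 (\<lambda>z. \<rho> n z * \<psi> z) x"
      by (simp only: rsum_def Ft sc_mult[symmetric] sc_of_real)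
  qed
  obtain C where C: "C > 0" "\<And>z. z \<in> strip \<theta> \<Longrightarrow> cmod (\<phi> z) \<le> C / (1 + (Re z)\<^sup>2)" using H0_decay[OF \<phi>] by blast
  obtain C' where C': "C' > 0" "\<And>z. z \<in> strip \<theta> \<Longrightarrow> cmod (\<psi> z) \<le> C' / (1 + (Re z)\<^sup>2)" using H0_decay[OF \<psi>] by blast
  obtain B where B: "B > 0" "\<And>n. rsum n (\<lambda>t::real. 1 / (1 + t\<^sup>2)) \<le> B" using rsum_bounded by blast
  define L where "L = 2 * C / (h2 - h1)"
  have L: "L > 0" using C(1) h by (simp add: L_def)
  have keq: "k z t = \<phi> (Complex t (-h2)) / (Complex t (-h2) - z) - \<phi> (Complex t h2) / (Complex t h2 - z)" for z t
    by (simp add: k_def)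
  have kc: "continuous_on UNIV (k z)" and kb: "cmod (k z t) \<le> L / (1 + t\<^sup>2)"
    and ki: "integral UNIV (k z) = 2 * pi * \<i> * \<phi> z" if z: "\<bar>Im z\<bar> = h1" for z t
  proof -
    have zz: "\<bar>Im z\<bar> < h2" using z h by simp
    show "continuous_on UNIV (k z)" "cmod (k z t) \<le> L / (1 + t\<^sup>2)"
      using Cauchy_kernel[OF \<phi> h(3) zz C] by (simp_all add: keq[abs_def] L_def z)
    show "integral UNIV (k z) = 2 * pi * \<i> * \<phi> z" using Cauchy_strip[OF \<phi> h(3) zz] by (simp add: keq[abs_def])
  qed
  have \<rho>lim: "(\<lambda>n. \<rho> n z) \<longlonglongrightarrow> \<phi> z" if "\<bar>Im z\<bar> = h1" for z
  proof -
    have "(\<lambda>n. c * rsum n (k z)) \<longlonglongrightarrow> c * (2 * pi * \<i> * \<phi> z)"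
      using rsum_tendsto_integral[OF kc[OF that] kb[OF that]] unfolding ki[OF that] by (rule tendsto_mult_left)
    then show ?thesis by (simp add: \<rho>_def c_def)
  qed
  have \<rho>bd: "cmod (\<rho> n z) \<le> cmod c * (L * B)" if "\<bar>Im z\<bar> = h1" for n z
  proof -
    have "cmod (rsum n (k z)) \<le> rsum n (\<lambda>t. cmod (k z t))" by (rule rsum_norm_le)
    also have "\<dots> \<le> rsum n (\<lambda>t. L * (1 / (1 + t\<^sup>2)))"
      by (rule rsum_mono) (use kb[OF that] in simp)
    also have "\<dots> = L * rsum n (\<lambda>t. 1 / (1 + t\<^sup>2))"
      by (simp add: rsum_def sum_distrib_left mult.left_commute divide_inverse mult.assoc)
    also have "\<dots> \<le> L * B" using L by (intro mult_left_mono B) auto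
    finally show ?thesis unfolding \<rho>_def norm_mult by (intro mult_left_mono) auto
  qed
  \<comment> \<open>By \<open>c\<rho>\<close> this sequence also consists of the Riemann sums for
    the outer contour integral; comparing the two limits finishes the proof.\<close>
  have "(\<lambda>n. ctr h1 (\<lambda>z. \<rho> n z * \<psi> z) x) \<longlonglongrightarrow> ctr h1 (\<lambda>z. \<phi> z * \<psi> z) x"
  proof (rule ctr_tendsto[OF h(1) l\<rho>])
    show "lines h1 (\<lambda>z. \<phi> z * \<psi> z)" by (rule lines_H0[OF H0_mult[OF \<phi> \<psi>] h0(1,4)])
    have b: "cmod (\<rho> n z * \<psi> z) \<le> (cmod c * (L * B) * C') / (1 + (Re z)\<^sup>2)" if "\<bar>Im z\<bar> = h1" for n z
    proof -
      have "cmod (\<rho> n z * \<psi> z) \<le> (cmod c * (L * B)) * (C' / (1 + (Re z)\<^sup>2))"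
        unfolding norm_mult using that h0 L B by (intro mult_mono \<rho>bd C') (auto simp: strip_pos[OF \<theta>])
      then show ?thesis by simp
    qed
    show "cmod (\<rho> n (Complex t h1) * \<psi> (Complex t h1)) \<le> (cmod c * (L * B) * C') / (1 + t\<^sup>2)
       \<and> cmod (\<rho> n (Complex t (-h1)) * \<psi> (Complex t (-h1))) \<le> (cmod c * (L * B) * C') / (1 + t\<^sup>2)" for n t
      using b[of "Complex t h1" n] b[of "Complex t (-h1)" n] h0 by simp
    show "(\<lambda>n. \<rho> n (Complex t h1) * \<psi> (Complex t h1)) \<longlonglongrightarrow> \<phi> (Complex t h1) * \<psi> (Complex t h1)"
      "(\<lambda>n. \<rho> n (Complex t (-h1)) * \<psi> (Complex t (-h1))) \<longlonglongrightarrow> \<phi> (Complex t (-h1)) * \<psi> (Complex t (-h1))" for t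
      using h0 by (auto intro!: tendsto_mult \<rho>lim)
  qed
  moreover have "(\<lambda>n. c \<odot> rsum n (cint h2 \<phi> y)) \<longlonglongrightarrow> c \<odot> integral UNIV (cint h2 \<phi> y)"
  proof -
    obtain K where "\<And>x t. norm (cint h2 \<phi> x t) \<le> (K * norm x) / (1 + t\<^sup>2)" using cint_dominated[OF l\<phi> h0(3)] by blast
    then show ?thesis
      by (intro sc.tendsto tendsto_const rsum_tendsto_integral[OF cint_continuous[OF l\<phi> h0(3)]])
  qed
  ultimately show ?thesis
    unfolding c\<rho> using LIMSEQ_unique by (fastforce simp: ctr_def y_def c_def)
qed

end

section \<open>The calculus \<open>Phi\<close> on H0\<close>

locale strip_calculus = strip_op J D A \<omega> for J :: "'a::banach \<Rightarrow> 'a" and D A \<omega> +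
  fixes \<theta> :: real
  assumes \<theta>: "\<theta> > \<omega>"
begin

lemma \<theta>_pos: "\<theta> > 0" using \<theta> \<omega> by linarith

definition hc where "hc = (\<omega> + \<theta>) / 2"

lemma hc: "\<omega> < hc" "hc < \<theta>" "0 \<le> hc" "0 < hc" using \<theta> \<omega> by (auto simp: hc_def)

abbreviation H0 where "H0 \<equiv> H0_infty \<theta>"

lemma lines_hc: "\<psi> \<in> H0 \<Longrightarrow> lines hc \<psi>"
  by (rule lines_H0) (use hc in auto)

definition Phi :: "(complex \<Rightarrow> complex) \<Rightarrow> 'a \<Rightarrow>\<^sub>L 'a" where
  "Phi \<psi> = Blinfun (ctr hc \<psi>)"

lemma Phi_apply: "\<psi> \<in> H0 \<Longrightarrow> blinfun_apply (Phi \<psi>) = ctr hc \<psi>"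
  unfolding Phi_def by (rule bounded_linear_Blinfun_apply[OF ctr_bounded_linear[OF hc(1) lines_hc]])

lemma Phi_psi_op: "\<psi> \<in> H0 \<Longrightarrow> psi_op J D A \<omega> \<theta> \<psi> = blinfun_apply (Phi \<psi>)"
  by (simp add: Phi_apply psi_op_eq hc_def)

lemma Phi_add: "\<phi> \<in> H0 \<Longrightarrow> \<psi> \<in> H0 \<Longrightarrow> Phi (\<lambda>z. \<phi> z + \<psi> z) = Phi \<phi> + Phi \<psi>"
  by (rule blinfun_eqI) (simp add: Phi_apply H0_add blinfun.add_left ctr_add[OF hc(1) lines_hc lines_hc])

lemma Phi_scale: "\<psi> \<in> H0 \<Longrightarrow> Phi (\<lambda>z. c * \<psi> z) x = c \<odot> Phi \<psi> x"
  by (simp add: Phi_apply H0_scale ctr_scale[OF hc(1) lines_hc])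

lemma Phi_diff: "\<phi> \<in> H0 \<Longrightarrow> \<psi> \<in> H0 \<Longrightarrow> Phi (\<lambda>z. \<phi> z - \<psi> z) = Phi \<phi> - Phi \<psi>"
  using Phi_add[of \<phi> "\<lambda>z. (-1) * \<psi> z"] H0_scale[of \<psi> \<theta> "-1"] Phi_scale[of \<psi> "-1"]
  by (intro blinfun_eqI) (simp add: blinfun.add_left blinfun.diff_left sc.minus_left)

lemma Phi_J: "\<psi> \<in> H0 \<Longrightarrow> Phi \<psi> (J x) = J (Phi \<psi> x)"
  by (simp add: Phi_apply ctr_J[OF hc(1) lines_hc])

lemma Phi_mult:
  assumes "\<phi> \<in> H0" "\<psi> \<in> H0"
  shows "Phi (\<lambda>z. \<phi> z * \<psi> z) = Phi \<phi> o\<^sub>L Phi \<psi>"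
proof (rule blinfun_eqI)
  fix x
  \<comment> \<open>A second height strictly between hc and \<theta>, for the outer contour.\<close>
  define h where "h = (hc + \<theta>) / 2"
  have h: "hc < h" "h < \<theta>" "\<omega> < h" using hc by (auto simp: h_def)
  have "ctr hc \<phi> (ctr hc \<psi> x) = ctr h \<phi> (ctr hc \<psi> x)"
    by (rule ctr_height[OF assms(1) hc(1)]) (use h in auto)
  also have "\<dots> = ctr hc (\<lambda>z. \<phi> z * \<psi> z) x" by (rule ctr_mult_nested[OF assms hc(1) h(1,2)])
  finally show "Phi (\<lambda>z. \<phi> z * \<psi> z) x = (Phi \<phi> o\<^sub>L Phi \<psi>) x"
    using assms by (simp add: Phi_apply H0_mult)
qed

lemma H0_linear: "e \<in> H0 \<Longrightarrow> (\<lambda>z. (l - z) * e z) \<in> H0"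
proof (rule H0_mult_linear[where M="cmod l + \<theta> + 1"])
  fix z assume "z \<in> strip \<theta>"
  then have "\<bar>Im z\<bar> < \<theta>" by (simp add: strip_pos[OF \<theta>_pos])
  then have "cmod (l - z) \<le> cmod l + (\<bar>Re z\<bar> + \<theta>)"
    using norm_triangle_ineq4[of l z] cmod_le[of z] by linarith
  also have "\<dots> \<le> (cmod l + \<theta> + 1) * (1 + \<bar>Re z\<bar>)"
    using \<theta>_pos by (simp add: algebra_simps add_nonneg_nonneg)
  finally show "cmod (l - z) \<le> (cmod l + \<theta> + 1) * (1 + \<bar>Re z\<bar>)" .
qed (auto intro!: holomorphic_intros)

text \<open>As (l - z) e is again in H0, the resolvent is tied to the calculus through e(A) = R(l)
  ((l - z) e)(A), although 1 / (l - z) itself is not in H0.\<close>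

lemma Phi_resolvent:
  assumes e: "e \<in> H0" and l: "\<bar>Im l\<bar> > \<omega>"
  shows "res l (Phi (\<lambda>z. (l - z) * e z) x) = Phi e x" "Phi (\<lambda>z. (l - z) * e z) (res l x) = Phi e x"
proof -
  obtain C where C: "C > 0" "\<And>z. z \<in> strip \<theta> \<Longrightarrow> cmod (e z) \<le> C / (1 + (Re z)\<^sup>2)" using H0_decay[OF e] by blast
  have "integral UNIV (\<lambda>t. e (Complex t (-hc)) - e (Complex t hc)) = 0"
  proof (rule Cauchy_lines_eq[OF _ hc(4,2)])
    show "e holomorphic_on {z. \<bar>Im z\<bar> < \<theta>}" using H0_holomorphic[OF e] by (simp add: strip_pos[OF \<theta>_pos])
    show "cmod (e z) \<le> C / (1 + (Re z)\<^sup>2)" if "\<bar>Im z\<bar> \<le> hc" for z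
      using that hc by (intro C) (auto simp: strip_pos[OF \<theta>_pos])
  qed
  then show 1: "res l (Phi (\<lambda>z. (l - z) * e z) x) = Phi e x"
    using ctr_res[OF l hc(1) lines_hc[OF e] lines_hc[OF H0_linear[OF e, of l]], of x] by (simp add: Phi_apply e H0_linear)
  show "Phi (\<lambda>z. (l - z) * e z) (res l x) = Phi e x"
    using 1 ctr_res_commute[OF hc(1) lines_hc[OF H0_linear[OF e, of l]] l, of x] by (simp add: Phi_apply e H0_linear)
qed

lemma res_expand:
  assumes "x \<in> D" "\<bar>Im u\<bar> > \<omega>"
  shows "res u x = (1 / u) \<odot> (x + res u (A x))"
proof -
  have u: "u \<noteq> 0" using assms \<omega> by auto
  have "u \<odot> res u x - res u (A x) = x"
    using res_left[OF assms(2,1)] by (simp add: blinfun.diff_right res_sc[OF assms(2)])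
  then have "u \<odot> res u x = x + res u (A x)" by (simp add: algebra_simps)
  then have "(1 / u) \<odot> (u \<odot> res u x) = (1 / u) \<odot> (x + res u (A x))" by simp
  then show ?thesis using u by (simp add: sc_mult)
qed

lemma Complex_norm_bound: "0 < h \<Longrightarrow> h \<le> \<bar>y\<bar> \<Longrightarrow> 1 / (cmod (Complex t y))\<^sup>2 \<le> (1 / min 1 (h\<^sup>2)) / (1 + t\<^sup>2)"
proof -
  assume h: "0 < h" "h \<le> \<bar>y\<bar>"
  have m: "0 < min 1 (h\<^sup>2)" using h by simp
  have "h\<^sup>2 \<le> y\<^sup>2" using h by (metis abs_le_square_iff abs_of_pos)
  moreover have "min 1 (h\<^sup>2) * t\<^sup>2 \<le> 1 * t\<^sup>2" by (intro mult_right_mono) auto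
  ultimately have "min 1 (h\<^sup>2) * (1 + t\<^sup>2) \<le> t\<^sup>2 + y\<^sup>2"
    unfolding distrib_left by (smt (verit) min.cobounded2)
  then have "1 / (t\<^sup>2 + y\<^sup>2) \<le> 1 / (min 1 (h\<^sup>2) * (1 + t\<^sup>2))"
    using m h by (intro divide_left_mono mult_pos_pos) (auto simp: sum_power2_gt_zero_iff)
  then show ?thesis by (simp add: cmod_power2)
qed

text \<open>With \<open>R(u)x = (x + R(u)Ax) / u\<close>, Cauchy's formula turns the first summand into \<open>\<eta>(0) x\<close>; the
  integrand of the second is \<open>O(1/u\<^sup>2)\<close> and its limit vanishes by moving the two lines to infinity.\<close>
lemma Phi_approx_identity:
  assumes \<eta>: "\<And>n. \<eta> n \<in> H0" "\<And>n. \<eta> n 0 = 1" and bd: "\<And>n z. \<bar>Im z\<bar> = hc \<Longrightarrow> cmod (\<eta> n z) \<le> B"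
    and lim: "\<And>z. \<bar>Im z\<bar> = hc \<Longrightarrow> (\<lambda>n. \<eta> n z) \<longlonglongrightarrow> 1" and x: "x \<in> D" "A x \<in> D"
  shows "(\<lambda>n. Phi (\<eta> n) x) \<longlonglongrightarrow> x"
proof -
  define c where "c = 1 / (2 * complex_of_real pi * \<i>)"
  define y where "y = A x"
  obtain M where M: "M > 0" "\<And>l x. \<bar>Im l\<bar> \<ge> hc \<Longrightarrow> norm (res l x) \<le> M * norm x" using res_bound[OF hc(1)] by blast
  define K where "K = norm y + M * norm (A y)"
  define m where "m = 1 / min 1 (hc\<^sup>2)"
  define G where "G z = (1 / z) \<odot> res z y" for z
  define G' where "G' z = (- 1 / z\<^sup>2) \<odot> res z y + (1 / z) \<odot> (- res z (res z y))" for z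
  have K0: "K \<ge> 0" using M by (simp add: K_def)
  \<comment> \<open>Expanding R(z) y a second time gains another factor 1 / z; for this y = A x has
    to lie in D.\<close>
  have Gn: "norm (G z) \<le> K * (1 / (cmod z)\<^sup>2)" if "\<bar>Im z\<bar> \<ge> hc" for z
  proof -
    have i: "\<bar>Im z\<bar> > \<omega>" using that hc by linarith
    have "norm (y + res z (A y)) \<le> K"
      unfolding K_def using M(2)[OF that, of "A y"] norm_triangle_ineq[of y "res z (A y)"] by linarith
    then have "cmod (1 / z) * (cmod (1 / z) * norm (y + res z (A y))) \<le> cmod (1 / z) * (cmod (1 / z) * K)"
      by (intro mult_left_mono) auto
    then show ?thesis unfolding G_def using res_expand[OF x(2) i] by (simp add: y_def power2_eq_square norm_divide)
  qed
  have Gb: "norm (G (Complex t y')) \<le> (K * m) / (1 + t\<^sup>2)" if "\<bar>y'\<bar> \<ge> hc" for t y'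
    using order_trans[OF Gn[of "Complex t y'"] mult_left_mono[OF Complex_norm_bound[OF hc(4) that] K0]] that
    by (simp add: m_def)
  have Gd: "(G has_derivative (\<lambda>u. u \<odot> G' z)) (at z)" if "\<bar>Im z\<bar> > \<omega>" for z
  proof -
    have z: "z \<noteq> 0" using that \<omega> by auto
    have "((\<lambda>z. 1 / z) has_derivative (\<lambda>u. u * (- 1 / z\<^sup>2))) (at z)"
    proof -
      have "((\<lambda>z. 1 / z) has_field_derivative (- 1 / z\<^sup>2)) (at z)"
        using z by (auto intro!: derivative_eq_intros simp: power2_eq_square)
      then show ?thesis unfolding has_field_derivative_def by (simp only: mult_commute_abs)
    qed
    from sc.FDERIV[OF this res_has_derivative[OF that, of y]]
    show ?thesis by (simp add: G_def[abs_def] G'_def sc_mult sc.add_right mult.commute add.commute)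
  qed
  have Gc: "continuous_on {z. \<bar>Im z\<bar> > \<omega>} G'"
    unfolding G'_def
    by (intro continuous_on_add sc.continuous_on continuous_on_minus blinfun.continuous_on resolvent_continuous_on continuous_on_const
          continuous_intros) (use \<omega> in auto)
  have Gl: "continuous_on UNIV (\<lambda>t. G (Complex t y'))" if "\<bar>y'\<bar> \<ge> hc" for y'
  proof -
    have "continuous_on {z. \<bar>Im z\<bar> > \<omega>} G"
      by (rule continuous_at_imp_continuous_on) (auto intro!: has_derivative_continuous Gd)
    then show ?thesis
      by (rule continuous_on_compose2) (use that hc in \<open>auto simp: Complex_line intro!: continuous_intros\<close>)
  qed
  \<comment> \<open>On the lines Im z = s (hc + n) the integrand has a majorant independent of n and
    tends to 0 pointwise.\<close>
  have far: "(\<lambda>n. integral UNIV (\<lambda>t. G (Complex t (s * (hc + real n))))) \<longlonglongrightarrow> 0" if s: "s = 1 \<or> s = -1" for s :: real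
  proof -
    have "(\<lambda>n. integral UNIV (\<lambda>t. G (Complex t (s * (hc + real n))))) \<longlonglongrightarrow> integral UNIV (\<lambda>t::real. 0)"
    proof (rule integral_dominated_tendsto[OF Gl _ Gb])
      have ge: "\<bar>s * (hc + real n)\<bar> \<ge> hc" for n using s hc by auto
      show "\<bar>s * (hc + real n)\<bar> \<ge> hc" for n by (rule ge)
      show "\<bar>s * (hc + real n)\<bar> \<ge> hc" for n by (rule ge)
      fix t
      show "(\<lambda>n. G (Complex t (s * (hc + real n)))) \<longlonglongrightarrow> 0"
      proof (rule Lim_null_comparison[OF always_eventually], rule)
        fix n
        have "norm (G (Complex t (s * (hc + real n)))) \<le> K * (1 / (cmod (Complex t (s * (hc + real n))))\<^sup>2)"
          using ge[of n] by (intro Gn) simp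
        also have "\<dots> = K * (1 / (t\<^sup>2 + (hc + real n)\<^sup>2))"
          using s by (auto simp only: cmod_power2 complex.sel power_mult_distrib) simp_all
        finally show "norm (G (Complex t (s * (hc + real n)))) \<le> K * (1 / (t\<^sup>2 + (hc + real n)\<^sup>2))" .
        show "(\<lambda>n. K * (1 / (t\<^sup>2 + (hc + real n)\<^sup>2))) \<longlonglongrightarrow> 0" by real_asymp
      qed
    qed auto
    then show ?thesis by simp
  qed
  have up: "integral UNIV (\<lambda>t. G (Complex t hc)) = 0"
  proof -
    have "integral UNIV (\<lambda>t. G (Complex t (1 * (hc + real n)))) = integral UNIV (\<lambda>t. G (Complex t hc))" for n
      unfolding mult_1 by (rule line_shift_UNIV[OF Gd continuous_on_subset[OF Gc] Gb]) (use hc in auto)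
    then have "(\<lambda>n::nat. integral UNIV (\<lambda>t. G (Complex t hc))) \<longlonglongrightarrow> 0"
      using far[of 1] by (simp only:) simp
    then show ?thesis by (simp add: LIMSEQ_const_iff)
  qed
  have dn: "integral UNIV (\<lambda>t. G (Complex t (-hc))) = 0"
  proof -
    have E: "integral UNIV (\<lambda>t. G (Complex t (-hc))) = integral UNIV (\<lambda>t. G (Complex t (-1 * (hc + real n))))" for n
      by (rule line_shift_UNIV[OF Gd continuous_on_subset[OF Gc] Gb]) (use hc in auto)
    have "(\<lambda>n::nat. integral UNIV (\<lambda>t. G (Complex t (-hc)))) \<longlonglongrightarrow> 0"
      using far[of "-1"] unfolding E[symmetric] by simp
    then show ?thesis by (simp add: LIMSEQ_const_iff)
  qed
  define F where "F n t = \<eta> n (Complex t (-hc)) \<odot> G (Complex t (-hc)) - \<eta> n (Complex t hc) \<odot> G (Complex t hc)" for n t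
  have \<eta>c: "continuous_on UNIV (\<lambda>t. \<eta> n (Complex t hc))" "continuous_on UNIV (\<lambda>t. \<eta> n (Complex t (-hc)))" for n
    using lines_hc[OF \<eta>(1)] by (auto simp: lines_def)
  have B0: "B \<ge> 0" using order_trans[OF norm_ge_zero bd[of "Complex 0 hc" 0]] hc by simp
  have Fc: "continuous_on UNIV (F n)" for n
    unfolding F_def by (intro continuous_on_diff sc.continuous_on \<eta>c Gl) (use hc in auto)
  have Fb: "norm (F n t) \<le> (2 * (B * (K * m))) / (1 + t\<^sup>2)" for n t
  proof -
    have "norm (\<eta> n (Complex t y') \<odot> G (Complex t y')) \<le> B * ((K * m) / (1 + t\<^sup>2))" if "\<bar>y'\<bar> = hc" for y'
      unfolding norm_sc using that B0 by (intro mult_mono bd Gb) auto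
    then have "norm (F n t) \<le> B * ((K * m) / (1 + t\<^sup>2)) + B * ((K * m) / (1 + t\<^sup>2))"
      unfolding F_def using hc by (intro order_trans[OF norm_triangle_ineq4] add_mono) auto
    then show ?thesis by (simp add: mult_ac)
  qed
  have "(\<lambda>n. integral UNIV (F n)) \<longlonglongrightarrow> integral UNIV (\<lambda>t. G (Complex t (-hc)) - G (Complex t hc))"
  proof (rule integral_dominated_tendsto[OF Fc _ Fb])
    show "continuous_on UNIV (\<lambda>t. G (Complex t (-hc)) - G (Complex t hc))"
      by (intro continuous_on_diff Gl) (use hc in auto)
    fix t
    have "(\<lambda>n. F n t) \<longlonglongrightarrow> 1 \<odot> G (Complex t (-hc)) - 1 \<odot> G (Complex t hc)"
      unfolding F_def using hc by (intro tendsto_diff sc.tendsto lim tendsto_const) auto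
    then show "(\<lambda>n. F n t) \<longlonglongrightarrow> G (Complex t (-hc)) - G (Complex t hc)" by simp
  qed
  also have "integral UNIV (\<lambda>t. G (Complex t (-hc)) - G (Complex t hc)) = 0"
    using up dn hc by (subst Henstock_Kurzweil_Integration.integral_diff) (auto intro!: integrable_dominated[OF Gl Gb])
  finally have F0: "(\<lambda>n. x + c \<odot> integral UNIV (F n)) \<longlonglongrightarrow> x + c \<odot> 0"
    by (intro tendsto_add sc.tendsto tendsto_const)
  have "Phi (\<eta> n) x = x + c \<odot> integral UNIV (F n)" for n
  proof -
    let ?s = "\<lambda>t. \<eta> n (Complex t (-hc)) / (Complex t (-hc) - 0) - \<eta> n (Complex t hc) / (Complex t hc - 0)"
    have z: "\<bar>Im 0\<bar> < hc" using hc by simp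
    obtain C where C: "C > 0" "\<And>z. z \<in> strip \<theta> \<Longrightarrow> cmod (\<eta> n z) \<le> C / (1 + (Re z)\<^sup>2)" using H0_decay[OF \<eta>(1)] by blast
    have si: "?s integrable_on UNIV" by (rule integrable_dominated[OF Cauchy_kernel[OF \<eta>(1) hc(2) z C]])
    have sI: "integral UNIV ?s = 2 * pi * \<i>" using Cauchy_strip[OF \<eta>(1) hc(2) z] by (simp add: \<eta>(2))
    have sx: "(\<lambda>t. ?s t \<odot> x) integrable_on UNIV" "integral UNIV (\<lambda>t. ?s t \<odot> x) = (2 * complex_of_real pi * \<i>) \<odot> x"
      using integrable_linear[OF si sc.bounded_linear_left[of x]] integral_linear[OF si sc.bounded_linear_left[of x]] unfolding sI
      by (auto simp: o_def)
    have "cint hc (\<eta> n) x t = ?s t \<odot> x + F n t" for t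
    proof -
      have "\<eta> n z \<odot> res z x = (\<eta> n z / z) \<odot> x + \<eta> n z \<odot> G z" if "\<bar>Im z\<bar> > \<omega>" for z
        by (simp add: res_expand[OF x(1) that] G_def y_def sc_mult sc.add_right)
      then show ?thesis using hc by (simp add: cint_def F_def sc.diff_left)
    qed
    then have "integral UNIV (cint hc (\<eta> n) x) = (2 * complex_of_real pi * \<i>) \<odot> x + integral UNIV (F n)"
      using sx integrable_dominated[OF Fc Fb, of n] by (simp add: Henstock_Kurzweil_Integration.integral_add cong: Henstock_Kurzweil_Integration.integral_cong)
    then have "blinfun_apply (Phi (\<eta> n)) x = c \<odot> ((2 * complex_of_real pi * \<i>) \<odot> x) + c \<odot> integral UNIV (F n)"
      by (simp add: Phi_apply \<eta> ctr_def c_def sc.add_right)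
    then show ?thesis by (simp add: sc_mult c_def)
  qed
  then show ?thesis using F0 by simp
qed

section \<open>Dense range of the Gaussians of A\<close>

lemma dense_D2: "closure {x \<in> D. A x \<in> D} = UNIV"
proof -
  define l where "l = \<i> * of_real (\<omega> + 1)"
  have l: "\<bar>Im l\<bar> > \<omega>" using \<omega> by (simp add: l_def)
  have dD: "closure D = UNIV" using dd by (simp add: densely_defined_op_def)
  \<comment> \<open>A R(l) z = l R(l) z - z, so R(l) maps D into the domain of A^2. As R(l) is
    continuous with range D, the image of the dense set D is dense in D.\<close>
  have sub: "res l ` D \<subseteq> {x \<in> D. A x \<in> D}"
  proof
    fix y assume "y \<in> res l ` D"
    then obtain z where z: "z \<in> D" "y = res l z" by auto
    have "A y = l \<odot> y + (-1) *\<^sub>R z" using res_right[OF l, of z] z by (simp add: algebra_simps)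
    moreover have "l \<odot> y + (-1) *\<^sub>R z \<in> D" using z res_D[OF l] by (intro D_closed) auto
    ultimately show "y \<in> {x \<in> D. A x \<in> D}" using z res_D[OF l] by auto
  qed
  have "D \<subseteq> res l ` UNIV" using res_left[OF l] by (metis image_iff subsetI UNIV_I)
  also have "\<dots> = res l ` closure D" by (simp add: dD)
  also have "\<dots> \<subseteq> closure (res l ` D)"
    by (rule image_closure_subset[OF _ closed_closure closure_subset]) (intro linear_continuous_on blinfun.bounded_linear_right)
  also have "\<dots> \<subseteq> closure {x \<in> D. A x \<in> D}" by (rule closure_mono[OF sub])
  finally have "closure D \<subseteq> closure {x \<in> D. A x \<in> D}" by (simp add: closure_minimal)
  then show ?thesis using dD by auto
qed

text \<open>On the strip Re z^4 is at least s^2 - 6 \<theta>^2 s with s = (Re z)^2, so the quartic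
  term dominates m z^2 and still leaves Gaussian decay.\<close>

lemma quartic_estimate:
  assumes "n > 0" "z \<in> strip \<theta>"
  shows "cmod (exp (of_real m * z\<^sup>2) * exp (- (z ^ 4) / of_real n)) \<le> exp (\<bar>m\<bar> * \<theta>\<^sup>2 + n * (\<bar>m\<bar> + 6 * \<theta>\<^sup>2 / n + 1)\<^sup>2 / 4) * exp (- (1 * (Re z)\<^sup>2))"
proof -
  define t y where "t = Re z" and "y = Im z"
  have z: "z = Complex t y" by (simp add: t_def y_def)
  have y: "y\<^sup>2 \<le> \<theta>\<^sup>2" using strip_Im_le[OF assms(2)] \<theta>_pos by (metis abs_le_square_iff abs_of_pos less_imp_le y_def)
  have sq: "z\<^sup>2 = Complex (t\<^sup>2 - y\<^sup>2) (2 * t * y)" by (simp add: z complex_eq_iff power2_eq_square)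
  have "Re (z ^ 4) = (t\<^sup>2 - y\<^sup>2)\<^sup>2 - (2 * t * y)\<^sup>2"
  proof -
    have "z ^ 4 = z\<^sup>2 * z\<^sup>2" by (simp add: power4_eq_xxxx power2_eq_square mult.assoc)
    then show ?thesis by (simp add: sq) (simp add: power2_eq_square)
  qed
  then have re4: "Re (z ^ 4) = t\<^sup>2 * t\<^sup>2 - 6 * t\<^sup>2 * y\<^sup>2 + y\<^sup>2 * y\<^sup>2" by (simp add: power2_eq_square algebra_simps)
  define s where "s = t\<^sup>2"
  have s: "s \<ge> 0" by (simp add: s_def)
  have "6 * s * y\<^sup>2 \<le> 6 * s * \<theta>\<^sup>2" using s y by (intro mult_left_mono) auto
  moreover have "y\<^sup>2 * y\<^sup>2 \<ge> 0" by simp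
  ultimately have 1: "- Re (z ^ 4) \<le> 6 * s * \<theta>\<^sup>2 - s * s" unfolding re4 s_def by linarith
  have "m * (s - y\<^sup>2) \<le> \<bar>m\<bar> * (s + \<theta>\<^sup>2)"
  proof -
    have "m * (s - y\<^sup>2) \<le> \<bar>m\<bar> * \<bar>s - y\<^sup>2\<bar>" by (metis abs_ge_self abs_mult)
    also have "\<dots> \<le> \<bar>m\<bar> * (s + \<theta>\<^sup>2)" using s y zero_le_power2[of y] by (intro mult_left_mono) linarith+
    finally show ?thesis .
  qed
  moreover have "- Re (z ^ 4) / n \<le> (6 * s * \<theta>\<^sup>2 - s * s) / n" using 1 assms(1) by (intro divide_right_mono) auto
  ultimately have 2: "m * (s - y\<^sup>2) - Re (z ^ 4) / n \<le> \<bar>m\<bar> * \<theta>\<^sup>2 + ((\<bar>m\<bar> + 6 * \<theta>\<^sup>2 / n) * s - s * s / n)"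
    by (simp add: algebra_simps diff_divide_distrib)
  \<comment> \<open>The summand 1 sets aside the decay -s; the rest is the maximum of b s - s^2 / n,
    attained at s = n b / 2.\<close>
  define b where "b = \<bar>m\<bar> + 6 * \<theta>\<^sup>2 / n + 1"
  have "0 \<le> (2 * s - n * b)\<^sup>2 / (4 * n)" using assms(1) by simp
  also have "\<dots> = s * s / n - b * s + n * b\<^sup>2 / 4" using assms(1) by (simp add: power2_eq_square field_simps)
  finally have "b * s - s * s / n \<le> n * b\<^sup>2 / 4" by simp
  then have "(\<bar>m\<bar> + 6 * \<theta>\<^sup>2 / n) * s - s * s / n \<le> n * b\<^sup>2 / 4 - s" by (simp add: b_def algebra_simps)
  then have 3: "m * (s - y\<^sup>2) - Re (z ^ 4) / n \<le> (\<bar>m\<bar> * \<theta>\<^sup>2 + n * b\<^sup>2 / 4) + - (1 * s)" using 2 by linarith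
  have "cmod (exp (of_real m * z\<^sup>2) * exp (- (z ^ 4) / of_real n)) = exp (m * (s - y\<^sup>2) - Re (z ^ 4) / n)"
    by (simp add: exp_add[symmetric] norm_mult norm_exp_eq_Re sq s_def Re_divide_of_real)
  also have "\<dots> \<le> exp ((\<bar>m\<bar> * \<theta>\<^sup>2 + n * b\<^sup>2 / 4) + - (1 * s))" using 3 by simp
  finally show ?thesis by (simp only: exp_add b_def s_def t_def)
qed

lemma H0_quartic: "n > 0 \<Longrightarrow> (\<lambda>z. exp (of_real m * z\<^sup>2) * exp (- (z ^ 4) / of_real n)) \<in> H0"
  by (rule H0_gaussI[where c=1, OF _ _ quartic_estimate]) (auto intro!: holomorphic_intros)

lemma H0_exp_square: "m > 0 \<Longrightarrow> (\<lambda>z. exp (- of_real m * z\<^sup>2)) \<in> H0"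
  using H0_gauss[OF \<theta>_pos, of m 0] by simp

text \<open>\<eta>_n = exp(-z^4/n) (with n shifted by one) is the product of the Gaussian and a
  function of H0, so \<eta>_n(A) x lies in the range, and it tends to x for x in the dense domain of
  A^2.\<close>

lemma dense_range:
  assumes m: "m > 0"
  shows "closure (range (Phi (\<lambda>z. exp (- of_real m * z\<^sup>2)))) = UNIV"
proof -
  let ?E = "\<lambda>z. exp (- of_real m * z\<^sup>2)"
  define \<eta> where "\<eta> n z = exp (- (z ^ 4) / of_real (real (Suc n)))" for n and z :: complex
  have \<eta>H: "\<eta> n \<in> H0" for n using H0_quartic[of "real (Suc n)" 0] by (simp add: \<eta>_def[abs_def])
  have L: "(\<lambda>n. Phi (\<eta> n) x) \<longlonglongrightarrow> x" if "x \<in> D" "A x \<in> D" for x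
  proof (rule Phi_approx_identity[OF \<eta>H _ _ _ that])
    show "\<eta> n 0 = 1" for n by (simp add: \<eta>_def)
    show "(\<lambda>n. \<eta> n z) \<longlonglongrightarrow> 1" for z
    proof -
      have "(\<lambda>n. - (z ^ 4) * of_real (inverse (real (Suc n)))) \<longlonglongrightarrow> - (z ^ 4) * of_real 0"
        by (intro tendsto_mult tendsto_const tendsto_of_real LIMSEQ_inverse_real_of_nat)
      from tendsto_exp[OF this] show ?thesis by (simp add: \<eta>_def divide_inverse)
    qed
    fix n z assume z: "\<bar>Im z\<bar> = hc"
    define t y where "t = Re z" and "y = Im z"
    have sq: "z\<^sup>2 = Complex (t\<^sup>2 - y\<^sup>2) (2 * t * y)" by (simp add: t_def y_def complex_eq_iff power2_eq_square)
    have "Re (z ^ 4) = (t\<^sup>2 - y\<^sup>2)\<^sup>2 - (2 * t * y)\<^sup>2"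
    proof -
      have "z ^ 4 = z\<^sup>2 * z\<^sup>2" by (simp add: power4_eq_xxxx power2_eq_square mult.assoc)
      then show ?thesis by (simp add: sq) (simp add: power2_eq_square)
    qed
    \<comment> \<open>A square minus a quantity that is constant on the lines: this bounds
      exp(-z^4/n) there uniformly in n.\<close>
    also have "\<dots> = (t\<^sup>2 - 3 * y\<^sup>2)\<^sup>2 - 8 * (y\<^sup>2)\<^sup>2" by (simp add: power2_eq_square algebra_simps)
    finally have "- Re (z ^ 4) \<le> 8 * (y\<^sup>2)\<^sup>2" by simp
    then have "- Re (z ^ 4) / real (Suc n) \<le> 8 * (y\<^sup>2)\<^sup>2 / real (Suc n)" by (rule divide_right_mono) simp
    also have "\<dots> \<le> 8 * (y\<^sup>2)\<^sup>2 / 1" by (intro divide_left_mono) auto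
    finally have "- Re (z ^ 4) / real (Suc n) \<le> 8 * (y\<^sup>2)\<^sup>2" by simp
    moreover have "y\<^sup>2 = hc\<^sup>2" using z by (metis y_def power2_abs)
    moreover have "Re (- (z ^ 4) / of_real (real (Suc n))) = - Re (z ^ 4) / real (Suc n)"
      by (simp only: Re_divide_of_real uminus_complex.sel)
    ultimately show "cmod (\<eta> n z) \<le> exp (8 * (hc\<^sup>2)\<^sup>2)"
      unfolding \<eta>_def norm_exp_eq_Re by (metis exp_le_cancel_iff)
  qed
  have Rg: "Phi (\<eta> n) x \<in> range (Phi ?E)" for n x
  proof -
    let ?q = "\<lambda>z. exp (of_real m * z\<^sup>2) * exp (- (z ^ 4) / of_real (real (Suc n)))"
    have "\<eta> n = (\<lambda>z. ?E z * ?q z)" by (simp add: \<eta>_def fun_eq_iff exp_add[symmetric])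
    then have "Phi (\<eta> n) = Phi ?E o\<^sub>L Phi ?q"
      using Phi_mult[OF H0_exp_square[OF m] H0_quartic[of "real (Suc n)" m]] by simp
    then show ?thesis by simp
  qed
  have "x \<in> closure (range (Phi ?E))" if "x \<in> D" "A x \<in> D" for x
    unfolding closure_sequential using L[OF that] Rg by (intro exI[of _ "\<lambda>n. Phi (\<eta> n) x"]) blast
  then have "{x \<in> D. A x \<in> D} \<subseteq> closure (range (Phi ?E))" by blast
  then have "closure {x \<in> D. A x \<in> D} \<subseteq> closure (range (Phi ?E))" by (simp add: closure_minimal)
  then show ?thesis using dense_D2 by auto
qed

end

section \<open>Strong limits of bounded families\<close>

lemma kind_bounded_subset: "kind_bounded k J T \<Longrightarrow> T' \<subseteq> T \<Longrightarrow> kind_bounded k J T'"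
  by (cases k) (simp_all add: kind_bounded_def op_bounded_def gamma_bounded_def R_bounded_def, (meson subsetD)+)

lemma sets_cgauss: "sets cgauss = sets borel"
  by (simp add: cgauss_def)

lemma sigma_finite_cgauss: "sigma_finite_measure cgauss"
  unfolding cgauss_def by (subst sigma_finite_measure.sigma_finite_iff_density_finite[OF sigma_finite_lborel]) auto

text \<open>Positive and finite, so the moment can be cancelled from the inequality of
  gamma-boundedness for a single vector.\<close>

lemma cgauss_second_moment: "0 < (\<integral>\<^sup>+z. ennreal ((cmod z)\<^sup>2) \<partial>cgauss)" "(\<integral>\<^sup>+z. ennreal ((cmod z)\<^sup>2) \<partial>cgauss) < \<infinity>"
proof -
  have eq: "(\<integral>\<^sup>+z. ennreal ((cmod z)\<^sup>2) \<partial>cgauss) = (\<integral>\<^sup>+z. ennreal (exp (- (cmod z)\<^sup>2) / pi) * ennreal ((cmod z)\<^sup>2) \<partial>lborel)"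
    unfolding cgauss_def by (rule nn_integral_density) measurable
  have "\<not> (AE z in (lborel :: complex measure). ennreal (exp (- (cmod z)\<^sup>2) / pi) * ennreal ((cmod z)\<^sup>2) = 0)"
  proof
    assume "AE z in (lborel :: complex measure). ennreal (exp (- (cmod z)\<^sup>2) / pi) * ennreal ((cmod z)\<^sup>2) = 0"
    then have "AE z in (lborel :: complex measure). z = 0"
      by eventually_elim (use pi_gt_zero in \<open>auto simp: ennreal_mult[symmetric] ennreal_eq_0_iff mult_le_0_iff divide_le_0_iff\<close>)
    moreover have "AE z in (lborel :: complex measure). z \<noteq> 0" by (rule AE_lborel_singleton)
    ultimately have "AE z in (lborel :: complex measure). False" by eventually_elim auto
    then show False by (simp add: eventually_False ae_filter_eq_bot_iff emeasure_lborel_UNIV)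
  qed
  then show "0 < (\<integral>\<^sup>+z. ennreal ((cmod z)\<^sup>2) \<partial>cgauss)"
    unfolding eq zero_less_iff_neq_zero by (subst nn_integral_0_iff_AE) auto
  \<comment> \<open>\<open>r\<^sup>2 \<le> 2 * exp (r\<^sup>2 / 2)\<close> gives up half of the
    exponent and leaves a product of one-dimensional Gaussians.\<close>
  have le: "ennreal (exp (- (cmod z)\<^sup>2) / pi) * ennreal ((cmod z)\<^sup>2) \<le> ennreal (2 / pi) * (\<Prod>b\<in>Basis. ennreal (exp (- ((z \<bullet> b)\<^sup>2 / 2))))" for z
  proof -
    have "(cmod z)\<^sup>2 / 2 \<le> exp ((cmod z)\<^sup>2 / 2)" using exp_ge_add_one_self[of "(cmod z)\<^sup>2 / 2"] by linarith
    then have "exp (- (cmod z)\<^sup>2) * (cmod z)\<^sup>2 \<le> exp (- (cmod z)\<^sup>2) * (2 * exp ((cmod z)\<^sup>2 / 2))"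
      by (intro mult_left_mono) auto
    also have "\<dots> = 2 * exp (- ((cmod z)\<^sup>2 / 2))" by (simp add: exp_add[symmetric])
    also have "exp (- ((cmod z)\<^sup>2 / 2)) = exp (- ((Re z)\<^sup>2 / 2)) * exp (- ((Im z)\<^sup>2 / 2))"
      by (simp add: cmod_power2 exp_add[symmetric] add_divide_distrib)
    finally have "exp (- (cmod z)\<^sup>2) / pi * (cmod z)\<^sup>2 \<le> 2 / pi * (exp (- ((Re z)\<^sup>2 / 2)) * exp (- ((Im z)\<^sup>2 / 2)))"
      by (simp add: divide_right_mono)
    moreover have "(\<Prod>b\<in>Basis. ennreal (exp (- ((z \<bullet> b)\<^sup>2 / 2)))) = ennreal (exp (- ((Re z)\<^sup>2 / 2)) * exp (- ((Im z)\<^sup>2 / 2)))"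
      by (simp add: Basis_complex_def inner_complex_def ennreal_mult)
    ultimately show ?thesis by (simp add: ennreal_mult[symmetric] ennreal_leI)
  qed
  have "(\<integral>\<^sup>+z. ennreal ((cmod z)\<^sup>2) \<partial>cgauss) \<le> (\<integral>\<^sup>+z. ennreal (2 / pi) * (\<Prod>b\<in>Basis. ennreal (exp (- ((z \<bullet> b)\<^sup>2 / 2)))) \<partial>(lborel :: complex measure))"
    unfolding eq by (intro nn_integral_mono le)
  also have "\<dots> = ennreal (2 / pi) * (\<integral>\<^sup>+z. (\<Prod>b\<in>Basis. ennreal (exp (- ((z \<bullet> b)\<^sup>2 / 2)))) \<partial>(lborel :: complex measure))"
    by (rule nn_integral_cmult) measurable
  also have "(\<integral>\<^sup>+z. (\<Prod>b\<in>Basis. ennreal (exp (- ((z \<bullet> b)\<^sup>2 / 2)))) \<partial>(lborel :: complex measure))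
     = (\<Prod>b\<in>(Basis :: complex set). (\<integral>\<^sup>+x. ennreal (exp (- (x\<^sup>2 / 2))) \<partial>lborel))"
    by (rule nn_integral_lborel_prod) auto
  finally have "(\<integral>\<^sup>+z. ennreal ((cmod z)\<^sup>2) \<partial>cgauss) \<le> ennreal (2 / pi) * (\<Prod>b\<in>(Basis :: complex set). (\<integral>\<^sup>+x. ennreal (exp (- (x\<^sup>2 / 2))) \<partial>lborel))" .
  moreover have "(\<integral>\<^sup>+x. ennreal (exp (- ((x::real)\<^sup>2 / 2))) \<partial>lborel) < \<infinity>"
  proof -
    have "integrable lborel (\<lambda>x::real. exp (- (x\<^sup>2 / 2)))"
    proof (rule Bochner_Integration.integrable_bound[OF integrable_inverse_one_plus_square[of 2]])
      have "exp (- (1/2 * x\<^sup>2)) \<le> 2 / (1 + x\<^sup>2)" for x :: real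
      proof -
        have "exp (- (1/2 * x\<^sup>2)) \<le> 1 / (1 + 1/2 * x\<^sup>2)" by (rule exp_neg_square_le) simp
        also have "\<dots> \<le> 1 / ((1 + x\<^sup>2) / 2)"
          by (intro divide_left_mono mult_pos_pos add_pos_nonneg) (auto simp: field_simps)
        finally show ?thesis by simp
      qed
      then show "AE x::real in lborel. norm (exp (- (x\<^sup>2 / 2))) \<le> norm (2 / (1 + x\<^sup>2))"
        by (auto intro!: AE_I2)
    qed measurable
    then show ?thesis by (simp add: nn_integral_eq_integral)
  qed
  ultimately show "(\<integral>\<^sup>+z. ennreal ((cmod z)\<^sup>2) \<partial>cgauss) < \<infinity>"
    by (auto simp: ennreal_mult_less_top Basis_complex_def elim!: le_less_trans)
qed

context cstruct
begin

text \<open>Since X may be nonseparable, measurability is not assembled from X-valued summands: the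
  scalar function of g is continuous on the full countable product, whose product sigma-algebra is
  the Borel one.\<close>

lemma gauss_sum_measurable:
  "(\<lambda>g. ennreal ((norm (\<Sum>j<n. g j \<odot> y j))\<^sup>2)) \<in> borel_measurable (PiM {..<n::nat} (\<lambda>_. cgauss))"
proof -
  have "continuous_on UNIV (\<lambda>g::nat \<Rightarrow> complex. (norm (\<Sum>j<n. g j \<odot> y j))\<^sup>2)"
    by (intro continuous_intros continuous_on_power continuous_on_norm continuous_on_sum sc.continuous_on continuous_on_product_coordinates)
  then have "(\<lambda>g::nat \<Rightarrow> complex. (norm (\<Sum>j<n. g j \<odot> y j))\<^sup>2) \<in> borel_measurable borel"
    by (rule borel_measurable_continuous_onI)
  then have m: "(\<lambda>g::nat \<Rightarrow> complex. (norm (\<Sum>j<n. g j \<odot> y j))\<^sup>2) \<in> borel_measurable (PiM UNIV (\<lambda>_. borel))"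
    by (simp cong: measurable_cong_sets add: sets_PiM_equal_borel)
  \<comment> \<open>Extension by 0 embeds the finite product into the full one.\<close>
  have "(\<lambda>g i. if i < n then g i else 0) \<in> measurable (PiM {..<n} (\<lambda>_. borel)) (PiM UNIV (\<lambda>_::nat. borel :: complex measure))"
  proof (rule measurable_PiM_single')
    show "(\<lambda>g. if i < n then g i else 0) \<in> measurable (PiM {..<n} (\<lambda>_. borel)) (borel :: complex measure)" for i
      by (cases "i < n") (auto intro: measurable_component_singleton)
  qed auto
  from measurable_compose[OF this m]
  have "(\<lambda>g. (norm (\<Sum>j<n. g j \<odot> y j))\<^sup>2) \<in> borel_measurable (PiM {..<n} (\<lambda>_. borel))" by simp
  moreover have "sets (PiM {..<n} (\<lambda>_. cgauss)) = sets (PiM {..<n} (\<lambda>_. borel))"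
    by (rule sets_PiM_cong) (auto simp: sets_cgauss)
  ultimately show ?thesis by (simp cong: measurable_cong_sets)
qed

text \<open>The case of one vector: both averages are the squared norm times a constant, the number
  of signs or the second moment, and the constant cancels.\<close>

lemma kind_bounded_imp_op_bounded:
  assumes "kind_bounded k J T"
  obtains C where "C > 0" "\<And>S x. S \<in> T \<Longrightarrow> norm (S x) \<le> C * norm x"
proof -
  have "\<exists>C. \<forall>S\<in>T. \<forall>x. norm (S x) \<le> C * norm x"
  proof (cases k)
    case Bdd
    then show ?thesis using assms by (simp add: kind_bounded_def op_bounded_def)
  next
    case Gamma
    define m where "m = (\<integral>\<^sup>+z. ennreal ((cmod z)\<^sup>2) \<partial>cgauss)"
    have m: "0 < m" "m < \<infinity>" using cgauss_second_moment by (auto simp: m_def)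
    have "gamma_bounded J T" using assms Gamma by (simp add: kind_bounded_def)
    then obtain C where C: "\<forall>n (S :: nat \<Rightarrow> 'a \<Rightarrow> 'a) (x :: nat \<Rightarrow> 'a). (\<forall>j<n. S j \<in> T) \<longrightarrow>
     (\<integral>\<^sup>+ g. ennreal ((norm (\<Sum>j<n. g j \<odot> S j (x j)))\<^sup>2) \<partial>(PiM {..<n} (\<lambda>_. cgauss)))
     \<le> ennreal (C\<^sup>2) * (\<integral>\<^sup>+ g. ennreal ((norm (\<Sum>j<n. g j \<odot> x j))\<^sup>2) \<partial>(PiM {..<n} (\<lambda>_. cgauss)))"
      unfolding gamma_bounded_def by blast
    interpret product_sigma_finite "\<lambda>_::nat. cgauss"
      by (rule product_sigma_finite.intro) (rule sigma_finite_cgauss)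
    have I: "(\<integral>\<^sup>+ g. ennreal ((norm (\<Sum>j<1::nat. g j \<odot> y))\<^sup>2) \<partial>(PiM {..<1} (\<lambda>_. cgauss))) = ennreal ((norm y)\<^sup>2) * m" for y
    proof -
      have "(\<integral>\<^sup>+ g. ennreal ((norm (\<Sum>j<1::nat. g j \<odot> y))\<^sup>2) \<partial>(PiM {..<1} (\<lambda>_. cgauss)))
         = (\<integral>\<^sup>+ g. (\<lambda>z. ennreal ((norm y)\<^sup>2) * ennreal ((cmod z)\<^sup>2)) (g 0) \<partial>(PiM {0::nat} (\<lambda>_. cgauss)))"
        by (simp add: lessThan_Suc power_mult_distrib ennreal_mult[symmetric] mult.commute)
      also have "\<dots> = (\<integral>\<^sup>+z. ennreal ((norm y)\<^sup>2) * ennreal ((cmod z)\<^sup>2) \<partial>cgauss)"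
        by (rule product_nn_integral_singleton) (simp add: sets_cgauss cong: measurable_cong_sets)
      also have "\<dots> = ennreal ((norm y)\<^sup>2) * m"
        unfolding m_def by (rule nn_integral_cmult) (simp add: sets_cgauss cong: measurable_cong_sets)
      finally show ?thesis .
    qed
    have "norm (S x) \<le> \<bar>C\<bar> * norm x" if "S \<in> T" for S x
    proof -
      have "ennreal ((norm (S x))\<^sup>2) * m \<le> ennreal (C\<^sup>2) * (ennreal ((norm x)\<^sup>2) * m)"
        using C[rule_format, of 1 "\<lambda>_. S" "\<lambda>_. x"] that unfolding I by simp
      then have "m * ennreal ((norm (S x))\<^sup>2) \<le> m * ennreal (C\<^sup>2 * (norm x)\<^sup>2)"
        by (simp add: ennreal_mult mult_ac)
      then have "ennreal ((norm (S x))\<^sup>2) \<le> ennreal (C\<^sup>2 * (norm x)\<^sup>2)"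
        using m by (subst (asm) ennreal_mult_le_mult_iff) auto
      then have "(norm (S x))\<^sup>2 \<le> (\<bar>C\<bar> * norm x)\<^sup>2" by (simp add: power_mult_distrib)
      then show ?thesis by (rule power2_le_imp_le) simp
    qed
    then show ?thesis by blast
  next
    case Rad
    let ?E = "PiE {..<1::nat} (\<lambda>_. {-1, 1::real})"
    have "R_bounded T" using assms Rad by (simp add: kind_bounded_def)
    then obtain C where C: "\<forall>n (S :: nat \<Rightarrow> 'a \<Rightarrow> 'a) (x :: nat \<Rightarrow> 'a). (\<forall>j<n. S j \<in> T) \<longrightarrow>
     (\<Sum>\<epsilon>\<in>PiE {..<n} (\<lambda>_. {-1, 1::real}). (norm (\<Sum>j<n. \<epsilon> j *\<^sub>R S j (x j)))\<^sup>2)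
     \<le> C\<^sup>2 * (\<Sum>\<epsilon>\<in>PiE {..<n} (\<lambda>_. {-1, 1::real}). (norm (\<Sum>j<n. \<epsilon> j *\<^sub>R x j))\<^sup>2)"
      unfolding R_bounded_def by blast
    have fin: "finite ?E" by (intro finite_PiE) auto
    have ne: "?E \<noteq> {}" by (simp add: PiE_eq_empty_iff)
    have I: "(\<Sum>\<epsilon>\<in>?E. (norm (\<Sum>j<1::nat. \<epsilon> j *\<^sub>R y))\<^sup>2) = real (card ?E) * (norm y)\<^sup>2" for y :: 'a
    proof -
      have "(norm (\<Sum>j<1::nat. \<epsilon> j *\<^sub>R y))\<^sup>2 = (norm y)\<^sup>2" if "\<epsilon> \<in> ?E" for \<epsilon>
      proof -
        have "\<epsilon> 0 = -1 \<or> \<epsilon> 0 = 1" using that by (auto dest: PiE_mem[of _ _ _ 0])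
        then show ?thesis by auto
      qed
      then have "(\<Sum>\<epsilon>\<in>?E. (norm (\<Sum>j<1::nat. \<epsilon> j *\<^sub>R y))\<^sup>2) = (\<Sum>\<epsilon>\<in>?E. (norm y)\<^sup>2)"
        by (intro sum.cong refl)
      then show ?thesis by (simp only: sum_constant)
    qed
    have "norm (S x) \<le> \<bar>C\<bar> * norm x" if "S \<in> T" for S x
    proof -
      have "real (card ?E) * (norm (S x))\<^sup>2 \<le> C\<^sup>2 * (real (card ?E) * (norm x)\<^sup>2)"
        using C[rule_format, of 1 "\<lambda>_. S" "\<lambda>_. x"] that unfolding I by simp
      then have "real (card ?E) * (norm (S x))\<^sup>2 \<le> real (card ?E) * (C\<^sup>2 * (norm x)\<^sup>2)" by (simp add: mult_ac)
      then have "(norm (S x))\<^sup>2 \<le> (\<bar>C\<bar> * norm x)\<^sup>2"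
        using fin ne by (subst (asm) mult_le_cancel_left_pos) (auto simp: card_gt_0_iff power_mult_distrib)
      then show ?thesis by (rule power2_le_imp_le) simp
    qed
    then show ?thesis by blast
  qed
  then obtain C where C: "\<And>S x. S \<in> T \<Longrightarrow> norm (S x) \<le> C * norm x" by blast
  show ?thesis
  proof (rule that[of "\<bar>C\<bar> + 1"])
    show "norm (S x) \<le> (\<bar>C\<bar> + 1) * norm x" if "S \<in> T" for S x
      by (rule order_trans[OF C[OF that] mult_right_mono]) auto
  qed simp
qed

text \<open>For Rademacher sums the limit is taken in a finite sum, for Gaussian sums by Fatou's
  lemma. The factor c allows approximants that lie in the bounded set only after rescaling.\<close>

lemma kind_bounded_limit:
  assumes T: "kind_bounded k J T"
    and lim: "\<And>S. S \<in> T' \<Longrightarrow> \<exists>U. (\<forall>n. U n \<in> T) \<and> (\<forall>x. (\<lambda>n. c *\<^sub>R U n x) \<longlonglongrightarrow> S x)"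
  shows "kind_bounded k J T'"
proof -
  obtain U where U: "\<And>S n. S \<in> T' \<Longrightarrow> U S n \<in> T" "\<And>S x. S \<in> T' \<Longrightarrow> (\<lambda>n. c *\<^sub>R U S n x) \<longlonglongrightarrow> S x"
    using lim by metis
  show ?thesis
  proof (cases k)
    case Bdd
    then obtain C where C: "\<And>S x. S \<in> T \<Longrightarrow> norm (S x) \<le> C * norm x"
      using T by (auto simp: kind_bounded_def op_bounded_def)
    have "norm (S x) \<le> (\<bar>c\<bar> * C) * norm x" if "S \<in> T'" for S x
    proof (rule LIMSEQ_le_const2[OF tendsto_norm[OF U(2)[OF that]]], intro exI allI impI)
      fix n
      show "norm (c *\<^sub>R U S n x) \<le> \<bar>c\<bar> * C * norm x"
        using C[OF U(1)[OF that, of n], of x] by (simp add: mult.assoc mult_left_mono)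
    qed
    then show ?thesis using Bdd by (auto simp: kind_bounded_def op_bounded_def)
  next
    case Rad
    have "R_bounded T" using T Rad by (simp add: kind_bounded_def)
    then obtain C where C: "\<forall>n (S :: nat \<Rightarrow> 'a \<Rightarrow> 'a) (x :: nat \<Rightarrow> 'a). (\<forall>j<n. S j \<in> T) \<longrightarrow>
     (\<Sum>\<epsilon>\<in>PiE {..<n} (\<lambda>_. {-1, 1::real}). (norm (\<Sum>j<n. \<epsilon> j *\<^sub>R S j (x j)))\<^sup>2)
     \<le> C\<^sup>2 * (\<Sum>\<epsilon>\<in>PiE {..<n} (\<lambda>_. {-1, 1::real}). (norm (\<Sum>j<n. \<epsilon> j *\<^sub>R x j))\<^sup>2)"
      unfolding R_bounded_def by blast
    have "R_bounded T'"
      unfolding R_bounded_def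
    proof (intro exI[of _ "c * C"] allI impI)
      fix n :: nat and S :: "nat \<Rightarrow> 'a \<Rightarrow> 'a" and x :: "nat \<Rightarrow> 'a"
      assume S: "\<forall>j<n. S j \<in> T'"
      let ?E = "PiE {..<n} (\<lambda>_. {-1, 1::real})"
      have "(\<lambda>m. \<Sum>\<epsilon>\<in>?E. (norm (\<Sum>j<n. \<epsilon> j *\<^sub>R (c *\<^sub>R U (S j) m (x j))))\<^sup>2) \<longlonglongrightarrow> (\<Sum>\<epsilon>\<in>?E. (norm (\<Sum>j<n. \<epsilon> j *\<^sub>R S j (x j)))\<^sup>2)"
        using S by (intro tendsto_sum tendsto_power tendsto_norm tendsto_scaleR tendsto_const U(2)) auto
      then show "(\<Sum>\<epsilon>\<in>?E. (norm (\<Sum>j<n. \<epsilon> j *\<^sub>R S j (x j)))\<^sup>2) \<le> (c * C)\<^sup>2 * (\<Sum>\<epsilon>\<in>?E. (norm (\<Sum>j<n. \<epsilon> j *\<^sub>R x j))\<^sup>2)"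
      proof (rule LIMSEQ_le_const2, intro exI allI impI)
        fix m
        have e: "(norm (\<Sum>j<n. \<epsilon> j *\<^sub>R (c *\<^sub>R U (S j) m (x j))))\<^sup>2 = c\<^sup>2 * (norm (\<Sum>j<n. \<epsilon> j *\<^sub>R U (S j) m (x j)))\<^sup>2" for \<epsilon>
        proof -
          have "(\<Sum>j<n. \<epsilon> j *\<^sub>R (c *\<^sub>R U (S j) m (x j))) = c *\<^sub>R (\<Sum>j<n. \<epsilon> j *\<^sub>R U (S j) m (x j))"
            by (simp add: scaleR_sum_right mult.commute)
          then show ?thesis by (simp add: power_mult_distrib)
        qed
        have "c\<^sup>2 * (\<Sum>\<epsilon>\<in>?E. (norm (\<Sum>j<n. \<epsilon> j *\<^sub>R U (S j) m (x j)))\<^sup>2) \<le> c\<^sup>2 * (C\<^sup>2 * (\<Sum>\<epsilon>\<in>?E. (norm (\<Sum>j<n. \<epsilon> j *\<^sub>R x j))\<^sup>2))"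
          using S U(1) by (intro mult_left_mono C[rule_format]) auto
        then show "(\<Sum>\<epsilon>\<in>?E. (norm (\<Sum>j<n. \<epsilon> j *\<^sub>R (c *\<^sub>R U (S j) m (x j))))\<^sup>2) \<le> (c * C)\<^sup>2 * (\<Sum>\<epsilon>\<in>?E. (norm (\<Sum>j<n. \<epsilon> j *\<^sub>R x j))\<^sup>2)"
          unfolding e sum_distrib_left[symmetric] power_mult_distrib mult.assoc .
      qed
    qed
    then show ?thesis using Rad by (simp add: kind_bounded_def)
  next
    case Gamma
    have "gamma_bounded J T" using T Gamma by (simp add: kind_bounded_def)
    then obtain C where C: "\<forall>n (S :: nat \<Rightarrow> 'a \<Rightarrow> 'a) (x :: nat \<Rightarrow> 'a). (\<forall>j<n. S j \<in> T) \<longrightarrow>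
     (\<integral>\<^sup>+ g. ennreal ((norm (\<Sum>j<n. g j \<odot> S j (x j)))\<^sup>2) \<partial>(PiM {..<n} (\<lambda>_. cgauss)))
     \<le> ennreal (C\<^sup>2) * (\<integral>\<^sup>+ g. ennreal ((norm (\<Sum>j<n. g j \<odot> x j))\<^sup>2) \<partial>(PiM {..<n} (\<lambda>_. cgauss)))"
      unfolding gamma_bounded_def by blast
    have "gamma_bounded J T'"
      unfolding gamma_bounded_def
    proof (intro exI[of _ "c * C"] allI impI)
      fix n :: nat and S :: "nat \<Rightarrow> 'a \<Rightarrow> 'a" and x :: "nat \<Rightarrow> 'a"
      assume S: "\<forall>j<n. S j \<in> T'"
      let ?P = "PiM {..<n} (\<lambda>_. cgauss)"
      let ?R = "\<integral>\<^sup>+ g. ennreal ((norm (\<Sum>j<n. g j \<odot> x j))\<^sup>2) \<partial>?P"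
      let ?f = "\<lambda>m g. ennreal ((norm (\<Sum>j<n. g j \<odot> (c *\<^sub>R U (S j) m (x j))))\<^sup>2)"
      have lim: "(\<lambda>m. ?f m g) \<longlonglongrightarrow> ennreal ((norm (\<Sum>j<n. g j \<odot> S j (x j)))\<^sup>2)" for g
        using S by (intro tendsto_ennrealI tendsto_sum tendsto_power tendsto_norm sc.tendsto tendsto_const U(2)) auto
      have bd: "(\<integral>\<^sup>+g. ?f m g \<partial>?P) \<le> ennreal ((c * C)\<^sup>2) * ?R" for m
      proof -
        have e: "?f m g = ennreal (c\<^sup>2) * ennreal ((norm (\<Sum>j<n. g j \<odot> U (S j) m (x j)))\<^sup>2)" for g
        proof -
          have "(\<Sum>j<n. g j \<odot> (c *\<^sub>R U (S j) m (x j))) = c *\<^sub>R (\<Sum>j<n. g j \<odot> U (S j) m (x j))"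
            by (simp add: scaleR_sum_right sc.scaleR_right)
          then show ?thesis by (simp add: power_mult_distrib ennreal_mult[symmetric])
        qed
        have "(\<integral>\<^sup>+g. ?f m g \<partial>?P) = ennreal (c\<^sup>2) * (\<integral>\<^sup>+g. ennreal ((norm (\<Sum>j<n. g j \<odot> U (S j) m (x j)))\<^sup>2) \<partial>?P)"
          unfolding e by (rule nn_integral_cmult[OF gauss_sum_measurable])
        also have "\<dots> \<le> ennreal (c\<^sup>2) * (ennreal (C\<^sup>2) * ?R)"
          using S U(1) by (intro mult_left_mono C[rule_format]) auto
        finally show ?thesis by (simp add: power_mult_distrib ennreal_mult mult.assoc)
      qed
      \<comment> \<open>Fatou: the integrand converges for every g, hence equals its lower
        limit.\<close>
      have "(\<integral>\<^sup>+ g. ennreal ((norm (\<Sum>j<n. g j \<odot> S j (x j)))\<^sup>2) \<partial>?P) = (\<integral>\<^sup>+ g. liminf (\<lambda>m. ?f m g) \<partial>?P)"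
        by (intro nn_integral_cong) (simp add: lim_imp_Liminf[OF _ lim])
      also have "\<dots> \<le> liminf (\<lambda>m. \<integral>\<^sup>+g. ?f m g \<partial>?P)"
        by (rule nn_integral_liminf) (rule gauss_sum_measurable)
      also have "\<dots> \<le> ennreal ((c * C)\<^sup>2) * ?R"
        by (rule Liminf_le) (use bd in auto)
      finally show "(\<integral>\<^sup>+ g. ennreal ((norm (\<Sum>j<n. g j \<odot> S j (x j)))\<^sup>2) \<partial>?P) \<le> ennreal ((c * C)\<^sup>2) * ?R" .
    qed
    then show ?thesis using Gamma by (simp add: kind_bounded_def)
  qed
qed

end

section \<open>From the Hoermander calculus to the elementary calculus\<close>

context weight
begin

lemma Wle_zero: "c \<ge> 0 \<Longrightarrow> Wle (\<lambda>z. 0) c"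
  using Wle_mono[OF Wle_scale[OF KG(2)[of 0], of 0], of c] by simp

lemma Hle_add: "Hle f c \<Longrightarrow> Hle g d \<Longrightarrow> c > 0 \<Longrightarrow> d > 0 \<Longrightarrow> Hle (\<lambda>z. f z + g z) (c + d)"
  unfolding Hle_def by (simp add: distrib_left Wle_add)

lemma hor_space_add: "f \<in> hor_space v w \<Longrightarrow> g \<in> hor_space v w \<Longrightarrow> (\<lambda>z. f z + g z) \<in> hor_space v w"
  by (elim hor_space_Hle) (auto intro: hor_spaceI[OF Hle_add])

lemma hor_space_scale: "f \<in> hor_space v w \<Longrightarrow> (\<lambda>z. a * f z) \<in> hor_space v w"
  by (elim hor_space_Hle) (auto intro: hor_spaceI[OF Hle_scale])

lemma hor_space_zero: "(\<lambda>z. 0) \<in> hor_space v w"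
  by (rule hor_spaceI[of _ 0]) (auto simp: Hle_def Wle_zero)

text \<open>With \<open>res_rep\<close> inserted, Cauchy's formula writes \<psi> as an integral of
  elements of W to which \<open>Wle_rsum\<close> applies: the decay of \<psi> along the lines is the
  decay in s, and the margin w < h gives the decay in r. In particular H0 is contained in W.\<close>

lemma H0_Cauchy_rsum:
  assumes \<psi>: "\<psi> \<in> H0_infty \<theta>" and h: "w < h" "h < \<theta>"
  defines "H \<equiv> \<lambda>s z. 1 / (2 * complex_of_real pi * \<i>) * (\<psi> (Complex s (-h)) / (Complex s (-h) - z) - \<psi> (Complex s h) / (Complex s h - z))"
  shows "\<exists>c>0. Wle \<psi> c"
    and "e > 0 \<Longrightarrow> eventually (\<lambda>n. Wle (\<lambda>z. rsum n (\<lambda>s. H s z) - \<psi> z) e) sequentially"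
proof -
  have h0: "h > 0" using h w_nonneg by linarith
  have \<theta>: "\<theta> > 0" using h h0 by linarith
  define c where "c = 1 / (2 * complex_of_real pi * \<i>)"
  obtain C where C: "C > 0" "\<And>z. z \<in> strip \<theta> \<Longrightarrow> cmod (\<psi> z) \<le> C / (1 + (Re z)\<^sup>2)" using H0_decay[OF \<psi>] by blast
  obtain K where K: "K > 0" "\<And>s. wt s * exp (- (h * \<bar>s\<bar>)) \<le> K / (1 + s\<^sup>2)" using wt_le_exp[OF h(1)] by blast
  have lc: "continuous_on UNIV (\<lambda>t. \<psi> (Complex t y))" if "\<bar>y\<bar> = h" for y
    by (rule continuous_on_compose2[OF holomorphic_on_imp_continuous_on[OF H0_holomorphic[OF \<psi>]]])
       (use that h in \<open>auto simp: Complex_line strip_pos[OF \<theta>] intro!: continuous_intros\<close>)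
  have c1: "continuous_on UNIV (\<lambda>t. \<psi> (Complex t (-h)))" "continuous_on UNIV (\<lambda>t. \<psi> (Complex t h))"
    using lc h0 by auto
  have [measurable]: "(\<lambda>t. \<psi> (Complex t (-h))) \<in> borel_measurable borel" "(\<lambda>t. \<psi> (Complex t h)) \<in> borel_measurable borel"
    using c1 by (auto intro: borel_measurable_continuous_onI)
  define k where "k s r = c * (\<psi> (Complex s (-h)) * res_rep (Complex s (-h)) r - \<psi> (Complex s h) * res_rep (Complex s h) r)" for s r
  \<comment> \<open>On each line the sign of the imaginary part is fixed, so the case distinction in
    \<open>res_rep\<close> disappears; continuity in s and joint measurability become
    visible.\<close>
  have rr: "res_rep (Complex s h) r = - \<i> * indicator {0<..} r * exp (\<i> * (of_real s + \<i> * of_real h) * of_real r)"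
    "res_rep (Complex s (-h)) r = \<i> * indicator {..<0} r * exp (\<i> * (of_real s + \<i> * of_real (-h)) * of_real r)" for s r
    using h0 by (auto simp: res_rep_def Complex_line)
  have km: "(\<lambda>(s, r). k s r) \<in> borel_measurable (borel \<Otimes>\<^sub>M borel)"
    unfolding k_def rr by measurable
  have kc: "continuous_on UNIV (\<lambda>s. k s r)" for r
    unfolding k_def rr by (intro continuous_intros c1)
  have kb: "wt r * cmod (k s r) \<le> (cmod c * (2 * C) * K) / (1 + r\<^sup>2) / (1 + s\<^sup>2)" for s r
  proof -
    have b: "cmod (\<psi> (Complex s y) * res_rep (Complex s y) r) \<le> C / (1 + s\<^sup>2) * exp (- (h * \<bar>r\<bar>))" if "\<bar>y\<bar> = h" for y
      unfolding norm_mult using C(2)[of "Complex s y"] norm_res_rep[of "Complex s y" r] that h C(1)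
      by (intro mult_mono) (auto simp: strip_pos[OF \<theta>])
    have "cmod (k s r) \<le> cmod c * (C / (1 + s\<^sup>2) * exp (- (h * \<bar>r\<bar>)) + C / (1 + s\<^sup>2) * exp (- (h * \<bar>r\<bar>)))"
      unfolding k_def norm_mult[of c] using h0
      by (intro mult_left_mono order_trans[OF norm_triangle_ineq4] add_mono b) auto
    then have "wt r * cmod (k s r) \<le> wt r * (cmod c * (C / (1 + s\<^sup>2) * exp (- (h * \<bar>r\<bar>)) + C / (1 + s\<^sup>2) * exp (- (h * \<bar>r\<bar>))))"
      using wt_pos[of r] by (intro mult_left_mono) auto
    also have "\<dots> = (cmod c * (2 * C) / (1 + s\<^sup>2)) * (wt r * exp (- (h * \<bar>r\<bar>)))" by (simp add: algebra_simps)
    also have "\<dots> \<le> (cmod c * (2 * C) / (1 + s\<^sup>2)) * (K / (1 + r\<^sup>2))" using C(1) by (intro mult_left_mono K) auto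
    finally show ?thesis by (simp add: mult_ac)
  qed
  have kK: "cmod c * (2 * C) * K > 0" using C K by (simp add: c_def norm_divide norm_mult)
  have Hk: "H s z = (LINT r|lborel. exp (- \<i> * z * of_real r) * k s r)" if z: "z \<in> strip w" for s z
  proof -
    have zi: "\<bar>Im z\<bar> < \<bar>Im (Complex s h)\<bar>" "\<bar>Im z\<bar> < \<bar>Im (Complex s (-h))\<bar>" using strip_Im_le[OF z w_nonneg] h h0 by auto
    have "has_bochner_integral lborel (\<lambda>r. c * (\<psi> (Complex s (-h)) * (exp (- \<i> * z * of_real r) * res_rep (Complex s (-h)) r)
        - \<psi> (Complex s h) * (exp (- \<i> * z * of_real r) * res_rep (Complex s h) r)))
      (c * (\<psi> (Complex s (-h)) * (1 / (Complex s (-h) - z)) - \<psi> (Complex s h) * (1 / (Complex s h - z))))"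
      by (intro has_bochner_integral_mult_right has_bochner_integral_diff res_rep_Fourier zi)
    moreover have "c * (\<psi> (Complex s (-h)) * (exp (- \<i> * z * of_real r) * res_rep (Complex s (-h)) r)
        - \<psi> (Complex s h) * (exp (- \<i> * z * of_real r) * res_rep (Complex s h) r)) = exp (- \<i> * z * of_real r) * k s r" for r
      by (simp only: k_def right_diff_distrib mult_ac)
    ultimately have "has_bochner_integral lborel (\<lambda>r. exp (- \<i> * z * of_real r) * k s r)
      (c * (\<psi> (Complex s (-h)) * (1 / (Complex s (-h) - z)) - \<psi> (Complex s h) * (1 / (Complex s h - z))))" by simp
    then show ?thesis by (simp add: has_bochner_integral_iff H_def c_def)
  qed
  have HI: "(LINT s|lborel. H s z) = \<psi> z" if z: "z \<in> strip w" for z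
  proof -
    have zi: "\<bar>Im z\<bar> < h" using strip_Im_le[OF z w_nonneg] h by linarith
    let ?f = "\<lambda>s. \<psi> (Complex s (-h)) / (Complex s (-h) - z) - \<psi> (Complex s h) / (Complex s h - z)"
    note ck = Cauchy_kernel[OF \<psi> h(2) zi C]
    have [measurable]: "?f \<in> borel_measurable borel" by (rule borel_measurable_continuous_onI[OF ck(1)])
    have fi: "integrable lborel ?f"
      by (rule Bochner_Integration.integrable_bound[OF integrable_inverse_one_plus_square[of "2 * C / (h - \<bar>Im z\<bar>)"]])
         (auto intro!: AE_I2 order_trans[OF ck(2)] simp del: abs_divide)
    have "(LINT s|lborel. H s z) = c * (LINT s|lborel. ?f s)" unfolding H_def c_def by (rule integral_mult_right_zero)
    also have "(LINT s|lborel. ?f s) = 2 * pi * \<i> * \<psi> z"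
      using Cauchy_strip[OF \<psi> h(2) zi] integral_lborel[OF fi] by simp
    finally show ?thesis by (simp add: c_def)
  qed
  have "\<exists>c>0. Wle (\<lambda>z. LINT s|lborel. H s z) c" by (rule Wle_rsum(1)[OF km kc kb kK Hk])
  then obtain c0 where c0: "c0 > 0" "Wle (\<lambda>z. LINT s|lborel. H s z) c0" by blast
  have "Wle \<psi> c0" by (rule Wle_cong[OF c0(2) HI])
  then show "\<exists>c>0. Wle \<psi> c" using c0(1) by blast
  assume e: "e > 0"
  have "eventually (\<lambda>n. Wle (\<lambda>z. rsum n (\<lambda>s. H s z) - (LINT s|lborel. H s z)) e) sequentially"
    by (rule Wle_rsum(2)[OF km kc kb kK _ e]) (rule Hk)
  then show "eventually (\<lambda>n. Wle (\<lambda>z. rsum n (\<lambda>s. H s z) - \<psi> z) e) sequentially"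
    by eventually_elim (rule Wle_cong, assumption, simp add: HI)
qed

end

text \<open>(x, y) belongs to the graph exactly when R (l x - y) = x, and this condition is
  closed.\<close>

lemma closed_op_if_resolvent:
  fixes J :: "'a::banach \<Rightarrow> 'a"
  assumes "cstruct J" "is_resolvent J D A l R"
  shows "closed_op D A"
proof -
  interpret cstruct J by fact
  show ?thesis unfolding closed_op_def closed_sequential_limits
  proof (intro allI impI, elim conjE)
    fix p :: "nat \<Rightarrow> 'a \<times> 'a" and q
    assume p: "\<forall>n. p n \<in> {(x, A x) |x. x \<in> D}" "p \<longlonglongrightarrow> q"
    define x y where "x = fst q" and "y = snd q"
    have 1: "(\<lambda>n. fst (p n)) \<longlonglongrightarrow> x" "(\<lambda>n. snd (p n)) \<longlonglongrightarrow> y"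
      using tendsto_fst[OF p(2)] tendsto_snd[OF p(2)] by (auto simp: x_def y_def)
    have pn: "fst (p n) \<in> D" "snd (p n) = A (fst (p n))" for n using p(1)[rule_format, of n] by auto
    have "R (l \<odot> fst (p n) - snd (p n)) = fst (p n)" for n
      using assms(2) pn[of n] by (simp add: is_resolvent_def)
    moreover have "(\<lambda>n. R (l \<odot> fst (p n) - snd (p n))) \<longlonglongrightarrow> R (l \<odot> x - y)"
      by (intro blinfun.tendsto tendsto_const tendsto_diff sc.tendsto 1)
    ultimately have "(\<lambda>n. fst (p n)) \<longlonglongrightarrow> R (l \<odot> x - y)" by simp
    then have x: "x = R (l \<odot> x - y)" by (rule LIMSEQ_unique[OF 1(1)])
    then have "x \<in> D" "l \<odot> x - A x = l \<odot> x - y"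
      using assms(2) unfolding is_resolvent_def by metis+
    then show "q \<in> {(x, A x) |x. x \<in> D}" by (auto simp: x_def y_def prod_eq_iff)
  qed
qed

lemma hor_calculus_imp_psi_bounded:
  fixes J :: "'a::banach \<Rightarrow> 'a"
  assumes "complex_structure J" "\<omega> \<ge> 0" "strongly_admissible v" "densely_defined_op J D A" "\<theta> > \<omega>"
    and calc: "hor_calculus k J D A v \<omega>"
  shows "strip_type J D A \<omega> \<and>
     kind_bounded k J {psi_op J D A \<omega> \<theta> \<psi> | \<psi>. \<psi> \<in> H0_infty \<theta> \<and> hor_norm v \<omega> \<psi> \<le> 1}"
proof -
  interpret cstruct J by (rule cstruct.intro) fact
  interpret weight v \<omega> by (rule weight.intro) fact+
  obtain \<Psi> :: "(complex \<Rightarrow> complex) \<Rightarrow> ('a \<Rightarrow>\<^sub>L 'a)" where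
    Q: "\<forall>f\<in>hor_space v \<omega>. \<forall>g\<in>hor_space v \<omega>. \<Psi> (\<lambda>z. f z + g z) = \<Psi> f + \<Psi> g"
      "\<forall>f\<in>hor_space v \<omega>. \<forall>c x. blinfun_apply (\<Psi> (\<lambda>z. c * f z)) x = cmult J c (blinfun_apply (\<Psi> f) x)"
      "\<forall>l. \<bar>Im l\<bar> > \<omega> \<longrightarrow> l \<in> resolvent_set J D A \<and> \<Psi> (\<lambda>z. 1 / (l - z)) = resolvent J D A l"
      and kb: "kind_bounded k J (blinfun_apply ` \<Psi> ` {f. hor_norm v \<omega> f \<le> 1})"
    using calc unfolding hor_calculus_def by (elim exE conjE) (rule that; assumption)
  have add: "\<And>f g. f \<in> hor_space v \<omega> \<Longrightarrow> g \<in> hor_space v \<omega> \<Longrightarrow> \<Psi> (\<lambda>z. f z + g z) = \<Psi> f + \<Psi> g"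
    and scal: "\<And>f c x. f \<in> hor_space v \<omega> \<Longrightarrow> blinfun_apply (\<Psi> (\<lambda>z. c * f z)) x = cmult J c (blinfun_apply (\<Psi> f) x)"
    and resv: "\<And>l. \<bar>Im l\<bar> > \<omega> \<Longrightarrow> l \<in> resolvent_set J D A" "\<And>l. \<bar>Im l\<bar> > \<omega> \<Longrightarrow> \<Psi> (\<lambda>z. 1 / (l - z)) = resolvent J D A l"
    using Q by blast+
  obtain C where C: "C > 0" "\<And>S x. S \<in> blinfun_apply ` \<Psi> ` {f. hor_norm v \<omega> f \<le> 1} \<Longrightarrow> norm (S x) \<le> C * norm x"
    using kind_bounded_imp_op_bounded[OF kb] by blast
  \<comment> \<open>Rescaling by 1/c turns the bound on the unit ball into one proportional to
    c.\<close>
  have bd: "norm (\<Psi> f x) \<le> C * c * norm x" if f: "Hle f c" and c: "c > 0" for f c x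
  proof -
    have "Hle (\<lambda>z. of_real (1 / c) * f z) 1" using Hle_scale[OF f, of "of_real (1 / c)"] c by (simp add: norm_divide)
    then have "hor_norm v \<omega> (\<lambda>z. of_real (1 / c) * f z) \<le> 1" using hor_norm_le[of _ 1] by simp
    then have "norm (\<Psi> (\<lambda>z. of_real (1 / c) * f z) x) \<le> C * norm x" by (intro C(2)) auto
    moreover have fh: "f \<in> hor_space v \<omega>" using hor_spaceI[OF f] c by simp
    ultimately have "cmod (of_real (1 / c)) * norm (\<Psi> f x) \<le> C * norm x"
      by (simp only: scal[OF fh] norm_sc)
    then have "(1 / c) * norm (\<Psi> f x) \<le> C * norm x" using c by (simp only: norm_of_real) simp
    then show ?thesis using c by (simp add: field_simps)
  qed
  have st: "strip_type J D A \<omega>"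
    unfolding strip_type_def
  proof (intro conjI allI impI)
    have "\<bar>Im (\<i> * of_real (\<omega> + 1))\<bar> > \<omega>" using assms(2) by simp
    then show "closed_op D A"
      using closed_op_if_resolvent[OF cstruct_axioms is_resolvent_resolvent[OF resv(1)]] by blast
    show "op_spectrum J D A \<subseteq> closure (strip \<omega>)"
      unfolding closure_strip[OF assms(2)] op_spectrum_def using resv(1) by force
    fix w' assume w': "w' > \<omega>"
    obtain K where K: "K > 0" "\<And>l. \<bar>Im l\<bar> \<ge> w' \<Longrightarrow> Wle (\<lambda>z. 1 / (l - z)) K" using Wle_resolvent[OF w'] by blast
    have p: "KW * KG * K > 0" using K KW_pos KG(1) by simp
    show "\<exists>B. \<forall>l. \<bar>Im l\<bar> > w' \<longrightarrow> norm (resolvent J D A l) \<le> B"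
    proof (intro exI allI impI)
      fix l assume l: "\<bar>Im l\<bar> > w'"
      have "Hle (\<lambda>z. 1 / (l - z)) (KW * KG * K)" using l K by (intro Wle_imp_Hle) auto
      from bd[OF this p] have "norm (resolvent J D A l x) \<le> C * (KW * KG * K) * norm x" for x
        using resv(2)[of l] l w' by simp
      then show "norm (resolvent J D A l) \<le> C * (KW * KG * K)"
        using C(1) p by (intro norm_blinfun_bound) auto
    qed
  qed
  \<comment> \<open>The contour calculus presupposes strip type, which has just been proved.\<close>
  interpret strip_calculus J D A \<omega> \<theta> by unfold_locales fact+
  have eq: "psi_op J D A \<omega> \<theta> \<psi> = blinfun_apply (\<Psi> \<psi>)" if \<psi>: "\<psi> \<in> H0_infty \<theta>" "hor_norm v \<omega> \<psi> \<le> 1" for \<psi>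
  proof
    fix x
    define c where "c = 1 / (2 * complex_of_real pi * \<i>)"
    have \<psi>h: "\<psi> \<in> hor_space v \<omega>" using \<psi>(2) by (auto simp: hor_space_def intro: le_less_trans)
    have rh: "(\<lambda>z. 1 / (l - z)) \<in> hor_space v \<omega>" if l: "\<bar>Im l\<bar> > \<omega>" for l
    proof -
      obtain K where "K > 0" "Wle (\<lambda>z. 1 / (l - z)) K" using Wle_resolvent[OF l] by blast
      then show ?thesis using KW_pos KG(1) by (intro hor_spaceI[OF Wle_imp_Hle]) auto
    qed
    define H where "H s z = c * (\<psi> (Complex s (-hc)) / (Complex s (-hc) - z) - \<psi> (Complex s hc) / (Complex s hc - z))" for s z
    \<comment> \<open>The integrand of Cauchy's formula combines two resolvent functions, whose
      images under \<Psi> are prescribed; so its image is the contour integrand.\<close>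
    have Hs: "H s \<in> hor_space v \<omega>" "\<Psi> (H s) x = c \<odot> cint hc \<psi> x s" for s
    proof -
      have i: "\<bar>Im (Complex s hc)\<bar> > \<omega>" "\<bar>Im (Complex s (-hc))\<bar> > \<omega>" using hc by auto
      let ?a = "\<lambda>z. (c * \<psi> (Complex s (-hc))) * (1 / (Complex s (-hc) - z))" and ?b = "\<lambda>z. (- c * \<psi> (Complex s hc)) * (1 / (Complex s hc - z))"
      have e: "H s = (\<lambda>z. ?a z + ?b z)" by (simp add: H_def fun_eq_iff algebra_simps)
      have ab: "?a \<in> hor_space v \<omega>" "?b \<in> hor_space v \<omega>" by (intro hor_space_scale rh i)+
      show "H s \<in> hor_space v \<omega>" unfolding e by (intro hor_space_add ab)
      show "\<Psi> (H s) x = c \<odot> cint hc \<psi> x s"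
        unfolding e add[OF ab] blinfun.add_left scal[OF rh[OF i(1)]] scal[OF rh[OF i(2)]] resv(2)[OF i(1)] resv(2)[OF i(2)]
        by (simp add: cint_def sc.diff_right sc_mult sc.minus_left)
    qed
    have sums: "(\<lambda>z. \<Sum>j\<in>S. H (g j) z) \<in> hor_space v \<omega> \<and> \<Psi> (\<lambda>z. \<Sum>j\<in>S. H (g j) z) x = (\<Sum>j\<in>S. \<Psi> (H (g j)) x)"
      if "finite S" for S :: "int set" and g
      using that
    proof (induction S rule: finite_induct)
      case empty
      have "\<Psi> (\<lambda>z. 0) x = 0" using scal[OF hor_space_zero, of 0 x] by simp
      then show ?case using hor_space_zero by simp
    next
      case (insert j S)
      then show ?case using add[OF Hs(1)[of "g j"], of "\<lambda>z. \<Sum>j\<in>S. H (g j) z"] hor_space_add[OF Hs(1)[of "g j"], of "\<lambda>z. \<Sum>j\<in>S. H (g j) z"]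
        by (simp add: blinfun.add_left)
    qed
    have rs: "(\<lambda>z. rsum n (\<lambda>s. H s z)) \<in> hor_space v \<omega>" "\<Psi> (\<lambda>z. rsum n (\<lambda>s. H s z)) x = c \<odot> rsum n (cint hc \<psi> x)" for n
    proof -
      let ?S = "{- int (n\<^sup>2)..<int (n\<^sup>2)}" and ?g = "\<lambda>j. real_of_int j / real n"
      note s = sums[of ?S ?g]
      have e: "(\<lambda>z. rsum n (\<lambda>s. H s z)) = (\<lambda>z. of_real (1 / real n) * (\<Sum>j\<in>?S. H (?g j) z))"
        by (simp add: rsum_def scaleR_conv_of_real)
      show "(\<lambda>z. rsum n (\<lambda>s. H s z)) \<in> hor_space v \<omega>" unfolding e using s by (intro hor_space_scale) auto
      have "\<Psi> (\<lambda>z. rsum n (\<lambda>s. H s z)) x = of_real (1 / real n) \<odot> (\<Sum>j\<in>?S. c \<odot> cint hc \<psi> x (?g j))"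
        unfolding e using s scal[of "\<lambda>z. \<Sum>j\<in>?S. H (?g j) z" "of_real (1 / real n)" x] by (simp only: Hs(2)) simp
      also have "\<dots> = c \<odot> rsum n (cint hc \<psi> x)"
        unfolding sc_of_real rsum_def by (simp only: sc.sum_right[symmetric] sc.scaleR_right)
      finally show "\<Psi> (\<lambda>z. rsum n (\<lambda>s. H s z)) x = c \<odot> rsum n (cint hc \<psi> x)" .
    qed
    obtain K where K: "\<And>x t. norm (cint hc \<psi> x t) \<le> (K * norm x) / (1 + t\<^sup>2)" using cint_dominated[OF lines_hc[OF \<psi>(1)] hc(1)] by blast
    have "(\<lambda>n. c \<odot> rsum n (cint hc \<psi> x)) \<longlonglongrightarrow> c \<odot> integral UNIV (cint hc \<psi> x)"
      by (intro sc.tendsto tendsto_const rsum_tendsto_integral[OF cint_continuous[OF lines_hc[OF \<psi>(1)] hc(1)] K])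
    moreover have "c \<odot> integral UNIV (cint hc \<psi> x) = psi_op J D A \<omega> \<theta> \<psi> x"
      by (simp add: psi_op_eq ctr_def c_def hc_def)
    moreover have "(\<lambda>n. \<Psi> (\<lambda>z. rsum n (\<lambda>s. H s z)) x) \<longlonglongrightarrow> \<Psi> \<psi> x"
    proof (rule LIMSEQ_I)
      fix e :: real assume e: "e > 0"
      define M where "M = C * (KW * KG) * (norm x + 1)"
      have M: "M > 0" using C KW_pos KG(1) by (simp add: M_def add_nonneg_pos)
      define d where "d = e / (2 * M)"
      have d: "d > 0" using e M by (simp add: d_def)
      have ev: "eventually (\<lambda>n. Wle (\<lambda>z. rsum n (\<lambda>s. H s z) - \<psi> z) d) sequentially"
        using H0_Cauchy_rsum(2)[OF \<psi>(1) hc(1,2) d] by (simp add: H_def c_def)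
      have "norm (\<Psi> (\<lambda>z. rsum n (\<lambda>s. H s z)) x - \<Psi> \<psi> x) < e" if n: "Wle (\<lambda>z. rsum n (\<lambda>s. H s z) - \<psi> z) d" for n
      proof -
        let ?d = "\<lambda>z. rsum n (\<lambda>s. H s z) - \<psi> z"
        have hd: "Hle ?d (KW * KG * d)" by (rule Wle_imp_Hle[OF n d])
        have pd: "KW * KG * d > 0" using KW_pos KG(1) d by simp
        have dh: "?d \<in> hor_space v \<omega>" using hor_spaceI[OF hd] pd by simp
        have "\<Psi> (\<lambda>z. rsum n (\<lambda>s. H s z)) = \<Psi> (\<lambda>z. \<psi> z + ?d z)" by simp
        also have "\<dots> = \<Psi> \<psi> + \<Psi> ?d" by (rule add[OF \<psi>h dh])
        finally have "norm (\<Psi> (\<lambda>z. rsum n (\<lambda>s. H s z)) x - \<Psi> \<psi> x) \<le> C * (KW * KG * d) * norm x"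
          using bd[OF hd pd, of x] by (simp add: blinfun.add_left)
        also have "\<dots> \<le> C * (KW * KG * d) * (norm x + 1)" using C pd by (intro mult_left_mono) auto
        also have "\<dots> = M * d" by (simp add: M_def)
        also have "\<dots> < e" using M e by (simp add: d_def)
        finally show ?thesis .
      qed
      then show "\<exists>no. \<forall>n\<ge>no. norm (\<Psi> (\<lambda>z. rsum n (\<lambda>s. H s z)) x - \<Psi> \<psi> x) < e"
        using ev unfolding eventually_sequentially by blast
    qed
    ultimately show "psi_op J D A \<omega> \<theta> \<psi> x = \<Psi> \<psi> x"
      unfolding rs(2) using LIMSEQ_unique by metis
  qed
  have "kind_bounded k J {psi_op J D A \<omega> \<theta> \<psi> | \<psi>. \<psi> \<in> H0_infty \<theta> \<and> hor_norm v \<omega> \<psi> \<le> 1}"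
    by (rule kind_bounded_subset[OF kb]) (auto simp: eq)
  then show ?thesis using st by simp
qed

section \<open>Extending the elementary calculus\<close>

text \<open>Each weighted sample is at most the integral of \<open>6 / (1 + (t - s)\<^sup>2)\<close>
  over its cell, and the integral over the line does not depend on t. In 6 = 2 * 3, the 2 comes from
  exp(-r^2/2) \<le> 2 / (1 + r^2) and the 3 from moving s within the cell.\<close>

lemma rsum_gauss_bounded: "\<exists>B>0. \<forall>n>0. \<forall>t. rsum n (\<lambda>s. exp (- ((t - s)\<^sup>2) / 2)) \<le> B"
proof -
  let ?I = "LINT s::real|lborel. 1 / (1 + s\<^sup>2)"
  have I: "?I \<ge> 0" by simp
  have main: "rsum n (\<lambda>s. exp (- ((t - s)\<^sup>2) / 2)) \<le> 6 * ?I" if n: "n > 0" for n t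
  proof -
    let ?S = "{- int (n\<^sup>2)..<int (n\<^sup>2)}"
    let ?P = "\<lambda>j. {real_of_int j / real n..<(real_of_int j + 1) / real n}"
    let ?f = "\<lambda>s. 6 * (1 / (1 + (t - s)\<^sup>2))"
    have base: "integrable lborel (\<lambda>s::real. 1 / (1 + s\<^sup>2))" by (rule integrable_inverse_one_plus_square)
    have fi: "integrable lborel ?f"
      using lborel_integrable_real_affine[OF base, of "-1" t] by (intro integrable_mult_right) simp
    have fI: "(LINT s|lborel. ?f s) = 6 * ?I"
      using lborel_integral_real_affine[of "-1" "\<lambda>s. 1 / (1 + s\<^sup>2)" t] by (subst integral_mult_right_zero) simp
    have piece: "(1 / real n) * exp (- ((t - real_of_int j / real n)\<^sup>2) / 2) \<le> (LINT s:?P j|lborel. ?f s)" for j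
    proof -
      let ?a = "real_of_int j / real n"
      let ?e = "exp (- ((t - ?a)\<^sup>2) / 2)"
      have len: "(real_of_int j + 1) / real n = ?a + 1 / real n" by (simp add: add_divide_distrib)
      have le: "?e \<le> ?f s" if "s \<in> ?P j" for s
      proof -
        have "1 / real n \<le> 1" using n by simp
        then have "\<bar>(t - ?a) - (t - s)\<bar> \<le> 1" using that unfolding len by auto
        then have "1 / (1 + (t - ?a)\<^sup>2) \<le> 3 / (1 + (t - s)\<^sup>2)" by (rule one_plus_square_le_of_close)
        moreover have "?e \<le> 2 * (1 / (1 + (t - ?a)\<^sup>2))"
        proof -
          have "exp (- (1/2 * (t - ?a)\<^sup>2)) \<le> 1 / (1 + 1/2 * (t - ?a)\<^sup>2)" by (rule exp_neg_square_le) simp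
          also have "\<dots> \<le> 1 / ((1 + (t - ?a)\<^sup>2) / 2)"
            by (intro divide_left_mono mult_pos_pos add_pos_nonneg) (auto simp: field_simps)
          finally show ?thesis by simp
        qed
        ultimately show ?thesis by simp
      qed
      have "(1 / real n) * ?e = (LINT s:?P j|lborel. ?e)"
        unfolding len by (simp add: set_lebesgue_integral_def measure_def)
      also have "\<dots> \<le> (LINT s:?P j|lborel. ?f s)"
      proof (rule set_integral_mono)
        show "set_integrable lborel (?P j) (\<lambda>s. ?e)"
          unfolding set_integrable_def len by (auto intro!: integrable_indicator simp: emeasure_lborel_Ico)
        show "set_integrable lborel (?P j) ?f"
          unfolding set_integrable_def using fi by (intro integrable_mult_indicator) auto
      qed (use le in auto)
      finally show ?thesis .
    qed
    have "rsum n (\<lambda>s. exp (- ((t - s)\<^sup>2) / 2)) = (\<Sum>j\<in>?S. (1 / real n) * exp (- ((t - real_of_int j / real n)\<^sup>2) / 2))"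
      by (simp add: rsum_def sum_distrib_left[symmetric] sum_divide_distrib)
    also have "\<dots> \<le> (\<Sum>j\<in>?S. LINT s:?P j|lborel. ?f s)" by (intro sum_mono piece)
    also have "\<dots> \<le> (LINT s|lborel. ?f s)" by (rule sum_piece_integrals_le[OF n fi]) auto
    finally show ?thesis by (simp only: fI)
  qed
  show ?thesis
  proof (intro exI[of _ "6 * ?I + 1"] conjI allI impI)
    show "6 * ?I + 1 > 0" by (intro add_nonneg_pos mult_nonneg_nonneg I) auto
    show "rsum n (\<lambda>s. exp (- ((t - s)\<^sup>2) / 2)) \<le> 6 * ?I + 1" if "n > 0" for n t
      by (rule order_trans[OF main[OF that]]) simp
  qed
qed

text \<open>The uniform bound carries the Cauchy property from a dense set to the whole space, in
  three thirds of epsilon.\<close>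

lemma strong_limit:
  fixes U :: "nat \<Rightarrow> 'a::banach \<Rightarrow>\<^sub>L 'b::banach"
  assumes bd: "\<And>n x. norm (U n x) \<le> C * norm x" and S: "closure S = UNIV" and conv: "\<And>y. y \<in> S \<Longrightarrow> Cauchy (\<lambda>n. U n y)"
  shows "\<exists>T :: 'a \<Rightarrow>\<^sub>L 'b. \<forall>x. (\<lambda>n. U n x) \<longlonglongrightarrow> T x"
proof -
  have "Cauchy (\<lambda>n. U n x)" for x
  proof (rule CauchyI)
    fix e :: real assume e: "e > 0"
    define a where "a = \<bar>C\<bar> + 1"
    have a: "a > 0" by (simp add: a_def)
    define d where "d = e / (3 * a)"
    have d: "d > 0" using e a by (simp add: d_def)
    obtain y where y: "y \<in> S" "dist y x < d" using S d by (metis UNIV_I closure_approachable)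
    have small: "norm (U n x - U n y) < e / 3" for n
    proof -
      have "norm (U n x - U n y) \<le> C * norm (x - y)" using bd[of n "x - y"] by (simp add: blinfun.diff_right)
      also have "\<dots> \<le> a * norm (x - y)" by (intro mult_right_mono) (auto simp: a_def)
      also have "\<dots> < a * d" using y(2) a by (intro mult_strict_left_mono) (auto simp: dist_norm norm_minus_commute)
      also have "\<dots> = e / 3" using a by (simp add: d_def)
      finally show ?thesis .
    qed
    obtain N where N: "\<And>m n. m \<ge> N \<Longrightarrow> n \<ge> N \<Longrightarrow> norm (U m y - U n y) < e / 3"
      using CauchyD[OF conv[OF y(1)], of "e / 3"] e by auto
    show "\<exists>M. \<forall>m\<ge>M. \<forall>n\<ge>M. norm (U m x - U n x) < e"
    proof (intro exI[of _ N] allI impI)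
      fix m n assume "m \<ge> N" "n \<ge> N"
      have "norm (U m x - U n x) \<le> norm (U m x - U m y) + norm (U m y - U n y) + norm (U n x - U n y)"
        using norm_triangle_ineq4[of "U m x - U m y + (U m y - U n y)" "U n x - U n y"] norm_triangle_ineq[of "U m x - U m y" "U m y - U n y"] by simp
      then show "norm (U m x - U n x) < e" using small[of m] small[of n] N[OF \<open>m \<ge> N\<close> \<open>n \<ge> N\<close>] by linarith
    qed
  qed
  then have "\<exists>l. (\<lambda>n. U n x) \<longlonglongrightarrow> l" for x by (metis Cauchy_convergent_iff convergent_def)
  then obtain T where T: "\<And>x. (\<lambda>n. U n x) \<longlonglongrightarrow> T x" by metis
  have "bounded_linear T"
  proof (rule bounded_linear_intro)
    show "T (x + y) = T x + T y" for x y
      using LIMSEQ_unique[OF T[of "x + y"]] tendsto_add[OF T[of x] T[of y]] by (simp add: blinfun.add_right)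
    show "T (r *\<^sub>R x) = r *\<^sub>R T x" for r x
      using LIMSEQ_unique[OF T[of "r *\<^sub>R x"]] tendsto_scaleR[OF tendsto_const T[of x], of r] by (simp add: blinfun.scaleR_right)
    show "norm (T x) \<le> norm x * C" for x
      using bd[of _ x] by (intro LIMSEQ_le_const2[OF tendsto_norm[OF T]]) (auto simp: mult.commute)
  qed
  then show ?thesis using T by (intro exI[of _ "Blinfun T"]) (simp add: bounded_linear_Blinfun_apply)
qed

section \<open>Operators represented by Hoermander functions\<close>

locale hor_strip = weight v \<omega> + strip_calculus J D A \<omega> \<theta>
  for v :: "real \<Rightarrow> real" and \<omega> :: real and J :: "'a::banach \<Rightarrow> 'a" and D A \<theta> +
  fixes k :: bkind
  assumes kb: "kind_bounded k J {psi_op J D A \<omega> \<theta> \<psi> | \<psi>. \<psi> \<in> H0_infty \<theta> \<and> hor_norm v \<omega> \<psi> \<le> 1}"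
begin

text \<open>Each of the three kinds of boundedness bounds the operator norms, and homogeneity
  removes the restriction to the unit ball.\<close>

lemma Phi_bound: "\<exists>C>0. \<forall>\<psi> c x. \<psi> \<in> H0 \<longrightarrow> c > 0 \<longrightarrow> Hle \<psi> c \<longrightarrow> norm (Phi \<psi> x) \<le> C * c * norm x"
proof -
  obtain C where C: "C > 0" "\<And>S x. S \<in> {psi_op J D A \<omega> \<theta> \<psi> | \<psi>. \<psi> \<in> H0_infty \<theta> \<and> hor_norm v \<omega> \<psi> \<le> 1} \<Longrightarrow> norm (S x) \<le> C * norm x"
    using kind_bounded_imp_op_bounded[OF kb] by blast
  have "norm (Phi \<psi> x) \<le> C * c * norm x" if \<psi>: "\<psi> \<in> H0" and c: "c > 0" and h: "Hle \<psi> c" for \<psi> c x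
  proof -
    let ?p = "\<lambda>z. of_real (1 / c) * \<psi> z"
    have "Hle ?p 1" using Hle_scale[OF h, of "of_real (1 / c)"] c by (simp add: norm_divide)
    then have "hor_norm v \<omega> ?p \<le> 1" using hor_norm_le[of _ 1] by simp
    then have "norm (psi_op J D A \<omega> \<theta> ?p x) \<le> C * norm x" using H0_scale[OF \<psi>] by (intro C(2)) blast
    then have "cmod (of_real (1 / c)) * norm (Phi \<psi> x) \<le> C * norm x"
      unfolding Phi_psi_op[OF H0_scale[OF \<psi>]] Phi_scale[OF \<psi>] norm_sc .
    then have "(1 / c) * norm (Phi \<psi> x) \<le> C * norm x" using c by (simp only: norm_of_real) simp
    then show ?thesis using c by (simp add: field_simps)
  qed
  then show ?thesis using C(1) by blast
qed

definition Cb where "Cb = (SOME C. C > 0 \<and> (\<forall>\<psi> c x. \<psi> \<in> H0 \<longrightarrow> c > 0 \<longrightarrow> Hle \<psi> c \<longrightarrow> norm (Phi \<psi> x) \<le> C * c * norm x))"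

lemma Cb: "Cb > 0" "\<psi> \<in> H0 \<Longrightarrow> c > 0 \<Longrightarrow> Hle \<psi> c \<Longrightarrow> norm (Phi \<psi> x) \<le> Cb * c * norm x"
proof -
  have "Cb > 0 \<and> (\<forall>\<psi> c x. \<psi> \<in> H0 \<longrightarrow> c > 0 \<longrightarrow> Hle \<psi> c \<longrightarrow> norm (Phi \<psi> x) \<le> Cb * c * norm x)"
    unfolding Cb_def by (rule someI_ex) (rule Phi_bound)
  then show "Cb > 0" "\<psi> \<in> H0 \<Longrightarrow> c > 0 \<Longrightarrow> Hle \<psi> c \<Longrightarrow> norm (Phi \<psi> x) \<le> Cb * c * norm x" by blast+
qed

definition CW where "CW = Cb * (KW * KG)"

lemma CW: "CW > 0" "\<psi> \<in> H0 \<Longrightarrow> c > 0 \<Longrightarrow> Wle \<psi> c \<Longrightarrow> norm (Phi \<psi> x) \<le> CW * c * norm x"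
  using Cb(1) KW_pos KG(1) Cb(2)[OF _ _ Wle_imp_Hle, of \<psi> c x] by (auto simp: CW_def mult.assoc)

lemma H0_Wle: "\<psi> \<in> H0 \<Longrightarrow> \<exists>c>0. Wle \<psi> c"
  by (rule H0_Cauchy_rsum(1)[OF _ hc(1,2)])

text \<open>The m-th power of G. As exponents add, two approximations that use different powers can
  be brought to a common one.\<close>

definition E :: "nat \<Rightarrow> complex \<Rightarrow> complex" where "E m z = exp (- of_real (real m) * z\<^sup>2)"

lemma E_H0: "m > 0 \<Longrightarrow> E m \<in> H0"
  using H0_exp_square[of "real m"] by (simp add: E_def[abs_def])

lemma E_add: "E m z * E n z = E (m + n) z"
  by (simp add: E_def exp_add[symmetric] algebra_simps)

lemma E_Wle: "m > 0 \<Longrightarrow> \<exists>c>0. Wle (E m) c"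
  by (rule H0_Wle[OF E_H0])

text \<open>Cancellation by density of the range: an identity that holds after composition with a
  Gaussian of A holds outright.\<close>

lemma eq_on_range:
  fixes T S :: "'a \<Rightarrow>\<^sub>L 'a"
  assumes "m > 0" "\<And>y. T (Phi (E m) y) = S (Phi (E m) y)"
  shows "T = S"
proof (rule blinfun_eqI)
  fix x
  have "x \<in> closure (range (Phi (E m)))" using dense_range[of "real m"] assms(1) by (simp add: E_def[abs_def])
  then obtain y where y: "\<And>n. y n \<in> range (Phi (E m))" "y \<longlonglongrightarrow> x" unfolding closure_sequential by blast
  have "(\<lambda>n. T (y n)) \<longlonglongrightarrow> T x" "(\<lambda>n. S (y n)) \<longlonglongrightarrow> S x"
    by (intro blinfun.tendsto tendsto_const y)+
  moreover have "T (y n) = S (y n)" for n using y(1)[of n] assms(2) by auto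
  ultimately show "T x = S x" using LIMSEQ_unique by auto
qed

text \<open>\<open>rep f T\<close> expresses \<open>f(A) = T\<close>: \<open>\<psi>\<^sub>n(A) \<rightarrow> T\<close> strongly for some \<open>\<psi>\<^sub>n \<in> H0\<close> which converge to \<open>f\<close> in the
  \<open>W\<close>-norm after multiplication with a power of the Gaussian.\<close>

definition conv :: "(nat \<Rightarrow> complex \<Rightarrow> complex) \<Rightarrow> (complex \<Rightarrow> complex) \<Rightarrow> nat \<Rightarrow> bool" where
  "conv \<psi> f m \<longleftrightarrow> (\<exists>c>0. Wle (\<lambda>z. f z * E m z) c) \<and> (\<forall>e>0. eventually (\<lambda>n. Wle (\<lambda>z. (\<psi> n z - f z) * E m z) e) sequentially)"

definition rep :: "(complex \<Rightarrow> complex) \<Rightarrow> ('a \<Rightarrow>\<^sub>L 'a) \<Rightarrow> bool" where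
  "rep f T \<longleftrightarrow> (\<exists>\<psi> m. (\<forall>n. \<psi> n \<in> H0) \<and> (\<exists>B. \<forall>n x. norm (Phi (\<psi> n) x) \<le> B * norm x)
     \<and> (\<forall>x. (\<lambda>n. Phi (\<psi> n) x) \<longlonglongrightarrow> T x) \<and> m > 0 \<and> conv \<psi> f m)"

text \<open>\<open>E j\<close> belongs to the algebra W, so multiplying by it preserves smallness up
  to the factor KW c.\<close>

lemma conv_raise:
  assumes "conv \<psi> f m" "j > 0"
  shows "conv \<psi> f (m + j)"
proof -
  obtain c where c: "c > 0" "Wle (E j) c" using E_Wle[OF assms(2)] by blast
  obtain d where d: "d > 0" "Wle (\<lambda>z. f z * E m z) d" using assms(1) by (auto simp: conv_def)
  show ?thesis unfolding conv_def
  proof (intro conjI allI impI)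
    show "\<exists>c>0. Wle (\<lambda>z. f z * E (m + j) z) c"
      using Wle_mult[OF d(2) c(2) d(1) c(1)] KW_pos c d unfolding mult.assoc E_add
      by (intro exI[of _ "KW * d * c"]) (simp add: mult.assoc)
    fix e :: real assume e: "e > 0"
    have "e / (KW * c) > 0" using e KW_pos c by simp
    then have "eventually (\<lambda>n. Wle (\<lambda>z. (\<psi> n z - f z) * E m z) (e / (KW * c))) sequentially"
      using assms(1) by (auto simp: conv_def)
    then show "eventually (\<lambda>n. Wle (\<lambda>z. (\<psi> n z - f z) * E (m + j) z) e) sequentially"
    proof eventually_elim
      case (elim n)
      from Wle_mult[OF this c(2) \<open>e / (KW * c) > 0\<close> c(1)] KW_pos c(1) show ?case
        unfolding mult.assoc E_add by (simp add: mult.assoc)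
    qed
  qed
qed

text \<open>After multiplication by a common power \<open>E M\<close> the two approximating
  sequences differ by a null sequence in W, and a small W-norm means a small operator. So T and S
  agree on the range of \<open>Phi (E M)\<close>.\<close>

lemma rep_unique:
  assumes "rep f T" "rep f S"
  shows "T = S"
proof -
  obtain \<psi> m where 1: "\<And>n. \<psi> n \<in> H0" "\<And>x. (\<lambda>n. Phi (\<psi> n) x) \<longlonglongrightarrow> T x" "m > 0" "conv \<psi> f m"
    using assms(1) by (auto simp: rep_def)
  obtain \<xi> m' where 2: "\<And>n. \<xi> n \<in> H0" "\<And>x. (\<lambda>n. Phi (\<xi> n) x) \<longlonglongrightarrow> S x" "m' > 0" "conv \<xi> f m'"
    using assms(2) by (auto simp: rep_def)
  define M where "M = m + m'"
  have M: "M > 0" using 1 by (simp add: M_def)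
  have c1: "conv \<psi> f M" unfolding M_def by (rule conv_raise[OF 1(4) 2(3)])
  have c2: "conv \<xi> f M" unfolding M_def by (subst add.commute) (rule conv_raise[OF 2(4) 1(3)])
  have "T (Phi (E M) y) = S (Phi (E M) y)" for y
  proof -
    have "(\<lambda>n. Phi (\<psi> n) (Phi (E M) y) - Phi (\<xi> n) (Phi (E M) y)) \<longlonglongrightarrow> 0"
    proof (rule LIMSEQ_I)
      fix e :: real assume e: "e > 0"
      define d where "d = e / (4 * (CW * (norm y + 1)))"
      have d: "d > 0" using e CW(1) by (simp add: d_def add_nonneg_pos)
      have "eventually (\<lambda>n. Wle (\<lambda>z. (\<psi> n z - f z) * E M z) d \<and> Wle (\<lambda>z. (\<xi> n z - f z) * E M z) d) sequentially"
        using c1 c2 d by (auto simp: conv_def intro: eventually_conj)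
      moreover have "norm (Phi (\<psi> n) (Phi (E M) y) - Phi (\<xi> n) (Phi (E M) y) - 0) < e"
        if n: "Wle (\<lambda>z. (\<psi> n z - f z) * E M z) d \<and> Wle (\<lambda>z. (\<xi> n z - f z) * E M z) d" for n
      proof -
        have "Wle (\<lambda>z. (\<psi> n z - f z) * E M z - (\<xi> n z - f z) * E M z) (d + d)" using n d by (intro Wle_diff) auto
        then have W: "Wle (\<lambda>z. (\<psi> n z - \<xi> n z) * E M z) (d + d)" by (simp add: algebra_simps)
        have H: "(\<lambda>z. \<psi> n z - \<xi> n z) \<in> H0" by (intro H0_diff 1 2)
        have "norm (Phi (\<lambda>z. (\<psi> n z - \<xi> n z) * E M z) y) \<le> CW * (d + d) * norm y"
          by (rule CW(2)[OF H0_mult[OF H E_H0[OF M]] _ W]) (use d in auto)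
        also have "\<dots> \<le> CW * (d + d) * (norm y + 1)" using CW(1) d by (intro mult_left_mono) auto
        also have "\<dots> = e / 2" using CW(1) by (simp add: d_def field_simps add_nonneg_eq_0_iff)
        also have "\<dots> < e" using e by simp
        finally show ?thesis
          by (simp add: Phi_mult[OF H E_H0[OF M]] Phi_diff[OF 1(1) 2(1)] blinfun.diff_left)
      qed
      ultimately show "\<exists>no. \<forall>n\<ge>no. norm (Phi (\<psi> n) (Phi (E M) y) - Phi (\<xi> n) (Phi (E M) y) - 0) < e"
        unfolding eventually_sequentially by blast
    qed
    moreover have "(\<lambda>n. Phi (\<psi> n) (Phi (E M) y) - Phi (\<xi> n) (Phi (E M) y)) \<longlonglongrightarrow> T (Phi (E M) y) - S (Phi (E M) y)"
      by (intro tendsto_diff 1 2)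
    ultimately show ?thesis using LIMSEQ_unique by fastforce
  qed
  then show ?thesis by (rule eq_on_range[OF M])
qed

lemma rep_cong: "rep f T \<Longrightarrow> (\<And>z. z \<in> strip \<omega> \<Longrightarrow> f z = g z) \<Longrightarrow> rep g T"
proof -
  assume a: "rep f T" "\<And>z. z \<in> strip \<omega> \<Longrightarrow> f z = g z"
  have "conv \<psi> g m" if "conv \<psi> f m" for \<psi> m
  proof -
    have "Wle (\<lambda>z. g z * E m z) c" if "Wle (\<lambda>z. f z * E m z) c" for c
      using Wle_cong[OF that] a(2) by simp
    moreover have "Wle (\<lambda>z. (\<psi> n z - g z) * E m z) c" if "Wle (\<lambda>z. (\<psi> n z - f z) * E m z) c" for n c
      using Wle_cong[OF that] a(2) by simp
    ultimately show ?thesis using that unfolding conv_def by (blast intro: eventually_mono)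
  qed
  then show "rep g T" using a(1) unfolding rep_def by blast
qed

lemma rep_J: "rep f T \<Longrightarrow> blinfun_apply T (J x) = J (blinfun_apply T x)"
proof -
  assume "rep f T"
  then obtain \<psi> where 1: "\<And>n. \<psi> n \<in> H0" "\<And>x. (\<lambda>n. Phi (\<psi> n) x) \<longlonglongrightarrow> T x" by (auto simp: rep_def)
  have "(\<lambda>n. J (Phi (\<psi> n) x)) \<longlonglongrightarrow> J (T x)"
    by (rule bounded_linear.tendsto[OF J_bounded_linear 1(2)])
  then have "(\<lambda>n. Phi (\<psi> n) (J x)) \<longlonglongrightarrow> J (T x)" by (simp add: Phi_J[OF 1(1)])
  then show ?thesis using LIMSEQ_unique[OF 1(2)] by blast
qed

lemma repE:
  assumes "rep f T"
  obtains \<psi> m B where "\<forall>n. \<psi> n \<in> H0" "\<forall>x. (\<lambda>n. Phi (\<psi> n) x) \<longlonglongrightarrow> T x" "m > 0" "conv \<psi> f m"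
    "\<forall>n x. norm (Phi (\<psi> n) x) \<le> B * norm x" "B \<ge> 0"
proof -
  obtain \<psi> m B where p: "\<forall>n. \<psi> n \<in> H0" "\<forall>x. (\<lambda>n. Phi (\<psi> n) x) \<longlonglongrightarrow> T x" "m > 0" "conv \<psi> f m"
    "\<forall>n x. norm (Phi (\<psi> n) x) \<le> B * norm x" using assms unfolding rep_def by blast
  have "norm (Phi (\<psi> n) x) \<le> \<bar>B\<bar> * norm x" for n x
    by (rule order_trans[OF p(5)[rule_format] mult_right_mono]) auto
  then show ?thesis using that[of \<psi> m "\<bar>B\<bar>"] p by auto
qed

lemma repI:
  fixes T :: "'a \<Rightarrow>\<^sub>L 'a"
  assumes "\<And>n. \<psi> n \<in> H0" "\<And>x. (\<lambda>n. Phi (\<psi> n) x) \<longlonglongrightarrow> T x" "m > 0" "conv \<psi> f m" "\<And>n x. norm (Phi (\<psi> n) x) \<le> B * norm x"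
  shows "rep f T"
  unfolding rep_def using assms by (intro exI[of _ \<psi>] exI[of _ m]) auto

lemma rep_add:
  assumes "rep f T" "rep g S"
  shows "rep (\<lambda>z. f z + g z) (T + S)"
proof -
  obtain \<psi> m B where p1: "\<forall>n. \<psi> n \<in> H0" "\<forall>x. (\<lambda>n. Phi (\<psi> n) x) \<longlonglongrightarrow> T x" "m > 0" "conv \<psi> f m"
    "\<forall>n x. norm (Phi (\<psi> n) x) \<le> B * norm x" "B \<ge> 0"
    by (rule repE[OF assms(1)], rule that)
  note 1 = p1(1)[rule_format] p1(2)[rule_format] p1(3,4) and B1 = p1(5)[rule_format] p1(6)
  obtain \<xi> m' B' where p2: "\<forall>n. \<xi> n \<in> H0" "\<forall>x. (\<lambda>n. Phi (\<xi> n) x) \<longlonglongrightarrow> S x" "m' > 0" "conv \<xi> g m'"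
    "\<forall>n x. norm (Phi (\<xi> n) x) \<le> B' * norm x" "B' \<ge> 0"
    by (rule repE[OF assms(2)], rule that)
  note 2 = p2(1)[rule_format] p2(2)[rule_format] p2(3,4) and B2 = p2(5)[rule_format] p2(6)
  define M where "M = m + m'"
  have M: "M > 0" using 1 by (simp add: M_def)
  have c1: "conv \<psi> f M" unfolding M_def by (rule conv_raise[OF 1(4) 2(3)])
  have c2: "conv \<xi> g M" unfolding M_def by (subst add.commute) (rule conv_raise[OF 2(4) 1(3)])
  have "conv (\<lambda>n z. \<psi> n z + \<xi> n z) (\<lambda>z. f z + g z) M"
    unfolding conv_def
  proof (intro conjI allI impI)
    obtain c d where "c > 0" "Wle (\<lambda>z. f z * E M z) c" "d > 0" "Wle (\<lambda>z. g z * E M z) d" using c1 c2 unfolding conv_def by blast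
    then have "Wle (\<lambda>z. f z * E M z + g z * E M z) (c + d)" "c + d > 0" by (auto intro: Wle_add)
    then show "\<exists>c>0. Wle (\<lambda>z. (f z + g z) * E M z) c" by (auto simp: distrib_right)
    fix e :: real assume e: "e > 0"
    then have "eventually (\<lambda>n. Wle (\<lambda>z. (\<psi> n z - f z) * E M z) (e/2) \<and> Wle (\<lambda>z. (\<xi> n z - g z) * E M z) (e/2)) sequentially"
      using c1 c2 by (auto simp: conv_def intro!: eventually_conj)
    then show "eventually (\<lambda>n. Wle (\<lambda>z. (\<psi> n z + \<xi> n z - (f z + g z)) * E M z) e) sequentially"
    proof eventually_elim
      case (elim n)
      then have "Wle (\<lambda>z. (\<psi> n z - f z) * E M z + (\<xi> n z - g z) * E M z) (e/2 + e/2)" using e by (intro Wle_add) auto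
      then show ?case by (simp add: algebra_simps)
    qed
  qed
  moreover have "(\<lambda>n. Phi (\<lambda>z. \<psi> n z + \<xi> n z) x) \<longlonglongrightarrow> (T + S) x" for x
    using tendsto_add[OF 1(2) 2(2), of x x] by (simp add: Phi_add[OF 1(1) 2(1)] blinfun.add_left)
  moreover have "norm (Phi (\<lambda>z. \<psi> n z + \<xi> n z) x) \<le> (B + B') * norm x" for n x
    using norm_triangle_le[OF add_mono[OF B1(1)[of n x] B2(1)[of n x]]]
    by (simp add: Phi_add[OF 1(1) 2(1)] blinfun.add_left distrib_right)
  ultimately show ?thesis using M H0_add[OF 1(1) 2(1)] by (intro repI[of "\<lambda>n z. \<psi> n z + \<xi> n z" _ M]) auto
qed

text \<open>The Gaussian powers add up, m for f and m' for g. Strong limits are multiplicative on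
  uniformly bounded sequences, which is the reason for the bound B inside
  \<open>rep\<close>.\<close>

lemma rep_mult:
  assumes "rep f T" "rep g S"
  shows "rep (\<lambda>z. f z * g z) (T o\<^sub>L S)"
proof -
  obtain \<psi> m B where p1: "\<forall>n. \<psi> n \<in> H0" "\<forall>x. (\<lambda>n. Phi (\<psi> n) x) \<longlonglongrightarrow> T x" "m > 0" "conv \<psi> f m"
    "\<forall>n x. norm (Phi (\<psi> n) x) \<le> B * norm x" "B \<ge> 0"
    by (rule repE[OF assms(1)], rule that)
  note 1 = p1(1)[rule_format] p1(2)[rule_format] p1(3,4) and B1 = p1(5)[rule_format] p1(6)
  obtain \<xi> m' B' where p2: "\<forall>n. \<xi> n \<in> H0" "\<forall>x. (\<lambda>n. Phi (\<xi> n) x) \<longlonglongrightarrow> S x" "m' > 0" "conv \<xi> g m'"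
    "\<forall>n x. norm (Phi (\<xi> n) x) \<le> B' * norm x" "B' \<ge> 0"
    by (rule repE[OF assms(2)], rule that)
  note 2 = p2(1)[rule_format] p2(2)[rule_format] p2(3,4) and B2 = p2(5)[rule_format] p2(6)
  define M where "M = m + m'"
  have M: "M > 0" using 1 by (simp add: M_def)
  obtain c where c: "c > 0" "Wle (\<lambda>z. f z * E m z) c" using 1(4) by (auto simp: conv_def)
  obtain d where d: "d > 0" "Wle (\<lambda>z. g z * E m' z) d" using 2(4) by (auto simp: conv_def)
  have "conv (\<lambda>n z. \<psi> n z * \<xi> n z) (\<lambda>z. f z * g z) M"
    unfolding conv_def
  proof (intro conjI allI impI)
    have "Wle (\<lambda>z. (f z * E m z) * (g z * E m' z)) (KW * c * d)" by (rule Wle_mult[OF c(2) d(2) c(1) d(1)])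
    moreover have "(f z * E m z) * (g z * E m' z) = (f z * g z) * E M z" for z
      unfolding M_def E_add[symmetric] by (simp only: mult_ac)
    ultimately show "\<exists>c>0. Wle (\<lambda>z. (f z * g z) * E M z) c" using KW_pos c d by (intro exI[of _ "KW * c * d"]) simp
    fix e :: real assume e: "e > 0"
    \<comment> \<open>The cap 1 makes \<open>(c + \<delta>) * \<delta>\<close> linear in \<delta>;
      the second entry then keeps the total below e.\<close>
    define \<delta> where "\<delta> = min 1 (e / (KW * (1 + c + d)))"
    have \<delta>: "\<delta> > 0" "\<delta> \<le> 1" using e KW_pos c d by (auto simp: \<delta>_def)
    have \<delta>e: "KW * (c + \<delta>) * \<delta> + KW * \<delta> * d \<le> e"
    proof -
      have "KW * (c + \<delta>) * \<delta> + KW * \<delta> * d = (KW * (\<delta> + c + d)) * \<delta>" by (simp add: algebra_simps)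
      also have "\<dots> \<le> (KW * (1 + c + d)) * \<delta>" using \<delta> KW_pos by (intro mult_right_mono mult_left_mono) auto
      also have "\<dots> \<le> (KW * (1 + c + d)) * (e / (KW * (1 + c + d)))" using KW_pos c d by (intro mult_left_mono) (auto simp: \<delta>_def)
      also have "\<dots> = e" using KW_pos c d by simp
      finally show ?thesis .
    qed
    have "eventually (\<lambda>n. Wle (\<lambda>z. (\<psi> n z - f z) * E m z) \<delta> \<and> Wle (\<lambda>z. (\<xi> n z - g z) * E m' z) \<delta>) sequentially"
      using 1(4) 2(4) \<delta> by (auto simp: conv_def intro!: eventually_conj)
    then show "eventually (\<lambda>n. Wle (\<lambda>z. (\<psi> n z * \<xi> n z - f z * g z) * E M z) e) sequentially"
    proof eventually_elim
      case (elim n)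
      have "Wle (\<lambda>z. f z * E m z + (\<psi> n z - f z) * E m z) (c + \<delta>)" using elim c \<delta> by (intro Wle_add) auto
      then have a: "Wle (\<lambda>z. \<psi> n z * E m z) (c + \<delta>)" by (simp add: algebra_simps)
      \<comment> \<open>The splitting \<psi> \<xi> - f g = \<psi> (\<xi> - g) + (\<psi> - f) g, with
        each factor carrying its own Gaussian power.\<close>
      have "Wle (\<lambda>z. (\<psi> n z * E m z) * ((\<xi> n z - g z) * E m' z) + ((\<psi> n z - f z) * E m z) * (g z * E m' z)) (KW * (c + \<delta>) * \<delta> + KW * \<delta> * d)"
        using elim a c d \<delta> KW_pos by (intro Wle_add Wle_mult) auto
      moreover have "(\<psi> n z * E m z) * ((\<xi> n z - g z) * E m' z) + ((\<psi> n z - f z) * E m z) * (g z * E m' z) = (\<psi> n z * \<xi> n z - f z * g z) * E M z" for z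
      proof -
        have "(\<psi> n z * E m z) * ((\<xi> n z - g z) * E m' z) + ((\<psi> n z - f z) * E m z) * (g z * E m' z) = (\<psi> n z * \<xi> n z - f z * g z) * (E m z * E m' z)"
          by (simp only: ring_distribs mult_ac) simp
        then show ?thesis by (simp only: M_def E_add)
      qed
      ultimately have "Wle (\<lambda>z. (\<psi> n z * \<xi> n z - f z * g z) * E M z) (KW * (c + \<delta>) * \<delta> + KW * \<delta> * d)" by simp
      then show ?case by (rule Wle_mono[OF _ _ \<delta>e]) (use KW_pos c d \<delta> in auto)
    qed
  qed
  moreover have "(\<lambda>n. Phi (\<lambda>z. \<psi> n z * \<xi> n z) x) \<longlonglongrightarrow> (T o\<^sub>L S) x" for x
  proof -
    have "(\<lambda>n. Phi (\<psi> n) (Phi (\<xi> n) x - S x)) \<longlonglongrightarrow> 0"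
    proof (rule Lim_null_comparison[OF always_eventually], rule)
      show "norm (Phi (\<psi> n) (Phi (\<xi> n) x - S x)) \<le> B * norm (Phi (\<xi> n) x - S x)" for n
        by (rule B1(1))
      show "(\<lambda>n. B * norm (Phi (\<xi> n) x - S x)) \<longlonglongrightarrow> 0"
        using tendsto_mult_right_zero[OF tendsto_norm_zero[OF LIM_zero[OF 2(2)[of x]]]] .
    qed
    from tendsto_add[OF this 1(2)[of "S x"]] show ?thesis
      by (simp add: Phi_mult[OF 1(1) 2(1)] blinfun.diff_right)
  qed
  moreover have "norm (Phi (\<lambda>z. \<psi> n z * \<xi> n z) x) \<le> (B * B') * norm x" for n x
    using order_trans[OF B1(1) mult_left_mono[OF B2(1) B1(2)], of n n x]
    by (simp add: Phi_mult[OF 1(1) 2(1)] mult.assoc)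
  ultimately show ?thesis using M H0_mult[OF 1(1) 2(1)] by (intro repI[of "\<lambda>n z. \<psi> n z * \<xi> n z" _ M]) auto
qed

end

section \<open>Algebra of Riemann sums\<close>

lemma rsum_const: "rsum n (\<lambda>s. b) = 2 * real n * b" for b :: real
  by (cases "n = 0") (simp_all add: rsum_def power2_eq_square)

lemma rsum_mult_left: "rsum n (\<lambda>s. a * f s) = a * rsum n f" for a :: "'b::real_algebra"
  by (simp add: rsum_def sum_distrib_left)

lemma rsum_mult_right: "rsum n (\<lambda>s. f s * a) = rsum n f * a" for a :: "'b::real_algebra"
  by (simp add: rsum_def sum_distrib_right)

lemma rsum_diff: "rsum n (\<lambda>s. f s - g s) = rsum n f - rsum n g"
  by (simp add: rsum_def sum_subtractf scaleR_diff_right)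

lemma H0_rsum: "(\<And>s. g s \<in> H0_infty \<theta>) \<Longrightarrow> (\<lambda>z. rsum n (\<lambda>s. g s z)) \<in> H0_infty \<theta>"
  unfolding rsum_def scaleR_conv_of_real by (intro H0_scale H0_sum) auto

context weight
begin

lemma Wle_of_rsum:
  assumes "n > 0" "\<And>s. Wle (g s) (b s)" "\<And>s. b s > 0"
  shows "Wle (\<lambda>z. rsum n (\<lambda>s. g s z)) (rsum n b)"
proof -
  let ?S = "{- int (n\<^sup>2)..<int (n\<^sup>2)}" and ?s = "\<lambda>j. real_of_int j / real n"
  have "Wle (\<lambda>z. \<Sum>j\<in>?S. of_real (1 / real n) * g (?s j) z) (\<Sum>j\<in>?S. cmod (of_real (1 / real n)) * b (?s j))"
  proof (rule Wle_sum)
    show "?S \<noteq> {}" using assms(1) by simp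
  qed (use assms in \<open>auto intro!: Wle_scale simp del: of_real_divide norm_of_real\<close>)
  moreover have "(\<lambda>z. \<Sum>j\<in>?S. of_real (1 / real n) * g (?s j) z) = (\<lambda>z. rsum n (\<lambda>s. g s z))"
    by (simp only: rsum_def scaleR_conv_of_real sum_distrib_left)
  moreover have "(\<Sum>j\<in>?S. cmod (of_real (1 / real n)) * b (?s j)) = rsum n b"
    by (simp only: rsum_def norm_of_real sum_distrib_left[symmetric]) simp
  ultimately show ?thesis by simp
qed

end

section \<open>Approximants and construction of the Hoermander calculus\<close>

context hor_strip
begin

definition scB :: "complex \<Rightarrow> 'a \<Rightarrow>\<^sub>L 'a" where "scB c = Blinfun (cmult J c)"

lemma scB_apply [simp]: "scB c x = c \<odot> x"
  unfolding scB_def by (simp add: bounded_linear_Blinfun_apply sc.bounded_linear_right)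

lemma rep_scale:
  assumes "rep f T"
  shows "rep (\<lambda>z. c * f z) (scB c o\<^sub>L T)"
proof -
  obtain \<psi> m B where p: "\<forall>n. \<psi> n \<in> H0" "\<forall>x. (\<lambda>n. Phi (\<psi> n) x) \<longlonglongrightarrow> T x" "m > 0" "conv \<psi> f m"
    "\<forall>n x. norm (Phi (\<psi> n) x) \<le> B * norm x" "B \<ge> 0"
    by (rule repE[OF assms], rule that)
  note 1 = p(1)[rule_format] p(2)[rule_format] p(3,4) and B = p(5)[rule_format]
  have "conv (\<lambda>n z. c * \<psi> n z) (\<lambda>z. c * f z) m"
    unfolding conv_def
  proof (intro conjI allI impI)
    obtain d where d: "d > 0" "Wle (\<lambda>z. f z * E m z) d" using 1(4) by (auto simp: conv_def)
    have "Wle (\<lambda>z. c * (f z * E m z)) (cmod c * d + 1)"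
      by (rule Wle_mono[OF Wle_scale[OF d(2)]]) (use d in auto)
    then show "\<exists>d>0. Wle (\<lambda>z. (c * f z) * E m z) d"
      using d by (intro exI[of _ "cmod c * d + 1"]) (auto simp: mult.assoc intro: add_nonneg_pos)
    fix e :: real assume e: "e > 0"
    define a where "a = cmod c + 1"
    have a: "a > 0" "cmod c \<le> a" by (auto simp: a_def add_nonneg_pos)
    have "e / a > 0" using e a by simp
    then have "eventually (\<lambda>n. Wle (\<lambda>z. (\<psi> n z - f z) * E m z) (e / a)) sequentially"
      using 1(4) by (auto simp: conv_def)
    then show "eventually (\<lambda>n. Wle (\<lambda>z. (c * \<psi> n z - c * f z) * E m z) e) sequentially"
    proof eventually_elim
      case (elim n)
      have "cmod c * (e / a) \<le> a * (e / a)" using a e by (intro mult_right_mono) auto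
      then have "Wle (\<lambda>z. c * ((\<psi> n z - f z) * E m z)) e"
        using a e by (intro Wle_mono[OF Wle_scale[OF elim]]) auto
      then show ?case by (simp add: algebra_simps)
    qed
  qed
  moreover have "(\<lambda>n. Phi (\<lambda>z. c * \<psi> n z) x) \<longlonglongrightarrow> (scB c o\<^sub>L T) x" for x
    using sc.tendsto[OF tendsto_const 1(2), of c x] by (simp add: Phi_scale[OF 1(1)])
  moreover have "norm (Phi (\<lambda>z. c * \<psi> n z) x) \<le> (cmod c * B) * norm x" for n x
    using mult_left_mono[OF B[of n x], of "cmod c"] by (simp add: Phi_scale[OF 1(1)] mult.assoc)
  ultimately show ?thesis using 1 H0_scale[OF 1(1)] by (intro repI[of "\<lambda>n z. c * \<psi> n z" _ m]) auto
qed

lemma rep_H0: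
  assumes "\<psi> \<in> H0"
  shows "rep \<psi> (Phi \<psi>)"
proof (rule repI[of "\<lambda>n. \<psi>" _ 1])
  have "Wle (\<lambda>z. (\<psi> z - \<psi> z) * E 1 z) e" if "e > 0" for e using Wle_zero[of e] that by simp
  then show "conv (\<lambda>n. \<psi>) \<psi> 1"
    unfolding conv_def using H0_Wle[OF H0_mult[OF assms E_H0]] by auto
  show "norm (Phi \<psi> x) \<le> norm (Phi \<psi>) * norm x" for x by (rule norm_blinfun)
qed (use assms in auto)

text \<open>The approximants are \<open>\<psi>\<^sub>n = (q/n) \<Sum>\<^sub>j G\<^sub>s F\<^sub>s\<close> with \<open>s = j/n\<close>, where \<open>F\<^sub>s\<close> is the Fourier transform of a
  truncation of the representing function of \<open>G\<^sub>s f\<close>. They stay bounded in the Hoermander norm because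
  \<open>G\<^sub>t G\<^sub>s\<close> decays like \<open>exp (- (t - s)\<^sup>2 / 2)\<close>, and \<open>(q/n) \<Sum>\<^sub>j G\<^sub>s\<^sup>2 \<rightarrow> 1\<close>.\<close>
lemma approximants:
  "\<exists>K>0. \<forall>f c. c > 0 \<longrightarrow> Hle f c \<longrightarrow> (\<exists>\<psi>. (\<forall>n. \<psi> n \<in> H0 \<and> Hle (\<psi> n) (K * c)) \<and> conv \<psi> f 2)"
proof -
  define q where "q = sqrt (2 / pi)"
  have q: "q > 0" by (simp add: q_def)
  obtain Kp where Kp: "Kp > 0" "\<And>s t::real. Wle (\<lambda>z. exp (- (z - of_real t)\<^sup>2) * exp (- (z - of_real s)\<^sup>2)) (Kp * exp (- ((t - s)\<^sup>2) / 2))"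
    using Wle_gauss_pair by blast
  obtain B where B: "B > 0" "\<And>n t. n > 0 \<Longrightarrow> rsum n (\<lambda>s. exp (- ((t - s)\<^sup>2) / 2)) \<le> B" using rsum_gauss_bounded by blast
  \<comment> \<open>q is the weight of the partition, KW and Kp bound the product of G_t G_s with
    F_s, and B sums the decay exp(-(t - s)^2 / 2) uniformly in t and n.\<close>
  define K where "K = q * KW * Kp * B"
  have K: "K > 0" using q KW_pos Kp B by (simp add: K_def)
  define G where "G s z = exp (- (z - complex_of_real s)\<^sup>2)" for s z
  have GG: "exp (- 2 * (z - complex_of_real s)\<^sup>2) = G s z * G s z" for s z
    by (simp add: G_def exp_add[symmetric])
  have E2: "E 2 z = exp (- z\<^sup>2) * exp (- z\<^sup>2)" for z by (simp add: E_def exp_add[symmetric])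
  have "\<exists>\<psi>. (\<forall>n. \<psi> n \<in> H0 \<and> Hle (\<psi> n) (K * c)) \<and> conv \<psi> f 2" if c: "c > 0" and f: "Hle f c" for f c
  proof -
    have fG: "Wle (\<lambda>z. G s z * f z) c" for s using f by (simp add: Hle_def G_def)
    \<comment> \<open>The tolerance 1 / (n + 1)^2 beats the length 2 n of the window over which the
      errors accumulate.\<close>
    define P where "P n s F \<longleftrightarrow> F holomorphic_on UNIV \<and> (\<forall>u. \<exists>C. \<forall>z. \<bar>Im z\<bar> \<le> u \<longrightarrow> cmod (F z) \<le> C) \<and> Wle F c
        \<and> Wle (\<lambda>z. F z - G s z * f z) (1 / (real n + 1)\<^sup>2)" for n :: nat and s F
    define F where "F n s = (SOME F. P n s F)" for n s
    have P: "P n s (F n s)" for n s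
      unfolding F_def
    proof (rule someI_ex[of "P n s"])
      have "1 / (real n + 1)\<^sup>2 > 0" by (simp add: add_nonneg_pos)
      then show "\<exists>F. P n s F"
      proof (rule Wle_truncate[OF fG[of s]])
        fix F assume F: "F holomorphic_on UNIV" "\<And>u. \<exists>C. \<forall>z. \<bar>Im z\<bar> \<le> u \<longrightarrow> cmod (F z) \<le> C" "Wle F c"
          "Wle (\<lambda>z. F z - G s z * f z) (1 / (real n + 1)\<^sup>2)"
        have "P n s F" unfolding P_def by (intro conjI allI F)
        then show ?thesis by blast
      qed
    qed
    note F = P[unfolded P_def, THEN conjunct1] P[unfolded P_def, THEN conjunct2, THEN conjunct1, rule_format]
      P[unfolded P_def, THEN conjunct2, THEN conjunct2, THEN conjunct1] P[unfolded P_def, THEN conjunct2, THEN conjunct2, THEN conjunct2]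
    define \<psi> where "\<psi> n z = rsum (Suc n) (\<lambda>s. of_real q * (F (Suc n) s z * G s z))" for n z
    \<comment> \<open>The Riemann sum of the partition of unity. Without truncation \<psi>_n would
      be \<phi>_n f.\<close>
    define \<phi> where "\<phi> n z = rsum (Suc n) (\<lambda>s. of_real q * exp (- 2 * (z - complex_of_real s)\<^sup>2))" for n z
    have GH: "G s \<in> H0" for s using H0_gauss[OF \<theta>_pos, of 1 s] by (simp add: G_def[abs_def])
    have \<psi>H: "\<psi> n \<in> H0" for n
      unfolding \<psi>_def[abs_def]
    proof (intro H0_rsum H0_scale)
      fix s
      obtain C where C: "\<And>z. \<bar>Im z\<bar> \<le> \<theta> \<Longrightarrow> cmod (F (Suc n) s z) \<le> C" using F(2)[of \<theta> "Suc n" s] by blast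
      show "(\<lambda>z. F (Suc n) s z * G s z) \<in> H0"
        by (rule H0_mult_bounded[OF GH holomorphic_on_subset[OF F(1)]]) (auto intro!: C simp: strip_pos[OF \<theta>_pos])
    qed
    have \<psi>h: "Hle (\<psi> n) (K * c)" for n
      unfolding Hle_def
    proof
      fix t :: real
      let ?b = "\<lambda>s. q * (KW * (Kp * exp (- ((t - s)\<^sup>2) / 2)) * c)"
      have b: "Wle (\<lambda>z. of_real q * ((exp (- (z - of_real t)\<^sup>2) * G s z) * F (Suc n) s z)) (?b s)" for s
        using Wle_scale[OF Wle_mult[OF Kp(2)[of t s] F(3)[of "Suc n" s]], of "of_real q"] Kp(1) c q by (simp add: G_def)
      have "Wle (\<lambda>z. rsum (Suc n) (\<lambda>s. of_real q * ((exp (- (z - of_real t)\<^sup>2) * G s z) * F (Suc n) s z))) (rsum (Suc n) ?b)"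
        by (rule Wle_of_rsum[OF _ b]) (use q KW_pos Kp c in auto)
      moreover have "rsum (Suc n) (\<lambda>s. of_real q * ((exp (- (z - of_real t)\<^sup>2) * G s z) * F (Suc n) s z)) = exp (- (z - of_real t)\<^sup>2) * \<psi> n z" for z
        unfolding \<psi>_def rsum_mult_left[symmetric] by (simp only: mult_ac)
      moreover have "rsum (Suc n) ?b = (q * KW * Kp * c) * rsum (Suc n) (\<lambda>s. exp (- ((t - s)\<^sup>2) / 2))"
        unfolding rsum_mult_left[symmetric] by (simp only: mult_ac)
      moreover have "(q * KW * Kp * c) * rsum (Suc n) (\<lambda>s. exp (- ((t - s)\<^sup>2) / 2)) \<le> (q * KW * Kp * c) * B"
        using q KW_pos Kp c by (intro mult_left_mono B) auto
      moreover have "0 \<le> rsum (Suc n) (\<lambda>s. exp (- ((t - s)\<^sup>2) / 2))"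
        unfolding rsum_def by (intro scaleR_nonneg_nonneg sum_nonneg) auto
      ultimately show "Wle (\<lambda>z. exp (- (z - of_real t)\<^sup>2) * \<psi> n z) (K * c)"
        using q KW_pos Kp c by (auto simp: K_def mult_ac intro: Wle_mono)
    qed
    \<comment> \<open>By \<open>rsum_const\<close> a uniform error is multiplied by the length of
      the window.\<close>
    define b where "b n = 2 * real (Suc n) * (q * (KW * (1 / (real (Suc n) + 1)\<^sup>2) * KG))" for n
    have b_pos: "b n > 0" for n using q KW_pos KG(1) by (simp add: b_def add_nonneg_pos)
    have diff: "Wle (\<lambda>z. \<psi> n z - \<phi> n z * f z) (b n)" for n
    proof -
      let ?d = "1 / (real (Suc n) + 1)\<^sup>2"
      have dp: "?d > 0" by (simp add: add_nonneg_pos)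
      have "Wle (\<lambda>z. of_real q * ((F (Suc n) s z - G s z * f z) * G s z)) (q * (KW * ?d * KG))" for s
        using Wle_scale[OF Wle_mult[OF F(4)[of "Suc n" s] KG(2)[of s] dp KG(1)], of "of_real q"] q
        by (simp only: G_def norm_of_real abs_of_pos)
      from Wle_of_rsum[OF _ this, of "Suc n"] have "Wle (\<lambda>z. rsum (Suc n) (\<lambda>s. of_real q * ((F (Suc n) s z - G s z * f z) * G s z))) (b n)"
        using q KW_pos KG(1) dp by (simp only: rsum_const b_def) auto
      moreover have "rsum (Suc n) (\<lambda>s. of_real q * ((F (Suc n) s z - G s z * f z) * G s z)) = \<psi> n z - \<phi> n z * f z" for z
        unfolding \<psi>_def \<phi>_def rsum_mult_right[symmetric] rsum_diff[symmetric] GG by (simp only: left_diff_distrib right_diff_distrib mult_ac)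
      ultimately show ?thesis by simp
    qed
    have b0: "b \<longlonglongrightarrow> 0"
    proof -
      have "(\<lambda>n. 2 * real (Suc n) * (1 / (real (Suc n) + 1)\<^sup>2)) \<longlonglongrightarrow> 0" by real_asymp
      then have "(\<lambda>n. (q * (KW * KG)) * (2 * real (Suc n) * (1 / (real (Suc n) + 1)\<^sup>2))) \<longlonglongrightarrow> 0"
        by (rule tendsto_mult_right_zero)
      then show ?thesis by (rule Lim_transform_eventually) (simp add: b_def mult_ac)
    qed
    have "Wle (\<lambda>z. exp (- z\<^sup>2)) KG" using KG(2)[of 0] by simp
    note W1 = this
    have W2: "Wle (\<lambda>z. exp (- z\<^sup>2) * f z) c" using fG[of 0] by (simp add: G_def)
    obtain cE where cE: "cE > 0" "Wle (E 2) cE" using E_Wle[of 2] by auto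
    have "conv \<psi> f 2"
      unfolding conv_def
    proof (intro conjI allI impI)
      have "Wle (\<lambda>z. exp (- z\<^sup>2) * (exp (- z\<^sup>2) * f z)) (KW * KG * c)" by (rule Wle_mult[OF W1 W2 KG(1) c])
      then show "\<exists>c>0. Wle (\<lambda>z. f z * E 2 z) c" using KW_pos KG(1) c
        by (intro exI[of _ "KW * KG * c"]) (simp add: E2 mult_ac)
      fix e :: real assume e: "e > 0"
      have e1: "e / (2 * KW * c) > 0" and e2: "e / (2 * KW * cE) > 0" using e KW_pos c cE by auto
      have "eventually (\<lambda>n. Wle (\<lambda>z. rsum n (\<lambda>s. of_real q * exp (- 2 * (z - of_real s)\<^sup>2) * exp (- z\<^sup>2)) - exp (- z\<^sup>2)) (e / (2 * KW * c))) sequentially"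
        unfolding q_def by (rule gauss_partition_tendsto[OF e1])
      then have "eventually (\<lambda>n. Wle (\<lambda>z. rsum (Suc n) (\<lambda>s. of_real q * exp (- 2 * (z - of_real s)\<^sup>2) * exp (- z\<^sup>2)) - exp (- z\<^sup>2)) (e / (2 * KW * c))) sequentially"
        by (subst eventually_sequentially_Suc)
      then have ev: "eventually (\<lambda>n. Wle (\<lambda>z. \<phi> n z * exp (- z\<^sup>2) - exp (- z\<^sup>2)) (e / (2 * KW * c))) sequentially"
        unfolding rsum_mult_right \<phi>_def .
      have "eventually (\<lambda>n. b n < e / (2 * KW * cE)) sequentially" using b0 e2 by (rule order_tendstoD)
      then show "eventually (\<lambda>n. Wle (\<lambda>z. (\<psi> n z - f z) * E 2 z) e) sequentially"
        using ev
      proof eventually_elim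
        case (elim n)
        \<comment> \<open>\<psi> - f = (\<psi> - \<phi> f) + (\<phi> - 1) f. In the second term one
          Gaussian goes to \<phi> - 1 and the other to f, which explains the power 2.\<close>
        have "Wle (\<lambda>z. (\<psi> n z - \<phi> n z * f z) * E 2 z + (\<phi> n z * exp (- z\<^sup>2) - exp (- z\<^sup>2)) * (exp (- z\<^sup>2) * f z))
           (KW * b n * cE + KW * (e / (2 * KW * c)) * c)"
          using KW_pos c cE(1) b_pos[of n] e1
          by (intro Wle_add Wle_mult diff cE W2 elim mult_pos_pos) auto
        moreover have "(\<psi> n z - \<phi> n z * f z) * E 2 z + (\<phi> n z * exp (- z\<^sup>2) - exp (- z\<^sup>2)) * (exp (- z\<^sup>2) * f z) = (\<psi> n z - f z) * E 2 z" for z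
          unfolding E2 by (simp add: algebra_simps)
        ultimately have W: "Wle (\<lambda>z. (\<psi> n z - f z) * E 2 z) (KW * b n * cE + KW * (e / (2 * KW * c)) * c)" by simp
        have "KW * b n * cE \<le> e / 2"
        proof -
          have "(KW * cE) * b n \<le> (KW * cE) * (e / (2 * KW * cE))" using elim KW_pos cE by (intro mult_left_mono) auto
          also have "\<dots> = e / 2" using KW_pos cE by simp
          finally show ?thesis by (simp add: mult_ac)
        qed
        moreover have "KW * (e / (2 * KW * c)) * c = e / 2" using KW_pos c by simp
        ultimately show ?case using KW_pos c cE(1) b_pos[of n] e1 e by (intro Wle_mono[OF W]) auto
      qed
    qed
    then show ?thesis using \<psi>H \<psi>h by blast
  qed
  then show ?thesis using K by blast
qed

text \<open>Smallness of (\<psi>_i - \<psi>_j) E^m in W makes the operators Cauchy on the dense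
  range of \<open>Phi (E m)\<close>; the common Hoermander bound extends this to all of X.\<close>

lemma rep_exists:
  assumes \<psi>: "\<And>n. \<psi> n \<in> H0" and h: "\<And>n. Hle (\<psi> n) c" and c: "c > 0" and conv: "conv \<psi> f m" and m: "m > 0"
  shows "\<exists>T. rep f T \<and> (\<forall>x. (\<lambda>n. Phi (\<psi> n) x) \<longlonglongrightarrow> blinfun_apply T x)"
proof -
  have bd: "norm (Phi (\<psi> n) x) \<le> (Cb * c) * norm x" for n x by (rule Cb(2)[OF \<psi> c h])
  have "\<exists>T :: 'a \<Rightarrow>\<^sub>L 'a. \<forall>x. (\<lambda>n. Phi (\<psi> n) x) \<longlonglongrightarrow> T x"
  proof (rule strong_limit[OF bd])
    show "closure (range (Phi (E m))) = UNIV" using dense_range[of "real m"] m by (simp add: E_def[abs_def])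
    fix u assume "u \<in> range (Phi (E m))"
    then obtain y where y: "u = Phi (E m) y" by auto
    show "Cauchy (\<lambda>n. Phi (\<psi> n) u)"
    proof (rule CauchyI)
      fix e :: real assume e: "e > 0"
      define a where "a = CW * (norm y + 1)"
      have a: "a > 0" using CW(1) by (simp add: a_def add_nonneg_pos)
      define d where "d = e / (4 * a)"
      have d: "d > 0" using e a by (simp add: d_def)
      obtain N where N: "\<And>n. n \<ge> N \<Longrightarrow> Wle (\<lambda>z. (\<psi> n z - f z) * E m z) d"
        using conv d by (auto simp: conv_def eventually_sequentially)
      have "norm (Phi (\<psi> i) u - Phi (\<psi> j) u) < e" if ij: "i \<ge> N" "j \<ge> N" for i j
      proof -
        have "Wle (\<lambda>z. (\<psi> i z - f z) * E m z - (\<psi> j z - f z) * E m z) (d + d)" using N ij d by (intro Wle_diff) auto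
        then have W: "Wle (\<lambda>z. (\<psi> i z - \<psi> j z) * E m z) (d + d)" by (simp add: algebra_simps)
        have H: "(\<lambda>z. \<psi> i z - \<psi> j z) \<in> H0" by (intro H0_diff \<psi>)
        have "norm (Phi (\<lambda>z. (\<psi> i z - \<psi> j z) * E m z) y) \<le> CW * (d + d) * norm y"
          by (rule CW(2)[OF H0_mult[OF H E_H0[OF m]] _ W]) (use d in auto)
        also have "\<dots> \<le> CW * (d + d) * (norm y + 1)" using CW(1) d by (intro mult_left_mono) auto
        also have "\<dots> = 2 * (a * d)" by (simp add: a_def algebra_simps)
        also have "\<dots> < e" using a e by (simp add: d_def)
        finally show ?thesis
          by (simp add: y Phi_mult[OF H E_H0[OF m]] Phi_diff[OF \<psi> \<psi>] blinfun.diff_left)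
      qed
      then show "\<exists>M. \<forall>i\<ge>M. \<forall>j\<ge>M. norm (Phi (\<psi> i) u - Phi (\<psi> j) u) < e" by blast
    qed
  qed
  then obtain T :: "'a \<Rightarrow>\<^sub>L 'a" where T: "\<And>x. (\<lambda>n. Phi (\<psi> n) x) \<longlonglongrightarrow> T x" by blast
  then have "rep f T" by (intro repI[OF \<psi> _ m conv bd])
  then show ?thesis using T by blast
qed

lemma calculus: "hor_calculus k J D A v \<omega>"
proof -
  obtain K where K: "K > 0" "\<And>f c. c > 0 \<Longrightarrow> Hle f c \<Longrightarrow> \<exists>\<psi>. (\<forall>n. \<psi> n \<in> H0 \<and> Hle (\<psi> n) (K * c)) \<and> conv \<psi> f 2"
    using approximants by blast
  have ex: "\<exists>T \<psi>. rep f T \<and> (\<forall>n. \<psi> n \<in> H0 \<and> Hle (\<psi> n) (K * c)) \<and> (\<forall>x. (\<lambda>n. Phi (\<psi> n) x) \<longlonglongrightarrow> blinfun_apply T x)"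
    if cf: "c > 0" "Hle f c" for f c
  proof -
    obtain \<psi> where \<psi>: "\<And>n. \<psi> n \<in> H0" "\<And>n. Hle (\<psi> n) (K * c)" "conv \<psi> f 2" using K(2)[OF cf] by auto
    have "K * c > 0" using K(1) cf by simp
    from rep_exists[OF \<psi>(1,2) this \<psi>(3)] show ?thesis using \<psi> by auto
  qed
  \<comment> \<open>Well defined by \<open>rep_unique\<close>; each law of the calculus is then a
    closure property of \<open>rep\<close>.\<close>
  define \<Psi> where "\<Psi> f = (THE T. rep f T)" for f
  have \<Psi>_eq: "\<Psi> f = T" if "rep f T" for f T
    unfolding \<Psi>_def using that rep_unique[OF _ that] by (intro the_equality)
  have \<Psi>: "rep f (\<Psi> f)" if fh: "f \<in> hor_space v \<omega>" for f
  proof -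
    obtain c where "c > 0" "Hle f c" by (rule hor_space_Hle[OF fh])
    then obtain T where "rep f T" using ex by blast
    then show ?thesis using \<Psi>_eq by simp
  qed
  have one: "(\<lambda>z. 1) \<in> hor_space v \<omega>"
    by (rule hor_spaceI[of _ KG]) (use KG in \<open>auto simp: Hle_def\<close>)
  have cancel: "S o\<^sub>L Phi (E 1) = Phi (E 1) \<Longrightarrow> S = id_blinfun" for S
    by (rule eq_on_range[of 1]) (auto dest!: arg_cong[of _ _ blinfun_apply] simp: fun_eq_iff)
  show ?thesis unfolding hor_calculus_def
  proof (intro exI[of _ \<Psi>] conjI ballI allI impI)
    show "\<Psi> f = \<Psi> f'" if "f \<in> hor_space v \<omega>" "\<forall>z\<in>strip \<omega>. f z = f' z" for f f'
      using \<Psi>_eq[OF rep_cong[OF \<Psi>[OF that(1)]], of f'] that(2) by simp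
    show "\<Psi> f (J x) = J (\<Psi> f x)" if "f \<in> hor_space v \<omega>" for f x
      by (rule rep_J[OF \<Psi>[OF that]])
    show "\<Psi> (\<lambda>z. f z + g z) = \<Psi> f + \<Psi> g" if "f \<in> hor_space v \<omega>" "g \<in> hor_space v \<omega>" for f g
      by (rule \<Psi>_eq[OF rep_add[OF \<Psi>[OF that(1)] \<Psi>[OF that(2)]]])
    show "\<Psi> (\<lambda>z. c * f z) x = c \<odot> \<Psi> f x" if "f \<in> hor_space v \<omega>" for f c x
      by (simp add: \<Psi>_eq[OF rep_scale[OF \<Psi>[OF that]]])
    show "\<Psi> (\<lambda>z. f z * g z) = \<Psi> f o\<^sub>L \<Psi> g" if "f \<in> hor_space v \<omega>" "g \<in> hor_space v \<omega>" for f g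
      by (rule \<Psi>_eq[OF rep_mult[OF \<Psi>[OF that(1)] \<Psi>[OF that(2)]]])
    \<comment> \<open>\<open>E 1\<close> is represented by the composition of \<Psi>(1) with
      \<open>Phi (E 1)\<close> and by \<open>Phi (E 1)\<close> alone, and the dense range permits
      cancelling.\<close>
    have "rep (\<lambda>z. 1 * E 1 z) (\<Psi> (\<lambda>z. 1) o\<^sub>L Phi (E 1))" by (rule rep_mult[OF \<Psi>[OF one] rep_H0[OF E_H0]]) simp
    then have "rep (E 1) (\<Psi> (\<lambda>z. 1) o\<^sub>L Phi (E 1))" by simp
    then have "\<Psi> (\<lambda>z. 1) o\<^sub>L Phi (E 1) = Phi (E 1)" by (rule rep_unique) (simp add: rep_H0 E_H0)
    then show "\<Psi> (\<lambda>_. 1) = id_blinfun" by (rule cancel)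
    fix l assume l: "\<bar>Im l\<bar> > \<omega>"
    show "l \<in> resolvent_set J D A" using is_res[OF l] by (auto simp: resolvent_set_def)
    obtain K' where "K' > 0" "Wle (\<lambda>z. 1 / (l - z)) K'" using Wle_resolvent[OF l] by blast
    then have rh: "(\<lambda>z. 1 / (l - z)) \<in> hor_space v \<omega>"
      using KW_pos KG(1) by (intro hor_spaceI[OF Wle_imp_Hle]) auto
    \<comment> \<open>This multiple of the Gaussian lies in H0 and turns 1 / (l - z) into
      \<open>E 1\<close>, whose operator is known.\<close>
    let ?e = "\<lambda>z. (l - z) * E 1 z"
    have e: "?e \<in> H0" by (intro H0_linear E_H0) simp
    have "rep (\<lambda>z. 1 / (l - z) * ?e z) (\<Psi> (\<lambda>z. 1 / (l - z)) o\<^sub>L Phi ?e)" by (rule rep_mult[OF \<Psi>[OF rh] rep_H0[OF e]])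
    then have "rep (E 1) (\<Psi> (\<lambda>z. 1 / (l - z)) o\<^sub>L Phi ?e)"
    proof (rule rep_cong)
      fix z assume "z \<in> strip \<omega>"
      then have "\<bar>Im z\<bar> \<le> \<omega>" by (rule strip_Im_le[OF _ \<omega>])
      then have "l - z \<noteq> 0" using l by auto
      then show "1 / (l - z) * ((l - z) * E 1 z) = E 1 z" by simp
    qed
    then have eq: "\<Psi> (\<lambda>z. 1 / (l - z)) o\<^sub>L Phi ?e = Phi (E 1)" by (rule rep_unique) (simp add: rep_H0 E_H0)
    show "\<Psi> (\<lambda>z. 1 / (l - z)) = resolvent J D A l"
    proof (rule eq_on_range[of 1])
      fix y
      have y: "Phi (E 1) y = Phi ?e (res l y)" using Phi_resolvent(2)[OF E_H0 l, of 1 y] by simp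
      have "\<Psi> (\<lambda>z. 1 / (l - z)) (Phi (E 1) y) = Phi (E 1) (res l y)"
        unfolding y using arg_cong[OF eq, of "\<lambda>T. blinfun_apply T (res l y)"] by simp
      also have "\<dots> = res l (Phi ?e (res l y))" using Phi_resolvent(1)[OF E_H0 l, of 1 "res l y"] by simp
      finally show "\<Psi> (\<lambda>z. 1 / (l - z)) (Phi (E 1) y) = resolvent J D A l (Phi (E 1) y)" by (simp only: y)
    qed simp
  next
    show "kind_bounded k J (blinfun_apply ` \<Psi> ` {f. hor_norm v \<omega> f \<le> 1})"
    \<comment> \<open>A norm at most 1 gives \<open>Hle f c\<close> for every c above 1, of which 2
      is one choice. The approximants then have norm at most 2 K, so they are 2 K times members of
      the given bounded set.\<close>
    proof (rule kind_bounded_limit[OF kb, where c="2 * K"])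
      fix S assume "S \<in> blinfun_apply ` \<Psi> ` {f. hor_norm v \<omega> f \<le> 1}"
      then obtain f where f: "hor_norm v \<omega> f \<le> 1" "S = blinfun_apply (\<Psi> f)" by auto
      have "Hle f 2" by (rule Hle_of_hor_norm[of f 1]) (use f in auto)
      then obtain T \<psi> where T: "rep f T" "\<And>n. \<psi> n \<in> H0" "\<And>n. Hle (\<psi> n) (K * 2)" "\<And>x. (\<lambda>n. Phi (\<psi> n) x) \<longlonglongrightarrow> blinfun_apply T x"
        using ex[of 2 f] by auto
      let ?r = "complex_of_real (1 / (2 * K))"
      let ?p = "\<lambda>n z. ?r * \<psi> n z"
      have pH: "?p n \<in> H0" for n by (rule H0_scale[OF T(2)])
      have "Hle (?p n) 1" for n using Hle_scale[OF T(3), of ?r n] K(1) by (simp add: norm_divide norm_mult)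
      then have "hor_norm v \<omega> (?p n) \<le> 1" for n using hor_norm_le[of _ 1] by simp
      then have U: "psi_op J D A \<omega> \<theta> (?p n) \<in> {psi_op J D A \<omega> \<theta> \<psi> | \<psi>. \<psi> \<in> H0_infty \<theta> \<and> hor_norm v \<omega> \<psi> \<le> 1}" for n
        using pH by blast
      have "(2 * K) *\<^sub>R psi_op J D A \<omega> \<theta> (?p n) x = Phi (\<psi> n) x" for n x
        unfolding Phi_psi_op[OF pH] Phi_scale[OF T(2)] sc_of_real using K(1) by simp
      then have "(\<lambda>n. (2 * K) *\<^sub>R psi_op J D A \<omega> \<theta> (?p n) x) \<longlonglongrightarrow> S x" for x
        using T(4)[of x] f(2) \<Psi>_eq[OF T(1)] by simp
      then show "\<exists>U. (\<forall>n. U n \<in> {psi_op J D A \<omega> \<theta> \<psi> | \<psi>. \<psi> \<in> H0_infty \<theta> \<and> hor_norm v \<omega> \<psi> \<le> 1}) \<and> (\<forall>x. (\<lambda>n. (2 * K) *\<^sub>R U n x) \<longlonglongrightarrow> S x)"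
        using U by (intro exI[of _ "\<lambda>n. psi_op J D A \<omega> \<theta> (?p n)"]) auto
    qed
  qed
qed

end

theorem theorem8p2:
  fixes J :: "'a::banach \<Rightarrow> 'a" and D :: "'a set" and A :: "'a \<Rightarrow> 'a"
    and v :: "real \<Rightarrow> real" and \<omega> \<theta> :: real and k :: bkind
  assumes "complex_structure J"
    and "\<omega> \<ge> 0"
    and "strongly_admissible v"
    and "densely_defined_op J D A"
    and "\<theta> > \<omega>"
  shows "hor_calculus k J D A v \<omega> \<longleftrightarrow>
    (strip_type J D A \<omega> \<and>
     kind_bounded k J {psi_op J D A \<omega> \<theta> \<psi> | \<psi>. \<psi> \<in> H0_infty \<theta> \<and> hor_norm v \<omega> \<psi> \<le> 1})"
proof
  assume "hor_calculus k J D A v \<omega>"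
  then show "strip_type J D A \<omega> \<and>
     kind_bounded k J {psi_op J D A \<omega> \<theta> \<psi> | \<psi>. \<psi> \<in> H0_infty \<theta> \<and> hor_norm v \<omega> \<psi> \<le> 1}"
    by (rule hor_calculus_imp_psi_bounded[OF assms])
next
  assume a: "strip_type J D A \<omega> \<and>
     kind_bounded k J {psi_op J D A \<omega> \<theta> \<psi> | \<psi>. \<psi> \<in> H0_infty \<theta> \<and> hor_norm v \<omega> \<psi> \<le> 1}"
  interpret hor_strip v \<omega> J D A \<theta> k
    by unfold_locales (use assms a in auto)
  show "hor_calculus k J D A v \<omega>" by (rule calculus)
qed

end
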